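(* Let $s>\frac m2$ and let $F:\mathcal{D}(F)\to L^2(\Omega_Y)$ satisfy: (i) there exists $r>0$ with $r>2\|x^{(0)}-x^\dagger\|_{H^s(\Omega_X)}$ such that $\mathcal{B}_r^{H^s}(x^\dagger)\subseteq\mathcal{D}(F)$, and $\mathcal{D}(F)$ is bounded and weakly closed in $H^s(\Omega_X)$; (ii) $F:\mathcal{D}(F)\subseteq C(\overline{\Omega_X})\to L^2(\Omega_Y)$ is continuous (with respect to the $L^\infty(\Omega_X)$ norm on $\mathcal{D}(F)$); (iii) $F:\mathcal{D}(F)\subseteq H^s(\Omega_X)\to L^2(\Omega_Y)$ is weakly sequentially closed, and Fréchet differentiable on $\mathcal{B}_r^{H^s}(x^\dagger)$ with Lipschitz continuous derivative, i.e. there is $L_1>0$ with $\|F'[x]-F'[x^\dagger]\|\le L_1\|x-x^\dagger\|_{H^s}$ for all $x\in\mathcal{B}_r^{H^s}(x^\dagger)$. Suppose further that the source condition $$x^{(0)}-x^\dagger=F'[x^\dagger]^*\omega\quad\text{with } \omega\in L^2(\Omega_Y),\ L_1\|\omega\|_{L^2(\Omega_Y)}<1$$ holds. Then for every $\varepsilon>0$ there exist $\mathtt n(\varepsilon)\in\mathbb{N}$ and a coefficient vector $\mathcal{T}_{\mathtt n(\varepsilon)}$ of size $\mathtt n(\varepsilon)$ such that the associated neural operator $F_{\mathtt n(\varepsilon)}$ satisfies $$\rho_{\mathtt n(\varepsilon)}:=\sup_{x\in\mathcal{B}_r^{H^s}(x^\dagger)}\|F[x]-F_{\mathtt n(\varepsilon)}[x]\|_{L^2(\Omega_Y)}\le\varepsilon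 .$$ Moreover, with $\mathtt n=\mathtt n(\varepsilon)$, let $x_{\mathtt n}^{\alpha\delta\eta}$ be an approximate minimizer over $\mathcal{D}(F)$ with accuracy $\eta>0$ of the functional $$\mathbf{T}_{\mathtt n}^{\alpha\delta}[x]:=\|F_{\mathtt n}[x]-y^\delta\|_{L^2(\Omega_Y)}^2+\alpha\|x-x^{(0)}\|_{H^s(\Omega_X)}^2 .$$ Then with the choice $\alpha\sim\delta$, $\eta\sim\alpha^2$ and $\varepsilon\sim\delta$ one has $$\|x_{\mathtt n}^{\alpha\delta\eta}-x^\dagger\|_{H^s(\Omega_X)}=\mathcal{O}(\sqrt\delta)\qquad(\delta\to0).$$
   Context: $\Omega_X\subseteq\mathbb{R}^m$ and $\Omega_Y\subseteq\mathbb{R}^n$ are bounded domains with piecewise smooth boundaries satisfying the (interior) cone property. Since $s>m/2$, elements of $H^s(\Omega_X)$ are identified with their continuous representatives. $x^{(0)}\in\mathcal{D}(F)$ is fixed; $y\in L^2(\Omega_Y)$ is exact data for which $F[x]=y$ is solvable, and $x^\dagger\in\mathcal{D}(F)$ is an $x^{(0)}$-minimum-norm solution, i.e. a solution of $F[x]=y$ minimizing $\|x-x^{(0)}\|_{H^s}$ among all solutions in $\mathcal{D}(F)$. Noisy data $y^\delta\in L^2(\Omega_Y)$ satisfy $\|y-y^\delta\|_{L^2(\Omega_Y)}\le\delta$, $\delta>0$. $\mathcal{B}_r^{H^s}(x^\dagger)$ is the open ball in $H^s(\Omega_X)$ of radius $r$ around $x^\dagger$. $F'[x^\dagger]^*$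 is the Hilbert space adjoint of $F'[x^\dagger]:H^s(\Omega_X)\to L^2(\Omega_Y)$. Weakly sequentially closed means: if $x_k\in\mathcal{D}(F)$, $x_k\rightharpoonup x$ in $H^s(\Omega_X)$ and $F[x_k]\rightharpoonup z$ in $L^2(\Omega_Y)$, then $x\in\mathcal{D}(F)$ and $F[x]=z$. Sigmoid function: $\sigma:\mathbb{R}\to\mathbb{R}$ strictly increasing, differentiable, with limits $1$ at $+\infty$ and $0$ at $-\infty$; one such $\sigma$ is fixed. Neural operator: for a coefficient vector $\mathcal{T}_{\mathtt n}=(\alpha_{j,k},w_{j,k,l},\vec w_j,\theta_{j,k},\vec s_l,\zeta_j)_{j\le J,k\le K,l\le L}$ with $\alpha_{j,k},w_{j,k,l},\theta_{j,k},\zeta_j\in\mathbb{R}$, $\vec w_j\in\mathbb{R}^n$, $\vec s_l\in\Omega_X$, of size $\mathtt n=|\mathcal{T}_{\mathtt n}|=J(K(L+2)+n+1)+Lm$, the associated neural operator is $$F_{\mathtt n}[x](\vec t)=\sum_{j=1}^{J}\sum_{k=1}^{K}\alpha_{j,k}\,\sigma\Big(\sum_{l=1}^{L}w_{j,k,l}\,x(\vec s_l)+\theta_{j,k}\Big)\sigma(\vec w_j^{T}\vec t+\zeta_j),\quad \vec t\in\Omega_Y,$$ with coefficients not depending on $x$. An approximate minimizer with accuracy (tolerance) $\eta$ of a functional $\mathbf{T}$ over a set $S$ is an element $\hat x\in S$ with $\mathbf{T}[\hat x]\le\inf_{x\in S}\mathbf{T}[x]+\eta$. $a\sim b$ means $c_1b\le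 a\le c_2b$ with constants $0<c_1\le c_2$ independent of $\delta$. *)

theory Defs
  imports
    "HOL-Analysis.Analysis"
    "HOL-Library.Landau_Symbols"
    "HOL-Probability.Essential_Supremum"
begin

text \<open>
  The spaces needed here depend on a domain (a set) and on a real order, so they cannot be types.
  A Hilbert space of functions is given by its elements and its inner product.  The inner product
  may be degenerate: elements of \<open>L\<^sup>2\<close> are square integrable functions rather than equivalence
  classes, and two functions denote the same element iff \<open>fs_eq\<close> holds.
\<close>

record 'a fspace =
  elems :: "('a \<Rightarrow> real) set"
  inner_on :: "('a \<Rightarrow> real) \<Rightarrow> ('a \<Rightarrow> real) \<Rightarrow> real"

definition fs_norm :: "'a fspace \<Rightarrow> ('a \<Rightarrow> real) \<Rightarrow> real" where
  "fs_norm H u = sqrt (inner_on H u u)"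

definition fs_eq :: "'a fspace \<Rightarrow> ('a \<Rightarrow> real) \<Rightarrow> ('a \<Rightarrow> real) \<Rightarrow> bool" where
  "fs_eq H u v \<longleftrightarrow> fs_norm H (u - v) = 0"

definition fs_ball :: "'a fspace \<Rightarrow> ('a \<Rightarrow> real) \<Rightarrow> real \<Rightarrow> ('a \<Rightarrow> real) set" where
  "fs_ball H x r = {z \<in> elems H. fs_norm H (z - x) < r}"

definition fs_bounded :: "'a fspace \<Rightarrow> ('a \<Rightarrow> real) set \<Rightarrow> bool" where
  "fs_bounded H D \<longleftrightarrow> D \<subseteq> elems H \<and> (\<exists>C. \<forall>x\<in>D. fs_norm H x \<le> C)"

text \<open>Continuous functionals are represented by inner products, following Riesz.\<close>

definition weak_topology :: "'a fspace \<Rightarrow> ('a \<Rightarrow> real) topology" where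
  "weak_topology H =
     topology_generated_by
       {{u \<in> elems H. inner_on H u g \<in> U} | g U. g \<in> elems H \<and> open U}"

definition weakly_seq_closed ::
  "'a fspace \<Rightarrow> 'b fspace \<Rightarrow> ('a \<Rightarrow> real) set \<Rightarrow> (('a \<Rightarrow> real) \<Rightarrow> ('b \<Rightarrow> real)) \<Rightarrow> bool" where
  "weakly_seq_closed H G D F \<longleftrightarrow>
     (\<forall>X x z. (\<forall>k::nat. X k \<in> D) \<and> limitin (weak_topology H) X x sequentially \<and>
        limitin (weak_topology G) (\<lambda>k. F (X k)) z sequentially \<longrightarrow> x \<in> D \<and> fs_eq G (F x) z)"

definition op_norm ::
  "'a fspace \<Rightarrow> 'b fspace \<Rightarrow> (('a \<Rightarrow> real) \<Rightarrow> ('b \<Rightarrow> real)) \<Rightarrow> ereal" where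
  "op_norm H G A = (SUP h\<in>{h \<in> elems H. fs_norm H h \<le> 1}. ereal (fs_norm G (A h)))"

definition bounded_linear_op ::
  "'a fspace \<Rightarrow> 'b fspace \<Rightarrow> (('a \<Rightarrow> real) \<Rightarrow> ('b \<Rightarrow> real)) \<Rightarrow> bool" where
  "bounded_linear_op H G A \<longleftrightarrow>
     (\<forall>h\<in>elems H. A h \<in> elems G) \<and>
     (\<forall>u\<in>elems H. \<forall>v\<in>elems H. \<forall>a b::real.
        fs_eq G (A (\<lambda>t. a * u t + b * v t)) (\<lambda>t. a * A u t + b * A v t)) \<and>
     op_norm H G A < \<infinity>"

definition has_frechet_derivative ::
  "'a fspace \<Rightarrow> 'b fspace \<Rightarrow> ('a \<Rightarrow> real) set \<Rightarrow> (('a \<Rightarrow> real) \<Rightarrow> ('b \<Rightarrow> real)) \<Rightarrow>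
   (('a \<Rightarrow> real) \<Rightarrow> ('b \<Rightarrow> real)) \<Rightarrow> ('a \<Rightarrow> real) \<Rightarrow> bool" where
  "has_frechet_derivative H G D F A x \<longleftrightarrow>
     bounded_linear_op H G A \<and>
     (\<forall>e>0. \<exists>d>0. \<forall>z\<in>D. fs_norm H (z - x) < d \<longrightarrow>
        fs_norm G (F z - F x - A (z - x)) \<le> e * fs_norm H (z - x))"

text \<open>By Riesz, bounded linear operators between the spaces below have exactly one adjoint.\<close>

definition is_adjoint ::
  "'a fspace \<Rightarrow> 'b fspace \<Rightarrow> (('a \<Rightarrow> real) \<Rightarrow> ('b \<Rightarrow> real)) \<Rightarrow>
   (('b \<Rightarrow> real) \<Rightarrow> ('a \<Rightarrow> real)) \<Rightarrow> bool" where
  "is_adjoint H G A B \<longleftrightarrow>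
     (\<forall>w\<in>elems G. B w \<in> elems H \<and> (\<forall>h\<in>elems H. inner_on G (A h) w = inner_on H h (B w)))"

text \<open>Only meaningful for functionals bounded below on a nonempty set, as \<open>INF\<close> is taken in the reals.\<close>

definition approx_minimizer :: "('c \<Rightarrow> real) \<Rightarrow> 'c set \<Rightarrow> real \<Rightarrow> 'c \<Rightarrow> bool" where
  "approx_minimizer T S \<eta> x \<longleftrightarrow> x \<in> S \<and> T x \<le> (INF z\<in>S. T z) + \<eta>"

text \<open>The finite cone with vertex \<open>x\<close>, axis \<open>\<xi>\<close>, height \<open>\<rho>\<close> and half-angle \<open>\<kappa>\<close>.\<close>

definition finite_cone :: "'a::euclidean_space \<Rightarrow> 'a \<Rightarrow> real \<Rightarrow> real \<Rightarrow> 'a set" where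
  "finite_cone x \<xi> \<rho> \<kappa> = {x + y | y. norm y \<le> \<rho> \<and> y \<bullet> \<xi> \<ge> norm y * cos \<kappa>}"

definition cone_property :: "'a::euclidean_space set \<Rightarrow> bool" where
  "cone_property \<Omega> \<longleftrightarrow>
     (\<exists>\<rho> \<kappa>. 0 < \<rho> \<and> 0 < \<kappa> \<and> \<kappa> < pi / 2 \<and>
        (\<forall>x\<in>\<Omega>. \<exists>\<xi>. norm \<xi> = 1 \<and> finite_cone x \<xi> \<rho> \<kappa> \<subseteq> \<Omega>))"

text \<open>
  A smooth patch is a hypersurface parametrised over the face \<open>x\<^sub>i = 0\<close> of the unit cube (a single
  point in dimension one) by a \<open>C\<^sup>1\<close> map defined near that face.  The map must be an injective
  immersion on the relative interior of the face, but may degenerate on its relative boundary, so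
  that conical points are allowed.
\<close>

definition smooth_patch :: "(real^'m) set \<Rightarrow> bool" where
  "smooth_patch S \<longleftrightarrow>
     (\<exists>(i::'m) U (\<phi> :: real^'m \<Rightarrow> real^'m) (\<phi>' :: real^'m \<Rightarrow> (real^'m) \<Rightarrow>\<^sub>L (real^'m)).
        let Q = {x. x $ i = 0 \<and> (\<forall>j. 0 \<le> x $ j \<and> x $ j \<le> 1)};
            Q\<^sub>0 = {x. x $ i = 0 \<and> (\<forall>j. j \<noteq> i \<longrightarrow> 0 < x $ j \<and> x $ j < 1)}
        in open U \<and> Q \<subseteq> U \<and>
           (\<forall>x\<in>U. (\<phi> has_derivative blinfun_apply (\<phi>' x)) (at x)) \<and> continuous_on U \<phi>' \<and>
           inj_on \<phi> Q\<^sub>0 \<and> (\<forall>x\<in>Q\<^sub>0. inj_on (blinfun_apply (\<phi>' x)) {h. h $ i = 0}) \<and>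
           S = \<phi> ` Q)"

definition piecewise_smooth_boundary :: "(real^'m) set \<Rightarrow> bool" where
  "piecewise_smooth_boundary \<Omega> \<longleftrightarrow>
     (\<exists>\<S>. finite \<S> \<and> (\<forall>S\<in>\<S>. smooth_patch S) \<and> frontier \<Omega> = \<Union>\<S>)"

definition admissible_domain :: "(real^'m) set \<Rightarrow> bool" where
  "admissible_domain \<Omega> \<longleftrightarrow>
     open \<Omega> \<and> connected \<Omega> \<and> \<Omega> \<noteq> {} \<and> bounded \<Omega> \<and>
     piecewise_smooth_boundary \<Omega> \<and> cone_property \<Omega>"

definition L2 :: "'a::euclidean_space set \<Rightarrow> 'a fspace" where
  "L2 \<Omega> =
     \<lparr>elems = {f. f \<in> borel_measurable (lebesgue_on \<Omega>) \<and>
                  integrable (lebesgue_on \<Omega>) (\<lambda>t. (f t)\<^sup>2)},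
      inner_on = (\<lambda>f g. \<integral>t. f t * g t \<partial>lebesgue_on \<Omega>)\<rparr>"

definition Linf_norm :: "'a::euclidean_space set \<Rightarrow> ('a \<Rightarrow> real) \<Rightarrow> ereal" where
  "Linf_norm \<Omega> f = esssup (lebesgue_on \<Omega>) (\<lambda>t. ereal \<bar>f t\<bar>)"

definition pderiv_at :: "'m \<Rightarrow> (real^'m \<Rightarrow> real) \<Rightarrow> real^'m \<Rightarrow> real" where
  "pderiv_at i f x = frechet_derivative f (at x) (axis i 1)"

definition pderivs :: "'m list \<Rightarrow> (real^'m \<Rightarrow> real) \<Rightarrow> real^'m \<Rightarrow> real" where
  "pderivs is f = foldr pderiv_at is f"

definition smooth_fun :: "(real^'m \<Rightarrow> real) \<Rightarrow> bool" where
  "smooth_fun f \<longleftrightarrow> (\<forall>is x. pderivs is f differentiable (at x))"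

definition test_functions :: "(real^'m) set \<Rightarrow> (real^'m \<Rightarrow> real) set" where
  "test_functions \<Omega> =
     {\<phi>. smooth_fun \<phi> \<and> compact (closure {x. \<phi> x \<noteq> 0}) \<and> closure {x. \<phi> x \<noteq> 0} \<subseteq> \<Omega>}"

text \<open>
  Multi-indices are functions \<open>\<alpha> :: 'm \<Rightarrow> nat\<close>.  The index type carries no order, so the classical
  derivative of a test function ranges over all lists of directions realising \<open>\<alpha>\<close>; by the
  symmetry of higher derivatives these all agree.
\<close>

definition mi_size :: "('m::finite \<Rightarrow> nat) \<Rightarrow> nat" where
  "mi_size \<alpha> = (\<Sum>i\<in>UNIV. \<alpha> i)"

definition is_weak_deriv ::
  "(real^'m) set \<Rightarrow> ('m \<Rightarrow> nat) \<Rightarrow> (real^'m \<Rightarrow> real) \<Rightarrow> (real^'m \<Rightarrow> real) \<Rightarrow> bool" where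
  "is_weak_deriv \<Omega> \<alpha> u v \<longleftrightarrow>
     (\<forall>\<phi>\<in>test_functions \<Omega>. \<forall>is. (\<forall>i. count_list is i = \<alpha> i) \<longrightarrow>
        (\<integral>t. u t * pderivs is \<phi> t \<partial>lebesgue_on \<Omega>) =
        (-1) ^ mi_size \<alpha> * (\<integral>t. v t * \<phi> t \<partial>lebesgue_on \<Omega>))"

text \<open>The choice affects values on a null set only.\<close>

definition weak_deriv ::
  "(real^'m) set \<Rightarrow> ('m \<Rightarrow> nat) \<Rightarrow> (real^'m \<Rightarrow> real) \<Rightarrow> (real^'m \<Rightarrow> real)" where
  "weak_deriv \<Omega> \<alpha> u = (SOME v. v \<in> elems (L2 \<Omega>) \<and> is_weak_deriv \<Omega> \<alpha> u v)"

definition slobodeckij_integrand ::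
  "real \<Rightarrow> (real^'m \<Rightarrow> real) \<Rightarrow> (real^'m \<Rightarrow> real) \<Rightarrow> (real^'m) \<times> (real^'m) \<Rightarrow> real" where
  "slobodeckij_integrand \<theta> f g =
     (\<lambda>(t, t'). (f t - f t') * (g t - g t') / norm (t - t') powr (real CARD('m) + 2 * \<theta>))"

text \<open>
  The Sobolev--Slobodeckij space of real order \<open>s > m/2\<close> with its usual inner product.  Each
  equivalence class is represented by its unique continuous representative, set to \<open>0\<close> outside
  \<open>\<Omega>\<close>, so equality of elements is equality of functions.  For \<open>s \<le> m/2\<close> the definition would
  miss the classes without a continuous representative.
\<close>

definition Hs :: "real \<Rightarrow> (real^'m) set \<Rightarrow> (real^'m) fspace" where
  "Hs s \<Omega> =
     (let k = nat \<lfloor>s\<rfloor>; \<theta> = frac s; LL = lebesgue_on \<Omega> \<Otimes>\<^sub>M lebesgue_on \<Omega> in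
      \<lparr>elems =
         {u. continuous_on \<Omega> u \<and> (\<forall>t. t \<notin> \<Omega> \<longrightarrow> u t = 0) \<and> u \<in> elems (L2 \<Omega>) \<and>
             (\<forall>\<alpha>. mi_size \<alpha> \<le> k \<longrightarrow> (\<exists>v\<in>elems (L2 \<Omega>). is_weak_deriv \<Omega> \<alpha> u v)) \<and>
             (\<theta> > 0 \<longrightarrow> (\<forall>\<alpha>. mi_size \<alpha> = k \<longrightarrow>
                integrable LL
                  (slobodeckij_integrand \<theta> (weak_deriv \<Omega> \<alpha> u) (weak_deriv \<Omega> \<alpha> u))))},
       inner_on = (\<lambda>u v.
         (\<Sum>\<alpha> | mi_size \<alpha> \<le> k. inner_on (L2 \<Omega>) (weak_deriv \<Omega> \<alpha> u) (weak_deriv \<Omega> \<alpha> v)) +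
         (if \<theta> > 0 then
            (\<Sum>\<alpha> | mi_size \<alpha> = k.
               \<integral>p. slobodeckij_integrand \<theta> (weak_deriv \<Omega> \<alpha> u) (weak_deriv \<Omega> \<alpha> v) p \<partial>LL)
          else 0))\<rparr>)"

definition sigmoid_fun :: "(real \<Rightarrow> real) \<Rightarrow> bool" where
  "sigmoid_fun \<sigma> \<longleftrightarrow>
     strict_mono \<sigma> \<and> (\<forall>t. \<sigma> differentiable (at t)) \<and>
     (\<sigma> \<longlongrightarrow> 1) at_top \<and> (\<sigma> \<longlongrightarrow> 0) at_bot"

text \<open>
  The indices \<open>j\<close>, \<open>k\<close>, \<open>l\<close> range over \<open>1..J\<close>, \<open>1..K\<close>, \<open>1..L\<close>; values of the fields at other
  indices are irrelevant.
\<close>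

record ('x, 'y) no_coeffs =
  no_J :: nat
  no_K :: nat
  no_L :: nat
  no_alpha :: "nat \<Rightarrow> nat \<Rightarrow> real"
  no_w :: "nat \<Rightarrow> nat \<Rightarrow> nat \<Rightarrow> real"
  no_wvec :: "nat \<Rightarrow> 'y"
  no_theta :: "nat \<Rightarrow> nat \<Rightarrow> real"
  no_s :: "nat \<Rightarrow> 'x"
  no_zeta :: "nat \<Rightarrow> real"

definition coeff_vectors :: "(real^'m) set \<Rightarrow> (real^'m, real^'n) no_coeffs set" where
  "coeff_vectors \<Omega> =
     {T. 1 \<le> no_J T \<and> 1 \<le> no_K T \<and> 1 \<le> no_L T \<and> (\<forall>l\<in>{1..no_L T}. no_s T l \<in> \<Omega>)}"

definition coeff_size :: "(real^'m, real^'n) no_coeffs \<Rightarrow> nat" where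
  "coeff_size T =
     no_J T * (no_K T * (no_L T + 2) + CARD('n) + 1) + no_L T * CARD('m)"

definition neural_operator ::
  "(real \<Rightarrow> real) \<Rightarrow> (real^'m, real^'n) no_coeffs \<Rightarrow> (real^'m \<Rightarrow> real) \<Rightarrow> (real^'n \<Rightarrow> real)" where
  "neural_operator \<sigma> T x =
     (\<lambda>t. \<Sum>j=1..no_J T. \<Sum>k=1..no_K T.
        no_alpha T j k *
        \<sigma> ((\<Sum>l=1..no_L T. no_w T j k l * x (no_s T l)) + no_theta T j k) *
        \<sigma> (no_wvec T j \<bullet> t + no_zeta T j))"

text \<open>Extended-real valued, so that an unbounded error is \<open>\<infinity>\<close>.\<close>

definition approx_error ::
  "'b fspace \<Rightarrow> ('a \<Rightarrow> real) set \<Rightarrow> (('a \<Rightarrow> real) \<Rightarrow> ('b \<Rightarrow> real)) \<Rightarrow>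
   (('a \<Rightarrow> real) \<Rightarrow> ('b \<Rightarrow> real)) \<Rightarrow> ereal" where
  "approx_error G B F F\<^sub>n = (SUP x\<in>B. ereal (fs_norm G (F x - F\<^sub>n x)))"

definition min_norm_solution ::
  "'a fspace \<Rightarrow> 'b fspace \<Rightarrow> ('a \<Rightarrow> real) set \<Rightarrow> (('a \<Rightarrow> real) \<Rightarrow> ('b \<Rightarrow> real)) \<Rightarrow>
   ('b \<Rightarrow> real) \<Rightarrow> ('a \<Rightarrow> real) \<Rightarrow> ('a \<Rightarrow> real) \<Rightarrow> bool" where
  "min_norm_solution H G D F y x\<^sub>0 x \<longleftrightarrow>
     x \<in> D \<and> fs_eq G (F x) y \<and>
     (\<forall>z\<in>D. fs_eq G (F z) y \<longrightarrow> fs_norm H (x - x\<^sub>0) \<le> fs_norm H (z - x\<^sub>0))"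

definition tikhonov ::
  "'a fspace \<Rightarrow> 'b fspace \<Rightarrow> (('a \<Rightarrow> real) \<Rightarrow> ('b \<Rightarrow> real)) \<Rightarrow> ('b \<Rightarrow> real) \<Rightarrow> ('a \<Rightarrow> real) \<Rightarrow>
   real \<Rightarrow> ('a \<Rightarrow> real) \<Rightarrow> real" where
  "tikhonov H G F\<^sub>n y\<^sub>\<delta> x\<^sub>0 \<alpha> x = (fs_norm G (F\<^sub>n x - y\<^sub>\<delta>))\<^sup>2 + \<alpha> * (fs_norm H (x - x\<^sub>0))\<^sup>2"

definition same_order :: "(real \<Rightarrow> real) \<Rightarrow> (real \<Rightarrow> real) \<Rightarrow> bool" where
  "same_order a b \<longleftrightarrow>
     (\<exists>c\<^sub>1 c\<^sub>2. 0 < c\<^sub>1 \<and> c\<^sub>1 \<le> c\<^sub>2 \<and> (\<forall>\<delta>>0. c\<^sub>1 * b \<delta> \<le> a \<delta> \<and> a \<delta> \<le> c\<^sub>2 * b \<delta>))"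

end

theory Submission
  imports Defs "HOL-Library.Diagonal_Subsequence"
begin

text \<open>
  Local averages over small cubes in the cones of \<open>\<Omega>\<^sub>X\<close>, extrapolated so that polynomials are reproduced,
  approximate the values of \<open>u \<in> H\<^sup>s\<close> uniformly.  They make bounded sets totally bounded in the supremum norm,
  so the bounded weakly closed set \<open>D\<close> is compact there.  Hence \<open>F\<close> is uniformly continuous on \<open>D\<close> and,
  up to a small error, determined by the values of its argument at finitely many sensors.  A partition of
  unity in these values and the universal approximation property of sigmoid sums give the neural operator.

  For the rate, the minimality of \<open>x\<^sub>n\<close> is compared with \<open>x\<^sub>d\<close>.  Since \<open>r > 2 \<parallel>x\<^sub>0 - x\<^sub>d\<parallel>\<close>, the minimizer lies in the
  ball for small \<open>\<delta>\<close>.  There the source condition turns the cross term into \<open>\<langle>F'(x\<^sub>d)(x\<^sub>n - x\<^sub>d), \<omega>\<rangle>\<close>, which is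
  linearised with an error \<open>L\<^sub>1/2 \<parallel>x\<^sub>n - x\<^sub>d\<parallel>\<^sup>2 \<parallel>\<omega>\<parallel>\<close>, absorbed by \<open>L\<^sub>1 \<parallel>\<omega>\<parallel> < 1\<close>.
\<close>

subsection \<open>Pre-Hilbert function spaces and completeness of \<open>L\<^sup>2\<close>\<close>

text \<open>Only the cone property controls the boundary, and s may be fractional, so the sup-norm
  bound is proved inside \<Omega> without extending u: every kernel lives in a cube along the cone
  axis, away from x itself, and its mean recovers u x only as the scale shrinks. A plain mean would
  exploit too little smoothness; extrapolating over k + 1 dyadic scales leaves just the oscillation
  of the derivatives of order k. A second obstacle is that sup-norm limits must be recognised as
  weak limits. The parallelogram law on midpoint hulls does this and at the same time shows that the
  limit belongs to H^s. The approximation is carried out on all of \<open>D\<close>, because the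
  open ball need not be compact in the supremum norm. For the rate, minimality first locates x_n
  near x_0 only: the squared distance exceeds ||x_0 - x_d||^2 by O(\<delta>), whence the factor 2 in
  the condition on r. With \<alpha> ~ \<delta> the terms \<delta>^2/\<alpha>, \<delta> and \<alpha>
  are of one order, and \<eta> ~ \<alpha>^2 and \<epsilon> ~ \<delta> keep the remaining errors
  there.\<close>

locale pre_hilbert =
  fixes H :: "'a fspace"
  assumes lincomb: "\<And>u v a b. u \<in> elems H \<Longrightarrow> v \<in> elems H \<Longrightarrow> (\<lambda>t. a * u t + b * v t) \<in> elems H"
    and inner_sym: "\<And>u v. u \<in> elems H \<Longrightarrow> v \<in> elems H \<Longrightarrow> inner_on H u v = inner_on H v u"
    and inner_lin: "\<And>u v w a b. u \<in> elems H \<Longrightarrow> v \<in> elems H \<Longrightarrow> w \<in> elems H \<Longrightarrow>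
      inner_on H (\<lambda>t. a * u t + b * v t) w = a * inner_on H u w + b * inner_on H v w"
    and inner_nonneg: "\<And>u. u \<in> elems H \<Longrightarrow> 0 \<le> inner_on H u u"
begin

lemma lincomb_eq:
  "u \<in> elems H \<Longrightarrow> v \<in> elems H \<Longrightarrow> w = (\<lambda>t. a * u t + b * v t) \<Longrightarrow> w \<in> elems H"
  by (simp add: lincomb)

lemma inner_lin_eq:
  "u \<in> elems H \<Longrightarrow> v \<in> elems H \<Longrightarrow> w \<in> elems H \<Longrightarrow> z = (\<lambda>t. a * u t + b * v t) \<Longrightarrow>
   inner_on H z w = a * inner_on H u w + b * inner_on H v w"
  by (simp add: inner_lin)

lemma diff_mem: "u \<in> elems H \<Longrightarrow> v \<in> elems H \<Longrightarrow> u - v \<in> elems H"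
  by (rule lincomb_eq[of u v _ 1 "-1"]) auto

lemma add_mem: "u \<in> elems H \<Longrightarrow> v \<in> elems H \<Longrightarrow> (\<lambda>t. u t + v t) \<in> elems H"
  by (rule lincomb_eq[of u v _ 1 1]) auto

lemma scale_mem: "u \<in> elems H \<Longrightarrow> (\<lambda>t. a * u t) \<in> elems H"
  by (rule lincomb_eq[of u u _ a 0]) auto

lemma inner_diff_left:
  "u \<in> elems H \<Longrightarrow> v \<in> elems H \<Longrightarrow> w \<in> elems H \<Longrightarrow> inner_on H (u - v) w = inner_on H u w - inner_on H v w"
  by (subst inner_lin_eq[of u v w _ 1 "-1"]) auto

lemma inner_add_left:
  "u \<in> elems H \<Longrightarrow> v \<in> elems H \<Longrightarrow> w \<in> elems H \<Longrightarrow> inner_on H (\<lambda>t. u t + v t) w = inner_on H u w + inner_on H v w"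
  by (subst inner_lin_eq[of u v w _ 1 1]) auto

lemma inner_scale_left:
  "u \<in> elems H \<Longrightarrow> w \<in> elems H \<Longrightarrow> inner_on H (\<lambda>t. a * u t) w = a * inner_on H u w"
  by (subst inner_lin_eq[of u u w _ a 0]) auto

lemma inner_diff_right:
  "u \<in> elems H \<Longrightarrow> v \<in> elems H \<Longrightarrow> w \<in> elems H \<Longrightarrow> inner_on H w (u - v) = inner_on H w u - inner_on H w v"
  using inner_diff_left[of u v w] by (simp add: inner_sym diff_mem)

lemma inner_add_right:
  "u \<in> elems H \<Longrightarrow> v \<in> elems H \<Longrightarrow> w \<in> elems H \<Longrightarrow> inner_on H w (\<lambda>t. u t + v t) = inner_on H w u + inner_on H w v"
  using inner_add_left[of u v w] by (simp add: inner_sym add_mem)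

lemma inner_scale_right:
  "u \<in> elems H \<Longrightarrow> w \<in> elems H \<Longrightarrow> inner_on H w (\<lambda>t. a * u t) = a * inner_on H w u"
  using inner_scale_left[of u w a] by (simp add: inner_sym scale_mem)

lemma norm_nonneg: "u \<in> elems H \<Longrightarrow> 0 \<le> fs_norm H u"
  by (simp add: fs_norm_def inner_nonneg)

lemma norm_sq: "u \<in> elems H \<Longrightarrow> (fs_norm H u)\<^sup>2 = inner_on H u u"
  by (simp add: fs_norm_def inner_nonneg)

lemma norm_scale: "u \<in> elems H \<Longrightarrow> fs_norm H (\<lambda>t. a * u t) = \<bar>a\<bar> * fs_norm H u"
  by (simp add: fs_norm_def inner_scale_left inner_scale_right scale_mem real_sqrt_mult
      flip: mult.assoc)

lemma norm_diff_sq: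
  assumes "u \<in> elems H" "v \<in> elems H"
  shows "(fs_norm H (u - v))\<^sup>2 = (fs_norm H u)\<^sup>2 + (fs_norm H v)\<^sup>2 - 2 * inner_on H u v"
  using assms by (simp add: norm_sq diff_mem inner_diff_left inner_diff_right inner_sym[of v u])

lemma norm_add_sq:
  assumes "u \<in> elems H" "v \<in> elems H"
  shows "(fs_norm H (\<lambda>t. u t + v t))\<^sup>2 = (fs_norm H u)\<^sup>2 + (fs_norm H v)\<^sup>2 + 2 * inner_on H u v"
  using assms by (simp add: norm_sq add_mem inner_add_left inner_add_right inner_sym[of v u])

lemma norm_minus_commute:
  assumes "u \<in> elems H" "v \<in> elems H"
  shows "fs_norm H (u - v) = fs_norm H (v - u)"
proof -
  have "(fs_norm H (u - v))\<^sup>2 = (fs_norm H (v - u))\<^sup>2"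
    using assms by (simp add: norm_diff_sq inner_sym)
  then show ?thesis
    using assms by (simp add: norm_nonneg diff_mem)
qed

text \<open>The quadratic \<open>A + 2 * c * B + c\<^sup>2 * C\<close> is nonnegative for all c. The
  case \<open>C = 0\<close> is a genuine one, because a nonzero function may have norm zero.\<close>

lemma Cauchy_Schwarz:
  assumes "u \<in> elems H" "v \<in> elems H"
  shows "\<bar>inner_on H u v\<bar> \<le> fs_norm H u * fs_norm H v"
proof -
  define A B C where "A = inner_on H u u" and "B = inner_on H u v" and "C = inner_on H v v"
  have 0: "0 \<le> A + 2 * c * B + c\<^sup>2 * C" for c
  proof -
    have "0 \<le> inner_on H (\<lambda>t. u t + c * v t) (\<lambda>t. u t + c * v t)"
      using assms by (intro inner_nonneg add_mem scale_mem)
    also have "\<dots> = A + 2 * c * B + c\<^sup>2 * C"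
      using assms by (simp add: inner_add_left[of u "\<lambda>t. c * v t"] inner_add_right[of u "\<lambda>t. c * v t"] inner_scale_left inner_scale_right
          scale_mem add_mem[of u "\<lambda>t. c * v t"] A_def B_def C_def inner_sym[of v u] power2_eq_square)
    finally show ?thesis .
  qed
  have C: "C \<ge> 0" "A \<ge> 0" using assms by (auto simp: C_def A_def inner_nonneg)
  have "B\<^sup>2 \<le> A * C"
  proof (cases "C = 0")
    case True
    have "B = 0"
    proof (rule ccontr)
      assume "B \<noteq> 0"
      \<comment> \<open>For C = 0 the quadratic is affine in c, and this c gives it the value
        -1.\<close>
      with 0[of "- (A + 1) / (2 * B)"] True show False by (simp add: field_simps)
    qed
    with C True show ?thesis by simp
  next
    case False
    with C have "C > 0" by simp
    with 0[of "- B / C"] show ?thesis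
      by (simp add: power2_eq_square field_simps)
  qed
  then have "sqrt (B\<^sup>2) \<le> sqrt (A * C)" by (rule real_sqrt_le_mono)
  then show ?thesis by (simp add: fs_norm_def real_sqrt_mult A_def B_def C_def)
qed

lemma norm_triangle:
  assumes "u \<in> elems H" "v \<in> elems H"
  shows "fs_norm H (\<lambda>t. u t + v t) \<le> fs_norm H u + fs_norm H v"
proof (rule power2_le_imp_le)
  show "(fs_norm H (\<lambda>t. u t + v t))\<^sup>2 \<le> (fs_norm H u + fs_norm H v)\<^sup>2"
    using Cauchy_Schwarz[OF assms] norm_add_sq[OF assms] by (simp add: power2_sum)
qed (use assms norm_nonneg in auto)

lemma norm_triangle_diff:
  assumes "u \<in> elems H" "v \<in> elems H" "w \<in> elems H"
  shows "fs_norm H (u - w) \<le> fs_norm H (u - v) + fs_norm H (v - w)"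
proof -
  have "u - w = (\<lambda>t. (u - v) t + (v - w) t)" by auto
  then show ?thesis using norm_triangle[of "u - v" "v - w"] assms by (simp add: diff_mem)
qed

lemma norm_diff_le:
  assumes "u \<in> elems H" "v \<in> elems H"
  shows "fs_norm H (u - v) \<le> fs_norm H u + fs_norm H v"
proof -
  have "u - v = (\<lambda>t. u t + (-1) * v t)" by auto
  then show ?thesis
    using norm_triangle[of u "\<lambda>t. (-1) * v t"] norm_scale[of v "-1"] scale_mem[of v "-1"] assms
    by simp
qed

lemma norm_eq_inner_zero:
  "u \<in> elems H \<Longrightarrow> v \<in> elems H \<Longrightarrow> fs_norm H u = 0 \<Longrightarrow> inner_on H u v = 0"
  using Cauchy_Schwarz[of u v] by simp

lemma norm_zero: "u \<in> elems H \<Longrightarrow> fs_norm H (u - u) = 0"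
  by (simp add: fs_norm_def inner_diff_left inner_diff_right diff_mem)

text \<open>The empty sum would be the zero function, whose membership is known only once some
  element of the space is at hand; hence \<open>A \<noteq> {}\<close>.\<close>

lemma sum_mem:
  assumes "finite A" "A \<noteq> {}" "\<And>i. i \<in> A \<Longrightarrow> u i \<in> elems H"
  shows "(\<lambda>t. \<Sum>i\<in>A. c i * u i t) \<in> elems H"
  using assms
proof (induction A rule: finite_ne_induct)
  case (singleton x) then show ?case by (simp add: scale_mem)
next
  case (insert x A)
  have "(\<lambda>t. \<Sum>i\<in>insert x A. c i * u i t) = (\<lambda>t. c x * u x t + 1 * (\<Sum>i\<in>A. c i * u i t))"
    using insert by auto
  then show ?case using insert by (simp only:) (intro lincomb; simp)
qed

lemma norm_sum_le:
  assumes "finite A" "A \<noteq> {}" "\<And>i. i \<in> A \<Longrightarrow> u i \<in> elems H"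
  shows "fs_norm H (\<lambda>t. \<Sum>i\<in>A. c i * u i t) \<le> (\<Sum>i\<in>A. \<bar>c i\<bar> * fs_norm H (u i))"
  using assms
proof (induction A rule: finite_ne_induct)
  case (singleton x) then show ?case by (simp add: norm_scale)
next
  case (insert x A)
  have "(\<lambda>t. \<Sum>i\<in>insert x A. c i * u i t) = (\<lambda>t. c x * u x t + (\<Sum>i\<in>A. c i * u i t))"
    using insert by auto
  moreover have "fs_norm H (\<lambda>t. c x * u x t + (\<Sum>i\<in>A. c i * u i t)) \<le>
      fs_norm H (\<lambda>t. c x * u x t) + fs_norm H (\<lambda>t. \<Sum>i\<in>A. c i * u i t)"
    using insert by (intro norm_triangle scale_mem sum_mem) auto
  ultimately show ?case using insert by (simp add: norm_scale)
qed

end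

section \<open>Square integrable functions over an arbitrary measure\<close>

text \<open>Any measure is allowed, so that the same facts serve the domain and the product measure
  on which the Slobodeckij difference quotients live.\<close>

definition l2 :: "'a measure \<Rightarrow> 'a fspace" where
  "l2 M = \<lparr>elems = {f. f \<in> borel_measurable M \<and> integrable M (\<lambda>t. (f t)\<^sup>2)},
           inner_on = (\<lambda>f g. \<integral>t. f t * g t \<partial>M)\<rparr>"

lemma L2_eq_l2: "L2 \<Omega> = l2 (lebesgue_on \<Omega>)"
  by (simp add: L2_def l2_def)

lemma mem_l2: "f \<in> elems (l2 M) \<longleftrightarrow> f \<in> borel_measurable M \<and> integrable M (\<lambda>t. (f t)\<^sup>2)"
  by (simp add: l2_def)

lemma l2_measurable: "f \<in> elems (l2 M) \<Longrightarrow> f \<in> borel_measurable M"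
  by (simp add: mem_l2)

lemma inner_l2: "inner_on (l2 M) f g = (\<integral>t. f t * g t \<partial>M)"
  by (simp add: l2_def)

lemma integrable_mult_l2:
  assumes "f \<in> elems (l2 M)" "g \<in> elems (l2 M)"
  shows "integrable M (\<lambda>t. f t * g t)"
proof (rule Bochner_Integration.integrable_bound)
  show "integrable M (\<lambda>t. (f t)\<^sup>2 + (g t)\<^sup>2)" using assms by (auto simp: mem_l2)
  show "(\<lambda>t. f t * g t) \<in> borel_measurable M" using assms by (auto simp: mem_l2)
  show "AE t in M. norm (f t * g t) \<le> norm ((f t)\<^sup>2 + (g t)\<^sup>2)"
  proof (rule AE_I2)
    fix t
    have "0 \<le> (\<bar>f t\<bar> - \<bar>g t\<bar>)\<^sup>2" by simp
    then have "2 * (\<bar>f t\<bar> * \<bar>g t\<bar>) \<le> (f t)\<^sup>2 + (g t)\<^sup>2" by (simp add: power2_diff)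
    moreover have "0 \<le> \<bar>f t\<bar> * \<bar>g t\<bar>" by simp
    ultimately have "\<bar>f t\<bar> * \<bar>g t\<bar> \<le> (f t)\<^sup>2 + (g t)\<^sup>2" by linarith
    then show "norm (f t * g t) \<le> norm ((f t)\<^sup>2 + (g t)\<^sup>2)"
      by (simp add: abs_mult)
  qed
qed

lemma pre_hilbert_l2: "pre_hilbert (l2 M)"
proof
  fix u v :: "'a \<Rightarrow> real" and a b :: real
  assume uv: "u \<in> elems (l2 M)" "v \<in> elems (l2 M)"
  have "(a * u t + b * v t)\<^sup>2 = a\<^sup>2 * (u t)\<^sup>2 + (2 * a * b) * (u t * v t) + b\<^sup>2 * (v t)\<^sup>2" for t
    by (simp add: power2_eq_square algebra_simps)
  then show "(\<lambda>t. a * u t + b * v t) \<in> elems (l2 M)"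
    using uv integrable_mult_l2[OF uv] by (auto simp: mem_l2)
  fix w assume w: "w \<in> elems (l2 M)"
  have "(a * u t + b * v t) * w t = a * (u t * w t) + b * (v t * w t)" for t
    by (simp add: algebra_simps)
  then show "inner_on (l2 M) (\<lambda>t. a * u t + b * v t) w = a * inner_on (l2 M) u w + b * inner_on (l2 M) v w"
    using integrable_mult_l2[OF uv(1) w] integrable_mult_l2[OF uv(2) w] by (simp add: inner_l2)
qed (auto simp: inner_l2 mult.commute)

lemma l2_norm_sq: "(fs_norm (l2 M) f)\<^sup>2 = (\<integral>t. (f t)\<^sup>2 \<partial>M)"
  by (simp add: fs_norm_def inner_l2 flip: power2_eq_square)

lemma l2_norm_nonneg: "0 \<le> fs_norm (l2 M) f"
  by (simp add: fs_norm_def inner_l2)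

lemma bounded_mem_l2:
  assumes "finite_measure M" "f \<in> borel_measurable M" "\<And>t. t \<in> space M \<Longrightarrow> \<bar>f t\<bar> \<le> B"
  shows "f \<in> elems (l2 M)"
proof -
  interpret finite_measure M by fact
  have "integrable M (\<lambda>t. (f t)\<^sup>2)"
  proof (rule integrable_const_bound[of _ "B\<^sup>2"])
    show "AE t in M. norm ((f t)\<^sup>2) \<le> B\<^sup>2"
    proof (rule AE_I2)
      fix t assume "t \<in> space M"
      then have "\<bar>f t\<bar>\<^sup>2 \<le> B\<^sup>2" by (intro power_mono assms(3)) auto
      then show "norm ((f t)\<^sup>2) \<le> B\<^sup>2" by simp
    qed
  qed (use assms in auto)
  then show ?thesis using assms by (simp add: mem_l2)
qed

lemma bounded_l2_norm_le:
  assumes "finite_measure M" "f \<in> borel_measurable M" "\<And>t. t \<in> space M \<Longrightarrow> \<bar>f t\<bar> \<le> B" "0 \<le> B"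
  shows "fs_norm (l2 M) f \<le> B * sqrt (measure M (space M))"
proof -
  interpret finite_measure M by fact
  have "(fs_norm (l2 M) f)\<^sup>2 = (\<integral>t. (f t)\<^sup>2 \<partial>M)" by (rule l2_norm_sq)
  also have "\<dots> \<le> (\<integral>t. B\<^sup>2 \<partial>M)"
    using bounded_mem_l2[OF assms(1,2,3)] assms(3,4)
    by (intro integral_mono) (auto simp: mem_l2 abs_le_square_iff[symmetric])
  also have "\<dots> = (B * sqrt (measure M (space M)))\<^sup>2"
    by (simp add: power_mult_distrib)
  finally show ?thesis
    using assms(4) by (auto intro: power2_le_imp_le)
qed

lemma integrable_l2:
  assumes "finite_measure M" "f \<in> elems (l2 M)"
  shows "integrable M f"
proof -
  have "(\<lambda>_. 1) \<in> elems (l2 M)" by (rule bounded_mem_l2[OF assms(1), of _ 1]) auto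
  from integrable_mult_l2[OF assms(2) this] show ?thesis by simp
qed

lemma l2_cong_AE:
  assumes "f \<in> elems (l2 M)" "g \<in> borel_measurable M" "AE t in M. f t = g t"
  shows "g \<in> elems (l2 M)"
proof -
  have "integrable M (\<lambda>t. (f t)\<^sup>2) = integrable M (\<lambda>t. (g t)\<^sup>2)"
    using assms by (intro integrable_cong_AE) (auto simp: mem_l2)
  then show ?thesis using assms by (auto simp: mem_l2)
qed

text \<open>Fatou's lemma bounds a nonnegative integral before integrability of the limit is known;
  membership and norm bound therefore come out together.\<close>

lemma l2_norm_le_nn:
  assumes "f \<in> borel_measurable M" "(\<integral>\<^sup>+t. ennreal ((f t)\<^sup>2) \<partial>M) \<le> ennreal (B\<^sup>2)" "0 \<le> B"
  shows "f \<in> elems (l2 M)" "fs_norm (l2 M) f \<le> B"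
proof -
  have i: "integrable M (\<lambda>t. (f t)\<^sup>2)"
    using assms by (intro integrableI_bounded) (auto intro: le_less_trans)
  then show "f \<in> elems (l2 M)" using assms by (simp add: mem_l2)
  have "ennreal ((fs_norm (l2 M) f)\<^sup>2) \<le> ennreal (B\<^sup>2)"
    using i assms(2) by (simp add: l2_norm_sq nn_integral_eq_integral)
  then show "fs_norm (l2 M) f \<le> B"
    using assms(3) by (auto intro: power2_le_imp_le)
qed

text \<open>Along a subsequence with rapidly decreasing steps \<open>d\<^sub>i\<close> the weighted series of \<open>2\<^sup>i d\<^sub>i\<^sup>2\<close>
  converges almost everywhere, which makes the subsequence converge pointwise; Fatou's lemma does the rest.\<close>

lemma l2_complete:
  fixes f :: "nat \<Rightarrow> 'a \<Rightarrow> real"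
  assumes f: "\<And>n. f n \<in> elems (l2 M)"
    and C: "\<And>e. e > 0 \<Longrightarrow> \<exists>N. \<forall>m\<ge>N. \<forall>n\<ge>N. fs_norm (l2 M) (f m - f n) < e"
  shows "\<exists>g r. g \<in> elems (l2 M) \<and> (\<lambda>n. fs_norm (l2 M) (f n - g)) \<longlonglongrightarrow> 0 \<and> strict_mono (r::nat\<Rightarrow>nat) \<and>
     (AE t in M. (\<lambda>i. f (r i) t) \<longlonglongrightarrow> g t)"
proof -
  interpret pre_hilbert "l2 M" by (rule pre_hilbert_l2)
  note [measurable] = f[THEN l2_measurable]
  obtain N where N: "\<And>e m n. e > 0 \<Longrightarrow> m \<ge> N e \<Longrightarrow> n \<ge> N e \<Longrightarrow> fs_norm (l2 M) (f m - f n) < e"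
    using C by metis
  \<comment> \<open>The index \<open>N ((1/2) ^ Suc i)\<close> makes consecutive members of the
    subsequence closer than (1/2)^i from stage i on; the maximum with \<open>Suc k\<close> keeps the
    indices strictly increasing.\<close>
  define r where "r = rec_nat (N 1) (\<lambda>i k. max (Suc k) (N ((1/2) ^ Suc i)))"
  have r: "strict_mono r" by (auto simp: strict_mono_Suc_iff r_def)
  have rN: "r i \<ge> N ((1/2)^i)" for i by (cases i) (auto simp: r_def)
  have step: "fs_norm (l2 M) (f (r (Suc i)) - f (r i)) < (1/2)^i" for i
    using rN[of i] strict_monoD[OF r, of i "Suc i"] by (intro N) auto
  define d where "d i t = f (r (Suc i)) t - f (r i) t" for i t
  have d: "d i \<in> elems (l2 M)" for i
    using diff_mem[OF f[of "r (Suc i)"] f[of "r i"]] by (simp add: d_def[abs_def] fun_diff_def)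
  note [measurable] = d[THEN l2_measurable]
  have dn: "(\<integral>\<^sup>+t. ennreal (2^i * (d i t)\<^sup>2) \<partial>M) \<le> ennreal ((1/2)^i)" for i
  proof -
    have "fs_norm (l2 M) (d i) < (1/2)^i"
      using step[of i] by (simp add: d_def[abs_def] fun_diff_def)
    then have "(fs_norm (l2 M) (d i))\<^sup>2 \<le> ((1/2)^i)\<^sup>2"
      by (intro power_mono) (auto simp: l2_norm_nonneg)
    then have "2^i * (\<integral>t. (d i t)\<^sup>2 \<partial>M) \<le> 2^i * ((1/2)^i)\<^sup>2"
      by (simp add: l2_norm_sq)
    also have "\<dots> = (1/2)^i"
      by (simp add: power2_eq_square power_one_over field_simps)
    finally have *: "(\<integral>t. 2^i * (d i t)\<^sup>2 \<partial>M) \<le> (1/2)^i" by simp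
    have "(\<integral>\<^sup>+t. ennreal (2^i * (d i t)\<^sup>2) \<partial>M) = ennreal (\<integral>t. 2^i * (d i t)\<^sup>2 \<partial>M)"
      using d[of i] by (intro nn_integral_eq_integral) (auto simp: mem_l2)
    with * show ?thesis by (simp add: ennreal_leI)
  qed
  have "(\<integral>\<^sup>+t. (\<Sum>i. ennreal (2^i * (d i t)\<^sup>2)) \<partial>M) = (\<Sum>i. \<integral>\<^sup>+t. ennreal (2^i * (d i t)\<^sup>2) \<partial>M)"
    by (intro nn_integral_suminf) measurable
  also have "\<dots> \<le> (\<Sum>i. ennreal ((1/2)^i))"
    by (intro suminf_le dn) auto
  also have "\<dots> < \<infinity>"
    by (subst suminf_ennreal2) (auto simp: summable_geometric)
  finally have "AE t in M. (\<Sum>i. ennreal (2^i * (d i t)\<^sup>2)) \<noteq> \<infinity>"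
    by (intro nn_integral_PInf_AE) (auto simp: top_unique)
  then have conv: "AE t in M. convergent (\<lambda>i. f (r i) t)"
  proof (rule AE_mp, intro AE_I2 impI)
    fix t assume "(\<Sum>i. ennreal (2^i * (d i t)\<^sup>2)) \<noteq> \<infinity>"
    then have "summable (\<lambda>i. 2^i * (d i t)\<^sup>2)"
      by (intro summable_suminf_not_top) auto
    then have "(\<lambda>i. 2^i * (d i t)\<^sup>2) \<longlonglongrightarrow> 0" by (rule summable_LIMSEQ_zero)
    then have "eventually (\<lambda>i. 2^i * (d i t)\<^sup>2 < 1) sequentially"
      by (auto dest: order_tendstoD(2)[of _ _ _ 1])
    \<comment> \<open>A bounded weighted term means that d_i is below 2^(-i/2), a geometric
      majorant.\<close>
    then have ev: "eventually (\<lambda>i. norm (d i t) \<le> (sqrt (1/2))^i) sequentially"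
    proof eventually_elim
      case (elim i)
      then have "(d i t)\<^sup>2 \<le> (1/2)^i" by (simp add: field_simps power_one_over)
      also have "\<dots> = ((sqrt (1/2))^i)\<^sup>2" by (simp add: power2_eq_square flip: power_mult_distrib)
      finally have "\<bar>d i t\<bar> \<le> \<bar>(sqrt (1/2))^i\<bar>" by (simp only: abs_le_square_iff)
      then show ?case by simp
    qed
    have "sqrt (1/2) < 1" by (simp add: real_sqrt_lt_1_iff)
    then have "summable (\<lambda>i. (sqrt (1/2))^i)" by (intro summable_geometric) simp
    then have "summable (\<lambda>i. d i t)"
      using ev by (rule summable_comparison_test_ev[rotated])
    then have "convergent (\<lambda>n. \<Sum>i<n. d i t)" by (simp add: summable_iff_convergent)
    moreover have "(\<Sum>i<n. d i t) = f (r n) t - f (r 0) t" for n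
      unfolding d_def by (rule sum_lessThan_telescope)
    ultimately have "convergent (\<lambda>n. f (r n) t - f (r 0) t)" by simp
    then have "convergent (\<lambda>n. (f (r n) t - f (r 0) t) + f (r 0) t)"
      by (intro convergent_add convergent_const)
    then show "convergent (\<lambda>i. f (r i) t)" by simp
  qed
  define g where "g t = lim (\<lambda>i. f (r i) t)" for t
  have g[measurable]: "g \<in> borel_measurable M" unfolding g_def by measurable
  have conv': "AE t in M. (\<lambda>i. f (r i) t) \<longlonglongrightarrow> g t"
    using conv by eventually_elim (simp add: g_def convergent_LIMSEQ_iff)
  have est: "f n - g \<in> elems (l2 M) \<and> fs_norm (l2 M) (f n - g) \<le> e" if "e > 0" "n \<ge> N e" for e n
  proof -
    have "(\<integral>\<^sup>+t. ennreal (((f n - g) t)\<^sup>2) \<partial>M) = (\<integral>\<^sup>+t. liminf (\<lambda>i. ennreal ((f n t - f (r i) t)\<^sup>2)) \<partial>M)"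
    proof (rule nn_integral_cong_AE, use conv' in eventually_elim)
      case (elim t)
      have "(\<lambda>i. ennreal ((f n t - f (r i) t)\<^sup>2)) \<longlonglongrightarrow> ennreal ((f n t - g t)\<^sup>2)"
        by (intro tendsto_intros elim tendsto_ennrealI)
      from lim_imp_Liminf[OF trivial_limit_sequentially this] show ?case by (simp only: fun_diff_def)
    qed
    also have "\<dots> \<le> liminf (\<lambda>i. \<integral>\<^sup>+t. ennreal ((f n t - f (r i) t)\<^sup>2) \<partial>M)"
      by (intro nn_integral_liminf) measurable
    also have "\<dots> \<le> ennreal (e\<^sup>2)"
    proof (rule Liminf_le)
      have "eventually (\<lambda>i. r i \<ge> N e) sequentially"
        using eventually_ge_at_top[of "N e"]
        by eventually_elim (use seq_suble[OF r] order_trans in blast)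
      then show "\<forall>\<^sub>F i in sequentially. (\<integral>\<^sup>+t. ennreal ((f n t - f (r i) t)\<^sup>2) \<partial>M) \<le> ennreal (e\<^sup>2)"
      proof eventually_elim
        case (elim i)
        have m: "f n - f (r i) \<in> elems (l2 M)" by (intro diff_mem f)
        have "(fs_norm (l2 M) (f n - f (r i)))\<^sup>2 \<le> e\<^sup>2"
          using N[OF that(1,2) elim] by (intro power_mono) (auto simp: l2_norm_nonneg)
        moreover have "(\<integral>\<^sup>+t. ennreal ((f n t - f (r i) t)\<^sup>2) \<partial>M) = ennreal ((fs_norm (l2 M) (f n - f (r i)))\<^sup>2)"
          using m unfolding l2_norm_sq by (subst nn_integral_eq_integral[symmetric]) (auto simp: mem_l2)
        ultimately show ?case by (simp add: ennreal_leI)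
      qed
    qed simp
    finally show ?thesis using l2_norm_le_nn[of "f n - g" M e] that
      by (simp add: fun_diff_def)
  qed
  \<comment> \<open>The estimate yields membership of the difference \<open>f n - g\<close> only;
    \<open>g\<close> itself is regained by subtracting once more.\<close>
  have "f (N 1) - (f (N 1) - g) \<in> elems (l2 M)"
    using diff_mem[OF f[of "N 1"], of "f (N 1) - g"] est[of 1 "N 1"] by auto
  moreover have "f (N 1) - (f (N 1) - g) = g" by auto
  ultimately have "g \<in> elems (l2 M)" by (simp only:)
  moreover have "(\<lambda>n. fs_norm (l2 M) (f n - g)) \<longlonglongrightarrow> 0"
  proof (rule LIMSEQ_I)
    fix e :: real assume "e > 0"
    then have "norm (fs_norm (l2 M) (f n - g) - 0) < e" if "n \<ge> N (e/2)" for n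
      using est[of "e/2" n] that l2_norm_nonneg[of M "f n - g"] by simp
    then show "\<exists>no. \<forall>n\<ge>no. norm (fs_norm (l2 M) (f n - g) - 0) < e" by blast
  qed
  ultimately show ?thesis using r conv' by blast
qed

subsection \<open>Smooth functions and test functions\<close>

text \<open>Asking for some derivative function at each stage, instead of iterating
  \<open>deriv\<close>, lets sums, products and affine substitutions be treated by induction without
  computing higher derivatives.\<close>

fun diff_times :: "nat \<Rightarrow> (real \<Rightarrow> real) \<Rightarrow> bool" where
  "diff_times 0 f \<longleftrightarrow> True"
| "diff_times (Suc n) f \<longleftrightarrow> (\<exists>f'. (\<forall>t. (f has_real_derivative f' t) (at t)) \<and> diff_times n f')"

definition smooth1 :: "(real \<Rightarrow> real) \<Rightarrow> bool" where
  "smooth1 f \<longleftrightarrow> (\<forall>n. diff_times n f)"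

lemma diff_times_Suc: "diff_times (Suc n) f \<Longrightarrow> diff_times n f"
proof (induction n arbitrary: f)
  case (Suc n)
  then obtain f' where "\<forall>t. (f has_real_derivative f' t) (at t)" "diff_times (Suc n) f'" by auto
  then show ?case using Suc.IH[of f'] by auto
qed simp

lemma diff_times_const: "diff_times n (\<lambda>t. c)"
proof (induction n arbitrary: c)
  case (Suc n)
  then show ?case by (auto intro!: exI[of _ "\<lambda>t. 0"])
qed simp

lemma diff_times_id: "diff_times n (\<lambda>t. t)"
  by (cases n) (auto intro!: exI[of _ "\<lambda>t. 1"] diff_times_const)

lemma diff_times_add: "diff_times n f \<Longrightarrow> diff_times n g \<Longrightarrow> diff_times n (\<lambda>t. f t + g t)"
proof (induction n arbitrary: f g)
  case (Suc n)
  then obtain f' g' where "\<forall>t. (f has_real_derivative f' t) (at t)" "diff_times n f'"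
    "\<forall>t. (g has_real_derivative g' t) (at t)" "diff_times n g'" by auto
  then show ?case using Suc.IH[of f' g']
    by (auto intro!: exI[of _ "\<lambda>t. f' t + g' t"] derivative_eq_intros)
qed simp

lemma diff_times_mult: "diff_times n f \<Longrightarrow> diff_times n g \<Longrightarrow> diff_times n (\<lambda>t. f t * g t)"
proof (induction n arbitrary: f g)
  case (Suc n)
  then obtain f' g' where fg: "\<forall>t. (f has_real_derivative f' t) (at t)" "diff_times n f'"
    "\<forall>t. (g has_real_derivative g' t) (at t)" "diff_times n g'" by auto
  have "diff_times n (\<lambda>t. f' t * g t + f t * g' t)"
    by (intro diff_times_add Suc.IH fg(2,4) diff_times_Suc[OF Suc.prems(1)] diff_times_Suc[OF Suc.prems(2)])
  moreover have "((\<lambda>t. f t * g t) has_real_derivative f' t * g t + f t * g' t) (at t)" for t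
    using DERIV_mult[OF fg(1)[rule_format, of t] fg(3)[rule_format, of t]] by (simp add: algebra_simps)
  ultimately show ?case unfolding diff_times.simps by (intro exI conjI allI)
qed simp

lemma diff_times_affine: "diff_times n f \<Longrightarrow> diff_times n (\<lambda>t. f (a * t + b))"
proof (induction n arbitrary: f)
  case (Suc n)
  then obtain f' where f: "\<forall>t. (f has_real_derivative f' t) (at t)" "diff_times n f'" by auto
  have "diff_times n (\<lambda>t. f' (a * t + b) * a)"
    using Suc.IH[OF f(2)] by (rule diff_times_mult) (rule diff_times_const)
  moreover have "((\<lambda>t. f (a * t + b)) has_real_derivative f' (a * t + b) * a) (at t)" for t
    by (rule DERIV_chain2[where f=f]) (use f in \<open>auto intro!: derivative_eq_intros\<close>)
  ultimately show ?case unfolding diff_times.simps by (intro exI conjI allI)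
qed simp

lemma smooth1_const: "smooth1 (\<lambda>t. c)"
  and smooth1_id: "smooth1 (\<lambda>t. t)"
  and smooth1_add: "smooth1 f \<Longrightarrow> smooth1 g \<Longrightarrow> smooth1 (\<lambda>t. f t + g t)"
  and smooth1_mult: "smooth1 f \<Longrightarrow> smooth1 g \<Longrightarrow> smooth1 (\<lambda>t. f t * g t)"
  and smooth1_affine: "smooth1 f \<Longrightarrow> smooth1 (\<lambda>t. f (a * t + b))"
  by (auto simp: smooth1_def diff_times_const diff_times_id diff_times_add diff_times_mult diff_times_affine)

lemma smooth1_power: "smooth1 f \<Longrightarrow> smooth1 (\<lambda>t. f t ^ k)"
  by (induction k) (auto intro: smooth1_const smooth1_mult)

lemma smooth1_DERIV: "smooth1 f \<Longrightarrow> (f has_real_derivative deriv f t) (at t)"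
proof -
  assume "smooth1 f"
  then have "diff_times (Suc 0) f" by (simp only: smooth1_def)
  then obtain f' where "\<And>t. (f has_real_derivative f' t) (at t)" by auto
  then show ?thesis using DERIV_imp_deriv by metis
qed

lemma smooth1_deriv: 
  assumes "smooth1 f" shows "smooth1 (deriv f)"
  unfolding smooth1_def
proof
  fix n
  obtain f' where f: "\<And>t. (f has_real_derivative f' t) (at t)" "diff_times n f'"
    using assms[unfolded smooth1_def, rule_format, of "Suc n"] by auto
  then have "deriv f = f'" by (auto simp: DERIV_imp_deriv)
  with f show "diff_times n (deriv f)" by simp
qed

lemma smooth1_continuous: "smooth1 f \<Longrightarrow> continuous_on S f"
  by (meson DERIV_isCont continuous_at_imp_continuous_on smooth1_DERIV)

definition flat_exp :: "real \<Rightarrow> real" where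
  "flat_exp t = (if t \<le> 0 then 0 else exp (- (1 / t)))"

lemma flat_exp_power_tendsto:
  "((\<lambda>t. (1 / t) ^ k * exp (- (1 / t))) \<longlongrightarrow> (0::real)) (at_right 0)"
proof -
  have "((\<lambda>x::real. x ^ k / exp x) \<longlongrightarrow> 0) at_top" by (rule tendsto_power_div_exp_0)
  from filterlim_compose[OF this filterlim_inverse_at_top_right] show ?thesis
    by (simp add: exp_minus divide_inverse)
qed

text \<open>The derivative of t^(-k) exp(-1/t) is a linear combination of the members k + 1 and k +
  2 of the same family, so the induction closes once k is arbitrary.\<close>

lemma diff_times_flat_exp_power:
  "diff_times n (\<lambda>t. if t \<le> 0 then 0 else (1 / t) ^ k * exp (- (1 / t)))"
proof (induction n arbitrary: k)
  case (Suc n)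
  let ?e = "\<lambda>k t. if t \<le> 0 then 0 else (1 / t) ^ k * exp (- (1 / t)) :: real"
  let ?d = "\<lambda>t. (- real k) * ?e (k + 1) t + ?e (k + 2) t"
  have "diff_times n ?d"
    by (intro diff_times_add diff_times_mult diff_times_const Suc.IH)
  moreover have "(?e k has_real_derivative ?d t) (at t)" for t
  proof -
    consider "t < 0" | "t = 0" | "t > 0" by linarith
    then show ?thesis
    proof cases
      case 1
      then have "eventually (\<lambda>s. s < 0) (nhds t)" by (intro eventually_nhds_in_open[of "{..<0}", simplified]) auto
      then have "eventually (\<lambda>s. ?e k s = 0) (nhds t)" by eventually_elim simp
      with 1 show ?thesis by (subst DERIV_cong_ev[OF refl _ refl]) auto
    next
      case 3
      then have "eventually (\<lambda>s. s > 0) (nhds t)" by (intro eventually_nhds_in_open[of "{0<..}", simplified]) auto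
      then have ev: "eventually (\<lambda>s. ?e k s = (1 / s) ^ k * exp (- (1 / s))) (nhds t)"
        by eventually_elim simp
      have *: "((\<lambda>s. (1 / s) ^ k * exp (- (1 / s))) has_real_derivative
        (real k * (1 / t) ^ (k - 1) * (- (1 / t^2))) * exp (- (1 / t)) +
        exp (- (1 / t)) * (1 / t^2) * (1 / t) ^ k) (at t)"
        using 3 by (auto intro!: derivative_eq_intros simp: power2_eq_square)
      have "(real k * (1 / t) ^ (k - 1) * (- (1 / t^2))) * exp (- (1 / t)) +
        exp (- (1 / t)) * (1 / t^2) * (1 / t) ^ k = ?d t"
        using 3 by (cases k) (auto simp: power2_eq_square field_simps)
      with * ev show ?thesis by (subst DERIV_cong_ev[OF refl ev refl]) simp
    next
      case 2
      have l: "((\<lambda>h. (?e k (0 + h) - ?e k 0) / h) \<longlongrightarrow> 0) (at_left 0)"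
      proof (rule tendsto_eventually)
        show "\<forall>\<^sub>F h in at_left 0. (?e k (0 + h) - ?e k 0) / h = 0"
          by (auto simp: eventually_at_filter)
      qed
      \<comment> \<open>The right difference quotient at 0 of the member k is the member k + 1,
        which tends to 0.\<close>
      have r: "((\<lambda>h. (?e k (0 + h) - ?e k 0) / h) \<longlongrightarrow> 0) (at_right 0)"
      proof (rule Lim_transform_eventually[OF flat_exp_power_tendsto[of "k + 1"]])
        show "\<forall>\<^sub>F h in at_right 0. (1 / h) ^ (k + 1) * exp (- (1 / h)) = (?e k (0 + h) - ?e k 0) / h"
          by (auto simp: eventually_at_filter)
      qed
      have "((\<lambda>h. (?e k (0 + h) - ?e k 0) / h) \<longlongrightarrow> 0) (at 0)"
        using l r filterlim_split_at by blast
      then show ?thesis using 2 by (simp add: DERIV_def)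
    qed
  qed
  ultimately show ?case unfolding diff_times.simps by (intro exI conjI allI)
qed simp

lemma smooth1_flat_exp: "smooth1 flat_exp"
proof -
  have "flat_exp = (\<lambda>t. if t \<le> 0 then 0 else (1 / t) ^ 0 * exp (- (1 / t)))"
    by (auto simp: flat_exp_def)
  then show ?thesis using diff_times_flat_exp_power[of _ 0] by (simp add: smooth1_def)
qed

lemma flat_exp_range: "0 \<le> flat_exp t" "flat_exp t \<le> 1"
  by (auto simp: flat_exp_def)

section \<open>Tensor products of one-variable functions\<close>

text \<open>A partial derivative changes a single factor and leaves a tensor product, so smoothness
  in several variables reduces to \<open>smooth1\<close>.\<close>

definition tens :: "('m::finite \<Rightarrow> real \<Rightarrow> real) \<Rightarrow> real^'m \<Rightarrow> real" where
  "tens f x = (\<Prod>i\<in>UNIV. f i (x $ i))"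

lemma tens_has_derivative:
  assumes "\<And>i. smooth1 (f i)"
  shows "(tens f has_derivative (\<lambda>y. \<Sum>i\<in>UNIV. (deriv (f i) (x $ i) * y $ i) * (\<Prod>j\<in>UNIV - {i}. f j (x $ j)))) (at x)"
  unfolding tens_def
proof (rule has_derivative_prod)
  fix i :: 'a
  have "((\<lambda>x. x $ i) has_derivative (\<lambda>y. y $ i)) (at x)"
    by (intro bounded_linear_imp_has_derivative bounded_linear_vec_nth)
  moreover have "(f i has_derivative (\<lambda>y. deriv (f i) (x $ i) * y)) (at (x $ i))"
    using smooth1_DERIV[OF assms, of i "x $ i"] by (simp add: has_field_derivative_def)
  ultimately show "((\<lambda>x. f i (x $ i)) has_derivative (\<lambda>y. deriv (f i) (x $ i) * y $ i)) (at x)"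
    by (rule has_derivative_compose)
qed

lemma pderiv_at_tens:
  assumes "\<And>i. smooth1 (f i)"
  shows "pderiv_at i (tens f) = tens (f(i := deriv (f i)))"
proof
  fix x
  have "pderiv_at i (tens f) x =
      (\<Sum>j\<in>UNIV. (deriv (f j) (x $ j) * axis i 1 $ j) * (\<Prod>l\<in>UNIV - {j}. f l (x $ l)))"
    unfolding pderiv_at_def frechet_derivative_at[OF tens_has_derivative[of f x, OF assms], symmetric] ..
  also have "\<dots> = (\<Sum>j\<in>UNIV. if j = i then deriv (f i) (x $ i) * (\<Prod>l\<in>UNIV - {i}. f l (x $ l)) else 0)"
    by (intro sum.cong) (auto simp: axis_def)
  also have "\<dots> = deriv (f i) (x $ i) * (\<Prod>l\<in>UNIV - {i}. f l (x $ l))" by simp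
  also have "(\<Prod>l\<in>UNIV - {i}. f l (x $ l)) = (\<Prod>l\<in>UNIV - {i}. (f(i := deriv (f i))) l (x $ l))"
    by (intro prod.cong) auto
  also have "deriv (f i) (x $ i) * \<dots> = tens (f(i := deriv (f i))) x"
    unfolding tens_def by (subst (2) prod.remove[of _ i]) auto
  finally show "pderiv_at i (tens f) x = tens (f(i := deriv (f i))) x" .
qed

lemma pderivs_tens:
  assumes "\<And>i. smooth1 (f i)"
  shows "\<exists>g. pderivs is (tens f) = tens g \<and> (\<forall>i. smooth1 (g i))"
proof (induction "is")
  case Nil then show ?case using assms by (auto simp: pderivs_def)
next
  case (Cons i "is")
  then obtain g where "pderivs is (tens f) = tens g" "\<forall>i. smooth1 (g i)" by auto
  then show ?case
    by (auto simp: pderivs_def pderiv_at_tens smooth1_deriv intro!: exI[of _ "g(i := deriv (g i))"])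
qed

lemma smooth_fun_tens:
  assumes "\<And>i. smooth1 (f i)" shows "smooth_fun (tens f)"
  unfolding smooth_fun_def
proof (intro allI)
  fix "is" x
  obtain g where "pderivs is (tens f) = tens g" "\<forall>i. smooth1 (g i)"
    using pderivs_tens assms by metis
  then show "pderivs is (tens f) differentiable at x"
    using tens_has_derivative[of g x] by (auto simp: differentiable_def)
qed

lemma continuous_on_tens:
  assumes "\<And>i. smooth1 (f i)" shows "continuous_on S (tens f)"
  by (meson assms continuous_at_imp_continuous_on has_derivative_continuous tens_has_derivative)

lemma tens_test_function:
  assumes "\<And>i. smooth1 (f i)" "\<And>i t. t \<notin> {a $ i..b $ i} \<Longrightarrow> f i t = 0" "cbox a b \<subseteq> \<Omega>"
  shows "tens f \<in> test_functions \<Omega>"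
proof -
  have sub: "{x. tens f x \<noteq> 0} \<subseteq> cbox a b"
  proof
    fix x assume x: "x \<in> {x. tens f x \<noteq> 0}"
    then have "f i (x $ i) \<noteq> 0" for i by (auto simp: tens_def)
    then have "x $ i \<in> {a $ i..b $ i}" for i using assms(2) by metis
    then show "x \<in> cbox a b" by (auto simp: mem_box_cart)
  qed
  have "closure {x. tens f x \<noteq> 0} \<subseteq> cbox a b" using sub
    by (intro closure_minimal closed_cbox)
  moreover have "bounded {x. tens f x \<noteq> 0}"
    using bounded_subset[OF bounded_cbox sub] .
  ultimately show ?thesis
    using assms(3) smooth_fun_tens[of f] assms(1) by (auto simp: test_functions_def)
qed

section \<open>The fundamental lemma of the calculus of variations\<close>

text \<open>The Borel sets whose trace on \<open>box c d\<close> has zero integral form a Dynkin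
  system; boxes are an intersection-stable generator. Applied to the sets where the function is
  positive or negative, this makes it vanish almost everywhere.\<close>

lemma integral_box_zero_AE:
  fixes V :: "'a::euclidean_space \<Rightarrow> real"
  assumes int: "integrable lebesgue V"
    and box: "\<And>a b. box a b \<subseteq> box c d \<Longrightarrow> (\<integral>x. indicator (box a b) x * V x \<partial>lebesgue) = 0"
  shows "AE x in lebesgue. x \<in> box c d \<longrightarrow> V x = 0"
proof -
  define P where "P A \<longleftrightarrow> (\<integral>x. indicator (A \<inter> box c d) x * V x \<partial>lebesgue) = 0" for A
  have i: "integrable lebesgue (\<lambda>x. indicator (A \<inter> box c d) x * V x)" if "A \<in> sets borel" for A
    using integrable_real_mult_indicator[of "A \<inter> box c d" lebesgue V] that int by (simp add: mult.commute)
  have PB: "P A" if "A \<in> sets borel" for A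
  proof -
    have "A \<in> sigma_sets UNIV (range (\<lambda>(a, b). box a b))"
      using that by (subst (asm) borel_eq_box) simp
    then show ?thesis
    proof (induction rule: sigma_sets_induct_disjoint[rotated 2, consumes 1, case_names basic empty compl union intstable subset])
      case (basic A)
      then obtain a b where A: "A = box a b" by auto
      then have "A \<inter> box c d = box (\<Sum>i\<in>Basis. max (a\<bullet>i) (c\<bullet>i) *\<^sub>R i) (\<Sum>i\<in>Basis. min (b\<bullet>i) (d\<bullet>i) *\<^sub>R i)"
        by (simp add: Int_interval_mixed_eq_empty box_Int_box)
      then show ?case unfolding P_def using box[OF subset_trans[OF equalityD2 inf_le2]] by simp
    next
      case empty then show ?case by (simp add: P_def)
    next
      case (compl A)
      have A: "A \<in> sets borel" using compl(1) by (subst borel_eq_box) simp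
      have "(\<integral>x. indicator ((UNIV - A) \<inter> box c d) x * V x \<partial>lebesgue) =
        (\<integral>x. indicator (UNIV \<inter> box c d) x * V x - indicator (A \<inter> box c d) x * V x \<partial>lebesgue)"
        by (intro Bochner_Integration.integral_cong) (auto simp: indicator_def)
      also have "\<dots> = 0"
        using box[of c d] compl(2) i[of UNIV] i[OF A]
        by (subst Bochner_Integration.integral_diff) (auto simp: P_def) 
      finally show ?case unfolding P_def .
    next
      case (union A)
      have A: "A i \<in> sets borel" for i using union(2) by (subst borel_eq_box) auto
      have U: "(\<Union>i. A i) \<in> sets borel" using A by auto
      have "(\<lambda>n. \<integral>x. indicator ((\<Union>i<n. A i) \<inter> box c d) x * V x \<partial>lebesgue) \<longlonglongrightarrow>
        (\<integral>x. indicator ((\<Union>i. A i) \<inter> box c d) x * V x \<partial>lebesgue)"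
      proof (rule integral_dominated_convergence[where w="\<lambda>x. \<bar>V x\<bar>"])
        show "integrable lebesgue (\<lambda>x. \<bar>V x\<bar>)" using int by simp
        show "AE x in lebesgue. (\<lambda>n. indicator ((\<Union>i<n. A i) \<inter> box c d) x * V x) \<longlonglongrightarrow>
          indicator ((\<Union>i. A i) \<inter> box c d) x * V x"
        proof (intro AE_I2 tendsto_mult tendsto_const)
          fix x
          show "(\<lambda>n. indicator ((\<Union>i<n. A i) \<inter> box c d) x) \<longlonglongrightarrow> (indicator ((\<Union>i. A i) \<inter> box c d) x :: real)"
          proof (cases "x \<in> (\<Union>i. A i) \<inter> box c d")
            case True
            then obtain i where i: "x \<in> A i" "x \<in> box c d" by auto
            then have "indicator ((\<Union>i<n. A i) \<inter> box c d) x = (1::real)" if "n > i" for n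
              using that by (auto simp: indicator_def)
            then have "eventually (\<lambda>n. indicator ((\<Union>i<n. A i) \<inter> box c d) x = (1::real)) sequentially"
              using eventually_gt_at_top[of i] by (rule eventually_mono[rotated])
            then show ?thesis using True by (simp add: tendsto_eventually)
          next
            case False
            then have "indicator ((\<Union>i<n. A i) \<inter> box c d) x = (0::real)" for n
              by (auto simp: indicator_def)
            with False show ?thesis by simp
          qed
        qed
        show "AE x in lebesgue. norm (indicator ((\<Union>i<n. A i) \<inter> box c d) x * V x) \<le> \<bar>V x\<bar>" for n
          by (auto simp: indicator_def)
      qed (use i[OF U] i[of "\<Union>i<n. A i" for n] A in \<open>auto intro: borel_measurable_integrable\<close>)
      moreover have "(\<integral>x. indicator ((\<Union>i<n. A i) \<inter> box c d) x * V x \<partial>lebesgue) = 0" for n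
      proof (induction n)
        case (Suc n)
        have "indicator ((\<Union>i<Suc n. A i) \<inter> box c d) x * V x =
          indicator ((\<Union>i<n. A i) \<inter> box c d) x * V x + indicator (A n \<inter> box c d) x * V x" for x
        proof -
          have "x \<notin> A i" if "x \<in> A n" "i < n" for i
            using union(1)[unfolded disjoint_family_on_def, rule_format, of i n] that by auto
          then show ?thesis by (auto simp: indicator_def lessThan_Suc)
        qed
        then show ?case using Suc i[of "A n"] i[of "\<Union>i<n. A i"] A union(3)[of n]
          by (simp add: P_def)
      qed simp
      ultimately show ?case unfolding P_def by (simp add: LIMSEQ_const_iff)
    qed (auto simp: Int_stable_def box_Int_box)
  qed
  \<comment> \<open>\<open>V\<close> is only Lebesgue measurable while \<open>P\<close> is known for
    Borel sets, so the sign sets are taken from a Borel version of \<open>V\<close>.\<close>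
  obtain g where g: "g \<in> borel_measurable lborel" "AE x in lborel. V x = g x"
    using completion_ex_borel_measurable_real[of V lborel] int by auto
  then have ae: "AE x in lebesgue. V x = g x" by (simp add: AE_completion)
  have gm: "g \<in> borel_measurable lebesgue"
    using g(1) by (simp add: measurable_completion)
  have *: "AE x in lebesgue. indicator ({x. s * g x > 0} \<inter> box c d) x * g x = 0" if "s = 1 \<or> s = -1" for s :: real
  proof -
    let ?A = "{x. s * g x > 0}"
    have A: "?A \<in> sets borel" using g(1) by simp
    then have "?A \<inter> box c d \<in> sets lborel" by simp
    then have B: "?A \<inter> box c d \<in> sets lebesgue" by (rule sets_completionI_sets)
    have m: "(\<lambda>x. indicator (?A \<inter> box c d) x * g x) \<in> borel_measurable lebesgue"
      by (intro borel_measurable_times borel_measurable_indicator B gm)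
    have e: "AE x in lebesgue. indicator (?A \<inter> box c d) x * g x = indicator (?A \<inter> box c d) x * V x"
      using ae by eventually_elim simp
    have "integrable lebesgue (\<lambda>x. indicator (?A \<inter> box c d) x * g x)"
      by (rule integrable_cong_AE_imp[OF i[OF A] m AE_symmetric[OF e]])
    then have 1: "integrable lebesgue (\<lambda>x. s * (indicator (?A \<inter> box c d) x * g x))" by simp
    have "(\<integral>x. indicator (?A \<inter> box c d) x * g x \<partial>lebesgue) = (\<integral>x. indicator (?A \<inter> box c d) x * V x \<partial>lebesgue)"
      by (rule integral_cong_AE[OF m borel_measurable_integrable[OF i[OF A]] e])
    also have "\<dots> = 0" using PB[OF A] by (simp add: P_def)
    finally have "(\<integral>x. s * (indicator (?A \<inter> box c d) x * g x) \<partial>lebesgue) = 0" by simp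
    then have "AE x in lebesgue. s * (indicator (?A \<inter> box c d) x * g x) = 0"
      by (subst (asm) integral_nonneg_eq_0_iff_AE[OF 1]) (auto simp: indicator_def)
    then show ?thesis by eventually_elim (use that in auto)
  qed
  show ?thesis using ae *[of 1, simplified] *[of "-1", simplified]
  proof eventually_elim
    case (elim x)
    then show ?case by (cases "g x" "0::real" rule: linorder_cases) (auto simp: indicator_def split: if_splits)
  qed
qed

lemma lebesgue_on_integral:
  fixes f :: "'a::euclidean_space \<Rightarrow> real"
  assumes "\<Omega> \<in> sets lebesgue"
  shows "(\<integral>x. f x \<partial>lebesgue_on \<Omega>) = (\<integral>x. indicator \<Omega> x * f x \<partial>lebesgue)"
    and "integrable (lebesgue_on \<Omega>) f \<longleftrightarrow> integrable lebesgue (\<lambda>x. indicator \<Omega> x * f x)"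
  using assms by (auto simp: integral_restrict_space integrable_restrict_space)

text \<open>Indicators of open boxes are bounded pointwise limits of test functions, which reduces
  the claim to \<open>integral_box_zero_AE\<close> on each box of a countable cover.\<close>

lemma test_functions_separate:
  fixes v :: "real^'m \<Rightarrow> real"
  assumes "open \<Omega>" and v: "integrable (lebesgue_on \<Omega>) v"
    and 0: "\<And>\<phi>. \<phi> \<in> test_functions \<Omega> \<Longrightarrow> (\<integral>t. v t * \<phi> t \<partial>lebesgue_on \<Omega>) = 0"
  shows "AE t in lebesgue_on \<Omega>. v t = 0"
proof -
  define V where "V x = indicator \<Omega> x * v x" for x
  have O: "\<Omega> \<in> sets lebesgue" using assms(1) by simp
  have V: "integrable lebesgue V" using v O by (simp add: V_def[abs_def] lebesgue_on_integral)
  have box0: "(\<integral>x. indicator (box a b) x * V x \<partial>lebesgue) = 0" if "cbox a b \<subseteq> \<Omega>" for a b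
  proof -
    \<comment> \<open>On the open interval both arguments tend to infinity with n and the product
      tends to 1; outside, one of them is nonpositive and the product is exactly 0.\<close>
    define f where "f n i t = flat_exp (real (Suc n) * (t - a $ i)) * flat_exp (real (Suc n) * (b $ i - t))"
      for n i t
    have s: "smooth1 (f n i)" for n i
      using smooth1_mult[OF smooth1_affine[OF smooth1_flat_exp, of "real (Suc n)" "- real (Suc n) * a $ i"]
          smooth1_affine[OF smooth1_flat_exp, of "- real (Suc n)" "real (Suc n) * b $ i"]]
      by (simp add: f_def[abs_def] algebra_simps)
    have z: "f n i t = 0" if "t \<notin> {a $ i<..<b $ i}" for n i t
      using that by (auto simp: f_def flat_exp_def mult_le_0_iff)
    have t: "tens (f n) \<in> test_functions \<Omega>" for n
      by (rule tens_test_function[OF s _ that]) (use z in auto)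
    have r: "0 \<le> f n i t" "f n i t \<le> 1" for n i t
      using flat_exp_range by (auto simp: f_def intro: mult_le_one)
    have int0: "(\<integral>x. V x * tens (f n) x \<partial>lebesgue) = 0" for n
    proof -
      have "(\<integral>x. V x * tens (f n) x \<partial>lebesgue) = (\<integral>x. v x * tens (f n) x \<partial>lebesgue_on \<Omega>)"
        using O by (simp add: lebesgue_on_integral V_def mult.assoc)
      then show ?thesis using 0[OF t] by simp
    qed
    have tm: "tens (f n) \<in> borel_measurable lebesgue" for n
      using borel_measurable_continuous_onI[OF continuous_on_tens[of "f n" UNIV, OF s]]
      by (intro measurable_completion) simp
    have "(\<lambda>n. \<integral>x. V x * tens (f n) x \<partial>lebesgue) \<longlonglongrightarrow> (\<integral>x. indicator (box a b) x * V x \<partial>lebesgue)"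
    proof (rule integral_dominated_convergence[where w="\<lambda>x. \<bar>V x\<bar>"])
      show "integrable lebesgue (\<lambda>x. \<bar>V x\<bar>)" using V by simp
      show "(\<lambda>x. indicator (box a b) x * V x) \<in> borel_measurable lebesgue" 
        using V by (intro borel_measurable_times borel_measurable_indicator) auto
      show "(\<lambda>x. V x * tens (f n) x) \<in> borel_measurable lebesgue" for n
        using V tm by (intro borel_measurable_times) auto
      show "AE x in lebesgue. norm (V x * tens (f n) x) \<le> \<bar>V x\<bar>" for n
      proof (rule AE_I2)
        fix x
        have "\<bar>tens (f n) x\<bar> \<le> 1"
          unfolding tens_def abs_prod using r by (intro prod_le_1) auto
        then show "norm (V x * tens (f n) x) \<le> \<bar>V x\<bar>"
          by (simp add: abs_mult mult_left_le)
      qed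
      show "AE x in lebesgue. (\<lambda>n. V x * tens (f n) x) \<longlonglongrightarrow> indicator (box a b) x * V x"
      proof (rule AE_I2)
        fix x
        have "(\<lambda>n. tens (f n) x) \<longlonglongrightarrow> indicator (box a b) x"
        proof (cases "x \<in> box a b")
          case True
          have "(\<lambda>n. tens (f n) x) \<longlonglongrightarrow> (\<Prod>i\<in>(UNIV::'m set). 1)"
            unfolding tens_def
          proof (rule tendsto_prod)
            fix i
            have x: "a $ i < x $ i" "x $ i < b $ i" using True by (auto simp: mem_box_cart)
            have l: "(\<lambda>n. flat_exp (real (Suc n) * c)) \<longlonglongrightarrow> 1" if "c > 0" for c :: real
            proof -
              have "(\<lambda>n. exp (- ((1 / c) * inverse (real (Suc n))))) \<longlonglongrightarrow> exp (- ((1 / c) * 0))"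
                by (intro tendsto_intros LIMSEQ_inverse_real_of_nat)
              moreover have "flat_exp (real (Suc n) * c) = exp (- ((1 / c) * inverse (real (Suc n))))" for n
              proof -
                have "\<not> real (Suc n) * c \<le> 0" using mult_pos_pos[of "real (Suc n)" c] that by (simp add: not_le del: of_nat_Suc)
                then show ?thesis by (simp add: flat_exp_def divide_simps)
              qed
              ultimately show ?thesis by simp
            qed
            show "(\<lambda>n. f n i (x $ i)) \<longlonglongrightarrow> 1"
              unfolding f_def using tendsto_mult[OF l l, of "x $ i - a $ i" "b $ i - x $ i"] x by simp
          qed
          then show ?thesis using True by simp
        next
          case False
          then obtain i where "x $ i \<notin> {a $ i<..<b $ i}" by (auto simp: mem_box_cart)
          then have "tens (f n) x = 0" for n
            unfolding tens_def using z[of "x $ i" i n] by (intro prod_zero) auto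
          then show ?thesis using False by simp
        qed
        then show "(\<lambda>n. V x * tens (f n) x) \<longlonglongrightarrow> indicator (box a b) x * V x"
          by (subst mult.commute) (intro tendsto_intros)
      qed
    qed
    then show ?thesis using int0 by (simp add: LIMSEQ_const_iff)
  qed
  have boxz: "AE x in lebesgue. x \<in> box c d \<longrightarrow> V x = 0" if cd: "cbox c d \<subseteq> \<Omega>" for c d :: "real^'m"
  proof (rule integral_box_zero_AE[OF V])
    fix a b :: "real^'m" assume ab: "box a b \<subseteq> box c d"
    show "(\<integral>x. indicator (box a b) x * V x \<partial>lebesgue) = 0"
    proof (cases "box a b = {}")
      case False
      then have "cbox a b \<subseteq> closure (box c d)"
        using ab closure_mono[OF ab] by (simp add: closure_box)
      also have "\<dots> \<subseteq> cbox c d" by (intro closure_minimal box_subset_cbox closed_cbox)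
      finally have "cbox a b \<subseteq> \<Omega>" using cd by (rule subset_trans)
      then show ?thesis by (rule box0)
    qed simp
  qed
  have cboxz: "AE x in lebesgue. x \<in> cbox c d \<longrightarrow> V x = 0" if cd: "cbox c d \<subseteq> \<Omega>" for c d :: "real^'m"
  proof -
    \<comment> \<open>The countable cover of \<Omega> consists of closed boxes, so their faces are
      discarded as null sets.\<close>
    have "cbox c d - box c d \<in> null_sets lebesgue"
      using negligible_frontier_interval negligible_iff_null_sets by blast
    then have "AE x in lebesgue. x \<notin> cbox c d - box c d" by (rule AE_not_in)
    then show ?thesis using boxz[OF cd] by eventually_elim auto
  qed
  obtain \<D> where D: "countable \<D>" "\<D> \<subseteq> Pow \<Omega>" "\<And>X. X \<in> \<D> \<Longrightarrow> \<exists>a b. X = cbox a b" "\<Union>\<D> = \<Omega>"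
    using open_countable_Union_open_cbox[OF assms(1)] by metis
  have "AE x in lebesgue. \<forall>X\<in>\<D>. x \<in> X \<longrightarrow> V x = 0"
    using D(1)
  proof (subst AE_ball_countable, simp, intro ballI)
    fix X assume "X \<in> \<D>"
    then obtain a b where "X = cbox a b" "cbox a b \<subseteq> \<Omega>" using D(2,3) by blast
    then show "AE x in lebesgue. x \<in> X \<longrightarrow> V x = 0" using cboxz by simp
  qed
  then have "AE x in lebesgue. x \<in> \<Omega> \<longrightarrow> v x = 0"
  proof eventually_elim
    case (elim x)
    show ?case
    proof
      assume "x \<in> \<Omega>"
      then have "V x = 0" using elim D(4) by blast
      with \<open>x \<in> \<Omega>\<close> show "v x = 0" by (simp add: V_def)
    qed
  qed
  then show ?thesis using O by (simp add: AE_restrict_space_iff)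
qed

subsection \<open>Sobolev--Slobodeckij spaces\<close>

lemma finite_measure_lebesgue_on:
  fixes \<Omega> :: "'a::euclidean_space set"
  assumes "open \<Omega>" "bounded \<Omega>" shows "finite_measure (lebesgue_on \<Omega>)"
  using assms by (intro finite_measure_lebesgue_on) (simp add: bounded_set_imp_lmeasurable)

lemma test_function_pderiv_at:
  assumes \<phi>: "\<phi> \<in> test_functions \<Omega>" shows "pderiv_at i \<phi> \<in> test_functions \<Omega>"
proof -
  let ?K = "closure {x. \<phi> x \<noteq> 0}"
  have "pderiv_at i \<phi> x = 0" if "x \<notin> ?K" for x
  proof -
    have "\<forall>\<^sub>F y in nhds x. y \<in> - ?K" using that by (intro eventually_nhds_in_open) auto
    then have "\<forall>\<^sub>F y in nhds x. \<phi> y = 0"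
      by eventually_elim (use closure_subset[of "{x. \<phi> x \<noteq> 0}"] in auto)
    then have e: "\<forall>\<^sub>F y in at x. \<phi> y = 0" "\<phi> x = 0"
      using eventually_nhds_x_imp_x by (auto simp: eventually_at_filter elim: eventually_mono)
    have "(\<phi> has_derivative (\<lambda>h. 0)) (at x)"
      by (rule has_derivative_transform_eventually[OF has_derivative_const[of 0]])
        (use e in \<open>auto elim: eventually_mono\<close>)
    then show ?thesis by (simp add: pderiv_at_def frechet_derivative_at[symmetric])
  qed
  then have "closure {x. pderiv_at i \<phi> x \<noteq> 0} \<subseteq> ?K"
    by (intro closure_minimal) auto
  moreover have "smooth_fun (pderiv_at i \<phi>)"
    unfolding smooth_fun_def
  proof (intro allI)
    fix "is" x
    have "pderivs is (pderiv_at i \<phi>) = pderivs (is @ [i]) \<phi>" by (simp add: pderivs_def)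
    then show "pderivs is (pderiv_at i \<phi>) differentiable at x"
      using \<phi> by (auto simp: test_functions_def smooth_fun_def)
  qed
  moreover have "bounded {x. pderiv_at i \<phi> x \<noteq> 0}"
  proof (rule bounded_subset)
    show "bounded ?K" using \<phi> by (auto simp: test_functions_def intro: compact_imp_bounded)
    show "{x. pderiv_at i \<phi> x \<noteq> 0} \<subseteq> ?K" using calculation(1) closure_subset by (rule subset_trans[rotated])
  qed
  ultimately show ?thesis using \<phi> by (auto simp: test_functions_def)
qed

lemma test_function_pderivs: "\<phi> \<in> test_functions \<Omega> \<Longrightarrow> pderivs is \<phi> \<in> test_functions \<Omega>"
  by (induction "is") (auto simp: pderivs_def test_function_pderiv_at)

lemma test_function_continuous:
  assumes "\<phi> \<in> test_functions \<Omega>" shows "continuous_on S \<phi>"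
proof -
  have "pderivs [] \<phi> differentiable at x" for x
    using assms unfolding test_functions_def smooth_fun_def by blast
  then show ?thesis
    by (simp add: pderivs_def differentiable_imp_continuous_within continuous_at_imp_continuous_on)
qed

lemma test_function_bounded:
  assumes "\<phi> \<in> test_functions \<Omega>" obtains B where "\<And>x. \<bar>\<phi> x\<bar> \<le> B"
proof -
  let ?K = "closure {x. \<phi> x \<noteq> 0}"
  have "compact (\<phi> ` ?K)"
    using assms by (intro compact_continuous_image test_function_continuous) (auto simp: test_functions_def)
  then obtain B where "\<forall>y\<in>\<phi> ` ?K. norm y \<le> B" using compact_imp_bounded bounded_iff by metis
  then have B: "\<bar>\<phi> x\<bar> \<le> B" if "x \<in> ?K" for x using that by auto
  have "\<bar>\<phi> x\<bar> \<le> max B 0" for x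
  proof (cases "\<phi> x = 0")
    case False
    then have "x \<in> ?K" using closure_subset[of "{x. \<phi> x \<noteq> 0}"] by auto
    from B[OF this] show ?thesis by simp
  qed simp
  then show ?thesis by (rule that)
qed

lemma test_function_l2:
  assumes "open \<Omega>" "bounded \<Omega>" "\<phi> \<in> test_functions \<Omega>"
  shows "\<phi> \<in> elems (l2 (lebesgue_on \<Omega>))"
proof -
  obtain B where "\<And>x. \<bar>\<phi> x\<bar> \<le> B" using test_function_bounded[OF assms(3)] by metis
  moreover have "\<phi> \<in> borel_measurable (lebesgue_on \<Omega>)"
    using assms by (intro continuous_imp_measurable_on_sets_lebesgue test_function_continuous) auto
  ultimately show ?thesis
    using finite_measure_lebesgue_on[OF assms(1,2)] by (intro bounded_mem_l2) auto
qed

text \<open>\<open>is_weak_deriv\<close> quantifies over the lists realising a multi-index. Without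
  such a list it would hold vacuously and weak derivatives would not be unique.\<close>

lemma ex_list_count:
  fixes \<alpha> :: "'m::finite \<Rightarrow> nat"
  obtains xs where "\<forall>i. count_list xs i = \<alpha> i"
proof -
  obtain xs where "mset xs = Abs_multiset \<alpha>" using ex_mset by metis
  then have "count (mset xs) i = \<alpha> i" for i by (simp add: count_Abs_multiset)
  then have "\<forall>i. count_list xs i = \<alpha> i" by (simp add: count_mset)
  then show ?thesis by (rule that)
qed

lemma mi_size_count_list: "mi_size (count_list (xs :: 'm::finite list)) = length xs"
  unfolding mi_size_def
proof (induction xs)
  case (Cons a xs)
  have "(\<Sum>i\<in>UNIV. count_list (a # xs) i) = (\<Sum>i\<in>UNIV. count_list xs i + (if i = a then 1 else 0))"
    by (intro sum.cong) auto
  then show ?case using Cons by (simp add: sum.distrib)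
qed simp

lemma finite_mi_size_le: "finite {\<alpha> :: 'm::finite \<Rightarrow> nat. mi_size \<alpha> \<le> k}"
proof (rule finite_subset)
  show "{\<alpha> :: 'm \<Rightarrow> nat. mi_size \<alpha> \<le> k} \<subseteq> PiE UNIV (\<lambda>_. {..k})"
    by (auto simp: mi_size_def intro: order_trans[OF member_le_sum[of _ UNIV]])
  show "finite (PiE UNIV (\<lambda>_::'m. {..k}))" by (intro finite_PiE) auto
qed

lemma finite_mi_size_eq: "finite {\<alpha> :: 'm::finite \<Rightarrow> nat. mi_size \<alpha> = k}"
  by (rule finite_subset[OF _ finite_mi_size_le[of k]]) auto

text \<open>Halving the exponent splits the Slobodeckij integrand into a product of two such
  quotients. The fractional part of the inner product thereby becomes an \<open>l2\<close> inner
  product on the product measure.\<close>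

definition slob_quot :: "real \<Rightarrow> (real^'m \<Rightarrow> real) \<Rightarrow> (real^'m) \<times> (real^'m) \<Rightarrow> real" where
  "slob_quot \<theta> f = (\<lambda>(t, t'). (f t - f t') / norm (t - t') powr ((real CARD('m) + 2 * \<theta>) / 2))"

lemma slobodeckij_integrand_eq:
  fixes f g :: "real^'m \<Rightarrow> real"
  shows "slobodeckij_integrand \<theta> f g = (\<lambda>p. slob_quot \<theta> f p * slob_quot \<theta> g p)"
proof
  fix p :: "(real^'m) \<times> (real^'m)"
  obtain t t' where p: "p = (t, t')" by (cases p)
  let ?e = "real CARD('m) + 2 * \<theta>"
  have "norm (t - t') powr ?e = norm (t - t') powr (?e / 2) * norm (t - t') powr (?e / 2)"
    by (simp only: powr_add[symmetric] field_sum_of_halves)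
  then show "slobodeckij_integrand \<theta> f g p = slob_quot \<theta> f p * slob_quot \<theta> g p"
    by (simp only: slobodeckij_integrand_def slob_quot_def p prod.case times_divide_times_eq)
qed

lemma AE_pair_fst:
  assumes "sigma_finite_measure N" "AE x in M. P x" shows "AE p in M \<Otimes>\<^sub>M N. P (fst p)"
proof -
  interpret sigma_finite_measure N by fact
  obtain A where A: "{x \<in> space M. \<not> P x} \<subseteq> A" "A \<in> sets M" "emeasure M A = 0"
    using assms(2) by (auto elim: AE_E)
  have "A \<times> space N \<in> null_sets (M \<Otimes>\<^sub>M N)"
    using A by (auto simp: null_sets_def emeasure_pair_measure_Times)
  then show ?thesis
    by (rule AE_I') (use A in \<open>auto simp: space_pair_measure\<close>)
qed

lemma AE_pair_snd:
  assumes "sigma_finite_measure N" "AE x in N. P x" shows "AE p in M \<Otimes>\<^sub>M N. P (snd p)"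
proof -
  interpret sigma_finite_measure N by fact
  obtain A where A: "{x \<in> space N. \<not> P x} \<subseteq> A" "A \<in> sets N" "emeasure N A = 0"
    using assms(2) by (auto elim: AE_E)
  have "space M \<times> A \<in> null_sets (M \<Otimes>\<^sub>M N)"
    using A by (auto simp: null_sets_def emeasure_pair_measure_Times)
  then show ?thesis
    by (rule AE_I') (use A in \<open>auto simp: space_pair_measure\<close>)
qed

lemma inner_l2_cong_AE:
  assumes "f \<in> borel_measurable M" "f' \<in> borel_measurable M" "g \<in> borel_measurable M"
    "AE t in M. f t = f' t"
  shows "inner_on (l2 M) f g = inner_on (l2 M) f' g"
  unfolding inner_l2 using assms by (intro integral_cong_AE) auto

lemma norm_l2_cong_AE:
  assumes "f \<in> borel_measurable M" "f' \<in> borel_measurable M" "AE t in M. f t = f' t"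
  shows "fs_norm (l2 M) f = fs_norm (l2 M) f'"
  unfolding fs_norm_def inner_l2 using assms by (intro arg_cong[where f=sqrt] integral_cong_AE) auto

section \<open>The pre-Hilbert structure of H^s\<close>

locale sobolev_domain =
  fixes \<Omega> :: "(real^'m) set" and s :: real
  assumes open_dom: "open \<Omega>" and bounded_dom: "bounded \<Omega>"
begin

abbreviation "M \<equiv> lebesgue_on \<Omega>"
abbreviation "LL \<equiv> lebesgue_on \<Omega> \<Otimes>\<^sub>M lebesgue_on \<Omega>"
abbreviation "H \<equiv> Hs s \<Omega>"
abbreviation "k \<equiv> nat \<lfloor>s\<rfloor>"
abbreviation "\<theta> \<equiv> frac s"
abbreviation "wd \<equiv> weak_deriv \<Omega>"
abbreviation "q \<equiv> slob_quot (frac s)"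

lemma finite_M: "finite_measure M" by (rule finite_measure_lebesgue_on[OF open_dom bounded_dom])

lemma sigma_finite_M: "sigma_finite_measure M"
  using finite_M by (simp add: finite_measure_def)

lemma finite_LL: "finite_measure LL"
  using finite_measure_pair_measure[OF finite_M finite_M] .

lemma slob_quot_measurable: "f \<in> borel_measurable M \<Longrightarrow> q f \<in> borel_measurable LL"
proof -
  assume [measurable]: "f \<in> borel_measurable M"
  have [measurable]: "(\<lambda>x. x) \<in> borel_measurable M"
    by (intro measurable_restrict_space1 measurable_completion) simp
  have "(\<lambda>p. (f (fst p) - f (snd p)) / norm (fst p - snd p) powr ((real CARD('m) + 2 * \<theta>) / 2)) \<in> borel_measurable LL"
    by measurable
  then show ?thesis by (simp add: slob_quot_def case_prod_unfold)
qed

lemma slob_quot_cong_AE: "AE t in M. f t = g t \<Longrightarrow> AE p in LL. q f p = q g p"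
proof -
  assume *: "AE t in M. f t = g t"
  show ?thesis
    using AE_pair_fst[OF sigma_finite_M *] AE_pair_snd[OF sigma_finite_M *, of M]
    by eventually_elim (simp add: slob_quot_def case_prod_unfold)
qed

lemma slob_quot_lin: "q (\<lambda>t. a * f t + b * g t) = (\<lambda>p. a * q f p + b * q g p)"
  by (auto simp: slob_quot_def case_prod_unfold algebra_simps diff_divide_distrib add_divide_distrib)

lemma mem_Hs: "u \<in> elems H \<longleftrightarrow> continuous_on \<Omega> u \<and> (\<forall>t. t \<notin> \<Omega> \<longrightarrow> u t = 0) \<and> u \<in> elems (l2 M) \<and>
    (\<forall>\<alpha>. mi_size \<alpha> \<le> k \<longrightarrow> (\<exists>v\<in>elems (l2 M). is_weak_deriv \<Omega> \<alpha> u v)) \<and>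
    (\<theta> > 0 \<longrightarrow> (\<forall>\<alpha>. mi_size \<alpha> = k \<longrightarrow> integrable LL (\<lambda>p. (q (wd \<alpha> u) p)\<^sup>2)))"
  unfolding Hs_def Let_def L2_eq_l2 slobodeckij_integrand_eq power2_eq_square by simp

lemma inner_Hs: "inner_on H u v =
    (\<Sum>\<alpha> | mi_size \<alpha> \<le> k. inner_on (l2 M) (wd \<alpha> u) (wd \<alpha> v)) +
    (if \<theta> > 0 then (\<Sum>\<alpha> | mi_size \<alpha> = k. inner_on (l2 LL) (q (wd \<alpha> u)) (q (wd \<alpha> v))) else 0)"
  unfolding Hs_def Let_def L2_eq_l2 slobodeckij_integrand_eq inner_l2 by simp

lemma wd_mem: "u \<in> elems H \<Longrightarrow> mi_size \<alpha> \<le> k \<Longrightarrow> wd \<alpha> u \<in> elems (l2 M)"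
  and wd_weak: "u \<in> elems H \<Longrightarrow> mi_size \<alpha> \<le> k \<Longrightarrow> is_weak_deriv \<Omega> \<alpha> u (wd \<alpha> u)"
proof -
  assume "u \<in> elems H" "mi_size \<alpha> \<le> k"
  then have "\<exists>v. v \<in> elems (L2 \<Omega>) \<and> is_weak_deriv \<Omega> \<alpha> u v"
    unfolding L2_eq_l2 by (auto simp: mem_Hs)
  from someI_ex[OF this] show "wd \<alpha> u \<in> elems (l2 M)" "is_weak_deriv \<Omega> \<alpha> u (wd \<alpha> u)"
    by (auto simp: weak_deriv_def L2_eq_l2)
qed

lemma slob_mem: "u \<in> elems H \<Longrightarrow> mi_size \<alpha> = k \<Longrightarrow> \<theta> > 0 \<Longrightarrow> q (wd \<alpha> u) \<in> elems (l2 LL)"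
  using slob_quot_measurable[OF l2_measurable[OF wd_mem[of u \<alpha>]]]
  by (simp add: mem_l2) (simp add: mem_Hs)

lemma Hs_l2: "u \<in> elems H \<Longrightarrow> u \<in> elems (l2 M)" by (simp add: mem_Hs)

text \<open>The difference of two weak derivatives integrates to zero against every test function.
  This makes the arbitrary choice in \<open>weak_deriv\<close> linear up to null sets.\<close>

lemma weak_deriv_unique:
  assumes v: "v \<in> elems (l2 M)" "is_weak_deriv \<Omega> \<alpha> u v"
    and w: "w \<in> elems (l2 M)" "is_weak_deriv \<Omega> \<alpha> u w"
  shows "AE t in M. v t = w t"
proof -
  interpret L: pre_hilbert "l2 M" by (rule pre_hilbert_l2)
  obtain "is" where "is": "\<forall>i. count_list is i = \<alpha> i" using ex_list_count by metis
  have "(\<integral>t. (v - w) t * \<phi> t \<partial>M) = 0" if \<phi>: "\<phi> \<in> test_functions \<Omega>" for \<phi>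
  proof -
    have \<phi>2: "\<phi> \<in> elems (l2 M)" using test_function_l2 \<phi> open_dom bounded_dom by blast
    have "(-1) ^ mi_size \<alpha> * (\<integral>t. v t * \<phi> t \<partial>M) = (-1) ^ mi_size \<alpha> * (\<integral>t. w t * \<phi> t \<partial>M)"
      using v(2)[unfolded is_weak_deriv_def, rule_format, OF \<phi> "is"[rule_format]]
        w(2)[unfolded is_weak_deriv_def, rule_format, OF \<phi> "is"[rule_format]] by simp
    then have "inner_on (l2 M) v \<phi> = inner_on (l2 M) w \<phi>" by (simp add: inner_l2)
    then have "inner_on (l2 M) (v - w) \<phi> = 0" using L.inner_diff_left[OF v(1) w(1) \<phi>2] by simp
    then show ?thesis by (simp add: inner_l2)
  qed
  then have "AE t in M. (v - w) t = 0"
    using integrable_l2[OF finite_M L.diff_mem[OF v(1) w(1)]] open_dom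
    by (intro test_functions_separate[of \<Omega> "v - w"])
  then show ?thesis by eventually_elim simp
qed

lemma is_weak_deriv_lin:
  assumes "u \<in> elems (l2 M)" "v \<in> elems (l2 M)" "u' \<in> elems (l2 M)" "v' \<in> elems (l2 M)"
    and "is_weak_deriv \<Omega> \<alpha> u u'" "is_weak_deriv \<Omega> \<alpha> v v'"
  shows "is_weak_deriv \<Omega> \<alpha> (\<lambda>t. a * u t + b * v t) (\<lambda>t. a * u' t + b * v' t)"
  unfolding is_weak_deriv_def
proof (intro ballI allI impI)
  interpret L: pre_hilbert "l2 M" by (rule pre_hilbert_l2)
  fix \<phi> "is" assume \<phi>: "\<phi> \<in> test_functions \<Omega>" and "is": "\<forall>i. count_list is i = \<alpha> i"
  have 1: "\<phi> \<in> elems (l2 M)" "pderivs is \<phi> \<in> elems (l2 M)"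
    using test_function_l2 test_function_pderivs \<phi> open_dom bounded_dom by blast+
  have "(\<integral>t. u t * pderivs is \<phi> t \<partial>M) = (-1) ^ mi_size \<alpha> * (\<integral>t. u' t * \<phi> t \<partial>M)"
    "(\<integral>t. v t * pderivs is \<phi> t \<partial>M) = (-1) ^ mi_size \<alpha> * (\<integral>t. v' t * \<phi> t \<partial>M)"
    using assms(5,6)[unfolded is_weak_deriv_def, rule_format, OF \<phi> "is"[rule_format]] by auto
  then show "(\<integral>t. (a * u t + b * v t) * pderivs is \<phi> t \<partial>M) =
      (-1) ^ mi_size \<alpha> * (\<integral>t. (a * u' t + b * v' t) * \<phi> t \<partial>M)"
    using L.inner_lin[OF assms(1,2) 1(2), of a b] L.inner_lin[OF assms(3,4) 1(1), of a b]
    by (simp add: inner_l2 algebra_simps)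
qed

lemma wd_AE:
  assumes "v \<in> elems (l2 M)" "is_weak_deriv \<Omega> \<alpha> u v"
  shows "wd \<alpha> u \<in> elems (l2 M)" "AE t in M. wd \<alpha> u t = v t"
proof -
  have "\<exists>v. v \<in> elems (L2 \<Omega>) \<and> is_weak_deriv \<Omega> \<alpha> u v"
    unfolding L2_eq_l2 using assms by auto
  from someI_ex[OF this] have *: "wd \<alpha> u \<in> elems (l2 M)" "is_weak_deriv \<Omega> \<alpha> u (wd \<alpha> u)"
    by (auto simp: weak_deriv_def L2_eq_l2)
  then show "wd \<alpha> u \<in> elems (l2 M)" "AE t in M. wd \<alpha> u t = v t"
    using weak_deriv_unique assms by auto
qed

lemma wd_lin:
  assumes "u \<in> elems H" "v \<in> elems H" "mi_size \<alpha> \<le> k"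
  shows "AE t in M. wd \<alpha> (\<lambda>t. a * u t + b * v t) t = a * wd \<alpha> u t + b * wd \<alpha> v t"
    and "wd \<alpha> (\<lambda>t. a * u t + b * v t) \<in> elems (l2 M)"
    and "is_weak_deriv \<Omega> \<alpha> (\<lambda>t. a * u t + b * v t) (\<lambda>t. a * wd \<alpha> u t + b * wd \<alpha> v t)"
proof -
  interpret L: pre_hilbert "l2 M" by (rule pre_hilbert_l2)
  have 1: "(\<lambda>t. a * wd \<alpha> u t + b * wd \<alpha> v t) \<in> elems (l2 M)"
    using assms by (intro L.lincomb wd_mem)
  show 2: "is_weak_deriv \<Omega> \<alpha> (\<lambda>t. a * u t + b * v t) (\<lambda>t. a * wd \<alpha> u t + b * wd \<alpha> v t)"
    using assms by (intro is_weak_deriv_lin wd_mem wd_weak Hs_l2)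
  show "AE t in M. wd \<alpha> (\<lambda>t. a * u t + b * v t) t = a * wd \<alpha> u t + b * wd \<alpha> v t"
    "wd \<alpha> (\<lambda>t. a * u t + b * v t) \<in> elems (l2 M)"
    using wd_AE[OF 1 2] by auto
qed

lemma slob_lin:
  assumes "u \<in> elems H" "v \<in> elems H" "mi_size \<alpha> = k"
  shows "AE p in LL. q (wd \<alpha> (\<lambda>t. a * u t + b * v t)) p = a * q (wd \<alpha> u) p + b * q (wd \<alpha> v) p"
  using slob_quot_cong_AE[OF wd_lin(1)[OF assms(1,2), of \<alpha> a b]] assms(3) by (simp add: slob_quot_lin)

text \<open>Since \<open>weak_deriv\<close> picks a representative, the derivative of a linear
  combination agrees with the combination of derivatives only almost everywhere. Each axiom is
  therefore proved for the combination and transported along the almost everywhere equality, on the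
  domain and on the product.\<close>

sublocale Hs: pre_hilbert H
proof
  interpret L: pre_hilbert "l2 M" by (rule pre_hilbert_l2)
  interpret Q: pre_hilbert "l2 LL" by (rule pre_hilbert_l2)
  fix u v :: "real^'m \<Rightarrow> real" and a b :: real
  assume uv: "u \<in> elems H" "v \<in> elems H"
  let ?w = "\<lambda>t. a * u t + b * v t"
  have qm: "q (wd \<alpha> ?w) \<in> borel_measurable LL" if "mi_size \<alpha> = k" for \<alpha>
    using that wd_lin(2)[OF uv] by (intro slob_quot_measurable l2_measurable) auto
  show w: "?w \<in> elems H"
    unfolding mem_Hs
  proof (intro conjI allI impI)
    show "continuous_on \<Omega> ?w" using uv by (auto simp: mem_Hs intro!: continuous_intros)
    show "?w t = 0" if "t \<notin> \<Omega>" for t using uv that by (auto simp: mem_Hs)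
    show "?w \<in> elems (l2 M)" using uv by (intro L.lincomb Hs_l2)
    show "\<exists>v\<in>elems (l2 M). is_weak_deriv \<Omega> \<alpha> ?w v" if "mi_size \<alpha> \<le> k" for \<alpha>
      using wd_lin(3)[OF uv that] L.lincomb[OF wd_mem[OF uv(1) that] wd_mem[OF uv(2) that]] by blast
    show "integrable LL (\<lambda>p. (q (wd \<alpha> ?w) p)\<^sup>2)" if "\<theta> > 0" "mi_size \<alpha> = k" for \<alpha>
    proof -
      have "q (wd \<alpha> ?w) \<in> elems (l2 LL)"
        by (rule l2_cong_AE[OF Q.lincomb[OF slob_mem[OF uv(1) that(2,1)] slob_mem[OF uv(2) that(2,1)]]
              qm[OF that(2)] AE_symmetric[OF slob_lin[OF uv that(2)]]])
      then show ?thesis by (simp add: mem_l2)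
    qed
  qed
  fix z assume z: "z \<in> elems H"
  have 1: "inner_on (l2 M) (wd \<alpha> ?w) (wd \<alpha> z) =
      a * inner_on (l2 M) (wd \<alpha> u) (wd \<alpha> z) + b * inner_on (l2 M) (wd \<alpha> v) (wd \<alpha> z)" if "mi_size \<alpha> \<le> k" for \<alpha>
  proof -
    have m: "wd \<alpha> u \<in> elems (l2 M)" "wd \<alpha> v \<in> elems (l2 M)" "wd \<alpha> z \<in> elems (l2 M)" "wd \<alpha> ?w \<in> elems (l2 M)"
      using uv z w that wd_mem by auto
    have "inner_on (l2 M) (wd \<alpha> ?w) (wd \<alpha> z) = inner_on (l2 M) (\<lambda>t. a * wd \<alpha> u t + b * wd \<alpha> v t) (wd \<alpha> z)"
      using m L.lincomb[OF m(1,2), of a b] wd_lin(1)[OF uv that, of a b]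
      by (intro inner_l2_cong_AE l2_measurable)
    then show ?thesis using L.inner_lin m by simp
  qed
  have 2: "inner_on (l2 LL) (q (wd \<alpha> ?w)) (q (wd \<alpha> z)) =
      a * inner_on (l2 LL) (q (wd \<alpha> u)) (q (wd \<alpha> z)) + b * inner_on (l2 LL) (q (wd \<alpha> v)) (q (wd \<alpha> z))"
    if "\<theta> > 0" "mi_size \<alpha> = k" for \<alpha>
  proof -
    have m: "q (wd \<alpha> u) \<in> elems (l2 LL)" "q (wd \<alpha> v) \<in> elems (l2 LL)" "q (wd \<alpha> z) \<in> elems (l2 LL)"
      "q (wd \<alpha> ?w) \<in> elems (l2 LL)"
      using uv z w that slob_mem by auto
    have "inner_on (l2 LL) (q (wd \<alpha> ?w)) (q (wd \<alpha> z)) =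
        inner_on (l2 LL) (\<lambda>t. a * q (wd \<alpha> u) t + b * q (wd \<alpha> v) t) (q (wd \<alpha> z))"
      using m Q.lincomb[OF m(1,2), of a b] slob_lin[OF uv that(2), of a b]
      by (intro inner_l2_cong_AE l2_measurable)
    then show ?thesis using Q.inner_lin m by simp
  qed
  show "inner_on H ?w z = a * inner_on H u z + b * inner_on H v z"
    unfolding inner_Hs using 1 2 by (simp add: sum.distrib sum_distrib_left algebra_simps)
next
  fix u v assume "u \<in> elems H" "v \<in> elems H"
  show "inner_on H u v = inner_on H v u"
    by (simp add: inner_Hs inner_l2 mult.commute)
next
  fix u assume "u \<in> elems H"
  show "0 \<le> inner_on H u u"
    unfolding inner_Hs inner_l2 by (auto intro!: add_nonneg_nonneg sum_nonneg integral_nonneg)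
qed

lemma norm_Hs_sq: "u \<in> elems H \<Longrightarrow> (fs_norm H u)\<^sup>2 =
    (\<Sum>\<alpha> | mi_size \<alpha> \<le> k. (fs_norm (l2 M) (wd \<alpha> u))\<^sup>2) +
    (if \<theta> > 0 then (\<Sum>\<alpha> | mi_size \<alpha> = k. (fs_norm (l2 LL) (q (wd \<alpha> u)))\<^sup>2) else 0)"
  unfolding Hs.norm_sq inner_Hs l2_norm_sq inner_l2 by (simp add: power2_eq_square)

lemma norm_wd_le:
  assumes "u \<in> elems H" "mi_size \<alpha> \<le> k"
  shows "fs_norm (l2 M) (wd \<alpha> u) \<le> fs_norm H u"
proof (rule power2_le_imp_le)
  have "(fs_norm (l2 M) (wd \<alpha> u))\<^sup>2 \<le> (\<Sum>\<alpha> | mi_size \<alpha> \<le> k. (fs_norm (l2 M) (wd \<alpha> u))\<^sup>2)"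
    using assms by (intro member_le_sum[of \<alpha>] finite_mi_size_le) auto
  also have "\<dots> \<le> (fs_norm H u)\<^sup>2"
    using assms by (subst norm_Hs_sq) (auto intro!: sum_nonneg)
  finally show "(fs_norm (l2 M) (wd \<alpha> u))\<^sup>2 \<le> (fs_norm H u)\<^sup>2" .
qed (use assms Hs.norm_nonneg in auto)

lemma norm_slob_le:
  assumes "u \<in> elems H" "mi_size \<alpha> = k" "\<theta> > 0"
  shows "fs_norm (l2 LL) (q (wd \<alpha> u)) \<le> fs_norm H u"
proof (rule power2_le_imp_le)
  have "(fs_norm (l2 LL) (q (wd \<alpha> u)))\<^sup>2 \<le> (\<Sum>\<alpha> | mi_size \<alpha> = k. (fs_norm (l2 LL) (q (wd \<alpha> u)))\<^sup>2)"
    using assms by (intro member_le_sum[of \<alpha>] finite_mi_size_eq) auto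
  also have "\<dots> \<le> (fs_norm H u)\<^sup>2"
    using assms by (subst norm_Hs_sq) (auto intro!: sum_nonneg)
  finally show "(fs_norm (l2 LL) (q (wd \<alpha> u)))\<^sup>2 \<le> (fs_norm H u)\<^sup>2" .
qed (use assms Hs.norm_nonneg in auto)

lemma wd_0:
  assumes "u \<in> elems (l2 M)" shows "AE t in M. wd (\<lambda>_. 0) u t = u t"
proof -
  have "is_weak_deriv \<Omega> (\<lambda>_. 0) u u"
    unfolding is_weak_deriv_def
  proof (intro ballI allI impI)
    fix \<phi> and "is" :: "'m list" assume "\<forall>i. count_list is i = 0"
    then have "is = []" by (cases "is") (auto dest: spec[of _ "hd is"])
    then show "(\<integral>t. u t * pderivs is \<phi> t \<partial>M) = (-1) ^ mi_size (\<lambda>_::'m. 0) * (\<integral>t. u t * \<phi> t \<partial>M)"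
      by (simp add: pderivs_def mi_size_def)
  qed
  from wd_AE(2)[OF assms this] show ?thesis .
qed

lemma norm_l2_le:
  assumes "u \<in> elems H" shows "fs_norm (l2 M) u \<le> fs_norm H u"
proof -
  have "fs_norm (l2 M) u = fs_norm (l2 M) (wd (\<lambda>_. 0) u)"
    using wd_mem[OF assms, of "\<lambda>_. 0"]
    by (intro norm_l2_cong_AE AE_symmetric[OF wd_0] Hs_l2[OF assms] l2_measurable) (simp add: mi_size_def)
  also have "\<dots> \<le> fs_norm H u" using assms by (intro norm_wd_le) (auto simp: mi_size_def)
  finally show ?thesis .
qed

end

subsection \<open>Local means on cones and the Sobolev embedding\<close>

text \<open>A cube around an axis point at distance \<open>R\<close> from the vertex fits into the
  cone together with all its contractions towards the vertex. So at every x the same kernel shape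
  can be used at all scales up to 1, and the centres \<open>a\<close> range over one sphere, a
  compact set.\<close>

lemma cone_property_cubes:
  fixes \<Omega> :: "(real^'m) set"
  assumes "cone_property \<Omega>"
  obtains R h where "R > 0" "h > 0"
    "\<And>x. x \<in> \<Omega> \<Longrightarrow> \<exists>a. norm a = R \<and> (\<forall>\<tau> z. 0 < \<tau> \<and> \<tau> \<le> 1 \<and> (\<forall>i. \<bar>z $ i - a $ i\<bar> \<le> h) \<longrightarrow> x + \<tau> *\<^sub>R z \<in> \<Omega>)"
proof -
  obtain \<rho> \<kappa> where \<rho>: "0 < \<rho>" "0 < \<kappa>" "\<kappa> < pi / 2"
    and cone: "\<And>x. x \<in> \<Omega> \<Longrightarrow> \<exists>\<xi>. norm \<xi> = 1 \<and> finite_cone x \<xi> \<rho> \<kappa> \<subseteq> \<Omega>"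
    using assms unfolding cone_property_def by metis
  define m where "m = real CARD('m)"
  have m: "m > 0" by (simp add: m_def)
  have c: "cos \<kappa> < 1" "0 < cos \<kappa>"
    using \<rho> cos_monotone_0_pi[of 0 \<kappa>] cos_gt_zero_pi[of \<kappa>] by auto
  define R where "R = \<rho> / 2"
  \<comment> \<open>Points of the cube are within m h of its centre by the l1 bound. This h gives 2
    m h = R (1 - cos \<kappa>), hence (R + m h) cos \<kappa> \<le> R - m h, which is the angle
    condition of the cone.\<close>
  define h where "h = \<rho> * (1 - cos \<kappa>) / (4 * m)"
  have Rh: "R > 0" "h > 0" using \<rho> c m by (auto simp: R_def h_def)
  have mh: "m * h = \<rho> * (1 - cos \<kappa>) / 4" using m by (simp add: h_def)
  show ?thesis
  proof (rule that[OF Rh])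
    fix x assume "x \<in> \<Omega>"
    then obtain \<xi> where \<xi>: "norm \<xi> = 1" "finite_cone x \<xi> \<rho> \<kappa> \<subseteq> \<Omega>" using cone by metis
    let ?a = "R *\<^sub>R \<xi>"
    have "x + \<tau> *\<^sub>R z \<in> \<Omega>" if \<tau>: "0 < \<tau>" "\<tau> \<le> 1" and z: "\<forall>i. \<bar>z $ i - ?a $ i\<bar> \<le> h" for \<tau> z
    proof -
      have "norm (z - ?a) \<le> (\<Sum>i\<in>UNIV. \<bar>(z - ?a) $ i\<bar>)" by (rule norm_le_l1_cart)
      also have "\<dots> \<le> (\<Sum>i\<in>(UNIV::'m set). h)" using z by (intro sum_mono) auto
      finally have d: "norm (z - ?a) \<le> m * h" by (simp add: m_def)
      have a: "norm ?a = R" using \<xi> Rh by simp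
      have "norm z \<le> norm ?a + norm (z - ?a)" using norm_triangle_ineq[of ?a "z - ?a"] by simp
      with a d have nz: "norm z \<le> R + m * h" by linarith
      have "z \<bullet> \<xi> = R + (z - ?a) \<bullet> \<xi>"
        using \<xi> by (simp add: inner_diff_left power2_norm_eq_inner[symmetric])
      moreover have "\<bar>(z - ?a) \<bullet> \<xi>\<bar> \<le> m * h"
        using Cauchy_Schwarz_ineq2[of "z - ?a" \<xi>] \<xi> d by simp
      ultimately have zi: "z \<bullet> \<xi> \<ge> R - m * h" by linarith
      have "norm z * cos \<kappa> \<le> (R + m * h) * cos \<kappa>" using nz c by (intro mult_right_mono) auto
      also have "\<dots> \<le> R - m * h"
      proof -
        have "m * h * (1 + cos \<kappa>) \<le> m * h * 2" using c Rh m by (intro mult_left_mono) auto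
        also have "\<dots> = R * (1 - cos \<kappa>)" by (simp add: mh R_def)
        finally show ?thesis by (simp add: algebra_simps)
      qed
      finally have 1: "norm z * cos \<kappa> \<le> z \<bullet> \<xi>" using zi by linarith
      have "m * h \<le> \<rho> / 4" using \<rho> c by (simp add: mh mult_le_cancel_left1)
      then have 2: "norm z \<le> \<rho>" using nz \<rho> by (simp add: R_def)
      have "\<tau> * norm z \<le> \<rho>" using 2 \<tau> mult_left_le_one_le[of "norm z" \<tau>] by simp
      moreover have "(\<tau> *\<^sub>R z) \<bullet> \<xi> \<ge> norm (\<tau> *\<^sub>R z) * cos \<kappa>"
        using 1 \<tau> by (simp add: mult.assoc)
      ultimately have "x + \<tau> *\<^sub>R z \<in> finite_cone x \<xi> \<rho> \<kappa>"
        using \<tau> unfolding finite_cone_def by auto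
      then show ?thesis using \<xi> by auto
    qed
    moreover have "norm ?a = R" using \<xi> Rh by simp
    ultimately show "\<exists>a. norm a = R \<and> (\<forall>\<tau> z. 0 < \<tau> \<and> \<tau> \<le> 1 \<and> (\<forall>i. \<bar>z $ i - a $ i\<bar> \<le> h) \<longrightarrow> x + \<tau> *\<^sub>R z \<in> \<Omega>)"
      by blast
  qed
qed

lemma l2_norm_le_indicator:
  assumes "finite_measure M" "f \<in> borel_measurable M" "A \<in> sets M"
    "\<And>t. t \<in> space M \<Longrightarrow> \<bar>f t\<bar> \<le> B * indicator A t" "0 \<le> B"
  shows "fs_norm (l2 M) f \<le> B * sqrt (measure M A)"
proof -
  interpret finite_measure M by fact
  have b: "\<bar>f t\<bar> \<le> B" if "t \<in> space M" for t
    using assms(4)[OF that] assms(5) by (cases "t \<in> A") auto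
  have "(fs_norm (l2 M) f)\<^sup>2 = (\<integral>t. (f t)\<^sup>2 \<partial>M)" by (rule l2_norm_sq)
  also have "\<dots> \<le> (\<integral>t. B\<^sup>2 * indicator A t \<partial>M)"
  proof (rule integral_mono)
    show "integrable M (\<lambda>t. (f t)\<^sup>2)" using bounded_mem_l2[OF assms(1,2) b] by (simp add: mem_l2)
    show "integrable M (\<lambda>t. B\<^sup>2 * indicator A t)"
      using assms(3) emeasure_finite[of A] by (intro integrable_mult_right integrable_real_indicator) (auto simp: less_top[symmetric])
    fix t assume "t \<in> space M"
    from assms(4)[OF this] have "\<bar>f t\<bar>\<^sup>2 \<le> (B * indicator A t)\<^sup>2" by (intro power_mono) auto
    then show "(f t)\<^sup>2 \<le> B\<^sup>2 * indicator A t" by (auto simp: indicator_def split: if_splits)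
  qed
  also have "\<dots> = (B * sqrt (measure M A))\<^sup>2"
    using assms(3) by (simp add: power_mult_distrib sets.Int_space_eq2)
  finally show ?thesis
    using assms(5) by (auto intro: power2_le_imp_le)
qed

text \<open>Differentiation under the integral sign. The weight \<open>w\<close> is kept apart from
  the kernel: it is merely integrable, while the mean value theorem bounds the difference quotients
  of \<open>K\<close> by \<open>B\<close>, so that \<open>\<bar>w p\<bar> * B\<close>
  dominates.\<close>

lemma has_real_derivative_integral:
  fixes K D :: "real \<Rightarrow> 'a \<Rightarrow> real"
  assumes w: "integrable M w" and \<tau>: "\<tau> \<in> {\<alpha><..<\<beta>}"
    and K: "\<And>t. t \<in> {\<alpha><..<\<beta>} \<Longrightarrow> integrable M (\<lambda>p. w p * K t p)"
    and deriv: "\<And>t p. t \<in> {\<alpha><..<\<beta>} \<Longrightarrow> p \<in> space M \<Longrightarrow> ((\<lambda>t. K t p) has_real_derivative D t p) (at t)"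
    and D: "D \<tau> \<in> borel_measurable M"
    and B: "\<And>t p. t \<in> {\<alpha><..<\<beta>} \<Longrightarrow> p \<in> space M \<Longrightarrow> \<bar>D t p\<bar> \<le> B"
  shows "((\<lambda>t. \<integral>p. w p * K t p \<partial>M) has_real_derivative (\<integral>p. w p * D \<tau> p \<partial>M)) (at \<tau>)"
proof -
  have "((\<lambda>y. ((\<integral>p. w p * K y p \<partial>M) - (\<integral>p. w p * K \<tau> p \<partial>M)) / (y - \<tau>)) \<longlongrightarrow> (\<integral>p. w p * D \<tau> p \<partial>M)) (at \<tau> within {\<alpha><..<\<beta>})"
    unfolding tendsto_at_iff_sequentially
  proof (intro allI impI)
    fix X :: "nat \<Rightarrow> real"
    assume "\<forall>n. X n \<in> {\<alpha><..<\<beta>} - {\<tau>}" "X \<longlonglongrightarrow> \<tau>"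
    then have X: "\<forall>n. X n \<noteq> \<tau>" "X \<longlonglongrightarrow> \<tau>" "\<forall>n. X n \<in> {\<alpha><..<\<beta>}" by auto
    have Q: "((\<integral>p. w p * K (X n) p \<partial>M) - (\<integral>p. w p * K \<tau> p \<partial>M)) / (X n - \<tau>) =
        (\<integral>p. w p * ((K (X n) p - K \<tau> p) / (X n - \<tau>)) \<partial>M)" for n
    proof -
      have "(\<integral>p. w p * K (X n) p \<partial>M) - (\<integral>p. w p * K \<tau> p \<partial>M) = (\<integral>p. w p * K (X n) p - w p * K \<tau> p \<partial>M)"
        using X \<tau> by (intro Bochner_Integration.integral_diff[symmetric] K) auto
      also have "\<dots> / (X n - \<tau>) = (\<integral>p. (w p * K (X n) p - w p * K \<tau> p) / (X n - \<tau>) \<partial>M)" by simp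
      also have "\<dots> = (\<integral>p. w p * ((K (X n) p - K \<tau> p) / (X n - \<tau>)) \<partial>M)"
        by (intro Bochner_Integration.integral_cong) (auto simp: algebra_simps)
      finally show ?thesis .
    qed
    have "(\<lambda>n. \<integral>p. w p * ((K (X n) p - K \<tau> p) / (X n - \<tau>)) \<partial>M) \<longlonglongrightarrow> (\<integral>p. w p * D \<tau> p \<partial>M)"
    proof (rule integral_dominated_convergence[where w="\<lambda>p. \<bar>w p\<bar> * B"])
      show "(\<lambda>p. w p * D \<tau> p) \<in> borel_measurable M" using w D by auto
      show "integrable M (\<lambda>p. \<bar>w p\<bar> * B)" using w by auto
      fix n
      have "integrable M (\<lambda>p. (w p * K (X n) p - w p * K \<tau> p) / (X n - \<tau>))"
        using X \<tau> by (intro integrable_divide Bochner_Integration.integrable_diff K) auto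
      then have "integrable M (\<lambda>p. w p * ((K (X n) p - K \<tau> p) / (X n - \<tau>)))"
        by (simp add: algebra_simps)
      then show "(\<lambda>p. w p * ((K (X n) p - K \<tau> p) / (X n - \<tau>))) \<in> borel_measurable M"
        by (rule borel_measurable_integrable)
      show "AE p in M. norm (w p * ((K (X n) p - K \<tau> p) / (X n - \<tau>))) \<le> \<bar>w p\<bar> * B"
      proof (rule AE_I2)
        fix p assume p: "p \<in> space M"
        have "\<bar>(K (X n) p - K \<tau> p) / (X n - \<tau>)\<bar> \<le> B"
        proof -
          have "norm (K (X n) p - K \<tau> p) \<le> B * norm (X n - \<tau>)"
          proof (rule field_differentiable_bound[where S="{\<alpha><..<\<beta>}"])
            show "((\<lambda>t. K t p) has_field_derivative D t p) (at t within {\<alpha><..<\<beta>})" if "t \<in> {\<alpha><..<\<beta>}" for t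
              using deriv[OF that p] by (rule has_field_derivative_at_within)
          qed (use X \<tau> B p in auto)
          then show ?thesis using X(1) by (simp add: abs_divide divide_simps)
        qed
        then show "norm (w p * ((K (X n) p - K \<tau> p) / (X n - \<tau>))) \<le> \<bar>w p\<bar> * B"
          by (simp only: real_norm_def abs_mult mult_left_mono abs_ge_zero)
      qed
    next
      show "AE p in M. (\<lambda>n. w p * ((K (X n) p - K \<tau> p) / (X n - \<tau>))) \<longlonglongrightarrow> w p * D \<tau> p"
      proof (rule AE_I2, rule tendsto_mult_left)
        fix p assume p: "p \<in> space M"
        have "((\<lambda>y. (K y p - K \<tau> p) / (y - \<tau>)) \<longlongrightarrow> D \<tau> p) (at \<tau>)"
          using deriv[OF \<tau> p] by (simp add: has_field_derivative_iff)
        moreover have "filterlim X (at \<tau>) sequentially"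
          using X by (auto simp: filterlim_at)
        ultimately show "(\<lambda>n. (K (X n) p - K \<tau> p) / (X n - \<tau>)) \<longlonglongrightarrow> D \<tau> p"
          by (rule filterlim_compose)
      qed
    qed
    then show "((\<lambda>y. ((\<integral>p. w p * K y p \<partial>M) - (\<integral>p. w p * K \<tau> p \<partial>M)) / (y - \<tau>)) \<circ> X) \<longlonglongrightarrow> (\<integral>p. w p * D \<tau> p \<partial>M)"
      by (simp only: Q o_def)
  qed
  then show ?thesis using \<tau> at_within_open[OF \<tau> open_greaterThanLessThan] by (simp add: has_field_derivative_iff)
qed

section \<open>Dilated kernels and their dependence on the scale\<close>

definition bump :: "real \<Rightarrow> real" where
  "bump t = flat_exp (1 + t) * flat_exp (1 - t)"

lemma smooth1_bump: "smooth1 bump"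
  using smooth1_mult[OF smooth1_affine[OF smooth1_flat_exp, of 1 1] smooth1_affine[OF smooth1_flat_exp, of "-1" 1]]
  by (simp add: bump_def[abs_def] add.commute)

lemma bump_range: "0 \<le> bump t" "bump t \<le> 1"
  using flat_exp_range by (auto simp: bump_def intro: mult_le_one)

lemma bump_support: "1 \<le> \<bar>t\<bar> \<Longrightarrow> bump t = 0"
  by (auto simp: bump_def flat_exp_def)

lemma bump_0: "bump 0 > 0" by (simp add: bump_def flat_exp_def)

text \<open>This is \<tau>^(-m) \<psi>((p - x)/\<tau>), where \<psi>(y) is the monomial y^n times a
  bump of half width h around a. The monomial collects the factors y_i produced by differentiating
  in \<tau>.\<close>

definition kern :: "real \<Rightarrow> ('m \<Rightarrow> nat) \<Rightarrow> real \<Rightarrow> real^'m \<Rightarrow> real^'m \<Rightarrow> real^'m \<Rightarrow> real" where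
  "kern h n \<tau> x a = tens (\<lambda>i t. (1 / \<tau>) * (((t - x $ i) / \<tau>) ^ n i * bump (((t - x $ i) / \<tau> - a $ i) / h)))"

definition kbox :: "real \<Rightarrow> real \<Rightarrow> real^'m \<Rightarrow> real^'m \<Rightarrow> (real^'m) set" where
  "kbox h \<tau> x a = cbox (\<chi> i. x $ i + \<tau> * (a $ i - h)) (\<chi> i. x $ i + \<tau> * (a $ i + h))"

lemma smooth1_kern_factor:
  "smooth1 (\<lambda>t. (1 / \<tau>) * (((t - y) / \<tau>) ^ n * bump (((t - y) / \<tau> - b) / h)))"
proof -
  have 1: "smooth1 (\<lambda>t. (t - y) / \<tau>)"
    using smooth1_affine[OF smooth1_id, of "1 / \<tau>" "- y / \<tau>"] by (simp add: diff_divide_distrib)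
  have 2: "smooth1 (\<lambda>t. bump (((t - y) / \<tau> - b) / h))"
  proof -
    have "((t - y) / \<tau> - b) / h = 1 / (\<tau> * h) * t + (- y / (\<tau> * h) - b / h)" for t
      by (simp add: diff_divide_distrib)
    then show ?thesis using smooth1_affine[OF smooth1_bump, of "1 / (\<tau> * h)" "- y / (\<tau> * h) - b / h"] by simp
  qed
  show ?thesis by (intro smooth1_mult smooth1_const smooth1_power 1 2)
qed

lemma kern_factor_0:
  assumes "\<tau> > 0" "h > 0" "t \<notin> {y + \<tau> * (b - h)..y + \<tau> * (b + h)}"
  shows "bump (((t - y) / \<tau> - b) / h) = 0"
proof (rule bump_support, rule ccontr)
  assume "\<not> 1 \<le> \<bar>((t - y) / \<tau> - b) / h\<bar>"
  then have "\<bar>(t - y) / \<tau> - b\<bar> < h" using assms by (simp add: abs_divide)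
  then have "b - h \<le> (t - y) / \<tau>" "(t - y) / \<tau> \<le> b + h" by linarith+
  then have "t \<in> {y + \<tau> * (b - h)..y + \<tau> * (b + h)}"
    using assms(1) by (simp add: field_simps)
  with assms(3) show False by simp
qed

lemma mem_kbox: "\<tau> > 0 \<Longrightarrow> p \<in> kbox h \<tau> x a \<longleftrightarrow> (\<forall>i. \<bar>(p $ i - x $ i) / \<tau> - a $ i\<bar> \<le> h)"
  by (auto simp: kbox_def mem_box_cart abs_le_iff field_simps)

lemma kern_outside: "\<tau> > 0 \<Longrightarrow> h > 0 \<Longrightarrow> p \<notin> kbox h \<tau> x a \<Longrightarrow> kern h n \<tau> x a p = 0"
  unfolding kern_def tens_def kbox_def mem_box_cart
  by (rule prod_zero) (use kern_factor_0[of \<tau> h] in fastforce)+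

lemma continuous_kern: "continuous_on S (kern h n \<tau> x a)"
  unfolding kern_def by (intro continuous_on_tens smooth1_kern_factor)

lemma kern_bound:
  fixes x a p :: "real^'m"
  assumes "\<tau> > 0" "h > 0" "norm a \<le> R"
  shows "\<bar>kern h n \<tau> x a p\<bar> \<le> (1 / \<tau>) ^ CARD('m) * (1 + R + h) ^ mi_size n * indicator (kbox h \<tau> x a) p"
proof (cases "p \<in> kbox h \<tau> x a")
  case True
  have R: "0 \<le> R" using assms norm_ge_zero order_trans by blast
  have "\<bar>kern h n \<tau> x a p\<bar> \<le> (\<Prod>i\<in>(UNIV::'m set). (1 / \<tau>) * (1 + R + h) ^ n i)"
    unfolding kern_def tens_def abs_prod
  proof (rule prod_mono, intro conjI)
    fix i
    have "\<bar>(p $ i - x $ i) / \<tau> - a $ i\<bar> \<le> h" "\<bar>a $ i\<bar> \<le> R"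
      using True assms component_le_norm_cart[of a i] by (auto simp: mem_kbox)
    then have "\<bar>(p $ i - x $ i) / \<tau>\<bar> \<le> 1 + R + h" by linarith
    then have "\<bar>(p $ i - x $ i) / \<tau>\<bar> ^ n i \<le> (1 + R + h) ^ n i" by (intro power_mono) auto
    moreover have "\<bar>bump (((p $ i - x $ i) / \<tau> - a $ i) / h)\<bar> \<le> 1" using bump_range by simp
    ultimately have "\<bar>(p $ i - x $ i) / \<tau>\<bar> ^ n i * \<bar>bump (((p $ i - x $ i) / \<tau> - a $ i) / h)\<bar> \<le> (1 + R + h) ^ n i * 1"
      using R assms by (intro mult_mono) auto
    then show "\<bar>1 / \<tau> * (((p $ i - x $ i) / \<tau>) ^ n i * bump (((p $ i - x $ i) / \<tau> - a $ i) / h))\<bar> \<le> 1 / \<tau> * (1 + R + h) ^ n i"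
      using assms(1) unfolding abs_mult power_abs by (intro mult_mono) auto
  qed auto
  also have "\<dots> = (1 / \<tau>) ^ CARD('m) * (1 + R + h) ^ mi_size n"
    by (simp only: prod.distrib prod_constant mi_size_def power_sum)
  finally show ?thesis using True by simp
qed (use assms kern_outside in auto)

lemma measure_kbox:
  fixes x a :: "real^'m"
  assumes "\<tau> > 0" "h > 0"
  shows "measure lebesgue (kbox h \<tau> x a) = (2 * h * \<tau>) ^ CARD('m)"
proof -
  have "kbox h \<tau> x a \<noteq> {}"
    using assms by (auto simp: kbox_def interval_ne_empty_cart intro!: mult_left_mono)
  then have "measure lebesgue (kbox h \<tau> x a) = (\<Prod>i\<in>(UNIV::'m set). 2 * h * \<tau>)"
    unfolding kbox_def by (subst measure_completion, simp, subst content_cbox_cart) (auto simp: algebra_simps)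
  then show ?thesis by simp
qed

text \<open>Substituting p = x + \<tau> (a + z) shows that the total mass depends neither on x nor
  on the scale. The comparison of two scales in \<open>scale_mean_osc\<close> and the limit in
  \<open>scale_mean_tendsto\<close> rest on this.\<close>

lemma integral_kern:
  fixes x a :: "real^'m"
  assumes "\<tau> > 0"
  shows "(\<integral>p. kern h n \<tau> x a p \<partial>lborel) = (\<integral>z. tens (\<lambda>i t. (a $ i + t) ^ n i * bump (t / h)) (z::real^'m) \<partial>lborel)"
proof -
  let ?t = "x + \<tau> *\<^sub>R a"
  have m: "kern h n \<tau> x a \<in> borel_measurable borel"
    by (intro borel_measurable_continuous_onI continuous_kern)
  have "(\<integral>p. kern h n \<tau> x a p \<partial>lborel) =
     (\<integral>p. kern h n \<tau> x a p \<partial>density (distr lborel borel (\<lambda>x. ?t + \<tau> *\<^sub>R x)) (\<lambda>_. ennreal (\<bar>\<tau>\<bar> ^ DIM(real^'m))))"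
    using assms by (subst lborel_affine[of \<tau> ?t]) auto
  also have "\<dots> = (\<integral>p. \<bar>\<tau>\<bar> ^ CARD('m) * kern h n \<tau> x a (?t + \<tau> *\<^sub>R p) \<partial>lborel)"
    using m by (subst integral_density) (auto simp: integral_distr)
  also have "\<dots> = (\<integral>z. tens (\<lambda>i t. (a $ i + t) ^ n i * bump (t / h)) (z::real^'m) \<partial>lborel)"
  proof (rule Bochner_Integration.integral_cong[OF refl])
    fix p :: "real^'m"
    have "kern h n \<tau> x a (?t + \<tau> *\<^sub>R p) = (\<Prod>i\<in>(UNIV::'m set). (1 / \<tau>) * ((a $ i + p $ i) ^ n i * bump (p $ i / h)))"
      unfolding kern_def tens_def
    proof (rule prod.cong[OF refl])
      fix i :: 'm
      have "((?t + \<tau> *\<^sub>R p) $ i - x $ i) / \<tau> = a $ i + p $ i" using assms by (simp add: field_simps)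
      then show "1 / \<tau> * ((((?t + \<tau> *\<^sub>R p) $ i - x $ i) / \<tau>) ^ n i * bump ((((?t + \<tau> *\<^sub>R p) $ i - x $ i) / \<tau> - a $ i) / h)) =
        1 / \<tau> * ((a $ i + p $ i) ^ n i * bump (p $ i / h))" by simp
    qed
    also have "\<dots> = (1 / \<tau>) ^ CARD('m) * tens (\<lambda>i t. (a $ i + t) ^ n i * bump (t / h)) p"
      by (simp only: prod.distrib prod_constant tens_def)
    finally show "\<bar>\<tau>\<bar> ^ CARD('m) * kern h n \<tau> x a (?t + \<tau> *\<^sub>R p) = tens (\<lambda>i t. (a $ i + t) ^ n i * bump (t / h)) p"
      using assms by (simp add: power_one_over)
  qed
  finally show ?thesis .
qed

text \<open>The identity \<open>\<partial>\<^sub>\<tau> (\<tau>\<^sup>-\<^sup>m \<phi> (y / \<tau>)) = - div (y / \<tau> \<cdot> \<tau>\<^sup>-\<^sup>m \<phi> (y / \<tau>))\<close>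
  lets weak derivatives of \<open>u\<close> be moved onto derivatives in the scale \<open>\<tau>\<close>.\<close>

lemma kern_deriv:
  fixes x a p :: "real^'m"
  assumes "\<tau> > 0"
  shows "((\<lambda>\<tau>. kern h n \<tau> x a p) has_real_derivative
    - (\<Sum>i\<in>UNIV. pderiv_at i (kern h (n(i := Suc (n i))) \<tau> x a) p)) (at \<tau>)"
proof -
  define g where "g i y = y ^ n i * bump ((y - a $ i) / h)" for i :: 'm and y :: real
  have gs: "smooth1 (g i)" for i
  proof -
    have "smooth1 (\<lambda>y. bump ((y - a $ i) / h))"
      using smooth1_affine[OF smooth1_bump, of "1 / h" "- a $ i / h"] by (simp add: diff_divide_distrib)
    then show ?thesis unfolding g_def[abs_def] by (intro smooth1_mult smooth1_power smooth1_id)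
  qed
  note gD = smooth1_DERIV[OF gs]
  have kern_g: "kern h n \<tau> x a p = (\<Prod>i\<in>UNIV. 1 / \<tau> * g i ((p $ i - x $ i) / \<tau>))" for \<tau> p
    by (simp add: kern_def tens_def g_def)
  define d where "d i = - (1 / \<tau>\<^sup>2) * g i ((p $ i - x $ i) / \<tau>)
      - (1 / \<tau>) * (deriv (g i) ((p $ i - x $ i) / \<tau>) * ((p $ i - x $ i) / \<tau>\<^sup>2))" for i
  have 1: "((\<lambda>\<tau>. 1 / \<tau> * g i ((p $ i - x $ i) / \<tau>)) has_real_derivative d i) (at \<tau>)" for i
  proof -
    have "((\<lambda>\<tau>. g i ((p $ i - x $ i) / \<tau>)) has_real_derivative
      deriv (g i) ((p $ i - x $ i) / \<tau>) * (- ((p $ i - x $ i) / \<tau>\<^sup>2))) (at \<tau>)"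
      by (rule DERIV_chain2[OF gD]) (use assms in \<open>auto intro!: derivative_eq_intros simp: power2_eq_square minus_divide_left\<close>)
    moreover have "((\<lambda>\<tau>. 1 / \<tau>) has_real_derivative - (1 / \<tau>\<^sup>2)) (at \<tau>)"
      using assms by (auto intro!: derivative_eq_intros simp: power2_eq_square)
    ultimately show ?thesis
      using DERIV_mult[of "\<lambda>\<tau>. 1 / \<tau>" "- (1 / \<tau>\<^sup>2)" \<tau> UNIV] unfolding d_def
      by (fastforce simp: algebra_simps)
  qed
  have "((\<lambda>\<tau>. \<Prod>i\<in>UNIV. 1 / \<tau> * g i ((p $ i - x $ i) / \<tau>)) has_derivative
     (\<lambda>y. \<Sum>i\<in>UNIV. (d i * y) * (\<Prod>j\<in>UNIV - {i}. 1 / \<tau> * g j ((p $ j - x $ j) / \<tau>)))) (at \<tau>)"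
    by (rule has_derivative_prod) (use 1 in \<open>simp add: has_field_derivative_def\<close>)
  moreover have "(\<lambda>y. \<Sum>i\<in>UNIV. (d i * y) * (\<Prod>j\<in>UNIV - {i}. 1 / \<tau> * g j ((p $ j - x $ j) / \<tau>))) =
     (*) (\<Sum>i\<in>UNIV. d i * (\<Prod>j\<in>UNIV - {i}. 1 / \<tau> * g j ((p $ j - x $ j) / \<tau>)))"
    by (rule ext) (simp only: sum_distrib_left mult_ac)
  ultimately have 2: "((\<lambda>\<tau>. kern h n \<tau> x a p) has_real_derivative
     (\<Sum>i\<in>UNIV. d i * (\<Prod>j\<in>UNIV - {i}. 1 / \<tau> * g j ((p $ j - x $ j) / \<tau>)))) (at \<tau>)"
    unfolding kern_g has_field_derivative_def by (simp only:)
  \<comment> \<open>Raising the exponent in direction i multiplies the factor i by y_i; its spatial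
    derivative is then, up to sign, the scale derivative of the original factor.\<close>
  have 3: "pderiv_at i (kern h (n(i := Suc (n i))) \<tau> x a) p =
     - (d i * (\<Prod>j\<in>UNIV - {i}. 1 / \<tau> * g j ((p $ j - x $ j) / \<tau>)))" for i
  proof -
    let ?n = "n(i := Suc (n i))"
    define f where "f j t = (1 / \<tau>) * (((t - x $ j) / \<tau>) ^ ?n j * bump (((t - x $ j) / \<tau> - a $ j) / h))" for j t
    have fs: "smooth1 (f j)" for j unfolding f_def[abs_def] by (rule smooth1_kern_factor)
    have "pderiv_at i (kern h ?n \<tau> x a) p = tens (f(i := deriv (f i))) p"
      using pderiv_at_tens[of f i, OF fs] by (simp add: kern_def f_def[abs_def])
    also have "\<dots> = deriv (f i) (p $ i) * (\<Prod>j\<in>UNIV - {i}. f j (p $ j))"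
      unfolding tens_def by (subst prod.remove[of _ i]) auto
    also have "(\<Prod>j\<in>UNIV - {i}. f j (p $ j)) = (\<Prod>j\<in>UNIV - {i}. 1 / \<tau> * g j ((p $ j - x $ j) / \<tau>))"
      by (intro prod.cong) (auto simp: f_def g_def)
    also have "deriv (f i) (p $ i) = - d i"
    proof (rule DERIV_imp_deriv)
      have fi: "f i = (\<lambda>t. (t - x $ i) / \<tau>\<^sup>2 * g i ((t - x $ i) / \<tau>))"
        by (auto simp: f_def g_def fun_eq_iff power2_eq_square)
      have "((\<lambda>t. g i ((t - x $ i) / \<tau>)) has_real_derivative deriv (g i) ((p $ i - x $ i) / \<tau>) * (1 / \<tau>)) (at (p $ i))"
        by (rule DERIV_chain2[OF gD]) (use assms in \<open>auto intro!: derivative_eq_intros\<close>)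
      moreover have "((\<lambda>t. (t - x $ i) / \<tau>\<^sup>2) has_real_derivative 1 / \<tau>\<^sup>2) (at (p $ i))"
        by (rule DERIV_cdivide) (auto intro!: derivative_eq_intros)
      ultimately have "(f i has_real_derivative 1 / \<tau>\<^sup>2 * g i ((p $ i - x $ i) / \<tau>) +
          deriv (g i) ((p $ i - x $ i) / \<tau>) * (1 / \<tau>) * ((p $ i - x $ i) / \<tau>\<^sup>2)) (at (p $ i))"
        unfolding fi by (rule DERIV_mult[rotated])
      moreover have "1 / \<tau>\<^sup>2 * g i ((p $ i - x $ i) / \<tau>) +
          deriv (g i) ((p $ i - x $ i) / \<tau>) * (1 / \<tau>) * ((p $ i - x $ i) / \<tau>\<^sup>2) = - d i"
        by (simp add: d_def)
      ultimately show "(f i has_real_derivative - d i) (at (p $ i))" by simp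
    qed
    finally show ?thesis by (simp only: mult_minus_left)
  qed
  show ?thesis using 2 by (simp add: 3 sum_negf)
qed

text \<open>Away from scale 0 the derivative is an explicit expression continuous in scale and point
  jointly, on a compact set. The bound is the dominating constant for differentiating
  integrals.\<close>

lemma kern_deriv_bounded:
  fixes x a :: "real^'m" and \<Omega> :: "(real^'m) set"
  assumes "bounded \<Omega>" "0 < \<alpha>"
  obtains B where "\<And>\<tau> p. \<tau> \<in> {\<alpha>..\<beta>} \<Longrightarrow> p \<in> \<Omega> \<Longrightarrow>
    \<bar>- (\<Sum>i\<in>UNIV. pderiv_at i (kern h (n(i := Suc (n i))) \<tau> x a) p)\<bar> \<le> B"
proof -
  define g where "g i j t = t ^ (n(i := Suc (n i))) j * bump ((t - a $ j) / h)" for i j :: 'm and t :: real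
  have gs: "smooth1 (g i j)" for i j
  proof -
    have "smooth1 (\<lambda>y. bump ((y - a $ j) / h))"
      using smooth1_affine[OF smooth1_bump, of "1 / h" "- a $ j / h"] by (simp add: diff_divide_distrib)
    then show ?thesis unfolding g_def[abs_def] by (intro smooth1_mult smooth1_power smooth1_id)
  qed
  let ?P = "\<lambda>i \<tau> p. (1 / \<tau>\<^sup>2) * deriv (g i i) ((p $ i - x $ i) / \<tau>) * (\<Prod>j\<in>UNIV - {i}. 1 / \<tau> * g i j ((p $ j - x $ j) / \<tau>))"
  have P: "pderiv_at i (kern h (n(i := Suc (n i))) \<tau> x a) p = ?P i \<tau> p" if "\<tau> > 0" for i \<tau> p
  proof -
    define f where "f j t = (1 / \<tau>) * g i j ((t - x $ j) / \<tau>)" for j t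
    have fs: "smooth1 (f j)" for j unfolding f_def[abs_def] g_def by (rule smooth1_kern_factor)
    have "pderiv_at i (kern h (n(i := Suc (n i))) \<tau> x a) p = tens (f(i := deriv (f i))) p"
      using pderiv_at_tens[of f i, OF fs] by (simp add: kern_def f_def[abs_def] g_def)
    also have "\<dots> = deriv (f i) (p $ i) * (\<Prod>j\<in>UNIV - {i}. f j (p $ j))"
      unfolding tens_def by (subst prod.remove[of _ i]) auto
    also have "deriv (f i) (p $ i) = 1 / \<tau> * (deriv (g i i) ((p $ i - x $ i) / \<tau>) * (1 / \<tau>))"
    proof (rule DERIV_imp_deriv)
      have "((\<lambda>t. g i i ((t - x $ i) / \<tau>)) has_real_derivative deriv (g i i) ((p $ i - x $ i) / \<tau>) * (1 / \<tau>)) (at (p $ i))"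
        by (rule DERIV_chain2[OF smooth1_DERIV[OF gs]]) (use that in \<open>auto intro!: derivative_eq_intros\<close>)
      then show "(f i has_real_derivative 1 / \<tau> * (deriv (g i i) ((p $ i - x $ i) / \<tau>) * (1 / \<tau>))) (at (p $ i))"
        unfolding f_def[abs_def] by (rule DERIV_cmult)
    qed
    also have "1 / \<tau> * (deriv (g i i) ((p $ i - x $ i) / \<tau>) * (1 / \<tau>)) * (\<Prod>j\<in>UNIV - {i}. f j (p $ j)) = ?P i \<tau> p"
      by (simp add: f_def power2_eq_square)
    finally show ?thesis .
  qed
  let ?S = "{\<alpha>..\<beta>} \<times> closure \<Omega>"
  have c: "continuous_on ?S (\<lambda>y. f ((snd y $ j - x $ j) / fst y))" if "smooth1 f" for f j
    by (rule continuous_on_compose2[OF smooth1_continuous[OF that, of UNIV]])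
      (use assms(2) in \<open>auto intro!: continuous_intros\<close>)
  have c1: "continuous_on ?S (\<lambda>y. deriv (g i i) ((snd y $ i - x $ i) / fst y))" for i
    by (rule c[OF smooth1_deriv[OF gs]])
  have c2: "continuous_on ?S (\<lambda>y. g i j ((snd y $ j - x $ j) / fst y))" for i j
    by (rule c[OF gs])
  have c3: "continuous_on ?S (\<lambda>y. 1 / fst y)" and c4: "continuous_on ?S (\<lambda>y. 1 / (fst y)\<^sup>2)"
    using assms(2) by (auto intro!: continuous_intros)
  have "continuous_on ?S (\<lambda>y. - (\<Sum>i\<in>UNIV. ?P i (fst y) (snd y)))"
    using assms(2) by (intro continuous_on_minus continuous_on_sum continuous_on_mult continuous_on_prod c1 c2 c3 c4)
  moreover have "compact ?S" using assms(1) by (intro compact_Times) auto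
  ultimately have "compact ((\<lambda>y. - (\<Sum>i\<in>UNIV. ?P i (fst y) (snd y))) ` ?S)"
    by (rule compact_continuous_image)
  then obtain B where B: "\<forall>z\<in>(\<lambda>y. - (\<Sum>i\<in>UNIV. ?P i (fst y) (snd y))) ` ?S. norm z \<le> B"
    using compact_imp_bounded[of "(\<lambda>y. - (\<Sum>i\<in>UNIV. ?P i (fst y) (snd y))) ` ?S"] unfolding bounded_iff by blast
  show ?thesis
  proof (rule that)
    fix \<tau> p assume "\<tau> \<in> {\<alpha>..\<beta>}" "p \<in> \<Omega>"
    then have "(\<tau>, p) \<in> ?S" "\<tau> > 0" using assms(2) closure_subset[of \<Omega>] by auto
    then show "\<bar>- (\<Sum>i\<in>UNIV. pderiv_at i (kern h (n(i := Suc (n i))) \<tau> x a) p)\<bar> \<le> B"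
      using B[rule_format, OF imageI, of "(\<tau>, p)"] by (simp add: P)
  qed
qed

section \<open>Means of weak derivatives as functions of the scale\<close>

context sobolev_domain
begin

text \<open>For j up to k and admissible kernels this is the derivative of order j in \<tau> of the
  mean of u. Summation over lists instead of multi-indices builds in the multinomial weights of
  iterated differentiation.\<close>

definition scale_mean :: "real \<Rightarrow> real^'m \<Rightarrow> real^'m \<Rightarrow> (real^'m \<Rightarrow> real) \<Rightarrow> nat \<Rightarrow> real \<Rightarrow> real" where
  "scale_mean h x a u j \<tau> =
     (\<Sum>is | length is = j. \<integral>p. wd (count_list is) u p * kern h (count_list is) \<tau> x a p \<partial>M)"

lemma kern_l2: "kern h n \<tau> x a \<in> elems (l2 M)"
proof -
  have "compact (kern h n \<tau> x a ` closure \<Omega>)"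
    using bounded_dom by (intro compact_continuous_image continuous_kern) auto
  then obtain B where B: "\<forall>z\<in>kern h n \<tau> x a ` closure \<Omega>. norm z \<le> B"
    using compact_imp_bounded bounded_iff by metis
  show ?thesis
  proof (rule bounded_mem_l2[OF finite_M])
    show "kern h n \<tau> x a \<in> borel_measurable M"
      using open_dom by (intro continuous_imp_measurable_on_sets_lebesgue continuous_kern) auto
    fix t assume "t \<in> space M"
    then have "t \<in> closure \<Omega>" using closure_subset[of \<Omega>] by auto
    then show "\<bar>kern h n \<tau> x a t\<bar> \<le> B" using B by auto
  qed
qed

text \<open>Both weak derivatives are tested with the same classical derivative of \<phi>: the lower
  one through \<open>pderiv_at i \<phi>\<close>, the higher one through \<phi>. Only counts matter,
  so \<open>is @ [i]\<close> and \<open>i # is\<close> stand for one multi-index.\<close>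

lemma wd_by_parts:
  assumes u: "u \<in> elems H" and l: "length is < k" and \<phi>: "\<phi> \<in> test_functions \<Omega>"
  shows "(\<integral>p. wd (count_list is) u p * pderiv_at i \<phi> p \<partial>M) = - (\<integral>p. wd (count_list (i # is)) u p * \<phi> p \<partial>M)"
proof -
  have 1: "is_weak_deriv \<Omega> (count_list is) u (wd (count_list is) u)"
    using l by (intro wd_weak u) (simp add: mi_size_count_list)
  have 2: "is_weak_deriv \<Omega> (count_list (i # is)) u (wd (count_list (i # is)) u)"
    using l by (intro wd_weak u) (simp only: mi_size_count_list length_Cons)
  have "(\<integral>t. u t * pderivs is (pderiv_at i \<phi>) t \<partial>M) = (-1) ^ length is * (\<integral>p. wd (count_list is) u p * pderiv_at i \<phi> p \<partial>M)"
    using 1[unfolded is_weak_deriv_def, rule_format, OF test_function_pderiv_at[OF \<phi>], of "is"]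
    by (simp add: mi_size_count_list)
  moreover have "(\<integral>t. u t * pderivs (is @ [i]) \<phi> t \<partial>M) = (-1) ^ length (i # is) * (\<integral>p. wd (count_list (i # is)) u p * \<phi> p \<partial>M)"
    using 2[unfolded is_weak_deriv_def, rule_format, OF \<phi>, of "is @ [i]"]
    by (simp only: mi_size_count_list) simp
  moreover have "pderivs (is @ [i]) \<phi> = pderivs is (pderiv_at i \<phi>)" by (simp add: pderivs_def)
  ultimately have "(-1) ^ length is * (\<integral>p. wd (count_list is) u p * pderiv_at i \<phi> p \<partial>M) =
      (-1) ^ length is * (- (\<integral>p. wd (count_list (i # is)) u p * \<phi> p \<partial>M))"
    by (simp del: count_list.simps)
  moreover have "(-1::real) ^ length is \<noteq> 0" by simp
  ultimately show ?thesis using mult_left_cancel by blast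
qed

lemma kern_test:
  assumes "0 < \<tau>" "0 < h" "kbox h \<tau> x a \<subseteq> \<Omega>"
  shows "kern h n \<tau> x a \<in> test_functions \<Omega>"
  unfolding kern_def
proof (rule tens_test_function[OF smooth1_kern_factor])
  show "cbox (\<chi> i. x $ i + \<tau> * (a $ i - h)) (\<chi> i. x $ i + \<tau> * (a $ i + h)) \<subseteq> \<Omega>"
    using assms(3) by (simp add: kbox_def)
qed (use kern_factor_0[OF assms(1,2)] in auto)

lemma scale_mean_deriv:
  assumes u: "u \<in> elems H" and j: "j < k" and h: "h > 0" and \<tau>: "\<tau> \<in> {0<..<1}"
    and box: "\<And>\<tau>. 0 < \<tau> \<Longrightarrow> \<tau> \<le> 1 \<Longrightarrow> kbox h \<tau> x a \<subseteq> \<Omega>"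
  shows "(scale_mean h x a u j has_real_derivative scale_mean h x a u (Suc j) \<tau>) (at \<tau>)"
proof -
  have 1: "((\<lambda>\<tau>. \<integral>p. wd (count_list is) u p * kern h (count_list is) \<tau> x a p \<partial>M) has_real_derivative
     (\<Sum>i\<in>UNIV. \<integral>p. wd (count_list (i # is)) u p * kern h (count_list (i # is)) \<tau> x a p \<partial>M)) (at \<tau>)"
    if l: "length is = j" for "is"
  proof -
    let ?n = "count_list is"
    have n: "count_list (i # is) = ?n(i := Suc (?n i))" for i by auto
    let ?D = "\<lambda>\<tau> p. - (\<Sum>i\<in>UNIV. pderiv_at i (kern h (?n(i := Suc (?n i))) \<tau> x a) p)"
    \<comment> \<open>Starting the interval at \<tau>/2 keeps the scale away from 0, where no
      uniform bound holds.\<close>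
    obtain B where B: "\<And>\<tau>' p. \<tau>' \<in> {\<tau>/2..1} \<Longrightarrow> p \<in> \<Omega> \<Longrightarrow> \<bar>?D \<tau>' p\<bar> \<le> B"
      using kern_deriv_bounded[OF bounded_dom, of "\<tau>/2" 1 h ?n x a] \<tau> by auto
    have w: "wd ?n u \<in> elems (l2 M)" using l j by (intro wd_mem u) (simp add: mi_size_count_list)
    have t: "pderiv_at i (kern h (?n(i := Suc (?n i))) \<tau> x a) \<in> test_functions \<Omega>"
      "kern h (?n(i := Suc (?n i))) \<tau> x a \<in> test_functions \<Omega>" for i
      using \<tau> h by (intro test_function_pderiv_at kern_test box; auto)+
    have t2: "pderiv_at i (kern h (?n(i := Suc (?n i))) \<tau> x a) \<in> elems (l2 M)" for i
      using test_function_l2[OF open_dom bounded_dom t(1)] .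
    have "((\<lambda>\<tau>. \<integral>p. wd ?n u p * kern h ?n \<tau> x a p \<partial>M) has_real_derivative (\<integral>p. wd ?n u p * ?D \<tau> p \<partial>M)) (at \<tau>)"
    proof (rule has_real_derivative_integral[where \<alpha>="\<tau>/2" and \<beta>=1 and B=B])
      show "integrable M (wd ?n u)" using w by (rule integrable_l2[OF finite_M])
      show "integrable M (\<lambda>p. wd ?n u p * kern h ?n t x a p)" for t
        using w kern_l2 by (rule integrable_mult_l2)
      show "((\<lambda>t. kern h ?n t x a p) has_real_derivative ?D t p) (at t)" if "t \<in> {\<tau>/2<..<1}" for t p
        using that \<tau> by (intro kern_deriv) auto
      show "?D \<tau> \<in> borel_measurable M"
        using t2[THEN l2_measurable] by (intro borel_measurable_uminus borel_measurable_sum)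
      show "\<bar>?D t p\<bar> \<le> B" if "t \<in> {\<tau>/2<..<1}" "p \<in> space M" for t p
        using that by (intro B) auto
    qed (use \<tau> in auto)
    also have "(\<integral>p. wd ?n u p * ?D \<tau> p \<partial>M) =
        (\<integral>p. - (\<Sum>i\<in>UNIV. wd ?n u p * pderiv_at i (kern h (?n(i := Suc (?n i))) \<tau> x a) p) \<partial>M)"
      by (simp add: sum_distrib_left)
    also have "\<dots> = - (\<Sum>i\<in>UNIV. \<integral>p. wd ?n u p * pderiv_at i (kern h (?n(i := Suc (?n i))) \<tau> x a) p \<partial>M)"
      using integrable_mult_l2[OF w t2] by simp
    also have "\<dots> = (\<Sum>i\<in>UNIV. \<integral>p. wd (count_list (i # is)) u p * kern h (count_list (i # is)) \<tau> x a p \<partial>M)"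
      unfolding n[symmetric] using wd_by_parts[OF u _ t(2), of "is"] l j
      by (simp add: n[symmetric] sum_negf del: count_list.simps)
    finally show ?thesis .
  qed
  have "(scale_mean h x a u j has_real_derivative
     (\<Sum>is | length is = j. \<Sum>i\<in>UNIV. \<integral>p. wd (count_list (i # is)) u p * kern h (count_list (i # is)) \<tau> x a p \<partial>M)) (at \<tau>)"
    unfolding scale_mean_def[abs_def] by (intro DERIV_sum 1) auto
  also have "(\<Sum>is | length is = j. \<Sum>i\<in>UNIV. \<integral>p. wd (count_list (i # is)) u p * kern h (count_list (i # is)) \<tau> x a p \<partial>M) =
     (\<Sum>(is, i)\<in>{is. length is = j} \<times> UNIV. \<integral>p. wd (count_list (i # is)) u p * kern h (count_list (i # is)) \<tau> x a p \<partial>M)"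
    by (rule sum.cartesian_product)
  \<comment> \<open>Lists of length j + 1 correspond to pairs of a tail and a head.\<close>
  also have "\<dots> = scale_mean h x a u (Suc j) \<tau>"
    unfolding scale_mean_def
    by (rule sum.reindex_bij_witness[where i="\<lambda>is. (tl is, hd is)" and j="\<lambda>(is, i). i # is"])
      (auto simp: length_Suc_conv simp del: count_list.simps)
  finally show ?thesis .
qed

lemma integral_mult_le_indicator:
  assumes "finite_measure N" "v \<in> elems (l2 N)" "w \<in> borel_measurable N" "A \<in> sets N"
    "\<And>t. t \<in> space N \<Longrightarrow> \<bar>w t\<bar> \<le> B * indicator A t" "0 \<le> B"
  shows "\<bar>\<integral>t. v t * w t \<partial>N\<bar> \<le> fs_norm (l2 N) v * (B * sqrt (measure N A))"
proof -
  interpret L: pre_hilbert "l2 N" by (rule pre_hilbert_l2)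
  have "\<bar>w t\<bar> \<le> B" if "t \<in> space N" for t
    using assms(5)[OF that] assms(6) by (cases "t \<in> A") auto
  then have "w \<in> elems (l2 N)" by (rule bounded_mem_l2[OF assms(1,3)])
  then have "\<bar>\<integral>t. v t * w t \<partial>N\<bar> \<le> fs_norm (l2 N) v * fs_norm (l2 N) w"
    using L.Cauchy_Schwarz[OF assms(2)] by (simp add: inner_l2)
  also have "\<dots> \<le> fs_norm (l2 N) v * (B * sqrt (measure N A))"
    using l2_norm_le_indicator[OF assms(1,3,4,5,6)] by (intro mult_left_mono l2_norm_nonneg)
  finally show ?thesis .
qed

lemma measure_kbox_M:
  assumes "\<tau> > 0" "h > 0" "kbox h \<tau> x a \<subseteq> \<Omega>"
  shows "measure M (kbox h \<tau> x a) = (2 * h * \<tau>) ^ CARD('m)" "kbox h \<tau> x a \<in> sets M"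
proof -
  have s: "kbox h \<tau> x a \<in> sets lebesgue" "\<Omega> \<in> sets lebesgue"
    using open_dom by (auto simp: kbox_def)
  then show "kbox h \<tau> x a \<in> sets M" using assms(3) by (simp add: sets_restrict_space_iff)
  show "measure M (kbox h \<tau> x a) = (2 * h * \<tau>) ^ CARD('m)"
    using measure_restrict_space[of \<Omega> lebesgue "kbox h \<tau> x a"] s assms by (simp add: measure_kbox)
qed

end

lemma integrable_pair_mult:
  fixes f g :: "'a \<Rightarrow> real"
  assumes "sigma_finite_measure M" "integrable M f" "integrable M g"
  shows "integrable (M \<Otimes>\<^sub>M M) (\<lambda>p. f (fst p) * g (snd p))"
    and "(\<integral>p. f (fst p) * g (snd p) \<partial>(M \<Otimes>\<^sub>M M)) = (\<integral>t. f t \<partial>M) * (\<integral>t. g t \<partial>M)"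
proof -
  interpret sigma_finite_measure M by fact
  interpret P: pair_sigma_finite M M ..
  have [measurable]: "f \<in> borel_measurable M" "g \<in> borel_measurable M" using assms by auto
  show i: "integrable (M \<Otimes>\<^sub>M M) (\<lambda>p. f (fst p) * g (snd p))"
  proof (rule P.Fubini_integrable)
    have "integrable M (\<lambda>x. \<bar>f x\<bar> * (\<integral>y. \<bar>g y\<bar> \<partial>M))" using assms by simp
    then show "integrable M (\<lambda>x. \<integral>y. norm (f (fst (x, y)) * g (snd (x, y))) \<partial>M)"
      by (simp add: abs_mult)
    show "AE x in M. integrable M (\<lambda>y. f (fst (x, y)) * g (snd (x, y)))" using assms by simp
  qed measurable
  have "(\<integral>p. f (fst p) * g (snd p) \<partial>(M \<Otimes>\<^sub>M M)) = (\<integral>x. (\<integral>y. f x * g y \<partial>M) \<partial>M)"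
    using P.integral_fst'[OF i] by simp
  then show "(\<integral>p. f (fst p) * g (snd p) \<partial>(M \<Otimes>\<^sub>M M)) = (\<integral>t. f t \<partial>M) * (\<integral>t. g t \<partial>M)" by simp
qed

context sobolev_domain
begin

lemma integral_kern_M:
  assumes "0 < \<tau>" "0 < h" "kbox h \<tau> x a \<subseteq> \<Omega>"
  shows "(\<integral>p. kern h n \<tau> x a p \<partial>M) = (\<integral>z. tens (\<lambda>i t. (a $ i + t) ^ n i * bump (t / h)) (z::real^'m) \<partial>lborel)"
proof -
  have "(\<integral>p. kern h n \<tau> x a p \<partial>M) = (\<integral>p. indicator \<Omega> p * kern h n \<tau> x a p \<partial>lebesgue)"
    using open_dom by (subst lebesgue_on_integral) auto
  also have "\<dots> = (\<integral>p. kern h n \<tau> x a p \<partial>lebesgue)"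
    using assms(3)
    by (intro Bochner_Integration.integral_cong) (auto simp: indicator_def intro!: kern_outside[OF assms(1,2)])
  also have "\<dots> = (\<integral>p. kern h n \<tau> x a p \<partial>lborel)"
    by (rule integral_completion) (simp add: borel_measurable_continuous_onI continuous_kern)
  finally show ?thesis using integral_kern[OF assms(1)] by simp
qed

text \<open>By Cauchy-Schwarz: the kernel is of size \<sigma>^(-m) on a cube of measure (2 h
  \<sigma>)^m, so its L2 norm is of order \<sigma>^(-m/2). This serves the case of integer
  order.\<close>

lemma kern_integral_size:
  assumes u: "u \<in> elems H" and n: "mi_size n = k" and h: "h > 0" and R: "norm a = R" and \<sigma>: "0 < \<sigma>"
    and box: "kbox h \<sigma> x a \<subseteq> \<Omega>"
  shows "\<bar>\<integral>p. wd n u p * kern h n \<sigma> x a p \<partial>M\<bar> \<le>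
    fs_norm H u * ((1 + R + h) ^ k * sqrt ((2 * h) ^ CARD('m)) * \<sigma> powr (- real CARD('m) / 2))"
proof -
  have A: "0 \<le> 1 + R + h" using R h norm_ge_zero[of a] by linarith
  have w: "wd n u \<in> elems (l2 M)" using n by (intro wd_mem u) simp
  have "\<bar>\<integral>p. wd n u p * kern h n \<sigma> x a p \<partial>M\<bar> \<le>
    fs_norm (l2 M) (wd n u) * ((1 / \<sigma>) ^ CARD('m) * (1 + R + h) ^ k * sqrt (measure M (kbox h \<sigma> x a)))"
  proof (rule integral_mult_le_indicator[OF finite_M w])
    show "kern h n \<sigma> x a \<in> borel_measurable M" using kern_l2 by (rule l2_measurable)
    show "kbox h \<sigma> x a \<in> sets M" using measure_kbox_M \<sigma> h box by blast
    show "\<bar>kern h n \<sigma> x a t\<bar> \<le> (1 / \<sigma>) ^ CARD('m) * (1 + R + h) ^ k * indicator (kbox h \<sigma> x a) t" for t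
      using kern_bound[OF \<sigma> h, of a R n x t] R n by simp
  qed (use A \<sigma> in auto)
  also have "\<dots> \<le> fs_norm H u * ((1 / \<sigma>) ^ CARD('m) * (1 + R + h) ^ k * sqrt (measure M (kbox h \<sigma> x a)))"
    using norm_wd_le[OF u, of n] n A \<sigma> by (intro mult_right_mono) auto
  also have "(1 / \<sigma>) ^ CARD('m) * (1 + R + h) ^ k * sqrt (measure M (kbox h \<sigma> x a)) =
      (1 + R + h) ^ k * sqrt ((2 * h) ^ CARD('m)) * ((1 / \<sigma>) ^ CARD('m) * sqrt (\<sigma> ^ CARD('m)))"
    using measure_kbox_M(1)[OF \<sigma> h box] by (simp add: power_mult_distrib real_sqrt_mult)
  also have "(1 / \<sigma>) ^ CARD('m) * sqrt (\<sigma> ^ CARD('m)) = \<sigma> powr (- real CARD('m) / 2)"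
  proof -
    have "(1 / \<sigma>) ^ CARD('m) = \<sigma> powr (- real CARD('m))"
      using \<sigma> by (simp add: powr_minus powr_realpow divide_inverse power_inverse)
    moreover have "sqrt (\<sigma> ^ CARD('m)) = \<sigma> powr (real CARD('m) / 2)"
      using \<sigma> by (simp add: powr_half_sqrt[symmetric] powr_realpow[symmetric] powr_powr)
    ultimately show ?thesis by (simp add: powr_add[symmetric])
  qed
  finally show ?thesis .
qed

lemma kbox_dist:
  fixes p x a :: "real^'m"
  assumes "0 < \<sigma>" "p \<in> kbox h \<sigma> x a" "norm a = R"
  shows "norm (p - x) \<le> real CARD('m) * (\<sigma> * (R + h))"
proof -
  have "norm (p - x) \<le> (\<Sum>i\<in>UNIV. \<bar>(p - x) $ i\<bar>)" by (rule norm_le_l1_cart)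
  also have "\<dots> \<le> (\<Sum>i\<in>(UNIV::'m set). \<sigma> * (R + h))"
  proof (rule sum_mono)
    fix i
    have "\<bar>(p $ i - x $ i) / \<sigma> - a $ i\<bar> \<le> h" "\<bar>a $ i\<bar> \<le> R"
      using assms component_le_norm_cart[of a i] by (auto simp: mem_kbox)
    then have "\<bar>(p $ i - x $ i) / \<sigma>\<bar> \<le> R + h" by linarith
    then show "\<bar>(p - x) $ i\<bar> \<le> \<sigma> * (R + h)" using assms(1) by (simp add: abs_divide field_simps)
  qed
  finally show ?thesis by simp
qed

text \<open>Averaging a second variable over the cube at scale \<tau> turns the difference into a
  double integral of v(p) - v(p'), which the Slobodeckij seminorm controls by Cauchy-Schwarz. The
  points involved are at distance O(\<tau>), and this distance to the power (m + 2\<theta>)/2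
  provides the gain.\<close>

lemma kern_integral_osc:
  assumes u: "u \<in> elems H" and n: "mi_size n = k" and \<theta>: "\<theta> > 0" and h: "h > 0" and R: "norm a = R"
    and \<sigma>: "0 < \<sigma>" "\<sigma> \<le> \<tau>"
    and box: "kbox h \<sigma> x a \<subseteq> \<Omega>" "kbox h \<tau> x a \<subseteq> \<Omega>"
  shows "\<bar>(\<integral>p. wd n u p * kern h n \<sigma> x a p \<partial>M) - (\<integral>z. tens (\<lambda>i t. (a $ i + t) ^ n i * bump (t / h)) (z::real^'m) \<partial>lborel) *
       (\<integral>p. wd n u p * indicator (kbox h \<tau> x a) p \<partial>M) / (2 * h * \<tau>) ^ CARD('m)\<bar> \<le>
    fs_norm H u * ((2 * real CARD('m) * (\<tau> * (R + h))) powr ((real CARD('m) + 2 * \<theta>) / 2) * ((1 / \<sigma>) ^ CARD('m) * (1 + R + h) ^ k))"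
    (is "\<bar>?I - ?J * ?V / ?\<mu>\<bar> \<le> fs_norm H u * ?B")
proof -
  let ?e = "(real CARD('m) + 2 * \<theta>) / 2"
  let ?Q = "kbox h \<tau> x a" and ?P = "kbox h \<sigma> x a"
  let ?K = "kern h n \<sigma> x a"
  let ?v = "wd n u"
  have \<tau>: "\<tau> > 0" using \<sigma> by simp
  have A: "0 \<le> 1 + R + h" "0 \<le> R + h" using R h norm_ge_zero[of a] by linarith+
  have B: "0 \<le> ?B" using A \<sigma> by simp
  have \<mu>: "?\<mu> > 0" using h \<tau> by simp
  have v: "?v \<in> elems (l2 M)" using n by (intro wd_mem u) simp
  have Q: "?Q \<in> sets M" "measure M ?Q = ?\<mu>" using measure_kbox_M[OF \<tau> h box(2)] by auto
  have P: "?P \<in> sets M" "measure M ?P = (2 * h * \<sigma>) ^ CARD('m)" using measure_kbox_M[OF \<sigma>(1) h box(1)] by auto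
  interpret F: finite_measure M by (rule finite_M)
  have ind: "indicator ?Q \<in> elems (l2 M)"
    by (rule bounded_mem_l2[OF finite_M, of _ 1]) (use Q(1) in \<open>auto simp: indicator_def\<close>)
  have i: "integrable M ?K" "integrable M (\<lambda>p. ?v p * ?K p)" "integrable M (indicator ?Q :: _ \<Rightarrow> real)"
      "integrable M (\<lambda>p. ?v p * indicator ?Q p)"
    by (rule integrable_l2[OF finite_M kern_l2] integrable_mult_l2[OF v kern_l2] integrable_l2[OF finite_M ind]
        integrable_mult_l2[OF v ind])+
  \<comment> \<open>\<open>W\<close> carries the denominator of the quotient, so the double integral
    becomes the inner product of \<open>q ?v\<close> with \<open>W\<close>. On the diagonal the
    difference and the quotient both vanish.\<close>
  define W where "W p = norm (fst p - snd p) powr ?e * (?K (fst p) * indicator ?Q (snd p))" for p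
  have [measurable]: "(\<lambda>x. x) \<in> borel_measurable M"
    by (intro measurable_restrict_space1 measurable_completion) simp
  have [measurable]: "?K \<in> borel_measurable M" using kern_l2 by (rule l2_measurable)
  have [measurable]: "?Q \<in> sets M" by fact
  have W: "W \<in> borel_measurable LL" unfolding W_def by measurable
  have "?\<mu> * ?I - ?J * ?V = (\<integral>p. ?v p * ?K p \<partial>M) * (\<integral>p. indicator ?Q p \<partial>M) - (\<integral>p. ?K p \<partial>M) * (\<integral>p. ?v p * indicator ?Q p \<partial>M)"
    using integral_kern_M[OF \<sigma>(1) h box(1)] Q by (simp add: Int_absorb2[OF box(2)])
  also have "\<dots> = (\<integral>p. (?v (fst p) * ?K (fst p)) * indicator ?Q (snd p) \<partial>LL) - (\<integral>p. ?K (fst p) * (?v (snd p) * indicator ?Q (snd p)) \<partial>LL)"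
    using integrable_pair_mult(2)[OF sigma_finite_M i(2,3)] integrable_pair_mult(2)[OF sigma_finite_M i(1,4)] by simp
  also have "\<dots> = (\<integral>p. (?v (fst p) * ?K (fst p)) * indicator ?Q (snd p) - ?K (fst p) * (?v (snd p) * indicator ?Q (snd p)) \<partial>LL)"
    using integrable_pair_mult(1)[OF sigma_finite_M i(2,3)] integrable_pair_mult(1)[OF sigma_finite_M i(1,4)]
    by (rule Bochner_Integration.integral_diff[symmetric])
  also have "\<dots> = (\<integral>p. q ?v p * W p \<partial>LL)"
  proof (rule Bochner_Integration.integral_cong[OF refl])
    fix p :: "(real^'m) \<times> (real^'m)"
    have "q ?v p * norm (fst p - snd p) powr ?e = ?v (fst p) - ?v (snd p)"
      by (cases "fst p = snd p") (auto simp: slob_quot_def case_prod_unfold)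
    then have "q ?v p * W p = (?v (fst p) - ?v (snd p)) * (?K (fst p) * indicator ?Q (snd p))"
      unfolding W_def by (simp only: mult.assoc[symmetric])
    then show "(?v (fst p) * ?K (fst p)) * indicator ?Q (snd p) - ?K (fst p) * (?v (snd p) * indicator ?Q (snd p)) = q ?v p * W p"
      by (simp add: algebra_simps)
  qed
  finally have eq: "?\<mu> * ?I - ?J * ?V = (\<integral>p. q ?v p * W p \<partial>LL)" .
  have "\<bar>\<integral>p. q ?v p * W p \<partial>LL\<bar> \<le> fs_norm (l2 LL) (q ?v) * (?B * sqrt (measure LL (?P \<times> ?Q)))"
  proof (rule integral_mult_le_indicator[OF finite_LL slob_mem[OF u n \<theta>] W _ _ B])
    show "?P \<times> ?Q \<in> sets LL" using P(1) Q(1) by simp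
    fix p assume "p \<in> space LL"
    show "\<bar>W p\<bar> \<le> ?B * indicator (?P \<times> ?Q) p"
    proof (cases "p \<in> ?P \<times> ?Q")
      case True
      have "norm (fst p - x) \<le> real CARD('m) * (\<sigma> * (R + h))" "norm (snd p - x) \<le> real CARD('m) * (\<tau> * (R + h))"
        using kbox_dist[OF \<sigma>(1) _ R, of "fst p"] kbox_dist[OF \<tau> _ R, of "snd p"] True by auto
      moreover have "real CARD('m) * (\<sigma> * (R + h)) \<le> real CARD('m) * (\<tau> * (R + h))"
        using \<sigma> A by (intro mult_left_mono mult_right_mono) auto
      moreover have "norm (fst p - snd p) \<le> norm (fst p - x) + norm (snd p - x)"
        using norm_triangle_ineq4[of "fst p - x" "snd p - x"] by simp
      ultimately have "norm (fst p - snd p) \<le> 2 * real CARD('m) * (\<tau> * (R + h))" by linarith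
      then have 1: "norm (fst p - snd p) powr ?e \<le> (2 * real CARD('m) * (\<tau> * (R + h))) powr ?e"
        using \<theta> by (intro powr_mono2) auto
      have 2: "\<bar>?K (fst p)\<bar> \<le> (1 / \<sigma>) ^ CARD('m) * (1 + R + h) ^ k"
        using kern_bound[OF \<sigma>(1) h, of a R n x "fst p"] R n True by auto
      have "\<bar>W p\<bar> = norm (fst p - snd p) powr ?e * \<bar>?K (fst p)\<bar>"
        using True by (auto simp: W_def abs_mult)
      also have "\<dots> \<le> ?B" using 1 2 by (intro mult_mono) auto
      finally show ?thesis using True by simp
    next
      case False
      then have "W p = 0" using kern_outside[OF \<sigma>(1) h, of "fst p" x a n]
        by (auto simp: W_def indicator_def mem_Times_iff)
      then show ?thesis using B by (simp add: indicator_def)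
    qed
  qed
  also have "measure LL (?P \<times> ?Q) = measure M ?P * measure M ?Q"
    using F.emeasure_pair_measure_Times[OF P(1) Q(1)] by (simp add: measure_def enn2real_mult)
  also have "fs_norm (l2 LL) (q ?v) * (?B * sqrt (measure M ?P * measure M ?Q)) \<le> fs_norm H u * (?B * ?\<mu>)"
  proof (intro mult_mono norm_slob_le[OF u n \<theta>])
    have "measure M ?P \<le> ?\<mu>" unfolding P(2) using \<sigma> h by (intro power_mono mult_left_mono) auto
    then have "measure M ?P * measure M ?Q \<le> ?\<mu> * ?\<mu>" unfolding Q(2) using \<mu> by (intro mult_right_mono) auto
    then have "sqrt (measure M ?P * measure M ?Q) \<le> sqrt (?\<mu> * ?\<mu>)" by (rule real_sqrt_le_mono)
    then show "sqrt (measure M ?P * measure M ?Q) \<le> ?\<mu>" using \<mu> by simp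
  qed (use A \<sigma> B u Hs.norm_nonneg in auto)
  finally have "\<bar>?\<mu> * ?I - ?J * ?V\<bar> \<le> fs_norm H u * (?B * ?\<mu>)" using eq by simp
  then have "\<bar>?\<mu> * ?I - ?J * ?V\<bar> / ?\<mu> \<le> fs_norm H u * ?B" using \<mu> by (simp add: pos_divide_le_eq mult.assoc)
  moreover have "\<bar>?\<mu> * ?I - ?J * ?V\<bar> / ?\<mu> = \<bar>(?\<mu> * ?I - ?J * ?V) / ?\<mu>\<bar>"
    using \<mu> by simp
  moreover have "(?\<mu> * ?I - ?J * ?V) / ?\<mu> = ?I - ?J * ?V / ?\<mu>"
    using nonzero_mult_div_cancel_left[of ?\<mu> ?I] \<mu> by (simp only: diff_divide_distrib less_irrefl)
  ultimately show ?thesis by simp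
qed

text \<open>The top-order scale derivatives oscillate by at most \<open>\<tau>\<^sup>s\<^sup>-\<^sup>k\<^sup>-\<^sup>m\<^sup>/\<^sup>2\<close> on \<open>[c\<tau>, \<tau>]\<close>.  The kernels at
  both scales have the same mean, so only differences of the derivative enter when \<open>s\<close> is fractional.\<close>

lemma scale_mean_osc:
  assumes s: "s > 0" and h: "h > 0" and c: "0 < c" "c \<le> 1" and R: "R \<ge> 0"
  obtains C where "C \<ge> 0" "\<And>u x a \<tau> \<sigma>. u \<in> elems H \<Longrightarrow> norm a = R \<Longrightarrow> 0 < \<tau> \<Longrightarrow> \<tau> \<le> 1 \<Longrightarrow> c * \<tau> \<le> \<sigma> \<Longrightarrow> \<sigma> \<le> \<tau> \<Longrightarrow>
    (\<And>\<tau>. 0 < \<tau> \<Longrightarrow> \<tau> \<le> 1 \<Longrightarrow> kbox h \<tau> x a \<subseteq> \<Omega>) \<Longrightarrow>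
    \<bar>scale_mean h x a u k \<sigma> - scale_mean h x a u k \<tau>\<bar> \<le> C * \<tau> powr (s - real k - real CARD('m) / 2) * fs_norm H u"
proof -
  let ?m = "real CARD('m)"
  have sk: "s = real k + \<theta>" using s by (simp add: frac_def)
  define A where "A = (1 + R + h) ^ k"
  define e where "e = (?m + 2 * \<theta>) / 2"
  \<comment> \<open>The factor 2 accounts for the two scales; the powers of c come from the lower
    bound \<open>c * \<tau>\<close> on \<sigma>.\<close>
  define C0 where "C0 = (if \<theta> > 0 then 2 * ((2 * ?m * (R + h)) powr e * ((1 / c) ^ CARD('m) * A))
      else 2 * (A * sqrt ((2 * h) ^ CARD('m)) * c powr (- ?m / 2)))"
  have C0: "0 \<le> C0" using h R c by (simp add: C0_def A_def)
  have one: "\<bar>(\<integral>p. wd (count_list is) u p * kern h (count_list is) \<sigma> x a p \<partial>M) -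
      (\<integral>p. wd (count_list is) u p * kern h (count_list is) \<tau> x a p \<partial>M)\<bar> \<le>
      C0 * \<tau> powr (s - real k - ?m / 2) * fs_norm H u"
    if u: "u \<in> elems H" and a: "norm a = R" and \<tau>: "0 < \<tau>" "\<tau> \<le> 1" and \<sigma>: "c * \<tau> \<le> \<sigma>" "\<sigma> \<le> \<tau>"
      and box: "\<And>\<tau>. 0 < \<tau> \<Longrightarrow> \<tau> \<le> 1 \<Longrightarrow> kbox h \<tau> x a \<subseteq> \<Omega>" and l: "length is = k"
    for u x a \<tau> \<sigma> "is"
  proof -
    have \<sigma>0: "0 < \<sigma>" using \<sigma> c \<tau> by (meson less_le_trans mult_pos_pos)
    have n: "mi_size (count_list is) = k" using l by (simp add: mi_size_count_list)
    have b: "kbox h \<sigma> x a \<subseteq> \<Omega>" "kbox h \<tau> x a \<subseteq> \<Omega>" using box \<tau> \<sigma> \<sigma>0 by auto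
    have nu: "0 \<le> fs_norm H u" by (rule Hs.norm_nonneg[OF u])
    show ?thesis
    proof (cases "\<theta> > 0")
      case True
      let ?B = "\<lambda>\<sigma>. fs_norm H u * ((2 * ?m * (\<tau> * (R + h))) powr e * ((1 / \<sigma>) ^ CARD('m) * A))"
      \<comment> \<open>Both integrals are compared with one and the same number: the mass of the
        kernel times the average of the derivative over the cube at scale \<tau>.\<close>
      have 1: "\<bar>(\<integral>p. wd (count_list is) u p * kern h (count_list is) \<sigma> x a p \<partial>M) -
          (\<integral>p. wd (count_list is) u p * kern h (count_list is) \<tau> x a p \<partial>M)\<bar> \<le> ?B \<sigma> + ?B \<tau>"
        using kern_integral_osc[OF u n True h a \<sigma>0 \<sigma>(2) b] kern_integral_osc[OF u n True h a \<tau>(1) order_refl b(2,2)]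
        unfolding A_def e_def by linarith
      have mono: "?B t \<le> fs_norm H u * (((2 * ?m * (R + h)) powr e * ((1 / c) ^ CARD('m) * A)) * \<tau> powr (\<theta> - ?m / 2))"
        if "c * \<tau> \<le> t" "t \<le> \<tau>" for t
      proof (rule mult_left_mono[OF _ nu])
        have t0: "0 < c * \<tau>" using c \<tau> by simp
        then have "0 < t" using that by linarith
        note t0 = t0 this
        have "(1 / t) ^ CARD('m) \<le> (1 / (c * \<tau>)) ^ CARD('m)"
          using that t0 by (intro power_mono divide_left_mono) auto
        also have "\<dots> = (1 / c) ^ CARD('m) * \<tau> powr (- ?m)"
          using \<tau> by (simp add: powr_minus powr_realpow power_mult_distrib power_inverse divide_inverse)
        finally have "(2 * ?m * (\<tau> * (R + h))) powr e * ((1 / t) ^ CARD('m) * A) \<le>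
            (2 * ?m * (\<tau> * (R + h))) powr e * (((1 / c) ^ CARD('m) * \<tau> powr (- ?m)) * A)"
          using R h by (intro mult_left_mono mult_right_mono) (auto simp: A_def)
        moreover have E: "(2 * ?m * (\<tau> * (R + h))) powr e = (2 * ?m * (R + h)) powr e * \<tau> powr e"
        proof -
          have "2 * ?m * (\<tau> * (R + h)) = (2 * ?m * (R + h)) * \<tau>" by simp
          then show ?thesis using \<tau> R h by (simp only: powr_mult)
        qed
        have T: "\<tau> powr e * \<tau> powr (- ?m) = \<tau> powr (\<theta> - ?m / 2)"
          unfolding powr_add[symmetric] by (simp add: e_def field_simps)
        have "(2 * ?m * (\<tau> * (R + h))) powr e * (((1 / c) ^ CARD('m) * \<tau> powr (- ?m)) * A) =
          ((2 * ?m * (R + h)) powr e * ((1 / c) ^ CARD('m) * A)) * \<tau> powr (\<theta> - ?m / 2)"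
          unfolding E T[symmetric] by (simp only: mult_ac)
        ultimately show "(2 * ?m * (\<tau> * (R + h))) powr e * ((1 / t) ^ CARD('m) * A) \<le>
          ((2 * ?m * (R + h)) powr e * ((1 / c) ^ CARD('m) * A)) * \<tau> powr (\<theta> - ?m / 2)"
          by simp
      qed
      have "?B \<sigma> + ?B \<tau> \<le> C0 * \<tau> powr (\<theta> - ?m / 2) * fs_norm H u"
      proof -
        have "c * \<tau> \<le> \<tau>" using \<tau> c by (simp add: mult_left_le_one_le)
        from mono[OF \<sigma>] mono[OF this order_refl] show ?thesis unfolding C0_def if_P[OF True] by (simp only: mult_ac)
      qed
      moreover have "s - real k - ?m / 2 = \<theta> - ?m / 2" using sk by linarith
      ultimately show ?thesis using 1 by (simp only:)
    next
      case False
      then have \<theta>0: "\<theta> = 0" using frac_ge_0[of s] by linarith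
      let ?B = "\<lambda>\<sigma>. fs_norm H u * (A * sqrt ((2 * h) ^ CARD('m)) * \<sigma> powr (- ?m / 2))"
      \<comment> \<open>For integer order each integral is bounded by itself; its order -m/2 is
        already s - k - m/2.\<close>
      have 1: "\<bar>(\<integral>p. wd (count_list is) u p * kern h (count_list is) \<sigma> x a p \<partial>M) -
          (\<integral>p. wd (count_list is) u p * kern h (count_list is) \<tau> x a p \<partial>M)\<bar> \<le> ?B \<sigma> + ?B \<tau>"
        using kern_integral_size[OF u n h a \<sigma>0 b(1)] kern_integral_size[OF u n h a \<tau>(1) b(2)]
        unfolding A_def by linarith
      have mono: "?B t \<le> fs_norm H u * ((A * sqrt ((2 * h) ^ CARD('m)) * c powr (- ?m / 2)) * \<tau> powr (- ?m / 2))"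
        if "c * \<tau> \<le> t" "t \<le> \<tau>" for t
      proof (rule mult_left_mono[OF _ nu])
        have "t powr (- ?m / 2) \<le> (c * \<tau>) powr (- ?m / 2)"
          using that c \<tau> by (intro powr_mono2') auto
        also have "\<dots> = c powr (- ?m / 2) * \<tau> powr (- ?m / 2)" using c \<tau> by (simp add: powr_mult)
        finally have "A * sqrt ((2 * h) ^ CARD('m)) * t powr (- ?m / 2) \<le>
            A * sqrt ((2 * h) ^ CARD('m)) * (c powr (- ?m / 2) * \<tau> powr (- ?m / 2))"
          using R h by (intro mult_left_mono) (auto simp: A_def)
        then show "A * sqrt ((2 * h) ^ CARD('m)) * t powr (- ?m / 2) \<le>
            (A * sqrt ((2 * h) ^ CARD('m)) * c powr (- ?m / 2)) * \<tau> powr (- ?m / 2)" by simp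
      qed
      have "?B \<sigma> + ?B \<tau> \<le> C0 * \<tau> powr (- ?m / 2) * fs_norm H u"
      proof -
        have "c * \<tau> \<le> \<tau>" using \<tau> c by (simp add: mult_left_le_one_le)
        from mono[OF \<sigma>] mono[OF this order_refl] show ?thesis unfolding C0_def if_not_P[OF False] by (simp only: mult_ac)
      qed
      moreover have "s - real k - ?m / 2 = - ?m / 2" using sk \<theta>0 by linarith
      ultimately show ?thesis using 1 by (simp only:)
    qed
  qed
  define N where "N = card {is :: 'm list. length is = k}"
  show ?thesis
  proof (rule that[of "real N * C0"])
    show "0 \<le> real N * C0" using C0 by simp
    fix u :: "real^'m \<Rightarrow> real" and x a \<tau> \<sigma>
    assume *: "u \<in> elems H" "norm a = R" "0 < \<tau>" "\<tau> \<le> 1" "c * \<tau> \<le> \<sigma>" "\<sigma> \<le> \<tau>"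
      "\<And>\<tau>. 0 < \<tau> \<Longrightarrow> \<tau> \<le> 1 \<Longrightarrow> kbox h \<tau> x a \<subseteq> \<Omega>"
    have "\<bar>scale_mean h x a u k \<sigma> - scale_mean h x a u k \<tau>\<bar> \<le>
      (\<Sum>is | length is = k. \<bar>(\<integral>p. wd (count_list is) u p * kern h (count_list is) \<sigma> x a p \<partial>M) -
      (\<integral>p. wd (count_list is) u p * kern h (count_list is) \<tau> x a p \<partial>M)\<bar>)"
      unfolding scale_mean_def sum_subtractf[symmetric] by (rule sum_abs)
    also have "\<dots> \<le> (\<Sum>is | length (is :: 'm list) = k. C0 * \<tau> powr (s - real k - ?m / 2) * fs_norm H u)"
      using * by (intro sum_mono one) auto
    also have "\<dots> = real N * C0 * \<tau> powr (s - real k - ?m / 2) * fs_norm H u" by (simp add: N_def)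
    finally show "\<bar>scale_mean h x a u k \<sigma> - scale_mean h x a u k \<tau>\<bar> \<le>
      real N * C0 * \<tau> powr (s - real k - ?m / 2) * fs_norm H u" .
  qed
qed

end

section \<open>Richardson extrapolation over dyadic scales\<close>

text \<open>The numbers are the coefficients of the polynomial p of degree at most k with p(1) = 1
  and zeros 2^(-1), ..., 2^(-k): the sums in question are the values of p at these points.\<close>

lemma extrapolation_coeffs:
  obtains c :: "nat \<Rightarrow> real" where "(\<Sum>i\<le>k. c i) = 1"
    "\<And>j. 1 \<le> j \<Longrightarrow> j \<le> k \<Longrightarrow> (\<Sum>i\<le>k. c i * ((1/2) ^ i) ^ j) = 0"
proof -
  define f :: "nat \<Rightarrow> real poly" where "f j = [: - ((1/2)^j) / (1 - (1/2)^j), 1 / (1 - (1/2)^j) :]" for j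
  define p where "p = (\<Prod>j=1..k. f j)"
  have n: "1 - (1/2::real)^j \<noteq> 0" if "j \<ge> 1" for j
    using power_strict_decreasing[of 0 j "1/2::real"] that by simp
  have "degree p \<le> (\<Sum>j=1..k. degree (f j))" unfolding p_def by (rule order_trans[OF degree_prod_sum_le]) auto
  also have "\<dots> \<le> (\<Sum>j=1..k. 1)" by (intro sum_mono) (simp add: f_def)
  finally have deg: "degree p \<le> k" by simp
  have P: "poly p x = (\<Sum>i\<le>k. coeff p i * x ^ i)" for x
    unfolding poly_altdef using deg by (intro sum.mono_neutral_left) (auto simp: coeff_eq_0)
  show ?thesis
  proof (rule that[of "coeff p"])
    have "poly (f j) 1 = 1" if "j \<ge> 1" for j
      using n[OF that] by (simp add: f_def diff_divide_distrib[symmetric])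
    then have "poly p 1 = 1"
      unfolding p_def poly_prod by (intro prod.neutral ballI) auto
    then show "(\<Sum>i\<le>k. coeff p i) = 1" using P[of 1] by simp
    fix j :: nat assume j: "1 \<le> j" "j \<le> k"
    have "poly p ((1/2)^j) = 0"
      unfolding p_def poly_prod by (rule prod_zero) (use j n[of j] in \<open>auto simp: f_def field_simps intro!: bexI[of _ j]\<close>)
    then show "(\<Sum>i\<le>k. coeff p i * ((1/2) ^ i) ^ j) = 0" using P[of "(1/2)^j"] by (simp add: power_mult[symmetric] mult.commute)
  qed
qed

text \<open>The Taylor expansion around \<tau> runs in powers of \<mu> - 1, whereas the coefficients
  annihilate powers of \<mu>; the binomial theorem passes from one to the other. The constant power
  drops out because two consecutive scales are subtracted.\<close>

lemma extrapolation_cancels: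
  fixes c :: "nat \<Rightarrow> real"
  assumes "\<And>j. 1 \<le> j \<Longrightarrow> j \<le> k \<Longrightarrow> (\<Sum>i\<le>k. c i * ((1/2) ^ i) ^ j) = 0" "j \<le> k"
  shows "(\<Sum>i\<le>k. c i * (((1/2) ^ Suc i - 1) ^ j - ((1/2) ^ i - 1) ^ j)) = 0"
proof -
  have mono: "(\<Sum>i\<le>k. c i * (((1/2) ^ Suc i) ^ l - ((1/2) ^ i) ^ l)) = 0" if "l \<le> k" for l
  proof -
    have "(\<Sum>i\<le>k. c i * (((1/2) ^ Suc i) ^ l - ((1/2) ^ i) ^ l)) = ((1/2) ^ l - 1) * (\<Sum>i\<le>k. c i * ((1/2) ^ i) ^ l)"
    proof -
      have *: "c * (x * y - y) = (x - 1) * (c * y)" for c x y :: real by (simp add: algebra_simps)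
      show ?thesis by (simp only: sum_distrib_left power_Suc power_mult_distrib *)
    qed
    then show ?thesis using assms(1)[of l] that by (cases "l = 0") auto
  qed
  have "(x - 1) ^ j = (\<Sum>l\<le>j. (real (j choose l) * (-1) ^ (j - l)) * x ^ l)" for x :: real
    using binomial_ring[of x "-1" j] by (simp add: mult_ac)
  then have "(\<Sum>i\<le>k. c i * (((1/2) ^ Suc i - 1) ^ j - ((1/2) ^ i - 1) ^ j)) =
      (\<Sum>i\<le>k. \<Sum>l\<le>j. (real (j choose l) * (-1) ^ (j - l)) * (c i * (((1/2) ^ Suc i) ^ l - ((1/2) ^ i) ^ l)))"
    by (simp only: sum_subtractf[symmetric] right_diff_distrib[symmetric] sum_distrib_left mult_ac)
  also have "\<dots> = (\<Sum>l\<le>j. (real (j choose l) * (-1) ^ (j - l)) * (\<Sum>i\<le>k. c i * (((1/2) ^ Suc i) ^ l - ((1/2) ^ i) ^ l)))"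
    by (subst sum.swap) (simp only: sum_distrib_left)
  also have "\<dots> = 0" using mono assms(2) by (intro sum.neutral ballI) auto
  finally show ?thesis .
qed

text \<open>Taylor's theorem is used with a positive number of terms and two distinct points; the
  degenerate cases \<open>k = 0\<close> and \<open>\<mu> = 1\<close> are added so that it applies
  uniformly to all scales.\<close>

lemma Taylor_scale:
  fixes g :: "nat \<Rightarrow> real \<Rightarrow> real"
  assumes "\<And>j t. j < k \<Longrightarrow> t \<in> {0<..<1} \<Longrightarrow> (g j has_real_derivative g (Suc j) t) (at t)"
    and "\<tau> \<in> {0<..<1}" "0 < \<mu>" "\<mu> \<le> 1"
  shows "\<exists>t\<in>{\<mu> * \<tau>..\<tau>}. g 0 (\<mu> * \<tau>) = (\<Sum>j<k. g j \<tau> / fact j * (\<mu> * \<tau> - \<tau>) ^ j) + g k t / fact k * (\<mu> * \<tau> - \<tau>) ^ k"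
proof -
  have le: "\<mu> * \<tau> \<le> \<tau>" using assms by (simp add: mult_left_le_one_le)
  have pos: "0 < \<mu> * \<tau>" using assms by simp
  consider "k = 0" | "k > 0" "\<mu> = 1" | "k > 0" "\<mu> \<noteq> 1" by auto
  then show ?thesis
  proof cases
    case 1 then show ?thesis using le by (intro bexI[of _ "\<mu> * \<tau>"]) auto
  next
    case 2
    then have "(\<Sum>j<k. g j \<tau> / fact j * (\<mu> * \<tau> - \<tau>) ^ j) = (\<Sum>j<k. if j = 0 then g 0 \<tau> else 0)"
      by (intro sum.cong) (auto simp: power_0_left)
    then show ?thesis using 2 by (intro bexI[of _ \<tau>]) auto
  next
    case 3
    then have lt: "\<mu> * \<tau> \<noteq> \<tau>" using assms by simp
    have "\<exists>t. (if \<mu> * \<tau> < \<tau> then \<mu> * \<tau> < t \<and> t < \<tau> else \<tau> < t \<and> t < \<mu> * \<tau>) \<and>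
      g 0 (\<mu> * \<tau>) = (\<Sum>j<k. g j \<tau> / fact j * (\<mu> * \<tau> - \<tau>) ^ j) + g k t / fact k * (\<mu> * \<tau> - \<tau>) ^ k"
      by (rule Taylor[of k g "g 0" "\<mu> * \<tau>" \<tau>]) (use 3 assms le lt pos in auto)
    then show ?thesis using le lt by (auto intro!: bexI split: if_splits)
  qed
qed

lemma extrapolation_step:
  fixes g :: "nat \<Rightarrow> real \<Rightarrow> real" and c :: "nat \<Rightarrow> real"
  assumes g: "\<And>j t. j < k \<Longrightarrow> t \<in> {0<..<1} \<Longrightarrow> (g j has_real_derivative g (Suc j) t) (at t)"
    and \<tau>: "\<tau> \<in> {0<..<1}"
    and c: "\<And>j. 1 \<le> j \<Longrightarrow> j \<le> k \<Longrightarrow> (\<Sum>i\<le>k. c i * ((1/2) ^ i) ^ j) = 0"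
    and W: "\<And>t. (1/2) ^ Suc k * \<tau> \<le> t \<Longrightarrow> t \<le> \<tau> \<Longrightarrow> \<bar>g k t - g k \<tau>\<bar> \<le> W"
  shows "\<bar>(\<Sum>i\<le>k. c i * g 0 ((1/2) ^ Suc i * \<tau>)) - (\<Sum>i\<le>k. c i * g 0 ((1/2) ^ i * \<tau>))\<bar> \<le> (\<Sum>i\<le>k. \<bar>c i\<bar>) * (2 * (W * \<tau> ^ k))"
proof -
  \<comment> \<open>The polynomial includes the term of degree k with coefficient taken at \<tau>.
    The Lagrange remainder minus this term involves only \<open>g k t - g k \<tau>\<close>, which is
    what \<open>W\<close> bounds.\<close>
  define P where "P \<mu> = (\<Sum>j\<le>k. g j \<tau> / fact j * (\<mu> * \<tau> - \<tau>) ^ j)" for \<mu>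
  define err where "err \<mu> = g 0 (\<mu> * \<tau>) - P \<mu>" for \<mu>
  have W0: "0 \<le> W" using W[of \<tau>] \<tau> power_decreasing[of 0 "Suc k" "1/2::real"]
    by (force simp: mult_left_le_one_le)
  have err: "\<bar>err \<mu>\<bar> \<le> W * \<tau> ^ k" if \<mu>: "(1/2) ^ Suc k \<le> \<mu>" "\<mu> \<le> 1" for \<mu>
  proof -
    have \<mu>0: "0 < \<mu>" using \<mu> by (meson less_le_trans zero_less_power zero_less_divide_1_iff zero_less_numeral)
    obtain t where t: "t \<in> {\<mu> * \<tau>..\<tau>}"
      "g 0 (\<mu> * \<tau>) = (\<Sum>j<k. g j \<tau> / fact j * (\<mu> * \<tau> - \<tau>) ^ j) + g k t / fact k * (\<mu> * \<tau> - \<tau>) ^ k"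
      using Taylor_scale[of k g \<tau> \<mu>] g \<tau> \<mu> \<mu>0 by blast
    have e: "err \<mu> = (g k t - g k \<tau>) * ((\<mu> * \<tau> - \<tau>) ^ k / fact k)"
      unfolding err_def P_def t(2) lessThan_Suc_atMost[symmetric] by (simp add: diff_divide_distrib left_diff_distrib)
    have w: "\<bar>g k t - g k \<tau>\<bar> \<le> W"
    proof (rule W)
      have "(1/2) ^ Suc k * \<tau> \<le> \<mu> * \<tau>" using \<tau> by (intro mult_right_mono[OF \<mu>(1)]) auto
      then show "(1/2) ^ Suc k * \<tau> \<le> t" using t(1) by (simp only: atLeastAtMost_iff) (rule order_trans, auto)
    qed (use t(1) in auto)
    have "\<bar>(\<mu> * \<tau> - \<tau>) ^ k / fact k\<bar> \<le> \<tau> ^ k"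
    proof -
      have "\<bar>\<mu> * \<tau> - \<tau>\<bar> \<le> \<tau>" using \<tau> \<mu> \<mu>0 mult_left_le_one_le[of \<tau> \<mu>] by (auto simp: abs_le_iff)
      then have "\<bar>\<mu> * \<tau> - \<tau>\<bar> ^ k \<le> \<tau> ^ k" by (intro power_mono) auto
      moreover have "\<bar>\<mu> * \<tau> - \<tau>\<bar> ^ k / fact k \<le> \<bar>\<mu> * \<tau> - \<tau>\<bar> ^ k"
        by (intro divide_le_eq_1_pos[THEN iffD2] mult_imp_div_pos_le) (auto simp: mult_le_cancel_left1 fact_ge_1)
      ultimately show ?thesis by (simp add: abs_divide power_abs)
    qed
    then show ?thesis unfolding e abs_mult using w W0 by (intro mult_mono) auto
  qed
  have poly: "(\<Sum>i\<le>k. c i * (P ((1/2) ^ Suc i) - P ((1/2) ^ i))) = 0"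
  proof -
    have e: "(x * \<tau> - \<tau>) ^ j = \<tau> ^ j * (x - 1) ^ j" for x j
      by (simp add: power_mult_distrib[symmetric] algebra_simps)
    have "(\<Sum>i\<le>k. c i * (P ((1/2) ^ Suc i) - P ((1/2) ^ i))) =
      (\<Sum>i\<le>k. \<Sum>j\<le>k. (g j \<tau> / fact j * \<tau> ^ j) * (c i * (((1/2) ^ Suc i - 1) ^ j - ((1/2) ^ i - 1) ^ j)))"
      unfolding P_def e by (simp only: sum_subtractf[symmetric] right_diff_distrib[symmetric] sum_distrib_left mult_ac)
    also have "\<dots> = (\<Sum>j\<le>k. (g j \<tau> / fact j * \<tau> ^ j) * (\<Sum>i\<le>k. c i * (((1/2) ^ Suc i - 1) ^ j - ((1/2) ^ i - 1) ^ j)))"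
      by (subst sum.swap) (simp only: sum_distrib_left)
    also have "\<dots> = 0" using extrapolation_cancels[of k c, OF c] by (intro sum.neutral ballI) auto
    finally show ?thesis .
  qed
  have "(\<Sum>i\<le>k. c i * g 0 ((1/2) ^ Suc i * \<tau>)) - (\<Sum>i\<le>k. c i * g 0 ((1/2) ^ i * \<tau>)) =
      (\<Sum>i\<le>k. c i * (err ((1/2) ^ Suc i) - err ((1/2) ^ i))) +
      (\<Sum>i\<le>k. c i * (P ((1/2) ^ Suc i) - P ((1/2) ^ i)))"
    unfolding err_def by (simp only: right_diff_distrib sum_subtractf)
  also have "\<dots> = (\<Sum>i\<le>k. c i * (err ((1/2) ^ Suc i) - err ((1/2) ^ i)))" using poly by simp
  also have "\<bar>\<dots>\<bar> \<le> (\<Sum>i\<le>k. \<bar>c i\<bar> * (2 * (W * \<tau> ^ k)))"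
  proof (rule order_trans[OF sum_abs sum_mono])
    fix i assume i: "i \<in> {..k}"
    have "\<bar>err ((1/2) ^ Suc i)\<bar> \<le> W * \<tau> ^ k" "\<bar>err ((1/2) ^ i)\<bar> \<le> W * \<tau> ^ k"
      using i by (intro err power_decreasing power_le_one; simp)+
    then show "\<bar>c i * (err ((1/2) ^ Suc i) - err ((1/2) ^ i))\<bar> \<le> \<bar>c i\<bar> * (2 * (W * \<tau> ^ k))"
      unfolding abs_mult by (intro mult_left_mono) auto
  qed
  finally show ?thesis by (simp only: sum_distrib_right)
qed

context sobolev_domain
begin

lemma scale_mean_0:
  assumes "u \<in> elems H"
  shows "scale_mean h x a u 0 \<tau> = (\<integral>p. u p * kern h (\<lambda>_. 0) \<tau> x a p \<partial>M)"
proof -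
  have c: "count_list ([] :: 'm list) = (\<lambda>_. 0)" by auto
  have "scale_mean h x a u 0 \<tau> = (\<integral>p. wd (\<lambda>_. 0) u p * kern h (\<lambda>_. 0) \<tau> x a p \<partial>M)"
    unfolding scale_mean_def by (simp add: c)
  also have "\<dots> = (\<integral>p. u p * kern h (\<lambda>_. 0) \<tau> x a p \<partial>M)"
    using inner_l2_cong_AE[OF _ _ _ wd_0[OF Hs_l2[OF assms]]] Hs_l2[OF assms] kern_l2
      wd_mem[OF assms, of "\<lambda>_. 0"]
    by (simp add: inner_l2 l2_measurable mi_size_def)
  finally show ?thesis .
qed

text \<open>The kernels form an approximate identity of mass \<open>?N0\<close>: they are
  nonnegative, the mass is independent of the scale, and the supports shrink to x, although they
  need not contain x.\<close>

lemma scale_mean_tendsto: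
  assumes u: "u \<in> elems H" and x: "x \<in> \<Omega>" and h: "h > 0"
    and box: "\<And>\<tau>. 0 < \<tau> \<Longrightarrow> \<tau> \<le> 1 \<Longrightarrow> kbox h \<tau> x a \<subseteq> \<Omega>"
    and t: "\<And>N. 0 < t N" "\<And>N. t N \<le> 1" "t \<longlonglongrightarrow> 0"
  shows "(\<lambda>N::nat. scale_mean h x a u 0 (t N)) \<longlonglongrightarrow> u x * (\<integral>z. tens (\<lambda>i t. bump (t / h)) (z::real^'m) \<partial>lborel)"
    (is "_ \<longlonglongrightarrow> _ * ?N0")
proof (rule LIMSEQ_I)
  fix e :: real assume e: "e > 0"
  let ?K = "\<lambda>\<tau>. kern h (\<lambda>_. 0) \<tau> x a"
  have K0: "0 \<le> ?K \<tau> p" if "\<tau> > 0" for \<tau> p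
    unfolding kern_def tens_def using that bump_range by (intro prod_nonneg) auto
  have KI: "(\<integral>p. ?K \<tau> p \<partial>M) = ?N0" if "0 < \<tau>" "\<tau> \<le> 1" for \<tau>
    using integral_kern_M[OF that(1) h box[OF that], of "\<lambda>_. 0"] by simp
  have "0 \<le> (\<integral>p. ?K 1 p \<partial>M)" by (intro Bochner_Integration.integral_nonneg K0) simp
  then have N0: "0 \<le> ?N0" using KI[of 1] by simp
  define e' where "e' = e / (?N0 + 1)"
  have e': "e' > 0" using e N0 by (simp add: e'_def)
  have "continuous (at x) u"
    using u x open_dom by (auto simp: mem_Hs continuous_on_eq_continuous_at)
  then obtain d where d: "d > 0" "\<And>p. dist p x < d \<Longrightarrow> dist (u p) (u x) < e'"
    using e' unfolding continuous_at_eps_delta by metis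
  define r where "r = real CARD('m) * (norm a + h)"
  have "(\<lambda>N. r * t N) \<longlonglongrightarrow> r * 0" by (intro tendsto_intros t(3))
  then have "\<forall>\<^sub>F N in sequentially. r * t N < d" using d(1) by (auto dest: order_tendstoD(2))
  then obtain N1 where N1: "\<And>N. N \<ge> N1 \<Longrightarrow> r * t N < d" unfolding eventually_sequentially by auto
  show "\<exists>no. \<forall>N\<ge>no. norm (scale_mean h x a u 0 (t N) - u x * ?N0) < e"
  proof (intro exI allI impI)
    fix N assume N: "N \<ge> N1"
    let ?\<tau> = "t N"
    have i: "integrable M (\<lambda>p. u p * ?K ?\<tau> p)" "integrable M (?K ?\<tau>)"
      using integrable_mult_l2[OF Hs_l2[OF u] kern_l2] integrable_l2[OF finite_M kern_l2] by auto
    have "scale_mean h x a u 0 ?\<tau> - u x * ?N0 = (\<integral>p. u p * ?K ?\<tau> p \<partial>M) - (\<integral>p. u x * ?K ?\<tau> p \<partial>M)"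
      using KI[OF t(1,2)] by (simp add: scale_mean_0[OF u])
    also have "\<dots> = (\<integral>p. u p * ?K ?\<tau> p - u x * ?K ?\<tau> p \<partial>M)"
      using i by (intro Bochner_Integration.integral_diff[symmetric]) auto
    also have "norm \<dots> \<le> (\<integral>p. norm (u p * ?K ?\<tau> p - u x * ?K ?\<tau> p) \<partial>M)"
      by (rule integral_norm_bound)
    also have "\<dots> \<le> (\<integral>p. e' * ?K ?\<tau> p \<partial>M)"
    proof (rule integral_mono)
      fix p
      show "norm (u p * ?K ?\<tau> p - u x * ?K ?\<tau> p) \<le> e' * ?K ?\<tau> p"
      proof (cases "p \<in> kbox h ?\<tau> x a")
        case True
        have "dist p x \<le> r * ?\<tau>"
          using kbox_dist[OF t(1) True refl] by (simp add: r_def dist_norm mult_ac)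
        then have "\<bar>u p - u x\<bar> \<le> e'" using N1[OF N] d(2)[of p] by (simp add: dist_real_def)
        then have "\<bar>u p - u x\<bar> * ?K ?\<tau> p \<le> e' * ?K ?\<tau> p" using K0[OF t(1)] by (intro mult_right_mono)
        moreover have "norm (u p * ?K ?\<tau> p - u x * ?K ?\<tau> p) = \<bar>u p - u x\<bar> * ?K ?\<tau> p"
          using K0[OF t(1)] by (simp add: left_diff_distrib[symmetric] abs_mult)
        ultimately show ?thesis by simp
      next
        case False
        then show ?thesis using kern_outside[OF t(1) h False] by simp
      qed
    qed (use i in auto)
    also have "\<dots> = e' * ?N0" using KI[OF t(1,2)] by simp
    also have "\<dots> < e" using e N0 by (simp add: e'_def field_simps)
    finally show "norm (scale_mean h x a u 0 ?\<tau> - u x * ?N0) < e" .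
  qed
qed

lemma bump_integral_pos:
  assumes "h > 0"
  shows "0 < (\<integral>z. tens (\<lambda>i t. bump (t / h)) (z::real^'m) \<partial>lborel)"
proof -
  let ?f = "tens (\<lambda>i t. bump (t / h)) :: real^'m \<Rightarrow> real"
  have s: "smooth1 (\<lambda>t. bump (t / h))" using smooth1_affine[OF smooth1_bump, of "1/h" 0] by simp
  have c: "continuous_on UNIV ?f" by (intro continuous_on_tens s)
  have nn: "0 \<le> ?f z" for z unfolding tens_def by (intro prod_nonneg bump_range ballI)
  have out: "?f z = 0" if "z \<notin> cbox (\<chi> i. -h) (\<chi> i. h)" for z
  proof -
    from that obtain i where "\<not> (-h \<le> z $ i \<and> z $ i \<le> h)" by (auto simp: mem_box_cart)
    then have "1 \<le> \<bar>z $ i / h\<bar>" using assms by (auto simp: abs_divide)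
    then have "bump (z $ i / h) = 0" by (rule bump_support)
    then show ?thesis unfolding tens_def by (intro prod_zero) auto
  qed
  have i: "integrable lborel ?f"
  proof -
    have "integrable lborel (\<lambda>z. indicator (cbox (\<chi> i. -h) (\<chi> i. h)) z *\<^sub>R ?f z)"
      by (rule borel_integrable_compact) (use c continuous_on_subset in auto)
    moreover have "(\<lambda>z. indicator (cbox (\<chi> i. -h) (\<chi> i. h)) z *\<^sub>R ?f z) = ?f"
    proof
      fix z show "indicator (cbox (\<chi> i. -h) (\<chi> i. h)) z *\<^sub>R ?f z = ?f z"
        using out[of z] by (cases "z \<in> cbox (\<chi> i. -h) (\<chi> i. h)") auto
    qed
    ultimately show ?thesis by simp
  qed
  have "(\<integral>z. ?f z \<partial>lborel) \<noteq> 0"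
  proof
    assume "(\<integral>z. ?f z \<partial>lborel) = 0"
    then have "AE z in lborel. ?f z = 0"
      using integral_nonneg_eq_0_iff_AE[OF i] nn by simp
    then have "AE z in lborel. z \<in> {z. ?f z = 0}" by simp
    have "open (?f -` {0<..})" by (rule open_vimage) (use c in auto)
    moreover have "0 \<in> ?f -` {0<..}" by (simp add: tens_def bump_0)
    ultimately obtain r where r: "r > 0" "ball 0 r \<subseteq> ?f -` {0<..}" by (meson openE)
    have "AE z in lborel. z \<notin> ball (0::real^'m) r"
      using \<open>AE z in lborel. ?f z = 0\<close> by eventually_elim (use r(2) in force)
    then have "ball (0::real^'m) r \<in> null_sets lborel"
      by (subst AE_iff_null_sets) auto
    then have "emeasure lborel (ball (0::real^'m) r) = 0" by auto
    then show False using r(1) emeasure_lborel_ball_finite by (simp add: emeasure_ball unit_ball_vol_pos less_imp_neq[symmetric])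
  qed
  moreover have "0 \<le> (\<integral>z. ?f z \<partial>lborel)" using nn by (intro Bochner_Integration.integral_nonneg) auto
  ultimately show ?thesis by simp
qed

definition local_mean :: "real \<Rightarrow> (nat \<Rightarrow> real) \<Rightarrow> real \<Rightarrow> real^'m \<Rightarrow> real^'m \<Rightarrow> real^'m \<Rightarrow> real" where
  "local_mean h c T x a p = (\<Sum>i\<le>k. c i * kern h (\<lambda>_. 0) ((1/2) ^ i * T) x a p)"

lemma local_mean_l2: "local_mean h c T x a \<in> elems (l2 M)"
  using pre_hilbert.sum_mem[OF pre_hilbert_l2 finite_atMost, of k "\<lambda>i. kern h (\<lambda>_. 0) ((1/2) ^ i * T) x a" M c] kern_l2
  by (simp add: local_mean_def[abs_def])

text \<open>Richardson extrapolation of the means at the scales \<open>T/2\<^sup>i\<close> annihilates the Taylor polynomial of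
  degree \<open>k\<close>, so consecutive dyadic scales differ by \<open>O(T\<^sup>s\<^sup>-\<^sup>m\<^sup>/\<^sup>2)\<close> and the differences can be summed up.\<close>

lemma local_mean_approx:
  assumes s: "s > real CARD('m) / 2" and cone: "cone_property \<Omega>"
  obtains h R N0 C \<mu> c where "h > 0" "R > 0" "N0 > 0" "C \<ge> 0" "\<mu> > 0"
    "\<And>x. x \<in> \<Omega> \<Longrightarrow> \<exists>a. norm a = R \<and> (\<forall>u\<in>elems H. \<forall>T\<in>{0<..<1}.
       \<bar>N0 * u x - (\<integral>p. u p * local_mean h c T x a p \<partial>M)\<bar> \<le> C * T powr \<mu> * fs_norm H u)"
proof -
  obtain R h where R: "R > 0" "h > 0"
    and spot: "\<And>x. x \<in> \<Omega> \<Longrightarrow> \<exists>a. norm a = R \<and> (\<forall>\<tau> z. 0 < \<tau> \<and> \<tau> \<le> 1 \<and> (\<forall>i. \<bar>z $ i - a $ i\<bar> \<le> h) \<longrightarrow> x + \<tau> *\<^sub>R z \<in> \<Omega>)"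
    using cone_property_cubes[OF cone] by metis
  obtain c :: "nat \<Rightarrow> real" where c: "(\<Sum>i\<le>k. c i) = 1"
    "\<And>j. 1 \<le> j \<Longrightarrow> j \<le> k \<Longrightarrow> (\<Sum>i\<le>k. c i * ((1/2) ^ i) ^ j) = 0"
    using extrapolation_coeffs[of k] by blast
  have s0: "s > 0" using s by (meson divide_nonneg_nonneg le_less_trans of_nat_0_le_iff zero_le_numeral)
  have "(1/2::real) ^ Suc k \<le> 1" by (intro power_le_one) auto
  note le1 = this
  have gt0: "0 < (1/2::real) ^ Suc k" by simp
  obtain C0 where C0: "C0 \<ge> 0" "\<And>u x a \<tau> \<sigma>. u \<in> elems H \<Longrightarrow> norm a = R \<Longrightarrow> 0 < \<tau> \<Longrightarrow> \<tau> \<le> 1 \<Longrightarrow> (1/2) ^ Suc k * \<tau> \<le> \<sigma> \<Longrightarrow> \<sigma> \<le> \<tau> \<Longrightarrow>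
    (\<And>\<tau>. 0 < \<tau> \<Longrightarrow> \<tau> \<le> 1 \<Longrightarrow> kbox h \<tau> x a \<subseteq> \<Omega>) \<Longrightarrow>
    \<bar>scale_mean h x a u k \<sigma> - scale_mean h x a u k \<tau>\<bar> \<le> C0 * \<tau> powr (s - real k - real CARD('m) / 2) * fs_norm H u"
    using scale_mean_osc[OF s0 R(2) gt0 le1 less_imp_le[OF R(1)]] by blast
  define \<mu> where "\<mu> = s - real CARD('m) / 2"
  have \<mu>: "\<mu> > 0" using s by (simp add: \<mu>_def)
  define N0 where "N0 = (\<integral>z. tens (\<lambda>i t. bump (t / h)) (z::real^'m) \<partial>lborel)"
  have N0: "N0 > 0" unfolding N0_def by (rule bump_integral_pos[OF R(2)])
  define C1 where "C1 = (\<Sum>i\<le>k. \<bar>c i\<bar>) * (2 * C0)"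
  have C1: "C1 \<ge> 0" unfolding C1_def using C0 by (intro mult_nonneg_nonneg sum_nonneg) auto
  \<comment> \<open>Halving the scale multiplies \<open>\<tau> powr \<mu>\<close> by \<rho>. The
    condition s > m/2 says that \<rho> < 1, and the geometric series contributes the factor 1/(1 -
    \<rho>).\<close>
  define \<rho> where "\<rho> = (1/2::real) powr \<mu>"
  have \<rho>: "0 < \<rho>" "\<rho> < 1" using \<mu> powr_less_mono2[of \<mu> "1/2" 1] by (auto simp: \<rho>_def)
  show ?thesis
  proof (rule that[OF R(2,1) N0 _ \<mu>, of "C1 / (1 - \<rho>)" c])
    show "0 \<le> C1 / (1 - \<rho>)" using C1 \<rho> by simp
    fix x assume x: "x \<in> \<Omega>"
    obtain a where a: "norm a = R"
      and az: "\<And>\<tau> z. 0 < \<tau> \<Longrightarrow> \<tau> \<le> 1 \<Longrightarrow> (\<forall>i. \<bar>z $ i - a $ i\<bar> \<le> h) \<Longrightarrow> x + \<tau> *\<^sub>R z \<in> \<Omega>"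
      using spot[OF x] by blast
    have box: "kbox h \<tau> x a \<subseteq> \<Omega>" if "0 < \<tau>" "\<tau> \<le> 1" for \<tau>
    proof
      fix p assume "p \<in> kbox h \<tau> x a"
      then have "\<forall>i. \<bar>((1 / \<tau>) *\<^sub>R (p - x)) $ i - a $ i\<bar> \<le> h" using that by (simp add: mem_kbox)
      from az[OF that this] show "p \<in> \<Omega>" using that by simp
    qed
    have "\<bar>N0 * u x - (\<integral>p. u p * local_mean h c T x a p \<partial>M)\<bar> \<le> C1 / (1 - \<rho>) * T powr \<mu> * fs_norm H u"
      if u: "u \<in> elems H" and T: "T \<in> {0<..<1}" for u T
    proof -
      let ?g = "scale_mean h x a u"
      have nu: "0 \<le> fs_norm H u" by (rule Hs.norm_nonneg[OF u])
      define E where "E \<tau> = (\<Sum>i\<le>k. c i * ?g 0 ((1/2) ^ i * \<tau>))" for \<tau>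
      have step: "\<bar>E (\<tau> / 2) - E \<tau>\<bar> \<le> C1 * \<tau> powr \<mu> * fs_norm H u" if \<tau>: "\<tau> \<in> {0<..<1}" for \<tau>
      proof -
        have E2: "E (\<tau> / 2) = (\<Sum>i\<le>k. c i * ?g 0 ((1/2) ^ Suc i * \<tau>))"
          by (simp add: E_def mult_ac)
        have b: "\<bar>(\<Sum>i\<le>k. c i * ?g 0 ((1/2) ^ Suc i * \<tau>)) - (\<Sum>i\<le>k. c i * ?g 0 ((1/2) ^ i * \<tau>))\<bar> \<le>
          (\<Sum>i\<le>k. \<bar>c i\<bar>) * (2 * ((C0 * \<tau> powr (s - real k - real CARD('m) / 2) * fs_norm H u) * \<tau> ^ k))"
        proof (rule extrapolation_step[OF _ \<tau> c(2)])
          show "(?g j has_real_derivative ?g (Suc j) t) (at t)" if "j < k" "t \<in> {0<..<1}" for j t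
            by (rule scale_mean_deriv[OF u that(1) R(2) that(2) box])
          show "\<bar>?g k t - ?g k \<tau>\<bar> \<le> C0 * \<tau> powr (s - real k - real CARD('m) / 2) * fs_norm H u"
            if "(1/2) ^ Suc k * \<tau> \<le> t" "t \<le> \<tau>" for t
            using \<tau> by (intro C0(2)[OF u a _ _ that box]) auto
        qed
        \<comment> \<open>The power \<tau>^k of the Taylor remainder turns the possibly negative
          exponent s - k - m/2 into the positive \<mu>.\<close>
        have T: "\<tau> powr (s - real k - real CARD('m) / 2) * \<tau> ^ k = \<tau> powr \<mu>"
        proof -
          have "\<tau> ^ k = \<tau> powr real k" using \<tau> by (simp add: powr_realpow)
          then show ?thesis by (simp add: \<mu>_def powr_add[symmetric])
        qed
        have "(C0 * \<tau> powr (s - real k - real CARD('m) / 2) * fs_norm H u) * \<tau> ^ k =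
            C0 * (\<tau> powr (s - real k - real CARD('m) / 2) * \<tau> ^ k) * fs_norm H u" by simp
        also have "\<dots> = C0 * \<tau> powr \<mu> * fs_norm H u" by (simp only: T)
        finally show ?thesis using b unfolding E2 unfolding E_def C1_def by (simp only: mult.assoc)
      qed
      have tel: "\<bar>E ((1/2) ^ N * T) - E T\<bar> \<le> C1 / (1 - \<rho>) * T powr \<mu> * fs_norm H u" for N
      proof -
        have TT: "(1/2) ^ l * T \<in> {0<..<1}" for l
        proof -
          have "(1/2) ^ l * T \<le> 1 * T" using T by (intro mult_right_mono power_le_one) auto
          then have "(1/2) ^ l * T < 1" using T unfolding greaterThanLessThan_iff mult_1_left by linarith
          then show ?thesis using T by simp
        qed
        have "E ((1/2) ^ N * T) - E T = (\<Sum>l<N. E ((1/2) ^ Suc l * T) - E ((1/2) ^ l * T))"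
          by (subst sum_lessThan_telescope) simp
        also have "\<bar>\<dots>\<bar> \<le> (\<Sum>l<N. C1 * T powr \<mu> * fs_norm H u * \<rho> ^ l)"
        proof (rule order_trans[OF sum_abs sum_mono])
          fix l
          have "\<bar>E ((1/2) ^ Suc l * T) - E ((1/2) ^ l * T)\<bar> \<le> C1 * ((1/2) ^ l * T) powr \<mu> * fs_norm H u"
            using step[OF TT[of l]] by (simp add: mult_ac)
          also have "((1/2) ^ l * T) powr \<mu> = \<rho> ^ l * T powr \<mu>"
          proof -
            have "((1/2::real) ^ l) powr \<mu> = \<rho> ^ l"
              unfolding \<rho>_def by (simp add: powr_realpow[symmetric] powr_powr mult.commute)
            then show ?thesis using T by (simp add: powr_mult)
          qed
          finally show "\<bar>E ((1/2) ^ Suc l * T) - E ((1/2) ^ l * T)\<bar> \<le> C1 * T powr \<mu> * fs_norm H u * \<rho> ^ l"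
            by (simp add: mult_ac)
        qed
        also have "\<dots> = C1 * T powr \<mu> * fs_norm H u * (\<Sum>l<N. \<rho> ^ l)" by (simp add: sum_distrib_left)
        also have "\<dots> \<le> C1 * T powr \<mu> * fs_norm H u * (1 / (1 - \<rho>))"
        proof (rule mult_left_mono)
          have "(\<Sum>l<N. \<rho> ^ l) \<le> (\<Sum>l. \<rho> ^ l)" using \<rho> by (intro sum_le_suminf summable_geometric) auto
          then show "(\<Sum>l<N. \<rho> ^ l) \<le> 1 / (1 - \<rho>)" using \<rho> by (simp add: suminf_geometric)
        qed (use C1 nu in auto)
        finally show ?thesis by simp
      qed
      have lim: "(\<lambda>N. E ((1/2) ^ N * T)) \<longlonglongrightarrow> N0 * u x"
      proof -
        have "(\<lambda>N. ?g 0 ((1/2) ^ i * ((1/2) ^ N * T))) \<longlonglongrightarrow> u x * N0" for i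
          unfolding N0_def
        proof (rule scale_mean_tendsto[OF u x R(2) box])
          show "0 < (1/2) ^ i * ((1/2) ^ N * T)" for N using T by simp
          have "(1/2) ^ N * T \<le> 1" for N
            using T by (intro mult_le_one power_le_one) auto
          then show "(1/2) ^ i * ((1/2) ^ N * T) \<le> 1" for N
            using T by (intro mult_le_one power_le_one) auto
          have "(\<lambda>N. (1/2) ^ i * ((1/2) ^ N * T)) \<longlonglongrightarrow> (1/2) ^ i * (0 * T)"
            by (intro tendsto_intros LIMSEQ_realpow_zero) auto
          then show "(\<lambda>N. (1/2) ^ i * ((1/2) ^ N * T)) \<longlonglongrightarrow> 0" by simp
        qed auto
        then have "(\<lambda>N. E ((1/2) ^ N * T)) \<longlonglongrightarrow> (\<Sum>i\<le>k. c i * (u x * N0))"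
          unfolding E_def by (intro tendsto_intros)
        also have "(\<Sum>i\<le>k. c i * (u x * N0)) = N0 * u x" using c(1) by (simp add: sum_distrib_right[symmetric] mult.commute)
        finally show ?thesis .
      qed
      have "\<bar>N0 * u x - E T\<bar> \<le> C1 / (1 - \<rho>) * T powr \<mu> * fs_norm H u"
        by (rule LIMSEQ_le_const2[OF tendsto_rabs[OF tendsto_diff[OF lim tendsto_const]]]) (use tel in auto)
      moreover have "E T = (\<integral>p. u p * local_mean h c T x a p \<partial>M)"
      proof -
        have "E T = (\<Sum>i\<le>k. c i * (\<integral>p. u p * kern h (\<lambda>_. 0) ((1/2) ^ i * T) x a p \<partial>M))"
          by (simp add: E_def scale_mean_0[OF u])
        also have "\<dots> = (\<Sum>i\<le>k. (\<integral>p. c i * (u p * kern h (\<lambda>_. 0) ((1/2) ^ i * T) x a p) \<partial>M))" by simp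
        also have "\<dots> = (\<integral>p. (\<Sum>i\<le>k. c i * (u p * kern h (\<lambda>_. 0) ((1/2) ^ i * T) x a p)) \<partial>M)"
          using integrable_mult_l2[OF Hs_l2[OF u] kern_l2] by (intro Bochner_Integration.integral_sum[symmetric]) auto
        also have "\<dots> = (\<integral>p. u p * local_mean h c T x a p \<partial>M)"
          by (simp add: local_mean_def sum_distrib_left mult_ac)
        finally show ?thesis .
      qed
      ultimately show ?thesis by simp
    qed
    then show "\<exists>a. norm a = R \<and> (\<forall>u\<in>elems H. \<forall>T\<in>{0<..<1}.
       \<bar>N0 * u x - (\<integral>p. u p * local_mean h c T x a p \<partial>M)\<bar> \<le> C1 / (1 - \<rho>) * T powr \<mu> * fs_norm H u)"
      using a by blast
  qed
qed

end

section \<open>The Sobolev inequality and total boundedness in the supremum norm\<close>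

locale sobolev_embedding = sobolev_domain \<Omega> s for \<Omega> :: "(real^'m) set" and s +
  assumes order: "s > real CARD('m) / 2" and cone: "cone_property \<Omega>" and nonempty: "\<Omega> \<noteq> {}"
begin

lemma local_mean_bound:
  assumes "h > 0" "T > 0"
  obtains B where "B \<ge> 0" "\<And>x a p. \<bar>local_mean h c T x a p\<bar> \<le> B"
proof (rule that)
  let ?B = "\<Sum>i\<le>k. \<bar>c i\<bar> * (1 / ((1/2) ^ i * T)) ^ CARD('m)"
  show "0 \<le> ?B" using assms by (intro sum_nonneg mult_nonneg_nonneg) auto
  fix x a p :: "real^'m"
  have "\<bar>kern h (\<lambda>_. 0) \<tau> x a p\<bar> \<le> (1 / \<tau>) ^ CARD('m)" if "\<tau> > 0" for \<tau>
  proof -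
    have "(1 / \<tau>) ^ CARD('m) * indicator (kbox h \<tau> x a) p \<le> (1 / \<tau>) ^ CARD('m) * 1"
      using that by (intro mult_left_mono) (auto simp: indicator_def)
    then show ?thesis using kern_bound[OF that assms(1) order_refl, where n="\<lambda>_. 0" and x=x and a=a and p=p] by (simp add: mi_size_def)
  qed
  then show "\<bar>local_mean h c T x a p\<bar> \<le> ?B"
    unfolding local_mean_def using assms
    by (intro order_trans[OF sum_abs sum_mono]) (auto simp: abs_mult intro!: mult_left_mono)
qed

lemma integral_mult_le_bound:
  assumes u: "u \<in> elems H" and w: "w \<in> borel_measurable M" "\<And>p. p \<in> \<Omega> \<Longrightarrow> \<bar>w p\<bar> \<le> B" and B: "0 \<le> B"
  shows "\<bar>\<integral>p. u p * w p \<partial>M\<bar> \<le> fs_norm H u * (B * sqrt (measure M \<Omega>))"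
proof -
  have "\<Omega> \<in> sets M" using sets.top[of M] by simp
  then have "\<bar>\<integral>p. u p * w p \<partial>M\<bar> \<le> fs_norm (l2 M) u * (B * sqrt (measure M \<Omega>))"
    using w B by (intro integral_mult_le_indicator[OF finite_M Hs_l2[OF u]]) auto
  also have "\<dots> \<le> fs_norm H u * (B * sqrt (measure M \<Omega>))"
    using norm_l2_le[OF u] B by (intro mult_right_mono) auto
  finally show ?thesis .
qed

text \<open>The Sobolev embedding into bounded functions: at one fixed scale, here 1/2, the local
  mean is bounded through the L2 norm and its distance to the value of u through
  \<open>local_mean_approx\<close>.\<close>

lemma sup_bound:
  "\<exists>C\<ge>0. \<forall>u\<in>elems H. \<forall>x\<in>\<Omega>. \<bar>u x\<bar> \<le> C * fs_norm H u"
proof -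
  obtain h R N0 C \<mu> c where *: "h > 0" "R > 0" "N0 > 0" "C \<ge> 0" "\<mu> > 0"
    "\<And>x. x \<in> \<Omega> \<Longrightarrow> \<exists>a. norm a = R \<and> (\<forall>u\<in>elems H. \<forall>T\<in>{0<..<1}.
       \<bar>N0 * u x - (\<integral>p. u p * local_mean h c T x a p \<partial>M)\<bar> \<le> C * T powr \<mu> * fs_norm H u)"
    using local_mean_approx[OF order cone] by blast
  obtain B where B: "B \<ge> 0" "\<And>x a p. \<bar>local_mean h c (1/2) x a p\<bar> \<le> B"
    using local_mean_bound[OF *(1), of "1/2" c] by auto
  let ?C = "(C * (1/2) powr \<mu> + B * sqrt (measure M \<Omega>)) / N0"
  show ?thesis
  proof (intro exI[of _ ?C] conjI ballI)
    show "0 \<le> ?C" using * B by simp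
    fix u x assume u: "u \<in> elems H" and x: "x \<in> \<Omega>"
    obtain a where "\<forall>u\<in>elems H. \<forall>T\<in>{0<..<1}.
       \<bar>N0 * u x - (\<integral>p. u p * local_mean h c T x a p \<partial>M)\<bar> \<le> C * T powr \<mu> * fs_norm H u"
      using *(6)[OF x] by blast
    then have a: "\<bar>N0 * u x - (\<integral>p. u p * local_mean h c (1/2) x a p \<partial>M)\<bar> \<le> C * (1/2) powr \<mu> * fs_norm H u"
      using u by simp
    have "\<bar>\<integral>p. u p * local_mean h c (1/2) x a p \<partial>M\<bar> \<le> fs_norm H u * (B * sqrt (measure M \<Omega>))"
      using local_mean_l2 by (intro integral_mult_le_bound[OF u] B l2_measurable)
    with a have "\<bar>N0 * u x\<bar> \<le> C * (1/2) powr \<mu> * fs_norm H u + fs_norm H u * (B * sqrt (measure M \<Omega>))" by linarith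
    then have "N0 * \<bar>u x\<bar> \<le> (C * (1/2) powr \<mu> + B * sqrt (measure M \<Omega>)) * fs_norm H u"
      using *(3) by (simp add: abs_mult algebra_simps)
    then show "\<bar>u x\<bar> \<le> ?C * fs_norm H u" using *(3) by (simp add: field_simps)
  qed
qed

text \<open>A continuous function on a compact set of triples. The second base point may lie in the
  closure of \<Omega>, because a finite net is later extracted from the compact set of pairs
  \<open>(x, a)\<close>.\<close>

lemma local_mean_uniformly_continuous:
  assumes "h > 0" "T > 0" "e > 0"
  obtains d where "d > 0" "\<And>x (a::real^'m) x' (a'::real^'m) p. x \<in> \<Omega> \<Longrightarrow> x' \<in> closure \<Omega> \<Longrightarrow> norm a = R \<Longrightarrow> norm a' = R \<Longrightarrow> p \<in> \<Omega> \<Longrightarrow>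
    dist (x, a) (x', a') < d \<Longrightarrow> \<bar>local_mean h c T x a p - local_mean h c T x' a' p\<bar> < e"
proof -
  let ?S = "(closure \<Omega> \<times> sphere (0::real^'m) R) \<times> closure \<Omega>"
  let ?f = "\<lambda>z. local_mean h c T (fst (fst z)) (snd (fst z)) (snd z)"
  have cb: "continuous_on ?S (\<lambda>z. bump (((snd z $ j - fst (fst z) $ j) / \<tau> - snd (fst z) $ j) / h))" if "\<tau> > 0" for \<tau> j
    by (rule continuous_on_compose2[OF smooth1_continuous[OF smooth1_bump, of UNIV]])
      (use that assms(1) in \<open>auto intro!: continuous_intros\<close>)
  have "continuous_on ?S ?f"
    unfolding local_mean_def kern_def tens_def power_0 mult_1
    by (intro continuous_on_sum continuous_on_mult continuous_on_const continuous_on_prod cb) (use assms(2) in auto)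
  moreover have "compact ?S" using bounded_dom by (intro compact_Times) auto
  ultimately have "uniformly_continuous_on ?S ?f" by (rule compact_uniformly_continuous)
  then obtain d where d: "d > 0" "\<And>z z'. z \<in> ?S \<Longrightarrow> z' \<in> ?S \<Longrightarrow> dist z' z < d \<Longrightarrow> dist (?f z') (?f z) < e"
    using assms(3) unfolding uniformly_continuous_on_def by metis
  show ?thesis
  proof (rule that[OF d(1)])
    fix x a x' a' p :: "real^'m"
    assume *: "x \<in> \<Omega>" "x' \<in> closure \<Omega>" "norm a = R" "norm a' = R" "p \<in> \<Omega>" "dist (x, a) (x', a') < d"
    then have "((x, a), p) \<in> ?S" "((x', a'), p) \<in> ?S" using closure_subset[of \<Omega>] by auto
    moreover have "dist ((x, a), p) ((x', a'), p) < d" using *(6) by (simp add: dist_Pair_Pair)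
    ultimately show "\<bar>local_mean h c T x a p - local_mean h c T x' a' p\<bar> < e"
      using d(2)[of "((x', a'), p)" "((x, a), p)"] by (simp add: dist_real_def)
  qed
qed

text \<open>A bounded set of \<open>H\<^sup>s\<close> is totally bounded in the supremum norm: up to an error \<open>e\<close> the values of \<open>u\<close>
  are determined by finitely many integrals against fixed kernels, and these are classified by rounding.\<close>

lemma sup_classifier:
  assumes e: "e > 0"
  shows "\<exists>code :: (real^'m \<Rightarrow> real) \<Rightarrow> ((real^'m) \<times> (real^'m) \<Rightarrow> int).
    finite (code ` {u \<in> elems H. fs_norm H u \<le> C}) \<and>
    (\<forall>u\<in>elems H. \<forall>v\<in>elems H. fs_norm H u \<le> C \<longrightarrow> fs_norm H v \<le> C \<longrightarrow> code u = code v \<longrightarrow>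
       (\<forall>x\<in>\<Omega>. \<bar>u x - v x\<bar> \<le> e))"
proof -
  obtain h R N0 C0 \<mu> c where *: "h > 0" "R > 0" "N0 > 0" "C0 \<ge> 0" "\<mu> > 0"
    "\<And>x. x \<in> \<Omega> \<Longrightarrow> \<exists>a. norm a = R \<and> (\<forall>u\<in>elems H. \<forall>T\<in>{0<..<1}.
       \<bar>N0 * u x - (\<integral>p. u p * local_mean h c T x a p \<partial>M)\<bar> \<le> C0 * T powr \<mu> * fs_norm H u)"
    using local_mean_approx[OF order cone] by blast
  define C' where "C' = max C 0"
  have C': "C' \<ge> 0" "C \<le> C'" by (auto simp: C'_def)
  \<comment> \<open>For each of the two functions, e1 is spent on replacing the value by a local
    mean and e1 on moving to a net point; rounding costs another e1. The total 5 e1 is below N0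
    e.\<close>
  define e1 where "e1 = N0 * e / 6"
  have e1: "e1 > 0" using e * by (simp add: e1_def)
  obtain T where T: "T \<in> {0<..<1}" "C0 * T powr \<mu> * C' < e1"
  proof -
    have "((\<lambda>T. C0 * T powr \<mu> * C') \<longlongrightarrow> C0 * 0 * C') (at_right 0)"
      using *(5) by (intro tendsto_intros tendsto_zero_powrI[where b=\<mu>]) (auto simp: eventually_at_filter)
    then have "\<forall>\<^sub>F T in at_right 0. C0 * T powr \<mu> * C' < e1" using e1 by (auto dest: order_tendstoD(2))
    moreover have "\<forall>\<^sub>F T::real in at_right 0. T \<in> {0<..<1}"
      by (rule eventually_at_right_real) simp
    ultimately have "\<forall>\<^sub>F T in at_right 0. T \<in> {0<..<1} \<and> C0 * T powr \<mu> * C' < e1"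
      by eventually_elim auto
    then show ?thesis using that eventually_happens[of _ "at_right (0::real)"] by (auto simp: trivial_limit_at_right_real)
  qed
  define m where "m = sqrt (measure M \<Omega>)"
  have m: "m \<ge> 0" by (simp add: m_def)
  \<comment> \<open>The summand 1 keeps the quotient meaningful when the norm bound or the measure
    term vanishes.\<close>
  define e2 where "e2 = e1 / (C' * m + 1)"
  have e2: "e2 > 0" "C' * (e2 * m) \<le> e1"
  proof -
    have "0 < C' * m + 1" using C' m by (meson add_nonneg_pos mult_nonneg_nonneg zero_less_one)
    then show "e2 > 0" "C' * (e2 * m) \<le> e1" using e1 by (auto simp: e2_def field_simps)
  qed
  obtain d where d: "d > 0" "\<And>x (a::real^'m) x' (a'::real^'m) p. x \<in> \<Omega> \<Longrightarrow> x' \<in> closure \<Omega> \<Longrightarrow> norm a = R \<Longrightarrow> norm a' = R \<Longrightarrow> p \<in> \<Omega> \<Longrightarrow>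
    dist (x, a) (x', a') < d \<Longrightarrow> \<bar>local_mean h c T x a p - local_mean h c T x' a' p\<bar> < e2"
    using local_mean_uniformly_continuous[OF *(1) _ e2(1), of T R c] T by auto
  have "compact (closure \<Omega> \<times> sphere (0::real^'m) R)" using bounded_dom by (intro compact_Times) auto
  then obtain I where I: "I \<subseteq> closure \<Omega> \<times> sphere (0::real^'m) R" "finite I" "closure \<Omega> \<times> sphere 0 R \<subseteq> (\<Union>z\<in>I. ball z d)"
  proof (rule compactE_image[of _ "closure \<Omega> \<times> sphere (0::real^'m) R" "\<lambda>z. ball z d"])
    show "closure \<Omega> \<times> sphere (0::real^'m) R \<subseteq> (\<Union>z\<in>closure \<Omega> \<times> sphere 0 R. ball z d)"
      using d(1) by auto
  qed auto
  obtain B where B: "B \<ge> 0" "\<And>x a p. \<bar>local_mean h c T x a p\<bar> \<le> B"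
    using local_mean_bound[OF *(1), of T c] T by auto
  define \<phi> where "\<phi> z u = (\<integral>p. u p * local_mean h c T (fst z) (snd z) p \<partial>M)" for z u
  \<comment> \<open>Integrals with equal floor differ by at most e1; the restriction to the finite
    net makes the set of codes of bounded functions finite.\<close>
  define code where "code u = restrict (\<lambda>z. \<lfloor>\<phi> z u / e1\<rfloor>) I" for u
  define K where "K = C' * (B * m) / e1"
  have \<phi>B: "\<bar>\<phi> z u / e1\<bar> \<le> K" if "u \<in> elems H" "fs_norm H u \<le> C" for z u
  proof -
    have "\<bar>\<phi> z u\<bar> \<le> fs_norm H u * (B * m)"
      unfolding \<phi>_def m_def using local_mean_l2 by (intro integral_mult_le_bound[OF that(1)] B l2_measurable)
    also have "\<dots> \<le> C' * (B * m)" using that C' B m by (intro mult_right_mono) auto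
    finally show ?thesis using e1 by (simp add: K_def abs_divide divide_right_mono)
  qed
  show ?thesis
  proof (intro exI[of _ code] conjI)
    have "code ` {u \<in> elems H. fs_norm H u \<le> C} \<subseteq> PiE I (\<lambda>_. {\<lfloor>-K\<rfloor>..\<lfloor>K\<rfloor>})"
    proof (intro image_subsetI)
      fix u assume "u \<in> {u \<in> elems H. fs_norm H u \<le> C}"
      then have u: "u \<in> elems H" "fs_norm H u \<le> C" by auto
      have "- K \<le> \<phi> z u / e1" "\<phi> z u / e1 \<le> K" for z using \<phi>B[OF u, of z] by linarith+
      then show "code u \<in> PiE I (\<lambda>_. {\<lfloor>-K\<rfloor>..\<lfloor>K\<rfloor>})"
        by (auto simp: code_def intro!: floor_mono)
    qed
    then show "finite (code ` {u \<in> elems H. fs_norm H u \<le> C})"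
      by (rule finite_subset) (intro finite_PiE I(2), simp)
  next
    show "\<forall>u\<in>elems H. \<forall>v\<in>elems H. fs_norm H u \<le> C \<longrightarrow> fs_norm H v \<le> C \<longrightarrow> code u = code v \<longrightarrow>
       (\<forall>x\<in>\<Omega>. \<bar>u x - v x\<bar> \<le> e)"
    proof (intro ballI impI)
    fix u v x
    assume u: "u \<in> elems H" "fs_norm H u \<le> C" and v: "v \<in> elems H" "fs_norm H v \<le> C"
      and eq: "code u = code v" and x: "x \<in> \<Omega>"
    obtain a where a: "norm a = R" "\<And>u T. u \<in> elems H \<Longrightarrow> T \<in> {0<..<1} \<Longrightarrow>
       \<bar>N0 * u x - (\<integral>p. u p * local_mean h c T x a p \<partial>M)\<bar> \<le> C0 * T powr \<mu> * fs_norm H u"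
      using *(6)[OF x] by blast
    have "(x, a) \<in> closure \<Omega> \<times> sphere 0 R" using x a(1) closure_subset[of \<Omega>] by auto
    then have "(x, a) \<in> (\<Union>z\<in>I. ball z d)" using I(3) by blast
    then obtain z where z: "z \<in> I" "dist (x, a) z < d" unfolding UN_iff mem_ball by (metis dist_commute)
    obtain x' a' where z': "z = (x', a')" by (cases z)
    have xa: "x' \<in> closure \<Omega>" "norm a' = R" using z(1) z' I(1) by auto
    have one: "\<bar>N0 * w x - \<phi> z w\<bar> \<le> 2 * e1" if w: "w \<in> elems H" "fs_norm H w \<le> C" for w
    proof -
      have nw: "0 \<le> fs_norm H w" "fs_norm H w \<le> C'" using Hs.norm_nonneg[OF w(1)] w C' by auto
      have "C0 * T powr \<mu> * fs_norm H w \<le> C0 * T powr \<mu> * C'" using nw * by (intro mult_left_mono) auto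
      then have 1: "\<bar>N0 * w x - (\<integral>p. w p * local_mean h c T x a p \<partial>M)\<bar> \<le> e1"
        using a(2)[OF w(1) T(1)] T(2) by linarith
      have "(\<integral>p. w p * local_mean h c T x a p \<partial>M) - \<phi> z w =
          (\<integral>p. w p * local_mean h c T x a p - w p * local_mean h c T x' a' p \<partial>M)"
        unfolding \<phi>_def z' fst_conv snd_conv
        by (intro Bochner_Integration.integral_diff[symmetric] integrable_mult_l2 Hs_l2[OF w(1)] local_mean_l2)
      also have "\<dots> = (\<integral>p. w p * (local_mean h c T x a p - local_mean h c T x' a' p) \<partial>M)"
        by (simp only: right_diff_distrib)
      also have "\<bar>\<dots>\<bar> \<le> fs_norm H w * (e2 * sqrt (measure M \<Omega>))"
      proof (rule integral_mult_le_bound[OF w(1)])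
        show "(\<lambda>p. local_mean h c T x a p - local_mean h c T x' a' p) \<in> borel_measurable M"
          by (intro borel_measurable_diff l2_measurable local_mean_l2)
        show "\<bar>local_mean h c T x a p - local_mean h c T x' a' p\<bar> \<le> e2" if "p \<in> \<Omega>" for p
          using d(2)[OF x xa(1) a(1) xa(2) that] z(2) z' by simp
      qed (use e2 in simp)
      also have "\<dots> \<le> C' * (e2 * m)" unfolding m_def[symmetric] using nw e2 m by (intro mult_right_mono) auto
      finally show ?thesis using 1 e2(2) by linarith
    qed
    have "\<lfloor>\<phi> z u / e1\<rfloor> = \<lfloor>\<phi> z v / e1\<rfloor>" using fun_cong[OF eq, of z] z(1) by (simp add: code_def)
    then have "\<bar>\<phi> z u / e1 - \<phi> z v / e1\<bar> \<le> 1" by linarith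
    then have "\<bar>\<phi> z u - \<phi> z v\<bar> \<le> e1" using e1 by (simp add: diff_divide_distrib[symmetric] abs_divide)
    then have "\<bar>N0 * u x - N0 * v x\<bar> \<le> 5 * e1" using one[OF u] one[OF v] by linarith
    then have "N0 * \<bar>u x - v x\<bar> \<le> N0 * e"
      using *(3) e by (simp add: e1_def right_diff_distrib[symmetric] abs_mult)
    then show "\<bar>u x - v x\<bar> \<le> e" using *(3) by simp
    qed
  qed
qed

text \<open>One sensor is enough for each pair of codes: a point where the two representatives
  differ by more than 3 e, if there is one. Functions with readings within e cannot have
  representatives differing by more than 3 e there, and passing to the representatives costs e
  twice.\<close>

lemma finite_sensors:
  assumes D: "D \<subseteq> elems H" "\<And>u. u \<in> D \<Longrightarrow> fs_norm H u \<le> C" and e: "e > 0"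
  obtains P where "finite P" "P \<subseteq> \<Omega>" "P \<noteq> {}"
    "\<And>u v x. u \<in> D \<Longrightarrow> v \<in> D \<Longrightarrow> (\<And>p. p \<in> P \<Longrightarrow> \<bar>u p - v p\<bar> \<le> e) \<Longrightarrow> x \<in> \<Omega> \<Longrightarrow> \<bar>u x - v x\<bar> \<le> 5 * e"
proof -
  obtain code :: "(real^'m \<Rightarrow> real) \<Rightarrow> ((real^'m) \<times> (real^'m) \<Rightarrow> int)" where code: "finite (code ` {u \<in> elems H. fs_norm H u \<le> C})"
    "\<forall>u\<in>elems H. \<forall>v\<in>elems H. fs_norm H u \<le> C \<longrightarrow> fs_norm H v \<le> C \<longrightarrow> code u = code v \<longrightarrow>
       (\<forall>x\<in>\<Omega>. \<bar>u x - v x\<bar> \<le> e)" using sup_classifier[OF e] by blast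
  have fin: "finite (code ` D)" using D by (intro finite_subset[OF _ code(1)]) auto
  define rep where "rep = inv_into D code"
  have rep: "rep c \<in> D \<and> code (rep c) = c" if "c \<in> code ` D" for c
    using that by (simp add: rep_def inv_into_into f_inv_into_f)
  obtain x0 where x0: "x0 \<in> \<Omega>" using nonempty by auto
  \<comment> \<open>The default \<open>x0\<close> stands for pairs without a separating point and
    keeps every sensor in \<Omega>.\<close>
  define pt where "pt c c' = (if \<exists>x\<in>\<Omega>. \<bar>rep c x - rep c' x\<bar> > 3 * e then SOME x. x \<in> \<Omega> \<and> \<bar>rep c x - rep c' x\<bar> > 3 * e else x0)"
    for c c'
  have pt: "pt c c' \<in> \<Omega> \<and> ((\<exists>x\<in>\<Omega>. \<bar>rep c x - rep c' x\<bar> > 3 * e) \<longrightarrow> \<bar>rep c (pt c c') - rep c' (pt c c')\<bar> > 3 * e)" for c c'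
  proof (cases "\<exists>x\<in>\<Omega>. \<bar>rep c x - rep c' x\<bar> > 3 * e")
    case True
    then have "\<exists>x. x \<in> \<Omega> \<and> \<bar>rep c x - rep c' x\<bar> > 3 * e" by blast
    from someI_ex[OF this] True show ?thesis by (simp add: pt_def)
  qed (use x0 in \<open>auto simp: pt_def\<close>)
  define P where "P = insert x0 ((\<lambda>(c, c'). pt c c') ` (code ` D \<times> code ` D))"
  show ?thesis
  proof (rule that[of P])
    show "finite P" using fin by (simp add: P_def)
    show "P \<subseteq> \<Omega>" using x0 pt by (auto simp: P_def)
    show "P \<noteq> {}" by (simp add: P_def)
    fix u v x
    assume uv: "u \<in> D" "v \<in> D" and P: "\<And>p. p \<in> P \<Longrightarrow> \<bar>u p - v p\<bar> \<le> e" and x: "x \<in> \<Omega>"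
    define u' v' where "u' = rep (code u)" and "v' = rep (code v)"
    have r: "u' \<in> D" "v' \<in> D" "code u' = code u" "code v' = code v" using rep uv by (auto simp: u'_def v'_def)
    have near: "\<bar>u y - u' y\<bar> \<le> e" "\<bar>v y - v' y\<bar> \<le> e" if "y \<in> \<Omega>" for y
      
      using code(2)[rule_format, of u u' y] code(2)[rule_format, of v v' y] r uv D that by (simp_all add: subset_iff)
    have "\<not> (\<exists>x\<in>\<Omega>. \<bar>u' x - v' x\<bar> > 3 * e)"
    proof
      assume "\<exists>x\<in>\<Omega>. \<bar>u' x - v' x\<bar> > 3 * e"
      then have p: "pt (code u) (code v) \<in> \<Omega>" "\<bar>u' (pt (code u) (code v)) - v' (pt (code u) (code v))\<bar> > 3 * e"
        using pt[of "code u" "code v"] by (auto simp: u'_def v'_def)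
      moreover have "pt (code u) (code v) \<in> P" using uv by (auto simp: P_def)
      ultimately show False using near[OF p(1)] P[of "pt (code u) (code v)"] by linarith
    qed
    then have "\<bar>u' x - v' x\<bar> \<le> 3 * e" using x by force
    then show "\<bar>u x - v x\<bar> \<le> 5 * e" using near[OF x] by linarith
  qed
qed

text \<open>For every tolerance 1/(n + 1) some code is attained infinitely often, which gives a
  subsequence with pairwise sup-distance at most that tolerance; a diagonal sequence serves all
  tolerances.\<close>

lemma sup_Cauchy_subseq:
  fixes X :: "nat \<Rightarrow> real^'m \<Rightarrow> real"
  assumes X: "\<And>n. X n \<in> elems H" "\<And>n. fs_norm H (X n) \<le> C"
  shows "\<exists>r :: nat \<Rightarrow> nat. strict_mono r \<and> (\<forall>e>0. \<exists>N. \<forall>i\<ge>N. \<forall>j\<ge>N. \<forall>x\<in>\<Omega>. \<bar>X (r i) x - X (r j) x\<bar> \<le> e)"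
proof -
  define P where "P n s \<longleftrightarrow> (\<forall>i j. \<forall>x\<in>\<Omega>. \<bar>X (s i) x - X (s j) x\<bar> \<le> 1 / real (Suc n))" for n and s :: "nat \<Rightarrow> nat"
  interpret subseqs P
  proof
    fix n and s :: "nat \<Rightarrow> nat" assume s: "strict_mono s"
    obtain code :: "(real^'m \<Rightarrow> real) \<Rightarrow> ((real^'m) \<times> (real^'m) \<Rightarrow> int)" where code: "finite (code ` {u \<in> elems H. fs_norm H u \<le> C})"
      "\<forall>u\<in>elems H. \<forall>v\<in>elems H. fs_norm H u \<le> C \<longrightarrow> fs_norm H v \<le> C \<longrightarrow> code u = code v \<longrightarrow>
         (\<forall>x\<in>\<Omega>. \<bar>u x - v x\<bar> \<le> 1 / real (Suc n))"
    proof -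
      have "0 < 1 / real (Suc n)" by simp
      from sup_classifier[OF this, of C] that show ?thesis by blast
    qed
    have "finite (range (\<lambda>i. code (X (s i))))"
      by (rule finite_subset[OF _ code(1)]) (use X in auto)
    then obtain i0 where "infinite {i. code (X (s i)) = code (X (s i0))}"
      using pigeonhole_infinite[of UNIV "\<lambda>i. code (X (s i))"] by auto
    then obtain r :: "nat \<Rightarrow> nat" where r: "strict_mono r" "\<And>i. r i \<in> {i. code (X (s i)) = code (X (s i0))}"
      using infinite_enumerate by blast
    have "P n (s \<circ> r)" unfolding P_def
    proof (intro allI ballI)
      fix i j x assume "x \<in> \<Omega>"
      moreover have "code (X ((s \<circ> r) i)) = code (X ((s \<circ> r) j))" using r(2)[of i] r(2)[of j] by simp
      ultimately show "\<bar>X ((s \<circ> r) i) x - X ((s \<circ> r) j) x\<bar> \<le> 1 / real (Suc n)"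
        using code(2)[rule_format, OF X(1) X(1) X(2) X(2)] by blast
    qed
    then show "\<exists>r'. strict_mono r' \<and> P n (s \<circ> r')" using r(1) by blast
  qed
  show ?thesis
  proof (intro exI[of _ diagseq] conjI subseq_diagseq allI impI)
    fix e :: real assume "e > 0"
    then obtain n where n: "1 / real (Suc n) < e" using nat_approx_posE by blast
    \<comment> \<open>\<open>P\<close> concerns all pairs of indices and is therefore inherited by
      subsequences, as the diagonal argument requires.\<close>
    have "P n (diagseq \<circ> ((+) (Suc n)))"
      by (rule diagseq_holds) (auto simp: P_def)
    then have "\<bar>X (diagseq (Suc n + i)) x - X (diagseq (Suc n + j)) x\<bar> \<le> e" if "x \<in> \<Omega>" for i j x
      using that unfolding P_def o_def by (intro order_trans[OF _ less_imp_le[OF n]]) blast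
    then have "\<bar>X (diagseq i) x - X (diagseq j) x\<bar> \<le> e" if "x \<in> \<Omega>" "Suc n \<le> i" "Suc n \<le> j" for i j x
      using that by (metis le_add_diff_inverse)
    then show "\<exists>N. \<forall>i\<ge>N. \<forall>j\<ge>N. \<forall>x\<in>\<Omega>. \<bar>X (diagseq i) x - X (diagseq j) x\<bar> \<le> e" by blast
  qed
qed

end

section \<open>Midpoint hulls of sequence tails\<close>

text \<open>Midpoints, that is dyadic convex combinations, are all that the parallelogram law uses,
  and a convex condition is inherited by the hull through a one-case induction.\<close>

inductive_set midpoint_hull :: "('a \<Rightarrow> real) set \<Rightarrow> ('a \<Rightarrow> real) set" for S where
  base: "w \<in> S \<Longrightarrow> w \<in> midpoint_hull S"
| mid: "f \<in> midpoint_hull S \<Longrightarrow> g \<in> midpoint_hull S \<Longrightarrow> (\<lambda>t. 1/2 * f t + 1/2 * g t) \<in> midpoint_hull S"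

lemma midpoint_hull_mono: "f \<in> midpoint_hull S \<Longrightarrow> S \<subseteq> T \<Longrightarrow> f \<in> midpoint_hull T"
proof (induction rule: midpoint_hull.induct)
  case (mid f g)
  then show ?case by (intro midpoint_hull.mid)
qed (auto intro: midpoint_hull.base)

context pre_hilbert
begin

lemma midpoint_hull_mem:
  assumes "f \<in> midpoint_hull S" "S \<subseteq> elems H" shows "f \<in> elems H"
  using assms
proof induction
  case (mid f g)
  show ?case by (rule lincomb) (use mid in auto)
qed auto

lemma parallelogram:
  assumes "f \<in> elems H" "g \<in> elems H"
  shows "(fs_norm H (f - g))\<^sup>2 = 2 * (fs_norm H f)\<^sup>2 + 2 * (fs_norm H g)\<^sup>2 - 4 * (fs_norm H (\<lambda>t. 1/2 * f t + 1/2 * g t))\<^sup>2"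
proof -
  have "(\<lambda>t. 1/2 * f t + 1/2 * g t) = (\<lambda>t. 1/2 * (f t + g t))" by (auto simp: algebra_simps)
  then have e: "fs_norm H (\<lambda>t. 1/2 * f t + 1/2 * g t) = 1/2 * fs_norm H (\<lambda>t. f t + g t)"
    using norm_scale[OF add_mem[OF assms], of "1/2"] by simp
  then show ?thesis
    using norm_diff_sq[OF assms] norm_add_sq[OF assms] unfolding e by (simp add: power_mult_distrib power_divide add_divide_distrib)
qed

text \<open>Near-minimal elements of the shrinking hulls of the tails form a Cauchy sequence, by the parallelogram
  law.  This replaces weak compactness together with Mazur's lemma.\<close>

lemma tail_hull_Cauchy:
  fixes w :: "nat \<Rightarrow> 'a \<Rightarrow> real"
  assumes w: "\<And>n. w n \<in> elems H" "\<And>n. fs_norm H (w n) \<le> C"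
  shows "\<exists>c. (\<forall>N. c N \<in> midpoint_hull (w ` {N..})) \<and>
    (\<forall>e>0. \<exists>N. \<forall>i\<ge>N. \<forall>j\<ge>N. fs_norm H (c i - c j) < e)"
proof -
  let ?T = "\<lambda>N. midpoint_hull (w ` {N..})"
  have Tm: "f \<in> elems H" if "f \<in> ?T N" for f N
    using midpoint_hull_mem[OF that] w by auto
  define d where "d N = Inf (fs_norm H ` ?T N)" for N
  have ne: "fs_norm H ` ?T N \<noteq> {}" for N using midpoint_hull.base[of "w N" "w ` {N..}"] by auto
  have bb: "bdd_below (fs_norm H ` ?T N)" for N
    by (rule bdd_belowI2[of _ 0]) (use Tm norm_nonneg in blast)
  have dle: "d N \<le> fs_norm H f" if "f \<in> ?T N" for N f
    unfolding d_def by (intro cInf_lower bb imageI that)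
  have d0: "0 \<le> d N" for N unfolding d_def by (rule cInf_greatest[OF ne]) (use Tm norm_nonneg in blast)
  \<comment> \<open>The hulls shrink with N, so the infimum of the norms increases; it is bounded by
    \<open>C\<close> and hence convergent.\<close>
  have dmono: "mono d"
  proof (rule monoI)
    fix i j :: nat assume "i \<le> j"
    then have "?T j \<subseteq> ?T i" by (auto intro: midpoint_hull_mono)
    then show "d i \<le> d j" unfolding d_def by (intro cInf_superset_mono ne bb image_mono)
  qed
  have dC: "d N \<le> C" for N using dle[OF midpoint_hull.base[of "w N" "w ` {N..}"]] w(2)[of N] by simp
  have "\<exists>f\<in>?T N. fs_norm H f < d N + 1 / real (Suc N)" for N
    using cInf_lessD[OF ne, of N "d N + 1 / real (Suc N)"] by (auto simp: d_def)
  then obtain c where c: "\<And>N. c N \<in> ?T N" "\<And>N. fs_norm H (c N) < d N + 1 / real (Suc N)" by metis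
  have "convergent d"
    using dmono dC d0 by (intro Bseq_mono_convergent BseqI'[of _ C]) (auto simp: mono_def)
  then obtain L where L: "d \<longlonglongrightarrow> L" by (auto simp: convergent_def)
  have "(\<lambda>N. (d N + 1 / real (Suc N))\<^sup>2) \<longlonglongrightarrow> (L + 0)\<^sup>2"
    by (intro tendsto_intros L LIMSEQ_Suc[OF lim_inverse_n']) 
  then have A: "(\<lambda>N. (d N + 1 / real (Suc N))\<^sup>2) \<longlonglongrightarrow> L\<^sup>2" by simp
  have B: "(\<lambda>N. (d N)\<^sup>2) \<longlonglongrightarrow> L\<^sup>2" by (intro tendsto_intros L)
  have "\<exists>N. \<forall>i\<ge>N. \<forall>j\<ge>N. fs_norm H (c i - c j) < e" if e: "e > 0" for e
  proof -
    \<comment> \<open>All squared quantities are within \<epsilon> of L^2, so the parallelogram law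
      gives 2 (L^2 + \<epsilon>) + 2 (L^2 + \<epsilon>) - 4 (L^2 - \<epsilon>) = 8 \<epsilon>, which
      is e^2/2.\<close>
    define \<epsilon> where "\<epsilon> = e\<^sup>2 / 16"
    have \<epsilon>: "\<epsilon> > 0" using e by (simp add: \<epsilon>_def)
    obtain N1 where N1: "\<And>n. n \<ge> N1 \<Longrightarrow> \<bar>(d n + 1 / real (Suc n))\<^sup>2 - L\<^sup>2\<bar> < \<epsilon>"
      using LIMSEQ_D[OF A \<epsilon>] by (metis real_norm_def)
    obtain N2 where N2: "\<And>n. n \<ge> N2 \<Longrightarrow> \<bar>(d n)\<^sup>2 - L\<^sup>2\<bar> < \<epsilon>"
      using LIMSEQ_D[OF B \<epsilon>] by (metis real_norm_def)
    have main: "fs_norm H (c i - c j) < e" if ij: "max N1 N2 \<le> i" "i \<le> j" for i j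
    proof -
      let ?m = "\<lambda>t. 1/2 * c i t + 1/2 * c j t"
      have "c j \<in> ?T i" by (rule midpoint_hull_mono[OF c(1)[of j]]) (use ij in auto)
      then have m: "?m \<in> ?T i" by (intro midpoint_hull.mid c)
      have "(d i)\<^sup>2 \<le> (fs_norm H ?m)\<^sup>2" using dle[OF m] d0 by (intro power_mono)
      moreover have "(fs_norm H (c n))\<^sup>2 \<le> (d n + 1 / real (Suc n))\<^sup>2" for n
        using c(2)[of n] norm_nonneg[OF Tm[OF c(1)[of n]]] by (intro power_mono) auto
      note this[of i] this[of j]
      moreover have "\<bar>(d i + 1 / real (Suc i))\<^sup>2 - L\<^sup>2\<bar> < \<epsilon>" "\<bar>(d j + 1 / real (Suc j))\<^sup>2 - L\<^sup>2\<bar> < \<epsilon>" "\<bar>(d i)\<^sup>2 - L\<^sup>2\<bar> < \<epsilon>"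
        using N1[of i] N1[of j] N2[of i] ij by auto
      ultimately have "(fs_norm H (c i - c j))\<^sup>2 < 8 * \<epsilon>"
        using parallelogram[OF Tm[OF c(1)[of i]] Tm[OF c(1)[of j]]] by linarith
      also have "\<dots> \<le> e\<^sup>2" using \<epsilon> by (simp add: \<epsilon>_def)
      finally show ?thesis using e by (simp add: power_less_imp_less_base)
    qed
    have "fs_norm H (c i - c j) < e" if "max N1 N2 \<le> i" "max N1 N2 \<le> j" for i j
    proof (cases "i \<le> j")
      case False
      then show ?thesis using main[of j i] that norm_minus_commute[OF Tm[OF c(1)[of i]] Tm[OF c(1)[of j]]] by simp
    qed (use main that in auto)
    then show ?thesis by blast
  qed
  then show ?thesis using c(1) by blast
qed

end

text \<open>Both sides of the defining identity are L2 inner products with fixed functions and so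
  pass to norm limits.\<close>

lemma is_weak_deriv_limit:
  fixes u :: "nat \<Rightarrow> real^'m \<Rightarrow> real"
  assumes dom: "open \<Omega>" "bounded \<Omega>"
    and u: "\<And>n. u n \<in> elems (l2 (lebesgue_on \<Omega>))" "U \<in> elems (l2 (lebesgue_on \<Omega>))" "(\<lambda>n. fs_norm (l2 (lebesgue_on \<Omega>)) (u n - U)) \<longlonglongrightarrow> 0"
    and v: "\<And>n. v n \<in> elems (l2 (lebesgue_on \<Omega>))" "V \<in> elems (l2 (lebesgue_on \<Omega>))" "(\<lambda>n. fs_norm (l2 (lebesgue_on \<Omega>)) (v n - V)) \<longlonglongrightarrow> 0"
    and w: "\<And>n. is_weak_deriv \<Omega> \<alpha> (u n) (v n)"
  shows "is_weak_deriv \<Omega> \<alpha> U V"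
  unfolding is_weak_deriv_def
proof (intro ballI allI impI)
  let ?M = "lebesgue_on \<Omega>"
  interpret L: pre_hilbert "l2 ?M" by (rule pre_hilbert_l2)
  have lim: "(\<lambda>n. \<integral>t. f n t * g t \<partial>?M) \<longlonglongrightarrow> (\<integral>t. F t * g t \<partial>?M)"
    if f: "\<And>n. f n \<in> elems (l2 ?M)" "F \<in> elems (l2 ?M)" "(\<lambda>n. fs_norm (l2 ?M) (f n - F)) \<longlonglongrightarrow> 0" and g: "g \<in> elems (l2 ?M)"
    for f :: "nat \<Rightarrow> real^'m \<Rightarrow> real" and F g
  proof (rule LIM_zero_cancel, rule Lim_null_comparison)
    show "\<forall>\<^sub>F n in sequentially. norm ((\<integral>t. f n t * g t \<partial>?M) - (\<integral>t. F t * g t \<partial>?M)) \<le> fs_norm (l2 ?M) (f n - F) * fs_norm (l2 ?M) g"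
    proof (rule always_eventually, rule allI)
      fix n
      show "norm ((\<integral>t. f n t * g t \<partial>?M) - (\<integral>t. F t * g t \<partial>?M)) \<le> fs_norm (l2 ?M) (f n - F) * fs_norm (l2 ?M) g"
        using L.Cauchy_Schwarz[OF L.diff_mem[OF f(1)[of n] f(2)] g] L.inner_diff_left[OF f(1)[of n] f(2) g]
        by (simp only: inner_l2 real_norm_def)
    qed
    show "(\<lambda>n. fs_norm (l2 ?M) (f n - F) * fs_norm (l2 ?M) g) \<longlonglongrightarrow> 0"
      using tendsto_mult_right[OF f(3), of "fs_norm (l2 ?M) g"] by simp
  qed
  fix \<phi> "is" assume \<phi>: "\<phi> \<in> test_functions \<Omega>" and "is": "\<forall>i. count_list is i = \<alpha> i"
  have 1: "\<phi> \<in> elems (l2 ?M)" "pderivs is \<phi> \<in> elems (l2 ?M)"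
    using test_function_l2 test_function_pderivs \<phi> dom by blast+
  have eq: "(\<integral>t. u n t * pderivs is \<phi> t \<partial>?M) = (-1) ^ mi_size \<alpha> * (\<integral>t. v n t * \<phi> t \<partial>?M)" for n
    using w[of n, unfolded is_weak_deriv_def, rule_format, OF \<phi> "is"[rule_format]] .
  have "(\<lambda>n. \<integral>t. u n t * pderivs is \<phi> t \<partial>?M) \<longlonglongrightarrow> (-1) ^ mi_size \<alpha> * (\<integral>t. V t * \<phi> t \<partial>?M)"
    unfolding eq by (intro tendsto_intros lim v 1)
  with lim[OF u 1(2)] show "(\<integral>t. U t * pderivs is \<phi> t \<partial>?M) = (-1) ^ mi_size \<alpha> * (\<integral>t. V t * \<phi> t \<partial>?M)"
    by (rule LIMSEQ_unique)
qed

context sobolev_domain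
begin

lemma wd_diff_norm:
  assumes "u \<in> elems H" "v \<in> elems H" "mi_size \<alpha> \<le> k"
  shows "fs_norm (l2 M) (wd \<alpha> (u - v)) = fs_norm (l2 M) (wd \<alpha> u - wd \<alpha> v)"
proof -
  have e: "u - v = (\<lambda>t. 1 * u t + (-1) * v t)" by auto
  have "AE t in M. wd \<alpha> (u - v) t = (wd \<alpha> u - wd \<alpha> v) t"
    using wd_lin(1)[OF assms, of 1 "-1"] unfolding e by eventually_elim simp
  then show ?thesis
    using assms pre_hilbert.diff_mem[OF pre_hilbert_l2 wd_mem wd_mem, of u \<alpha> v \<alpha>] 
    by (intro norm_l2_cong_AE) (auto intro!: l2_measurable wd_mem Hs.diff_mem)
qed

lemma slob_diff_norm:
  assumes "u \<in> elems H" "v \<in> elems H" "mi_size \<alpha> = k" "\<theta> > 0"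
  shows "fs_norm (l2 LL) (q (wd \<alpha> (u - v))) = fs_norm (l2 LL) (q (wd \<alpha> u) - q (wd \<alpha> v))"
proof -
  have e: "u - v = (\<lambda>t. 1 * u t + (-1) * v t)" by auto
  have "AE p in LL. q (wd \<alpha> (u - v)) p = (q (wd \<alpha> u) - q (wd \<alpha> v)) p"
    using slob_lin[OF assms(1-3), of 1 "-1"] unfolding e by eventually_elim simp
  then show ?thesis
    using assms pre_hilbert.diff_mem[OF pre_hilbert_l2 slob_mem slob_mem, of u \<alpha> v \<alpha>]
    by (intro norm_l2_cong_AE) (auto intro!: l2_measurable slob_mem Hs.diff_mem)
qed

end

section \<open>Completeness of H^s\<close>

context sobolev_embedding
begin

text \<open>\<open>sup_bound\<close> makes the sequence converge uniformly to a continuous U, and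
  the L2 limits of the derivatives are weak derivatives of U. The difference quotients also converge
  in L2 on the product; that their limit is the quotient of the derivative of U is seen by pointwise
  convergence along a common subsequence.\<close>

lemma Hs_complete:
  fixes u :: "nat \<Rightarrow> real^'m \<Rightarrow> real"
  assumes u: "\<And>n. u n \<in> elems H"
    and C: "\<forall>e>0. \<exists>N. \<forall>i\<ge>N. \<forall>j\<ge>N. fs_norm H (u i - u j) < e"
  shows "\<exists>U\<in>elems H. (\<lambda>n. fs_norm H (u n - U)) \<longlonglongrightarrow> 0"
proof -
  interpret L: pre_hilbert "l2 M" by (rule pre_hilbert_l2)
  interpret Q: pre_hilbert "l2 LL" by (rule pre_hilbert_l2)
  obtain S where S: "S \<ge> 0" "\<forall>u\<in>elems H. \<forall>x\<in>\<Omega>. \<bar>u x\<bar> \<le> S * fs_norm H u" using sup_bound by blast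
  have supC: "\<exists>N. \<forall>i\<ge>N. \<forall>j\<ge>N. \<forall>x\<in>\<Omega>. \<bar>u i x - u j x\<bar> \<le> e" if e: "e > 0" for e
  proof -
    have "e / (S + 1) > 0" using e S by simp
    then obtain N where N: "\<forall>i\<ge>N. \<forall>j\<ge>N. fs_norm H (u i - u j) < e / (S + 1)" using C by blast
    have "\<bar>u i x - u j x\<bar> \<le> e" if "i \<ge> N" "j \<ge> N" "x \<in> \<Omega>" for i j x
    proof -
      have d: "u i - u j \<in> elems H" using u by (intro Hs.diff_mem)
      have "\<bar>u i x - u j x\<bar> \<le> S * fs_norm H (u i - u j)" using S(2)[rule_format, OF d that(3)] by simp
      also have "\<dots> \<le> (S + 1) * fs_norm H (u i - u j)" using Hs.norm_nonneg[OF d] by (intro mult_right_mono) auto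
      also have "\<dots> \<le> e" using N that S by (auto simp: field_simps dest!: less_imp_le)
      finally show ?thesis .
    qed
    then show ?thesis by blast
  qed
  define U where "U x = lim (\<lambda>n. u n x)" for x
  have out: "U x = 0" if "x \<notin> \<Omega>" for x
  proof -
    have "u n x = 0" for n using u[of n] that by (simp add: mem_Hs)
    then show ?thesis by (simp add: U_def)
  qed
  have pt: "(\<lambda>n. u n x) \<longlonglongrightarrow> U x" if "x \<in> \<Omega>" for x
  proof -
    have "Cauchy (\<lambda>n. u n x)"
    proof (rule metric_CauchyI)
      fix e :: real assume "e > 0"
      then obtain N where "\<forall>i\<ge>N. \<forall>j\<ge>N. \<forall>x\<in>\<Omega>. \<bar>u i x - u j x\<bar> \<le> e / 2" using supC[of "e/2"] by auto
      then show "\<exists>N. \<forall>m\<ge>N. \<forall>n\<ge>N. dist (u m x) (u n x) < e"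
        using that \<open>e > 0\<close> by (intro exI[of _ N]) (fastforce simp: dist_real_def)
    qed
    then show ?thesis by (simp add: U_def Cauchy_convergent_iff convergent_LIMSEQ_iff)
  qed
  have unif: "\<exists>N. \<forall>n\<ge>N. \<forall>x\<in>\<Omega>. \<bar>u n x - U x\<bar> \<le> e" if "e > 0" for e
  proof -
    obtain N where N: "\<forall>i\<ge>N. \<forall>j\<ge>N. \<forall>x\<in>\<Omega>. \<bar>u i x - u j x\<bar> \<le> e" using supC[OF \<open>e > 0\<close>] by blast
    have "\<bar>u n x - U x\<bar> \<le> e" if "n \<ge> N" "x \<in> \<Omega>" for n x
      by (rule LIMSEQ_le_const2[OF tendsto_rabs[OF tendsto_diff[OF tendsto_const pt[OF that(2)]]]]) (use N that in auto)
    then show ?thesis by blast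
  qed
  have Uc: "continuous_on \<Omega> U"
  proof (rule uniform_limit_theorem)
    show "uniform_limit \<Omega> u U sequentially"
      unfolding uniform_limit_iff
    proof (intro allI impI)
      fix e :: real assume "e > 0"
      then obtain N where "\<forall>n\<ge>N. \<forall>x\<in>\<Omega>. \<bar>u n x - U x\<bar> \<le> e / 2" using unif[of "e/2"] by auto
      then show "\<forall>\<^sub>F n in sequentially. \<forall>x\<in>\<Omega>. dist (u n x) (U x) < e"
        using \<open>e > 0\<close> unfolding eventually_sequentially by (intro exI[of _ N]) (fastforce simp: dist_real_def)
    qed
    show "\<forall>\<^sub>F n in sequentially. continuous_on \<Omega> (u n)" using u by (simp add: mem_Hs)
  qed simp
  have Um: "U \<in> borel_measurable M"
    using open_dom Uc by (intro continuous_imp_measurable_on_sets_lebesgue) auto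
  have uU: "u n - U \<in> elems (l2 M) \<and> fs_norm (l2 M) (u n - U) \<le> e * sqrt (measure M (space M))"
    if "e > 0" "\<forall>x\<in>\<Omega>. \<bar>u n x - U x\<bar> \<le> e" for n e
  proof -
    have m: "u n - U \<in> borel_measurable M"
      using l2_measurable[OF Hs_l2[OF u[of n]]] Um by (simp add: fun_diff_def)
    show ?thesis using bounded_mem_l2[OF finite_M m, of e] bounded_l2_norm_le[OF finite_M m, of e] that by auto
  qed
  have U2: "U \<in> elems (l2 M)"
  proof -
    obtain N where "\<forall>n\<ge>N. \<forall>x\<in>\<Omega>. \<bar>u n x - U x\<bar> \<le> 1" using unif[of 1] by auto
    then have "u N - U \<in> elems (l2 M)" using uU[of 1 N] by auto
    then have "u N - (u N - U) \<in> elems (l2 M)" by (rule L.diff_mem[OF Hs_l2[OF u]])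
    moreover have "u N - (u N - U) = U" by auto
    ultimately show ?thesis by (simp only:)
  qed
  have ulim: "(\<lambda>n. fs_norm (l2 M) (u n - U)) \<longlonglongrightarrow> 0"
  proof (rule LIMSEQ_I)
    fix e :: real assume e: "e > 0"
    define m where "m = sqrt (measure M (space M))"
    have m: "m \<ge> 0" by (simp add: m_def)
    define e' where "e' = (e / 2) / (m + 1)"
    have e': "e' > 0" using e m by (simp add: e'_def)
    have "e' * m \<le> e' * (m + 1)" using e' by (intro mult_left_mono) auto
    moreover have "m + 1 \<noteq> 0" using m by linarith
    then have "e' * (m + 1) = e / 2" by (simp only: e'_def times_divide_eq_left[of "e / 2"] nonzero_mult_div_cancel_right not_False_eq_True)
    ultimately have "e' * m < e" using e by linarith
    note e' = e' this
    obtain N where N: "\<forall>n\<ge>N. \<forall>x\<in>\<Omega>. \<bar>u n x - U x\<bar> \<le> e'" using unif[OF e'(1)] by auto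
    have "norm (fs_norm (l2 M) (u n - U) - 0) < e" if "n \<ge> N" for n
      using uU[OF e'(1), of n] N that e'(2) l2_norm_nonneg[of M "u n - U"] unfolding m_def[symmetric] by auto
    then show "\<exists>no. \<forall>n\<ge>no. norm (fs_norm (l2 M) (u n - U) - 0) < e" by blast
  qed
  have wdC: "\<exists>N. \<forall>i\<ge>N. \<forall>j\<ge>N. fs_norm (l2 M) (wd \<alpha> (u i) - wd \<alpha> (u j)) < e" if "mi_size \<alpha> \<le> k" "e > 0" for \<alpha> e
  proof -
    obtain N where N: "\<forall>i\<ge>N. \<forall>j\<ge>N. fs_norm H (u i - u j) < e" using C \<open>e > 0\<close> by blast
    have "fs_norm (l2 M) (wd \<alpha> (u i) - wd \<alpha> (u j)) \<le> fs_norm H (u i - u j)" for i j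
      using norm_wd_le[OF Hs.diff_mem[OF u u] that(1)] wd_diff_norm[OF u u that(1)] by metis
    then show ?thesis using N by (meson le_less_trans)
  qed
  \<comment> \<open>The claim is made along an arbitrary subsequence r, so that t can refine the one
    on which the quotients already converge pointwise.\<close>
  have wdlim: "\<exists>g t. g \<in> elems (l2 M) \<and> (\<lambda>n. fs_norm (l2 M) (wd \<alpha> (u (r n)) - g)) \<longlonglongrightarrow> 0 \<and> strict_mono (t :: nat \<Rightarrow> nat) \<and>
      (AE x in M. (\<lambda>i. wd \<alpha> (u (r (t i))) x) \<longlonglongrightarrow> g x) \<and> is_weak_deriv \<Omega> \<alpha> U g"
    if \<alpha>: "mi_size \<alpha> \<le> k" and r: "strict_mono r" for \<alpha> and r :: "nat \<Rightarrow> nat"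
  proof -
    have "\<exists>N. \<forall>i\<ge>N. \<forall>j\<ge>N. fs_norm (l2 M) (wd \<alpha> (u (r i)) - wd \<alpha> (u (r j))) < e" if "e > 0" for e
    proof -
      obtain N where "\<forall>i\<ge>N. \<forall>j\<ge>N. fs_norm (l2 M) (wd \<alpha> (u i) - wd \<alpha> (u j)) < e" using wdC[OF \<alpha> \<open>e > 0\<close>] by blast
      then show ?thesis using seq_suble[OF r] order_trans by blast
    qed
    from l2_complete[of "\<lambda>n. wd \<alpha> (u (r n))" M, OF wd_mem[OF u \<alpha>] this]
    obtain g t where g: "g \<in> elems (l2 M)" "(\<lambda>n. fs_norm (l2 M) (wd \<alpha> (u (r n)) - g)) \<longlonglongrightarrow> 0" "strict_mono (t :: nat \<Rightarrow> nat)"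
      "AE x in M. (\<lambda>i. wd \<alpha> (u (r (t i))) x) \<longlonglongrightarrow> g x" by blast
    have "is_weak_deriv \<Omega> \<alpha> U g"
      by (rule is_weak_deriv_limit[OF open_dom bounded_dom, of "\<lambda>n. u (r n)" U "\<lambda>n. wd \<alpha> (u (r n))"])
        (use Hs_l2[OF u] U2 LIMSEQ_subseq_LIMSEQ[OF ulim r] wd_mem[OF u \<alpha>] wd_weak[OF u \<alpha>] g in \<open>auto simp: o_def\<close>)
    then show ?thesis using g by blast
  qed
  have q: "q (wd \<alpha> U) \<in> elems (l2 LL) \<and> (\<lambda>n. fs_norm (l2 LL) (q (wd \<alpha> (u n)) - q (wd \<alpha> U))) \<longlonglongrightarrow> 0"
    if \<alpha>: "mi_size \<alpha> = k" and \<theta>: "\<theta> > 0" for \<alpha>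
  proof -
    have \<alpha>': "mi_size \<alpha> \<le> k" using \<alpha> by simp
    have qC: "\<exists>N. \<forall>i\<ge>N. \<forall>j\<ge>N. fs_norm (l2 LL) (q (wd \<alpha> (u i)) - q (wd \<alpha> (u j))) < e" if "e > 0" for e
    proof -
      obtain N where N: "\<forall>i\<ge>N. \<forall>j\<ge>N. fs_norm H (u i - u j) < e" using C \<open>e > 0\<close> by blast
      have "fs_norm (l2 LL) (q (wd \<alpha> (u i)) - q (wd \<alpha> (u j))) \<le> fs_norm H (u i - u j)" for i j
        using norm_slob_le[OF Hs.diff_mem[OF u u] \<alpha> \<theta>] slob_diff_norm[OF u u \<alpha> \<theta>] by metis
      then show ?thesis using N by (meson le_less_trans)
    qed
    from l2_complete[of "\<lambda>n. q (wd \<alpha> (u n))" LL, OF slob_mem[OF u \<alpha> \<theta>] qC]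
    obtain W r where W: "W \<in> elems (l2 LL)" "(\<lambda>n. fs_norm (l2 LL) (q (wd \<alpha> (u n)) - W)) \<longlonglongrightarrow> 0" "strict_mono (r :: nat \<Rightarrow> nat)"
      "AE p in LL. (\<lambda>i. q (wd \<alpha> (u (r i))) p) \<longlonglongrightarrow> W p" by blast
    obtain g t where g: "g \<in> elems (l2 M)" "strict_mono (t :: nat \<Rightarrow> nat)"
      "AE x in M. (\<lambda>i. wd \<alpha> (u (r (t i))) x) \<longlonglongrightarrow> g x" "is_weak_deriv \<Omega> \<alpha> U g" using wdlim[OF \<alpha>' W(3)] by blast
    have gU: "AE x in M. wd \<alpha> U x = g x" "wd \<alpha> U \<in> elems (l2 M)" using wd_AE[OF g(1,4)] by auto
    \<comment> \<open>Along the indices \<open>r (t i)\<close> the quotients tend to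
      \<open>W\<close>, and the derivatives converge at both components of p, which identifies the
      limit.\<close>
    have "AE p in LL. q (wd \<alpha> U) p = W p"
      using W(4) AE_pair_fst[OF sigma_finite_M g(3)] AE_pair_snd[OF sigma_finite_M g(3), of M] slob_quot_cong_AE[OF gU(1)]
    proof eventually_elim
      case (elim p)
      have "(\<lambda>i. q (wd \<alpha> (u (r (t i)))) p) \<longlonglongrightarrow> q g p"
        unfolding slob_quot_def case_prod_unfold divide_inverse
        by (intro tendsto_intros elim(2,3))
      moreover have "(\<lambda>i. q (wd \<alpha> (u (r (t i)))) p) \<longlonglongrightarrow> W p"
        using LIMSEQ_subseq_LIMSEQ[OF elim(1) g(2)] by (simp add: o_def)
      ultimately show ?case using elim(4) LIMSEQ_unique by metis
    qed
    then have qW: "AE p in LL. W p = q (wd \<alpha> U) p" by (rule AE_symmetric)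
    have qm: "q (wd \<alpha> U) \<in> elems (l2 LL)"
      by (rule l2_cong_AE[OF W(1) slob_quot_measurable[OF l2_measurable[OF gU(2)]] qW])
    have "fs_norm (l2 LL) (q (wd \<alpha> (u n)) - W) = fs_norm (l2 LL) (q (wd \<alpha> (u n)) - q (wd \<alpha> U))" for n
      using qW by (intro norm_l2_cong_AE l2_measurable Q.diff_mem slob_mem[OF u \<alpha> \<theta>] W(1) qm) auto
    then show ?thesis using W(2) qm by simp
  qed
  have wdU: "wd \<alpha> U \<in> elems (l2 M) \<and> (\<lambda>n. fs_norm (l2 M) (wd \<alpha> (u n) - wd \<alpha> U)) \<longlonglongrightarrow> 0"
    if \<alpha>: "mi_size \<alpha> \<le> k" for \<alpha>
  proof -
    obtain g where g: "g \<in> elems (l2 M)" "(\<lambda>n. fs_norm (l2 M) (wd \<alpha> (u n) - g)) \<longlonglongrightarrow> 0" "is_weak_deriv \<Omega> \<alpha> U g"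
      using wdlim[OF \<alpha> strict_mono_id] by (auto simp: id_def)
    have gU: "AE x in M. wd \<alpha> U x = g x" "wd \<alpha> U \<in> elems (l2 M)" using wd_AE[OF g(1,3)] by auto
    have "fs_norm (l2 M) (wd \<alpha> (u n) - g) = fs_norm (l2 M) (wd \<alpha> (u n) - wd \<alpha> U)" for n
      using gU(1) by (intro norm_l2_cong_AE l2_measurable L.diff_mem wd_mem[OF u \<alpha>] g(1) gU(2)) auto
    then show ?thesis using g(2) gU(2) by simp
  qed
  have UH: "U \<in> elems H"
    unfolding mem_Hs
  proof (intro conjI allI impI)
    show "\<exists>v\<in>elems (l2 M). is_weak_deriv \<Omega> \<alpha> U v" if "mi_size \<alpha> \<le> k" for \<alpha>
      using wdlim[OF that strict_mono_id] by blast
    show "integrable LL (\<lambda>p. (q (wd \<alpha> U) p)\<^sup>2)" if "\<theta> > 0" "mi_size \<alpha> = k" for \<alpha>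
      using q[OF that(2,1)] by (simp add: mem_l2)
  qed (use Uc out U2 in auto)
  have "(\<lambda>n. (fs_norm H (u n - U))\<^sup>2) \<longlonglongrightarrow> (\<Sum>\<alpha>::'m \<Rightarrow> nat | mi_size \<alpha> \<le> k. 0\<^sup>2) + (if \<theta> > 0 then (\<Sum>\<alpha>::'m \<Rightarrow> nat | mi_size \<alpha> = k. 0\<^sup>2) else 0)"
  proof -
    have "(fs_norm H (u n - U))\<^sup>2 = (\<Sum>\<alpha> | mi_size \<alpha> \<le> k. (fs_norm (l2 M) (wd \<alpha> (u n) - wd \<alpha> U))\<^sup>2) +
      (if \<theta> > 0 then (\<Sum>\<alpha> | mi_size \<alpha> = k. (fs_norm (l2 LL) (q (wd \<alpha> (u n)) - q (wd \<alpha> U)))\<^sup>2) else 0)" for n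
      unfolding norm_Hs_sq[OF Hs.diff_mem[OF u UH]] using wd_diff_norm[OF u UH] slob_diff_norm[OF u UH] by simp
    moreover have "(\<lambda>n. (\<Sum>\<alpha> | mi_size \<alpha> \<le> k. (fs_norm (l2 M) (wd \<alpha> (u n) - wd \<alpha> U))\<^sup>2)) \<longlonglongrightarrow> (\<Sum>\<alpha>::'m \<Rightarrow> nat | mi_size \<alpha> \<le> k. 0\<^sup>2)"
      using wdU by (intro tendsto_sum tendsto_power) auto
    moreover have "(\<lambda>n. (if \<theta> > 0 then (\<Sum>\<alpha> | mi_size \<alpha> = k. (fs_norm (l2 LL) (q (wd \<alpha> (u n)) - q (wd \<alpha> U)))\<^sup>2) else 0))
        \<longlonglongrightarrow> (if \<theta> > 0 then (\<Sum>\<alpha>::'m \<Rightarrow> nat | mi_size \<alpha> = k. 0\<^sup>2) else 0)"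
    proof (cases "\<theta> > 0")
      case True
      have "(\<lambda>n. (\<Sum>\<alpha> | mi_size \<alpha> = k. (fs_norm (l2 LL) (q (wd \<alpha> (u n)) - q (wd \<alpha> U)))\<^sup>2)) \<longlonglongrightarrow> (\<Sum>\<alpha>::'m \<Rightarrow> nat | mi_size \<alpha> = k. 0\<^sup>2)"
        using q[OF _ True] by (intro tendsto_sum tendsto_power) auto
      then show ?thesis using True by simp
    qed simp
    ultimately show ?thesis by (simp only: tendsto_add)
  qed
  then have "(\<lambda>n. sqrt ((fs_norm H (u n - U))\<^sup>2)) \<longlonglongrightarrow> sqrt 0" by (intro tendsto_real_sqrt) (simp cong: if_cong)
  then have "(\<lambda>n. fs_norm H (u n - U)) \<longlonglongrightarrow> 0"
    using Hs.norm_nonneg[OF Hs.diff_mem[OF u UH]] by simp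
  then show ?thesis using UH by blast
qed

end

subsection \<open>Weak limits and compactness in the supremum norm\<close>

text \<open>Eventual membership survives finite intersections and passes to unions, so convergence
  can be tested on the generating sets.\<close>

lemma limitin_topology_generated_by:
  assumes "l \<in> \<Union>S" "\<And>U. U \<in> S \<Longrightarrow> l \<in> U \<Longrightarrow> eventually (\<lambda>n. f n \<in> U) F"
  shows "limitin (topology_generated_by S) f l F"
  unfolding limitin_def
proof (intro conjI allI impI)
  show "l \<in> topspace (topology_generated_by S)" using assms(1) by simp
  fix U assume "openin (topology_generated_by S) U \<and> l \<in> U"
  then have "generate_topology_on S U" "l \<in> U" by (auto simp: openin_topology_generated_by_iff)
  then show "eventually (\<lambda>n. f n \<in> U) F"
  proof (induction rule: generate_topology_on.induct)
    case (Int a b)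
    then show ?case by (auto simp: eventually_conj_iff)
  next
    case (UN K)
    then obtain k where "k \<in> K" "l \<in> k" by auto
    then have "eventually (\<lambda>n. f n \<in> k) F" using UN by auto
    then show ?case by eventually_elim (use \<open>k \<in> K\<close> in auto)
  qed (use assms(2) in auto)
qed

context sobolev_embedding
begin

lemma norm_limit_pointwise:
  assumes "\<And>n. u n \<in> elems H" "U \<in> elems H" "(\<lambda>n. fs_norm H (u n - U)) \<longlonglongrightarrow> 0" "x \<in> \<Omega>"
  shows "(\<lambda>n. u n x) \<longlonglongrightarrow> U x"
proof -
  obtain S where S: "S \<ge> 0" "\<forall>u\<in>elems H. \<forall>x\<in>\<Omega>. \<bar>u x\<bar> \<le> S * fs_norm H u" using sup_bound by blast
  have "\<bar>(u n - U) x\<bar> \<le> S * fs_norm H (u n - U)" for n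
    using S(2) Hs.diff_mem[OF assms(1)[of n] assms(2)] assms(4) by blast
  then have 1: "\<forall>\<^sub>F n in sequentially. norm (u n x - U x) \<le> S * fs_norm H (u n - U)" by simp
  have 2: "(\<lambda>n. S * fs_norm H (u n - U)) \<longlonglongrightarrow> 0" using tendsto_mult_left[OF assms(3), of S] by simp
  show ?thesis by (rule LIM_zero_cancel[OF Lim_null_comparison[OF 1 2]])
qed

text \<open>By completeness the Cauchy sequence of hull elements has a norm limit V, hence also
  pointwise. Pointwise closeness to U is a convex condition that the tails satisfy, so the hull
  elements tend to U as well, and U = V.\<close>

lemma tail_hull_limit:
  assumes X: "\<And>n. X n \<in> elems H" "\<And>n. fs_norm H (X n) \<le> C"
    and pt: "\<And>x. x \<in> \<Omega> \<Longrightarrow> (\<lambda>n. X n x) \<longlonglongrightarrow> U x" and out: "\<And>x. x \<notin> \<Omega> \<Longrightarrow> U x = 0"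
  obtains c where "\<And>N. c N \<in> midpoint_hull (range X)" "U \<in> elems H" "(\<lambda>n. fs_norm H (c n - U)) \<longlonglongrightarrow> 0"
proof -
  obtain c where c: "\<forall>N. c N \<in> midpoint_hull (X ` {N..})" "\<forall>e>0. \<exists>N. \<forall>i\<ge>N. \<forall>j\<ge>N. fs_norm H (c i - c j) < e"
    using Hs.tail_hull_Cauchy[of X C, OF X] by blast
  have c': "c N \<in> midpoint_hull (range X)" for N
    by (rule midpoint_hull_mono[OF c(1)[rule_format]]) auto
  have cH: "c N \<in> elems H" for N by (rule Hs.midpoint_hull_mem[OF c']) (use X in auto)
  obtain V where V: "V \<in> elems H" "(\<lambda>n. fs_norm H (c n - V)) \<longlonglongrightarrow> 0" using Hs_complete[OF cH c(2)] by blast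
  have "U x = V x" if x: "x \<in> \<Omega>" for x
  proof -
    have "(\<lambda>N. c N x) \<longlonglongrightarrow> U x"
    proof (rule LIMSEQ_I)
      fix e :: real assume e: "e > 0"
      then obtain N where N: "\<And>n. n \<ge> N \<Longrightarrow> \<bar>X n x - U x\<bar> < e" using LIMSEQ_D[OF pt[OF x] e] by auto
      have "\<bar>f x - U x\<bar> < e" if "f \<in> midpoint_hull (X ` {n..})" "n \<ge> N" for f n
        using that
      proof induction
        case (base w) then show ?case using N by auto
      next
        case (mid f g)
        then have "\<bar>f x - U x\<bar> < e" "\<bar>g x - U x\<bar> < e" by auto
        then show ?case by (simp add: abs_less_iff)
      qed
      then show "\<exists>no. \<forall>n\<ge>no. norm (c n x - U x) < e" using c(1) by auto
    qed
    then show ?thesis using norm_limit_pointwise[OF cH V x] LIMSEQ_unique by blast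
  qed
  moreover have "U x = V x" if "x \<notin> \<Omega>" for x using out that V(1) by (simp add: mem_Hs)
  ultimately have "U = V" by auto
  then show ?thesis using that[of c] c' V by blast
qed

lemma inner_limit:
  assumes "\<And>n. u n \<in> elems H" "U \<in> elems H" "g \<in> elems H" "(\<lambda>n. fs_norm H (u n - U)) \<longlonglongrightarrow> 0"
  shows "(\<lambda>n. inner_on H (u n) g) \<longlonglongrightarrow> inner_on H U g"
proof (rule LIM_zero_cancel, rule Lim_null_comparison)
  have "\<bar>inner_on H (u n - U) g\<bar> \<le> fs_norm H (u n - U) * fs_norm H g" for n
    using assms by (intro Hs.Cauchy_Schwarz Hs.diff_mem)
  then show "\<forall>\<^sub>F n in sequentially. norm (inner_on H (u n) g - inner_on H U g) \<le> fs_norm H (u n - U) * fs_norm H g"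
    using Hs.inner_diff_left[OF assms(1) assms(2,3)] by simp
  show "(\<lambda>n. fs_norm H (u n - U) * fs_norm H g) \<longlonglongrightarrow> 0"
    using tendsto_mult_right[OF assms(4), of "fs_norm H g"] by simp
qed

text \<open>If the inner products with g failed to converge, those of X_n - U would, up to sign,
  stay above some e along a subsequence. This bound passes to midpoint hulls by linearity, but hull
  elements of a sequence tending to 0 pointwise come arbitrarily close to 0 in norm.\<close>

lemma pointwise_weak_limit:
  assumes X: "\<And>n. X n \<in> elems H" "\<And>n. fs_norm H (X n) \<le> C"
    and pt: "\<And>x. x \<in> \<Omega> \<Longrightarrow> (\<lambda>n. X n x) \<longlonglongrightarrow> U x" and out: "\<And>x. x \<notin> \<Omega> \<Longrightarrow> U x = 0"
    and g: "g \<in> elems H"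
  shows "(\<lambda>n. inner_on H (X n) g) \<longlonglongrightarrow> inner_on H U g"
proof (rule ccontr)
  have U: "U \<in> elems H" using tail_hull_limit[OF X pt out] by blast
  have d: "X n - U \<in> elems H" for n using X U by (intro Hs.diff_mem)
  assume "\<not> (\<lambda>n. inner_on H (X n) g) \<longlonglongrightarrow> inner_on H U g"
  then obtain e where e: "e > 0" "\<not> (\<forall>\<^sub>F n in sequentially. dist (inner_on H (X n) g) (inner_on H U g) < e)"
    unfolding tendsto_iff by blast
  then have "\<exists>\<^sub>\<infinity>n. e \<le> \<bar>inner_on H (X n - U) g\<bar>"
    using Hs.inner_diff_left[OF X(1) U g] by (simp add: not_eventually cofinite_eq_sequentially dist_real_def not_less)
  then have "(\<exists>\<^sub>\<infinity>n. e \<le> 1 * inner_on H (X n - U) g) \<or> (\<exists>\<^sub>\<infinity>n. e \<le> -1 * inner_on H (X n - U) g)"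
    unfolding INFM_disj_distrib[symmetric] by (rule INFM_mono) linarith
  \<comment> \<open>s is 1 or -1: infinitely many deviations have the same sign, and a one-sided
    bound is what midpoints preserve.\<close>
  then obtain s :: real where "\<exists>\<^sub>\<infinity>n. e \<le> s * inner_on H (X n - U) g" by blast
  then have "infinite {n. e \<le> s * inner_on H (X n - U) g}" by (simp add: frequently_cofinite)
  then obtain r :: "nat \<Rightarrow> nat" where r: "strict_mono r" "\<And>n. r n \<in> {n. e \<le> s * inner_on H (X n - U) g}"
    using infinite_enumerate by blast
  define w where "w n = X (r n) - U" for n
  have w: "w n \<in> elems H" "fs_norm H (w n) \<le> C + fs_norm H U" for n
    using d[of "r n"] Hs.norm_diff_le[OF X(1)[of "r n"] U] X(2)[of "r n"] by (auto simp: w_def)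
  have wpt: "(\<lambda>n. w n x) \<longlonglongrightarrow> (\<lambda>_. 0) x" if "x \<in> \<Omega>" for x
    using LIM_zero[OF LIMSEQ_subseq_LIMSEQ[OF pt[OF that] r(1)]] by (simp add: w_def o_def)
  obtain c where c: "\<And>N. c N \<in> midpoint_hull (range w)" "(\<lambda>_. 0) \<in> elems H" "(\<lambda>n. fs_norm H (c n - (\<lambda>_. 0))) \<longlonglongrightarrow> 0"
    using tail_hull_limit[OF w wpt] by blast
  have ce: "f \<in> elems H \<and> e \<le> s * inner_on H f g" if "f \<in> midpoint_hull (range w)" for f
    using that
  proof induction
    case (base v) then show ?case using w r(2) by (auto simp: w_def)
  next
    case (mid f h)
    then have "inner_on H (\<lambda>t. 1/2 * f t + 1/2 * h t) g = 1/2 * inner_on H f g + 1/2 * inner_on H h g"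
      by (intro Hs.inner_lin g) auto
    moreover have "s * (1/2 * inner_on H f g + 1/2 * inner_on H h g) = 1/2 * (s * inner_on H f g) + 1/2 * (s * inner_on H h g)"
      by (simp add: algebra_simps)
    moreover have "e \<le> 1/2 * (s * inner_on H f g) + 1/2 * (s * inner_on H h g)" using mid by linarith
    ultimately show ?case using mid by (simp only:) (intro conjI Hs.lincomb; simp)
  qed
  have "(\<lambda>n. s * inner_on H (c n) g) \<longlonglongrightarrow> s * inner_on H (\<lambda>_. 0) g"
    using ce c by (intro tendsto_mult_left inner_limit g) auto
  then have "e \<le> s * inner_on H (\<lambda>_. 0) g" using ce[OF c(1)] by (intro LIMSEQ_le_const) auto
  moreover have "inner_on H (\<lambda>_. 0) g = 0" using Hs.inner_scale_left[OF c(2) g, of 0] by simp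
  ultimately show False using e(1) by simp
qed

text \<open>A bounded sequence converging pointwise converges in \<open>weak_topology\<close>, so
  closedness in that topology applies to its pointwise limit.\<close>

lemma weakly_closed_limit:
  assumes D: "closedin (weak_topology H) D" "\<And>u. u \<in> D \<Longrightarrow> fs_norm H u \<le> C" "D \<subseteq> elems H"
    and X: "\<And>n. X n \<in> D"
    and pt: "\<And>x. x \<in> \<Omega> \<Longrightarrow> (\<lambda>n. X n x) \<longlonglongrightarrow> U x" and out: "\<And>x. x \<notin> \<Omega> \<Longrightarrow> U x = 0"
  shows "U \<in> D"
proof -
  have XH: "X n \<in> elems H" "fs_norm H (X n) \<le> C" for n using X D by auto
  have U: "U \<in> elems H" using tail_hull_limit[OF XH pt out] by blast
  have "limitin (weak_topology H) X U sequentially"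
    unfolding weak_topology_def
  proof (rule limitin_topology_generated_by)
    show "U \<in> \<Union>{{u \<in> elems H. inner_on H u g \<in> V} |g V. g \<in> elems H \<and> open V}"
    proof (rule UnionI)
      show "{u \<in> elems H. inner_on H u U \<in> UNIV} \<in> {{u \<in> elems H. inner_on H u g \<in> V} |g V. g \<in> elems H \<and> open V}"
        using U open_UNIV by blast
      show "U \<in> {u \<in> elems H. inner_on H u U \<in> UNIV}" using U by simp
    qed
    fix W assume "W \<in> {{u \<in> elems H. inner_on H u g \<in> V} |g V. g \<in> elems H \<and> open V}" "U \<in> W"
    then obtain g V where g: "g \<in> elems H" "open V" "W = {u \<in> elems H. inner_on H u g \<in> V}" "inner_on H U g \<in> V" by auto
    have "\<forall>\<^sub>F n in sequentially. inner_on H (X n) g \<in> V"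
      using pointwise_weak_limit[OF XH pt out g(1)] g(2,4) by (rule topological_tendstoD)
    then show "\<forall>\<^sub>F n in sequentially. X n \<in> W" by eventually_elim (use g XH in auto)
  qed
  then show ?thesis using X by (intro limitin_closedin[OF _ D(1)]) auto
qed

lemma sup_compact:
  assumes D: "closedin (weak_topology H) D" "\<And>u. u \<in> D \<Longrightarrow> fs_norm H u \<le> C" "D \<subseteq> elems H"
    and X: "\<And>n. X n \<in> D"
  shows "\<exists>r U. strict_mono (r :: nat \<Rightarrow> nat) \<and> U \<in> D \<and>
    (\<forall>e>0. \<exists>N. \<forall>n\<ge>N. \<forall>x\<in>\<Omega>. \<bar>X (r n) x - U x\<bar> \<le> e)"
proof -
  have XH: "X n \<in> elems H" "fs_norm H (X n) \<le> C" for n using X D by auto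
  obtain r :: "nat \<Rightarrow> nat" where r: "strict_mono r" "\<forall>e>0. \<exists>N. \<forall>i\<ge>N. \<forall>j\<ge>N. \<forall>x\<in>\<Omega>. \<bar>X (r i) x - X (r j) x\<bar> \<le> e"
    using sup_Cauchy_subseq[of X C, OF XH] by blast
  define U where "U x = lim (\<lambda>n. X (r n) x)" for x
  have out: "U x = 0" if "x \<notin> \<Omega>" for x
  proof -
    have "X n x = 0" for n using XH(1)[of n] that by (simp add: mem_Hs)
    then show ?thesis by (simp add: U_def)
  qed
  have pt: "(\<lambda>n. X (r n) x) \<longlonglongrightarrow> U x" if "x \<in> \<Omega>" for x
  proof -
    have "Cauchy (\<lambda>n. X (r n) x)"
    proof (rule metric_CauchyI)
      fix e :: real assume "e > 0"
      then obtain N where "\<forall>i\<ge>N. \<forall>j\<ge>N. \<forall>x\<in>\<Omega>. \<bar>X (r i) x - X (r j) x\<bar> \<le> e / 2" using r(2)[rule_format, of "e/2"] by auto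
      then show "\<exists>N. \<forall>m\<ge>N. \<forall>n\<ge>N. dist (X (r m) x) (X (r n) x) < e"
        using that \<open>e > 0\<close> by (intro exI[of _ N]) (fastforce simp: dist_real_def)
    qed
    then show ?thesis by (simp add: U_def Cauchy_convergent_iff convergent_LIMSEQ_iff)
  qed
  have unif: "\<exists>N. \<forall>n\<ge>N. \<forall>x\<in>\<Omega>. \<bar>X (r n) x - U x\<bar> \<le> e" if "e > 0" for e
  proof -
    obtain N where N: "\<forall>i\<ge>N. \<forall>j\<ge>N. \<forall>x\<in>\<Omega>. \<bar>X (r i) x - X (r j) x\<bar> \<le> e" using r(2) \<open>e > 0\<close> by blast
    have "\<bar>X (r n) x - U x\<bar> \<le> e" if "n \<ge> N" "x \<in> \<Omega>" for n x
      by (rule LIMSEQ_le_const2[OF tendsto_rabs[OF tendsto_diff[OF tendsto_const pt[OF that(2)]]]]) (use N that in auto)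
    then show ?thesis by blast
  qed
  have "U \<in> D" by (rule weakly_closed_limit[OF D, of "\<lambda>n. X (r n)"]) (use X pt out in auto)
  then show ?thesis using r(1) unif by blast
qed

lemma Linf_norm_le:
  assumes "f \<in> borel_measurable M" "\<forall>x\<in>\<Omega>. \<bar>f x\<bar> \<le> e"
  shows "Linf_norm \<Omega> f \<le> ereal e"
  unfolding Linf_norm_def
proof (rule esssup_I)
  show "(\<lambda>t. ereal \<bar>f t\<bar>) \<in> borel_measurable M" using assms(1) by measurable
  show "AE x in M. ereal \<bar>f x\<bar> \<le> ereal e" using assms(2) by (intro AE_I2) auto
qed

lemma sup_uniformly_continuous:
  fixes G :: "'b fspace"
  assumes D: "closedin (weak_topology H) D" "\<And>u. u \<in> D \<Longrightarrow> fs_norm H u \<le> C" "D \<subseteq> elems H"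
    and G: "pre_hilbert G" "\<And>u. u \<in> D \<Longrightarrow> F u \<in> elems G"
    and F: "\<forall>x\<in>D. \<forall>e>0. \<exists>d>0. \<forall>z\<in>D. Linf_norm \<Omega> (z - x) < ereal d \<longrightarrow> fs_norm G (F z - F x) < e"
    and e: "e > 0"
  shows "\<exists>d>0. \<forall>u\<in>D. \<forall>v\<in>D. (\<forall>x\<in>\<Omega>. \<bar>u x - v x\<bar> \<le> d) \<longrightarrow> fs_norm G (F u - F v) < e"
proof (rule ccontr)
  interpret G: pre_hilbert G by fact
  assume "\<not> ?thesis"
  then have "\<forall>d>0. \<exists>u\<in>D. \<exists>v\<in>D. (\<forall>x\<in>\<Omega>. \<bar>u x - v x\<bar> \<le> d) \<and> \<not> fs_norm G (F u - F v) < e" by blast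
  then have "\<forall>n. \<exists>u\<in>D. \<exists>v\<in>D. (\<forall>x\<in>\<Omega>. \<bar>u x - v x\<bar> \<le> 1 / real (Suc n)) \<and> \<not> fs_norm G (F u - F v) < e"
    by (metis of_nat_0_less_iff zero_less_Suc zero_less_divide_1_iff)
  then obtain u v where uv: "\<And>n. u n \<in> D" "\<And>n. v n \<in> D" "\<And>n. \<forall>x\<in>\<Omega>. \<bar>u n x - v n x\<bar> \<le> 1 / real (Suc n)"
    "\<And>n. \<not> fs_norm G (F (u n) - F (v n)) < e" by metis
  obtain r :: "nat \<Rightarrow> nat" and U where r: "strict_mono r" "U \<in> D" "\<forall>e>0. \<exists>N. \<forall>n\<ge>N. \<forall>x\<in>\<Omega>. \<bar>u (r n) x - U x\<bar> \<le> e"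
    using sup_compact[of D C u, OF D uv(1)] by blast
  obtain d where d: "d > 0" "\<And>z. z \<in> D \<Longrightarrow> Linf_norm \<Omega> (z - U) < ereal d \<Longrightarrow> fs_norm G (F z - F U) < e / 2"
    using F[rule_format, OF r(2), of "e/2"] e by auto
  have near: "fs_norm G (F z - F U) < e / 2" if z: "z \<in> D" "\<forall>x\<in>\<Omega>. \<bar>z x - U x\<bar> \<le> d / 2" for z
  proof (rule d(2)[OF z(1)])
    have "z - U \<in> borel_measurable M"
      using l2_measurable[OF Hs_l2[OF Hs.diff_mem[of z U]]] z(1) r(2) D(3) by blast
    then have "Linf_norm \<Omega> (z - U) \<le> ereal (d / 2)" using z(2) by (intro Linf_norm_le) auto
    also have "\<dots> < ereal d" using d(1) by simp
    finally show "Linf_norm \<Omega> (z - U) < ereal d" .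
  qed
  \<comment> \<open>A quarter of d for u near U and another quarter for v near u give d/2. The
    strict inequality asked of the essential supremum is then available for both sequences.\<close>
  obtain N where N: "\<forall>n\<ge>N. \<forall>x\<in>\<Omega>. \<bar>u (r n) x - U x\<bar> \<le> d / 4" using r(3)[rule_format, of "d/4"] d(1) by auto
  obtain n0 where n0: "1 / real (Suc n0) < d / 4" using nat_approx_posE[of "d/4"] d(1) by auto
  define n where "n = max N n0"
  have "r n \<ge> n0" using seq_suble[OF r(1), of n] by (simp add: n_def)
  then have "1 / real (Suc (r n)) \<le> 1 / real (Suc n0)" by (intro divide_left_mono) auto
  then have "1 / real (Suc (r n)) \<le> d / 4" using n0 by linarith
  then have uvn: "\<bar>u (r n) x - v (r n) x\<bar> \<le> d / 4" if "x \<in> \<Omega>" for x using uv(3)[of "r n"] that by force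
  have un: "\<bar>u (r n) x - U x\<bar> \<le> d / 4" if "x \<in> \<Omega>" for x using N that by (simp add: n_def)
  have "\<forall>x\<in>\<Omega>. \<bar>u (r n) x - U x\<bar> \<le> d / 2"
  proof
    fix x assume "x \<in> \<Omega>" then show "\<bar>u (r n) x - U x\<bar> \<le> d / 2" using un[of x] d(1) by linarith
  qed
  from near[OF uv(1) this] have 1: "fs_norm G (F (u (r n)) - F U) < e / 2" .
  have "\<forall>x\<in>\<Omega>. \<bar>v (r n) x - U x\<bar> \<le> d / 2"
  proof
    fix x assume "x \<in> \<Omega>" then show "\<bar>v (r n) x - U x\<bar> \<le> d / 2" using un[of x] uvn[of x] by linarith
  qed
  from near[OF uv(2) this] have 2: "fs_norm G (F (v (r n)) - F U) < e / 2" .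
  have m: "F (u (r n)) \<in> elems G" "F (v (r n)) \<in> elems G" "F U \<in> elems G" using uv r(2) G(2) by auto
  have "fs_norm G (F (u (r n)) - F (v (r n))) < e"
    using G.norm_triangle_diff[OF m(1,3,2)] G.norm_minus_commute[OF m(2,3)] 1 2 by linarith
  with uv(4)[of "r n"] show False by simp
qed

lemma sensor_continuity:
  fixes G :: "'b fspace"
  assumes D: "closedin (weak_topology H) D" "\<And>u. u \<in> D \<Longrightarrow> fs_norm H u \<le> C" "D \<subseteq> elems H"
    and G: "pre_hilbert G" "\<And>u. u \<in> D \<Longrightarrow> F u \<in> elems G"
    and F: "\<forall>x\<in>D. \<forall>e>0. \<exists>d>0. \<forall>z\<in>D. Linf_norm \<Omega> (z - x) < ereal d \<longrightarrow> fs_norm G (F z - F x) < e"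
    and e: "e > 0"
  shows "\<exists>P d. finite P \<and> P \<subseteq> \<Omega> \<and> P \<noteq> {} \<and> d > 0 \<and>
    (\<forall>u\<in>D. \<forall>v\<in>D. (\<forall>p\<in>P. \<bar>u p - v p\<bar> \<le> d) \<longrightarrow> fs_norm G (F u - F v) < e)"
proof -
  obtain d where d: "d > 0" "\<forall>u\<in>D. \<forall>v\<in>D. (\<forall>x\<in>\<Omega>. \<bar>u x - v x\<bar> \<le> d) \<longrightarrow> fs_norm G (F u - F v) < e"
    using sup_uniformly_continuous[OF D G F e] by blast
  have "d / 5 > 0" using d(1) by simp
  then obtain P where P: "finite P" "P \<subseteq> \<Omega>" "P \<noteq> {}"
    "\<And>u v x. u \<in> D \<Longrightarrow> v \<in> D \<Longrightarrow> (\<And>p. p \<in> P \<Longrightarrow> \<bar>u p - v p\<bar> \<le> d / 5) \<Longrightarrow> x \<in> \<Omega> \<Longrightarrow> \<bar>u x - v x\<bar> \<le> 5 * (d / 5)"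
    using finite_sensors[OF D(3,2)] by metis
  have "fs_norm G (F u - F v) < e" if "u \<in> D" "v \<in> D" "\<forall>p\<in>P. \<bar>u p - v p\<bar> \<le> d / 5" for u v
  proof -
    have "\<bar>u x - v x\<bar> \<le> d" if "x \<in> \<Omega>" for x using P(4)[OF \<open>u \<in> D\<close> \<open>v \<in> D\<close> _ that] \<open>\<forall>p\<in>P. \<bar>u p - v p\<bar> \<le> d / 5\<close> by simp
    then show ?thesis using d(2) that by blast
  qed
  then show ?thesis using P(1-3) \<open>d / 5 > 0\<close> by blast
qed

end

subsection \<open>Approximation by sigmoid networks\<close>

lemma sigmoid_range:
  assumes "sigmoid_fun \<sigma>" shows "0 < \<sigma> t" "\<sigma> t < 1"
proof -
  have m: "strict_mono \<sigma>" and l: "(\<sigma> \<longlongrightarrow> 1) at_top" "(\<sigma> \<longlongrightarrow> 0) at_bot" using assms by (auto simp: sigmoid_fun_def)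
  have "\<sigma> (t - 1) \<ge> 0"
  proof (rule tendsto_upperbound[OF l(2)])
    show "\<forall>\<^sub>F x in at_bot. \<sigma> x \<le> \<sigma> (t - 1)"
      using eventually_le_at_bot[of "t - 1"] by eventually_elim (simp add: strict_mono_less_eq[OF m])
  qed simp
  moreover have "\<sigma> (t - 1) < \<sigma> t" using strict_monoD[OF m] by simp
  ultimately show "0 < \<sigma> t" by linarith
  have "\<sigma> (t + 1) \<le> 1"
  proof (rule tendsto_lowerbound[OF l(1)])
    show "\<forall>\<^sub>F x in at_top. \<sigma> (t + 1) \<le> \<sigma> x"
      using eventually_ge_at_top[of "t + 1"] by eventually_elim (simp add: strict_mono_less_eq[OF m])
  qed simp
  moreover have "\<sigma> t < \<sigma> (t + 1)" using strict_monoD[OF m] by simp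
  ultimately show "\<sigma> t < 1" by linarith
qed

lemma sigmoid_continuous:
  assumes "sigmoid_fun \<sigma>" shows "continuous_on S \<sigma>"
  using assms by (auto simp: sigmoid_fun_def intro!: continuous_at_imp_continuous_on differentiable_imp_continuous_within)

lemma sigmoid_steep:
  assumes "sigmoid_fun \<sigma>" "\<delta> > 0"
  obtains R where "R > 0" "\<And>x. x \<ge> R \<Longrightarrow> 1 - \<delta> < \<sigma> x" "\<And>x. x \<le> - R \<Longrightarrow> \<sigma> x < \<delta>"
proof -
  have l: "(\<sigma> \<longlongrightarrow> 1) at_top" "(\<sigma> \<longlongrightarrow> 0) at_bot" using assms by (auto simp: sigmoid_fun_def)
  obtain R1 where R1: "\<And>x. x \<ge> R1 \<Longrightarrow> 1 - \<delta> < \<sigma> x"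
    using order_tendstoD(1)[OF l(1), of "1 - \<delta>"] assms(2) by (auto simp: eventually_at_top_linorder)
  obtain R2 where R2: "\<And>x. x \<le> R2 \<Longrightarrow> \<sigma> x < \<delta>"
    using order_tendstoD(2)[OF l(2), of \<delta>] assms(2) by (auto simp: eventually_at_bot_linorder)
  show ?thesis
    by (rule that[of "max 1 (max R1 (- R2))"]) (use R1 R2 in auto)
qed

text \<open>A continuous function is close to the step function interpolating it on a fine grid, and each jump is
  imitated by a steep sigmoid; only the jumps next to the current point contribute a visible error.\<close>

lemma sigmoid_approx_interval:
  fixes g :: "real \<Rightarrow> real"
  assumes \<sigma>: "sigmoid_fun \<sigma>" and g: "continuous_on {-B..B} g" and B: "B > 0" and e: "e > 0"
  shows "\<exists>(n::nat) c M t c0. \<forall>x\<in>{-B..B}. \<bar>g x - (c0 + (\<Sum>i=1..n. c i * \<sigma> (M * x + t i)))\<bar> < (e::real)"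
proof -
  have "uniformly_continuous_on {-B..B} g" using g by (intro compact_uniformly_continuous) auto
  then obtain d where d: "d > 0" "\<And>x y. x \<in> {-B..B} \<Longrightarrow> y \<in> {-B..B} \<Longrightarrow> \<bar>y - x\<bar> < d \<Longrightarrow> \<bar>g y - g x\<bar> < e / 5"
    using e unfolding uniformly_continuous_on_def dist_real_def by (metis zero_less_divide_iff zero_less_numeral)
  obtain n :: nat where n: "2 * B / d < real n" using reals_Archimedean2 by blast
  have n0: "n > 0" using n B d(1) by (metis divide_pos_pos gr0I less_asym' mult_pos_pos of_nat_0 zero_less_numeral)
  define \<Delta> where "\<Delta> = 2 * B / n"
  have \<Delta>: "\<Delta> > 0" "\<Delta> < d" using n n0 B d(1) by (auto simp: \<Delta>_def field_simps)
  define p where "p i = - B + real i * \<Delta>" for i :: nat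
  have pB: "p i \<in> {-B..B}" if "i \<le> n" for i
  proof -
    have "real i * \<Delta> \<le> real n * \<Delta>" using that \<Delta> by (intro mult_right_mono) auto
    also have "\<dots> = 2 * B" using n0 by (simp add: \<Delta>_def)
    finally show ?thesis using \<Delta> by (auto simp: p_def)
  qed
  define D where "D i = g (p i) - g (p (i - 1))" for i
  have D: "\<bar>D i\<bar> \<le> e / 5" if "i \<in> {1..n}" for i
  proof -
    have "p i - p (i - 1) = \<Delta>" using that by (simp add: p_def of_nat_diff algebra_simps)
    then show ?thesis using d(2)[of "p (i - 1)" "p i"] pB[of i] pB[of "i - 1"] \<Delta> that unfolding D_def by auto
  qed
  \<comment> \<open>With tail tolerance 1/n the n jumps contribute tail errors of at most e/5 in
    total.\<close>
  obtain R where R: "R > 0" "\<And>x. x \<ge> R \<Longrightarrow> 1 - 1 / real n < \<sigma> x" "\<And>x. x \<le> - R \<Longrightarrow> \<sigma> x < 1 / real n"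
    using sigmoid_steep[OF \<sigma>, of "1 / real n"] n0 by (metis of_nat_0_less_iff zero_less_divide_1_iff)
  \<comment> \<open>One mesh width changes the argument of the sigmoid by R, so a jump at least one
    mesh away from x is already in its tail.\<close>
  define M where "M = R / \<Delta>"
  show ?thesis
  proof (rule exI[of _ n], rule exI[of _ D], rule exI[of _ M], rule exI[of _ "\<lambda>i. - M * p i"], rule exI[of _ "g (p 0)"], rule ballI)
    fix x assume x: "x \<in> {-B..B}"
    define j where "j = nat \<lfloor>(x + B) / \<Delta>\<rfloor>"
    have "0 \<le> (x + B) / \<Delta>" using x \<Delta> by simp
    then have j: "real j \<le> (x + B) / \<Delta>" "(x + B) / \<Delta> < real j + 1" by (auto simp: j_def)
    have pj: "p j \<le> x" "x < p j + \<Delta>" using j \<Delta> by (auto simp: p_def field_simps)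
    have jn: "j \<le> n"
    proof -
      have "(x + B) / \<Delta> \<le> 2 * B / \<Delta>" using x \<Delta> by (intro divide_right_mono) auto
      also have "\<dots> = n" using B n0 by (simp add: \<Delta>_def)
      finally show ?thesis using j(1) by linarith
    qed
    have tel: "(\<Sum>i=1..j. D i) = g (p j) - g (p 0)"
      by (induction j) (auto simp: D_def)
    have err: "\<bar>D i * (\<sigma> (M * x + - M * p i) - (if i \<le> j then 1 else 0))\<bar> \<le> e / 5 * (1 / real n + (if i \<in> {j, j + 1} then 1 else 0))"
      if i: "i \<in> {1..n}" for i
    proof -
      let ?s = "\<sigma> (M * x + - M * p i)"
      have s: "0 < ?s" "?s < 1" by (rule sigmoid_range[OF \<sigma>])+
      have "\<bar>?s - (if i \<le> j then 1 else 0)\<bar> \<le> 1 / real n + (if i \<in> {j, j + 1} then 1 else 0)"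
      proof -
        have M\<Delta>: "M * \<Delta> = R" "M > 0" using \<Delta> R by (auto simp: M_def)
        consider "i \<in> {j, j + 1}" | "i < j" | "i > j + 1" by force
        then show ?thesis
        proof cases
          case 1
          then have "(if i \<in> {j, j + 1} then 1 else 0) = (1::real)" by simp
          moreover have "\<bar>?s - (if i \<le> j then 1 else 0)\<bar> \<le> 1" using s by (auto simp: abs_le_iff)
          moreover have "0 < 1 / real n" using n0 by simp
          ultimately show ?thesis by linarith
        next
          case 2
          then have "real i + 1 \<le> real j" by linarith
          then have "(real i + 1) * \<Delta> \<le> real j * \<Delta>" using \<Delta> by (intro mult_right_mono) auto
          then have "p i + \<Delta> \<le> p j" by (simp add: p_def algebra_simps)
          then have "M * \<Delta> \<le> M * (x - p i)" using pj M\<Delta> by (intro mult_left_mono) auto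
          then have "1 - 1 / real n < ?s" using M\<Delta> by (intro R(2)) (simp add: algebra_simps)
          then show ?thesis using 2 s by auto
        next
          case 3
          then have "real j + 2 \<le> real i" by linarith
          then have "(real j + 2) * \<Delta> \<le> real i * \<Delta>" using \<Delta> by (intro mult_right_mono) auto
          then have "p j + 2 * \<Delta> \<le> p i" by (simp add: p_def algebra_simps)
          then have "M * \<Delta> \<le> M * (p i - x)" using pj M\<Delta> by (intro mult_left_mono) auto
          then have "?s < 1 / real n" using M\<Delta> by (intro R(3)) (simp add: algebra_simps)
          then show ?thesis using 3 s by auto
        qed
      qed
      then show ?thesis unfolding abs_mult using D[OF i] e by (intro mult_mono) auto
    qed
    have "(\<Sum>i=1..n. D i * (if i \<le> j then 1 else 0)) = (\<Sum>i=1..j. D i)"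
      using jn by (intro sum.mono_neutral_cong_right) auto
    then have eq: "g (p 0) + (\<Sum>i=1..n. D i * \<sigma> (M * x + - M * p i)) - g (p j) =
        (\<Sum>i=1..n. D i * (\<sigma> (M * x + - M * p i) - (if i \<le> j then 1 else 0)))"
      unfolding right_diff_distrib sum_subtractf using tel by simp
    have "\<bar>\<Sum>i=1..n. D i * (\<sigma> (M * x + - M * p i) - (if i \<le> j then 1 else 0))\<bar> \<le>
        (\<Sum>i=1..n. e / 5 * (1 / real n + (if i \<in> {j, j + 1} then 1 else 0)))"
      by (rule order_trans[OF sum_abs sum_mono]) (rule err)
    also have "\<dots> = e / 5 * (1 + (\<Sum>i=1..n. if i \<in> {j, j + 1} then 1 else 0))"
      unfolding sum_distrib_left[symmetric] sum.distrib using n0 by simp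
    \<comment> \<open>Only the jumps j and j + 1 can be in transition at x, each with error at most
      e/5. Together with the oscillation of g on one mesh the sum stays below 4 e/5.\<close>
    also have "\<dots> \<le> e / 5 * (1 + 2)"
    proof (intro mult_left_mono add_left_mono)
      have "(\<Sum>i=1..n. if i \<in> {j, j + 1} then 1 else (0::real)) = real (card ({1..n} \<inter> {j, j + 1}))"
        by (subst sum.inter_restrict[symmetric]) auto
      also have "\<dots> \<le> real (card {j, j + 1})" by (intro of_nat_mono card_mono) auto
      finally show "(\<Sum>i=1..n. if i \<in> {j, j + 1} then 1 else (0::real)) \<le> 2" by simp
    qed (use e in auto)
    finally have 1: "\<bar>g (p 0) + (\<Sum>i=1..n. D i * \<sigma> (M * x + - M * p i)) - g (p j)\<bar> \<le> e / 5 * 3" using eq by simp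
    have "\<bar>g x - g (p j)\<bar> < e / 5" using d(2)[OF pB[OF jn] x] pj \<Delta> by auto
    then show "\<bar>g x - (g (p 0) + (\<Sum>i=1..n. D i * \<sigma> (M * x + - M * p i)))\<bar> < e" using 1 e by linarith
  qed
qed

section \<open>Universal approximation by sigmoid networks\<close>

text \<open>The class \<Lambda> of inner functions is a parameter because two instances occur:
  linear forms in the sensor readings, and linear forms of t in the output domain.\<close>

inductive_set sig_net :: "(real \<Rightarrow> real) \<Rightarrow> ('a \<Rightarrow> real) set \<Rightarrow> ('a \<Rightarrow> real) set" for \<sigma> \<Lambda> where
  zero: "(\<lambda>x. 0) \<in> sig_net \<sigma> \<Lambda>"
| add: "l \<in> \<Lambda> \<Longrightarrow> f \<in> sig_net \<sigma> \<Lambda> \<Longrightarrow> (\<lambda>x. c * \<sigma> (l x + b) + f x) \<in> sig_net \<sigma> \<Lambda>"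

lemma sig_net_add: "f \<in> sig_net \<sigma> \<Lambda> \<Longrightarrow> g \<in> sig_net \<sigma> \<Lambda> \<Longrightarrow> (\<lambda>x. f x + g x) \<in> sig_net \<sigma> \<Lambda>"
proof (induction rule: sig_net.induct)
  case (add l f c b)
  then have "(\<lambda>x. c * \<sigma> (l x + b) + (f x + g x)) \<in> sig_net \<sigma> \<Lambda>" by (intro sig_net.add) auto
  then show ?case by (simp add: add.assoc)
qed simp

lemma sig_net_single: "l \<in> \<Lambda> \<Longrightarrow> (\<lambda>x. c * \<sigma> (l x + b)) \<in> sig_net \<sigma> \<Lambda>"
  using sig_net.add[OF _ sig_net.zero, of l \<Lambda> c \<sigma> b] by simp

lemma sig_net_sum:
  "finite I \<Longrightarrow> (\<And>i. i \<in> I \<Longrightarrow> f i \<in> sig_net \<sigma> \<Lambda>) \<Longrightarrow> (\<lambda>x. \<Sum>i\<in>I. f i x) \<in> sig_net \<sigma> \<Lambda>"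
  by (induction rule: finite_induct) (auto intro: sig_net.zero sig_net_add)

text \<open>The product-to-sum formula turns these sums into a ring, as Stone-Weierstrass demands;
  products of sigmoids admit no such reduction.\<close>

inductive_set cos_sums :: "('a \<Rightarrow> real) set \<Rightarrow> ('a \<Rightarrow> real) set" for \<Lambda> where
  single: "l \<in> \<Lambda> \<Longrightarrow> (\<lambda>x. c * cos (l x + b)) \<in> cos_sums \<Lambda>"
| add: "f \<in> cos_sums \<Lambda> \<Longrightarrow> g \<in> cos_sums \<Lambda> \<Longrightarrow> (\<lambda>x. f x + g x) \<in> cos_sums \<Lambda>"

text \<open>Stone--Weierstrass for sums of cosines of the functions in \<open>\<Lambda>\<close>, each of which is then replaced by
  sigmoids of a single variable.\<close>

lemma sigmoid_universal_approximation:
  fixes S :: "'a::t2_space set"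
  assumes \<sigma>: "sigmoid_fun \<sigma>" and S: "compact S"
    and L: "\<And>l. l \<in> \<Lambda> \<Longrightarrow> continuous_on S l" "\<Lambda> \<noteq> {}"
      "\<And>l l'. l \<in> \<Lambda> \<Longrightarrow> l' \<in> \<Lambda> \<Longrightarrow> (\<lambda>x. l x + l' x) \<in> \<Lambda>" "\<And>l a. l \<in> \<Lambda> \<Longrightarrow> (\<lambda>x. a * l x) \<in> \<Lambda>"
      "\<And>x y. x \<in> S \<Longrightarrow> y \<in> S \<Longrightarrow> x \<noteq> y \<Longrightarrow> \<exists>l\<in>\<Lambda>. l x \<noteq> l y"
    and f: "continuous_on S f" and e: "e > 0"
  shows "\<exists>g\<in>sig_net \<sigma> \<Lambda>. \<forall>x\<in>S. \<bar>f x - g x\<bar> < e"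
proof -
  obtain l0 where l0: "l0 \<in> \<Lambda>" using L(2) by auto
  have zero: "(\<lambda>x. 0) \<in> \<Lambda>" using L(4)[OF l0, of 0] by simp
  have diff: "(\<lambda>x. l x - l' x) \<in> \<Lambda>" if "l \<in> \<Lambda>" "l' \<in> \<Lambda>" for l l'
    using L(3)[OF that(1) L(4)[OF that(2), of "-1"]] by simp
  have cont: "continuous_on S h" if "h \<in> cos_sums \<Lambda>" for h
    using that
  proof induction
    case (single l c b)
    show ?case by (intro continuous_intros L(1)[OF single])
  next
    case (add f g) show ?case by (intro continuous_on_add add)
  qed
  have mult1: "(\<lambda>x. (c * cos (l x + b)) * g x) \<in> cos_sums \<Lambda>" if "g \<in> cos_sums \<Lambda>" "l \<in> \<Lambda>" for g l c b
    using that
  proof induction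
    case (single l' c' b')
    have "(c * cos (l x + b)) * (c' * cos (l' x + b')) =
        c * c' / 2 * cos ((l x + l' x) + (b + b')) + c * c' / 2 * cos ((l x - l' x) + (b - b'))" for x
    proof -
      have "cos ((l x + b) + (l' x + b')) + cos ((l x + b) - (l' x + b')) = 2 * (cos (l x + b) * cos (l' x + b'))"
        by (simp add: cos_add cos_diff)
      then have *: "cos ((l x + l' x) + (b + b')) + cos ((l x - l' x) + (b - b')) = 2 * (cos (l x + b) * cos (l' x + b'))"
        by (simp add: algebra_simps)
      show ?thesis unfolding distrib_left[symmetric] * by simp
    qed
    then show ?case
      using cos_sums.add[OF cos_sums.single[OF L(3)[OF single(2,1)], of "c * c' / 2" "b + b'"]
          cos_sums.single[OF diff[OF single(2,1)], of "c * c' / 2" "b - b'"]] by simp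
  next
    case (add f g)
    then show ?case using cos_sums.add by (simp add: distrib_left)
  qed
  have mult: "(\<lambda>x. h x * g x) \<in> cos_sums \<Lambda>" if "h \<in> cos_sums \<Lambda>" "g \<in> cos_sums \<Lambda>" for h g
    using that
  proof induction
    case (add f1 f2)
    then show ?case using cos_sums.add by (simp add: distrib_right)
  qed (use mult1 in auto)
  have const: "(\<lambda>x. c) \<in> cos_sums \<Lambda>" for c using cos_sums.single[OF zero, of c 0] by simp
  interpret function_ring_on "cos_sums \<Lambda>" S
  proof
    show "compact S" by (rule S)
    fix x y assume xy: "x \<in> S" "y \<in> S" "x \<noteq> y"
    then obtain l where l: "l \<in> \<Lambda>" "l x \<noteq> l y" using L(5) by blast
    \<comment> \<open>With this frequency and the phase \<open>- a * l y\<close> the cosine is -1 at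
      x and 1 at y.\<close>
    define a where "a = pi / (l x - l y)"
    have "a * (l x - l y) = pi" using l(2) by (simp add: a_def)
    then have "a * l x + - a * l y = pi" by (simp add: right_diff_distrib)
    then have "1 * cos (a * l x + - a * l y) \<noteq> 1 * cos (a * l y + - a * l y)" by simp
    then show "\<exists>f\<in>cos_sums \<Lambda>. f x \<noteq> f y"
      by (rule bexI[OF _ cos_sums.single[OF L(4)[OF l(1), of a], of 1 "- a * l y"]])
  qed (auto intro: cont cos_sums.add mult const)
  have approx: "\<exists>g\<in>sig_net \<sigma> \<Lambda>. \<forall>x\<in>S. \<bar>h x - g x\<bar> < e" if "h \<in> cos_sums \<Lambda>" "e > 0" for h e
    using that
  proof (induction arbitrary: e)
    case (single l c b)
    have "compact ((\<lambda>x. l x + b) ` S)" using L(1)[OF single(1)] S by (intro compact_continuous_image continuous_intros)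
    then obtain B0 where B0: "\<forall>y\<in>(\<lambda>x. l x + b) ` S. norm y \<le> B0" using compact_imp_bounded bounded_iff by blast
    define B where "B = max B0 1"
    have lB: "l x + b \<in> {-B..B}" if "x \<in> S" for x
      using B0[rule_format, OF imageI[OF that]] by (auto simp: B_def)
    have "continuous_on {-B..B} (\<lambda>y. c * cos y)" "B > 0" by (auto intro!: continuous_intros simp: B_def)
    from sigmoid_approx_interval[OF \<sigma> this single(2)]
    obtain n :: nat and d M t c0 where app: "\<forall>y\<in>{-B..B}. \<bar>c * cos y - (c0 + (\<Sum>i=1..n. d i * \<sigma> (M * y + t i)))\<bar> < e"
      by blast
    \<comment> \<open>The additive constant is itself written as a sigmoid term: the inner function
      is 0, and \<open>\<sigma> 0\<close> is positive.\<close>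
    let ?g = "\<lambda>x. (c0 / \<sigma> 0) * \<sigma> (0 + 0) + (\<Sum>i\<in>{1..n}. d i * \<sigma> (M * l x + (M * b + t i)))"
    have gn: "?g \<in> sig_net \<sigma> \<Lambda>"
      by (intro sig_net_add sig_net_single[OF zero] sig_net_sum sig_net_single[OF L(4)[OF single(1)]]) auto
    have "\<bar>c * cos (l x + b) - ?g x\<bar> < e" if "x \<in> S" for x
    proof -
      have "?g x = c0 + (\<Sum>i=1..n. d i * \<sigma> (M * (l x + b) + t i))"
        using sigmoid_range(1)[OF \<sigma>, of 0] by (simp add: algebra_simps)
      then show ?thesis using app[rule_format, OF lB[OF that]] by simp
    qed
    then show ?case by (intro bexI[OF _ gn] ballI)
  next
    case (add f g)
    have e2: "e / 2 > 0" using add.prems by simp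
    obtain f' where f': "f' \<in> sig_net \<sigma> \<Lambda>" "\<forall>x\<in>S. \<bar>f x - f' x\<bar> < e / 2" using add.IH(1)[OF e2] by (rule bexE) (rule that)
    obtain g' where g': "g' \<in> sig_net \<sigma> \<Lambda>" "\<forall>x\<in>S. \<bar>g x - g' x\<bar> < e / 2" using add.IH(2)[OF e2] by (rule bexE) (rule that)
    have "\<bar>f x + g x - (f' x + g' x)\<bar> < e" if "x \<in> S" for x
      using f'(2)[rule_format, OF that] g'(2)[rule_format, OF that] by linarith
    then show ?case by (intro bexI[OF _ sig_net_add[OF f'(1) g'(1)]]) blast
  qed
  obtain h where h: "h \<in> cos_sums \<Lambda>" "\<forall>x\<in>S. \<bar>f x - h x\<bar> < e / 2" using Stone_Weierstrass_basic[OF f, of "e/2"] e by auto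
  obtain g where g: "g \<in> sig_net \<sigma> \<Lambda>" "\<forall>x\<in>S. \<bar>h x - g x\<bar> < e / 2" using approx[OF h(1), of "e/2"] e by auto
  have "\<bar>f x - g x\<bar> < e" if "x \<in> S" for x
    using h(2)[rule_format, OF that] g(2)[rule_format, OF that] by linarith
  then show ?thesis using g(1) by blast
qed

text \<open>f is first truncated at height n. Continuous functions converging to f almost everywhere
  are clipped at the same height, so that on a set of finite measure dominated convergence has a
  constant majorant.\<close>

lemma l2_dense_continuous:
  fixes \<Omega> :: "'a::euclidean_space set"
  assumes dom: "open \<Omega>" "bounded \<Omega>" and f: "f \<in> elems (l2 (lebesgue_on \<Omega>))" and e: "e > 0"
  obtains h where "continuous_on UNIV h" "h \<in> elems (l2 (lebesgue_on \<Omega>))" "fs_norm (l2 (lebesgue_on \<Omega>)) (f - h) < e"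
proof -
  let ?M = "lebesgue_on \<Omega>"
  interpret L: pre_hilbert "l2 ?M" by (rule pre_hilbert_l2)
  note fin = finite_measure_lebesgue_on[OF dom]
  define cl where "cl B y = max (- B) (min B y)" for B y :: real
  have clB: "\<bar>cl B y\<bar> \<le> B" if "B \<ge> 0" for B y using that by (auto simp: cl_def)
  have clc: "continuous_on UNIV (cl B)" for B unfolding cl_def by (intro continuous_intros)
  have clm: "(\<lambda>x. cl B (g x)) \<in> borel_measurable ?M" if "g \<in> borel_measurable ?M" for B g
    using that unfolding cl_def by (intro borel_measurable_max borel_measurable_min) auto
  have fm: "f \<in> borel_measurable ?M" using f by (rule l2_measurable)
  have sq0: "\<exists>n. fs_norm (l2 ?M) (g n) < \<epsilon>" if "(\<lambda>n. \<integral>t. (g n t)\<^sup>2 \<partial>?M) \<longlonglongrightarrow> 0" "\<epsilon> > 0" for g :: "nat \<Rightarrow> 'a \<Rightarrow> real" and \<epsilon>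
  proof -
    have "\<forall>\<^sub>F n in sequentially. (\<integral>t. (g n t)\<^sup>2 \<partial>?M) < \<epsilon>\<^sup>2" using that by (intro order_tendstoD) auto
    then obtain n where n: "\<forall>i\<ge>n. (\<integral>t. (g i t)\<^sup>2 \<partial>?M) < \<epsilon>\<^sup>2" unfolding eventually_sequentially by (rule exE) (rule that)
    have "(fs_norm (l2 ?M) (g n))\<^sup>2 < \<epsilon>\<^sup>2" unfolding l2_norm_sq by (rule n[rule_format, OF order_refl])
    then have "fs_norm (l2 ?M) (g n) < \<epsilon>" using less_imp_le[OF that(2)] by (rule power_less_imp_less_base)
    then show ?thesis by (rule exI)
  qed
  have "(\<lambda>n. \<integral>t. ((f - (\<lambda>x. cl (real n) (f x))) t)\<^sup>2 \<partial>?M) \<longlonglongrightarrow> (\<integral>t. 0 \<partial>?M)"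
  proof (rule integral_dominated_convergence[where w="\<lambda>t. (f t)\<^sup>2"])
    show "integrable ?M (\<lambda>t. (f t)\<^sup>2)" using f by (simp add: mem_l2)
    show "(\<lambda>t. ((f - (\<lambda>x. cl (real n) (f x))) t)\<^sup>2) \<in> borel_measurable ?M" for n
      using fm clm[OF fm] by (auto simp: fun_diff_def)
    show "AE t in ?M. (\<lambda>n. ((f - (\<lambda>x. cl (real n) (f x))) t)\<^sup>2) \<longlonglongrightarrow> 0"
    proof (intro AE_I2 tendsto_eventually)
      fix t
      obtain N where "\<bar>f t\<bar> \<le> real N" using real_arch_simple by blast
      then have "((f - (\<lambda>x. cl (real n) (f x))) t)\<^sup>2 = 0" if "n \<ge> N" for n using that by (auto simp: cl_def)
      then show "\<forall>\<^sub>F n in sequentially. ((f - (\<lambda>x. cl (real n) (f x))) t)\<^sup>2 = 0"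
        using eventually_sequentially by blast
    qed
    show "AE t in ?M. norm (((f - (\<lambda>x. cl (real n) (f x))) t)\<^sup>2) \<le> (f t)\<^sup>2" for n
    proof (rule AE_I2)
      fix t
      have "\<bar>f t - cl (real n) (f t)\<bar> \<le> \<bar>f t\<bar>" by (auto simp: cl_def)
      then have "\<bar>f t - cl (real n) (f t)\<bar>\<^sup>2 \<le> \<bar>f t\<bar>\<^sup>2" by (intro power_mono) auto
      then show "norm (((f - (\<lambda>x. cl (real n) (f x))) t)\<^sup>2) \<le> (f t)\<^sup>2" by simp
    qed
  qed auto
  then obtain n where n: "fs_norm (l2 ?M) (f - (\<lambda>x. cl (real n) (f x))) < e / 2"
    using sq0[of "\<lambda>n. f - (\<lambda>x. cl (real n) (f x))" "e/2"] e by auto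
  let ?f = "\<lambda>x. cl (real n) (f x)"
  have fl: "?f \<in> elems (l2 ?M)" by (rule bounded_mem_l2[OF fin clm[OF fm] clB]) simp
  define f0 where "f0 x = (if x \<in> \<Omega> then f x else 0)" for x
  have "f0 \<in> borel_measurable lebesgue"
    using fm dom(1) borel_measurable_if[of \<Omega> f] by (simp add: f0_def[abs_def])
  then have "f0 measurable_on UNIV" by (rule lebesgue_measurable_imp_measurable_on) simp
  then obtain N g where g: "negligible N" "\<And>n. continuous_on UNIV (g n)" "\<And>x. x \<notin> N \<Longrightarrow> (\<lambda>n. g n x) \<longlonglongrightarrow> f0 x"
    unfolding measurable_on_def by auto
  have gm: "g i \<in> borel_measurable ?M" for i
    using continuous_on_subset[OF g(2)] dom(1) by (intro continuous_imp_measurable_on_sets_lebesgue) auto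
  let ?h = "\<lambda>i x. cl (real n) (g i x)"
  have hl: "?h i \<in> elems (l2 ?M)" for i by (rule bounded_mem_l2[OF fin clm[OF gm] clB]) simp
  have hc: "continuous_on UNIV (?h i)" for i by (rule continuous_on_compose2[OF clc g(2)]) auto
  have "(\<lambda>i. \<integral>t. ((?f - ?h i) t)\<^sup>2 \<partial>?M) \<longlonglongrightarrow> (\<integral>t. 0 \<partial>?M)"
  proof (rule integral_dominated_convergence[where w="\<lambda>t. (2 * real n)\<^sup>2"])
    show "integrable ?M (\<lambda>t. (2 * real n)\<^sup>2)" using fin by (simp add: finite_measure.integrable_const)
    show "(\<lambda>t. ((?f - ?h i) t)\<^sup>2) \<in> borel_measurable ?M" for i
      using clm[OF fm] clm[OF gm] by (auto simp: fun_diff_def)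
    have "N \<in> null_sets lebesgue" using g(1) by (simp add: negligible_iff_null_sets)
    then have "AE t in lebesgue. t \<notin> N" by (rule AE_not_in)
    then have "AE t in ?M. t \<notin> N \<and> t \<in> \<Omega>" using dom(1) by (auto simp: AE_restrict_space_iff elim: AE_mp)
    then show "AE t in ?M. (\<lambda>i. ((?f - ?h i) t)\<^sup>2) \<longlonglongrightarrow> 0"
    proof eventually_elim
      case (elim t)
      have "isCont (cl (real n)) (f t)" using clc by (simp add: continuous_on_eq_continuous_at)
      moreover have "(\<lambda>i. g i t) \<longlonglongrightarrow> f t" using g(3)[of t] elim by (simp add: f0_def)
      ultimately have "(\<lambda>i. cl (real n) (g i t)) \<longlonglongrightarrow> cl (real n) (f t)" by (rule isCont_tendsto_compose)
      then have "(\<lambda>i. (cl (real n) (f t) - cl (real n) (g i t))\<^sup>2) \<longlonglongrightarrow> (cl (real n) (f t) - cl (real n) (f t))\<^sup>2"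
        by (intro tendsto_intros)
      then show ?case by simp
    qed
    show "AE t in ?M. norm (((?f - ?h i) t)\<^sup>2) \<le> (2 * real n)\<^sup>2" for i
    proof (rule AE_I2)
      fix t
      have "\<bar>cl (real n) (f t) - cl (real n) (g i t)\<bar> \<le> 2 * real n"
        using clB[of "real n" "f t"] clB[of "real n" "g i t"] by linarith
      then have "\<bar>cl (real n) (f t) - cl (real n) (g i t)\<bar>\<^sup>2 \<le> (2 * real n)\<^sup>2" by (intro power_mono) auto
      then show "norm (((?f - ?h i) t)\<^sup>2) \<le> (2 * real n)\<^sup>2" by simp
    qed
  qed auto
  then obtain i where i: "fs_norm (l2 ?M) (?f - ?h i) < e / 2" using sq0[of "\<lambda>i. ?f - ?h i" "e/2"] e by auto
  have "fs_norm (l2 ?M) (f - ?h i) < e" using L.norm_triangle_diff[OF f fl hl[of i]] n i by linarith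
  then show ?thesis using that[OF hc hl] by blast
qed

section \<open>Neural operators with fixed sensors\<close>

text \<open>The sensors are fixed in advance, so that the sum of two such operators has the same
  sensors and differs only in its coefficients.\<close>

definition net_operators ::
  "(real \<Rightarrow> real) \<Rightarrow> (real^'m) set \<Rightarrow> nat \<Rightarrow> (nat \<Rightarrow> real^'m) \<Rightarrow> ((real^'m \<Rightarrow> real) \<Rightarrow> (real^'n \<Rightarrow> real)) set" where
  "net_operators \<sigma> \<Omega> L s = {A. \<exists>T\<in>coeff_vectors \<Omega>. no_L T = L \<and> no_s T = s \<and> neural_operator \<sigma> T = A}"

lemma net_operators_single:
  assumes "1 \<le> L" "\<And>l. l \<in> {1..L} \<Longrightarrow> s l \<in> \<Omega>"
  shows "(\<lambda>x t. c * \<sigma> ((\<Sum>l=1..L. w l * x (s l)) + b) * \<sigma> (v \<bullet> t + z)) \<in> net_operators \<sigma> \<Omega> L s"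
  unfolding net_operators_def
  by (rule CollectI, rule bexI[of _ "\<lparr>no_J = 1, no_K = 1, no_L = L, no_alpha = \<lambda>_ _. c, no_w = \<lambda>_ _. w, no_wvec = \<lambda>_. v,
      no_theta = \<lambda>_ _. b, no_s = s, no_zeta = \<lambda>_. z\<rparr>"])
    (use assms in \<open>auto simp: neural_operator_def coeff_vectors_def\<close>)

text \<open>Indices are concatenated in j and in k, and \<alpha> is set to 0 on the off-diagonal
  blocks. Each of the two double sums then survives on its own diagonal block.\<close>

lemma net_operators_add:
  assumes "A \<in> net_operators \<sigma> \<Omega> L s" "B \<in> net_operators \<sigma> \<Omega> L s"
  shows "(\<lambda>x t. A x t + B x t) \<in> net_operators \<sigma> \<Omega> L s"
proof -
  obtain T1 where T1: "T1 \<in> coeff_vectors \<Omega>" "no_L T1 = L" "no_s T1 = s" "A = neural_operator \<sigma> T1"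
    using assms(1) by (auto simp: net_operators_def)
  obtain T2 where T2: "T2 \<in> coeff_vectors \<Omega>" "no_L T2 = L" "no_s T2 = s" "B = neural_operator \<sigma> T2"
    using assms(2) by (auto simp: net_operators_def)
  define J1 J2 K1 K2 where "J1 = no_J T1" and "J2 = no_J T2" and "K1 = no_K T1" and "K2 = no_K T2"
  define T where "T = \<lparr>no_J = J1 + J2, no_K = K1 + K2, no_L = L,
    no_alpha = \<lambda>j k. if j \<le> J1 then (if k \<le> K1 then no_alpha T1 j k else 0)
      else (if k \<le> K1 then 0 else no_alpha T2 (j - J1) (k - K1)),
    no_w = \<lambda>j k. if j \<le> J1 then no_w T1 j k else no_w T2 (j - J1) (k - K1),
    no_wvec = \<lambda>j. if j \<le> J1 then no_wvec T1 j else no_wvec T2 (j - J1),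
    no_theta = \<lambda>j k. if j \<le> J1 then no_theta T1 j k else no_theta T2 (j - J1) (k - K1),
    no_s = s, no_zeta = \<lambda>j. if j \<le> J1 then no_zeta T1 j else no_zeta T2 (j - J1)\<rparr>"
  have "T \<in> coeff_vectors \<Omega>" using T1 T2 by (auto simp: T_def coeff_vectors_def J1_def K1_def)
  moreover have "neural_operator \<sigma> T x t = A x t + B x t" for x t
  proof -
    let ?a = "\<lambda>T j k. no_alpha T j k * \<sigma> ((\<Sum>l=1..no_L T. no_w T j k l * x (no_s T l)) + no_theta T j k) * \<sigma> (no_wvec T j \<bullet> t + no_zeta T j)"
    have "neural_operator \<sigma> T x t = (\<Sum>j=1..J1 + J2. \<Sum>k=1..K1 + K2. ?a T j k)"
      by (simp add: neural_operator_def T_def)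
    also have "\<dots> = (\<Sum>j=1..J1. \<Sum>k=1..K1 + K2. ?a T j k) + (\<Sum>j=J1+1..J1 + J2. \<Sum>k=1..K1 + K2. ?a T j k)"
      by (rule sum.ub_add_nat) simp
    also have "(\<Sum>j=1..J1. \<Sum>k=1..K1 + K2. ?a T j k) = (\<Sum>j=1..J1. \<Sum>k=1..K1. ?a T1 j k)"
    proof (rule sum.cong[OF refl])
      fix j assume "j \<in> {1..J1}"
      then show "(\<Sum>k=1..K1 + K2. ?a T j k) = (\<Sum>k=1..K1. ?a T1 j k)"
        using T1 by (intro sum.mono_neutral_cong_right) (auto simp: T_def)
    qed
    also have "(\<Sum>j=J1+1..J1 + J2. \<Sum>k=1..K1 + K2. ?a T j k) = (\<Sum>j=1..J2. \<Sum>k=1..K1 + K2. ?a T (j + J1) k)"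
      using sum.shift_bounds_cl_nat_ivl[of "\<lambda>j. \<Sum>k=1..K1 + K2. ?a T j k" 1 J1 J2] by (simp add: add.commute)
    also have "\<dots> = (\<Sum>j=1..J2. \<Sum>k=1..K2. ?a T2 j k)"
    proof (rule sum.cong[OF refl])
      fix j assume j: "j \<in> {1..J2}"
      have "(\<Sum>k=1..K1 + K2. ?a T (j + J1) k) = (\<Sum>k=K1+1..K1 + K2. ?a T (j + J1) k)"
        using j by (intro sum.mono_neutral_right) (auto simp: T_def)
      also have "\<dots> = (\<Sum>k=1..K2. ?a T (j + J1) (k + K1))"
        using sum.shift_bounds_cl_nat_ivl[of "\<lambda>k. ?a T (j + J1) k" 1 K1 K2] by (simp add: add.commute)
      also have "\<dots> = (\<Sum>k=1..K2. ?a T2 j k)" using j T2 by (intro sum.cong) (auto simp: T_def)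
      finally show "(\<Sum>k=1..K1 + K2. ?a T (j + J1) k) = (\<Sum>k=1..K2. ?a T2 j k)" .
    qed
    finally show ?thesis by (simp add: T1(4) T2(4) neural_operator_def J1_def J2_def K1_def K2_def)
  qed
  moreover have "no_L T = L" "no_s T = s" by (auto simp: T_def)
  ultimately show ?thesis unfolding net_operators_def by blast
qed

text \<open>Padding by 0 encodes the L readings as one point of the function space
  \<open>nat \<Rightarrow> real\<close>, so the number of sensors need not be a type.\<close>

definition sensor_values :: "nat \<Rightarrow> (nat \<Rightarrow> 'a) \<Rightarrow> ('a \<Rightarrow> real) \<Rightarrow> nat \<Rightarrow> real" where
  "sensor_values L s x = (\<lambda>l. if l \<in> {1..L} then x (s l) else 0)"

definition sensor_forms :: "nat \<Rightarrow> ((nat \<Rightarrow> real) \<Rightarrow> real) set" where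
  "sensor_forms L = {\<lambda>v. \<Sum>l=1..L. w l * v l | w. True}"

definition linear_forms :: "('a::euclidean_space \<Rightarrow> real) set" where
  "linear_forms = {\<lambda>t. w \<bullet> t | w. True}"

text \<open>Multiplying out leaves products of one sigmoid in the readings and one sigmoid in t,
  each of which is an operator with a single term.\<close>

lemma net_operators_product:
  assumes Ls: "1 \<le> L" "\<And>l. l \<in> {1..L} \<Longrightarrow> s l \<in> \<Omega>"
    and f: "f \<in> sig_net \<sigma> (sensor_forms L)" and g: "g \<in> sig_net \<sigma> linear_forms"
  shows "(\<lambda>x t. f (sensor_values L s x) * g t) \<in> net_operators \<sigma> \<Omega> L s"
proof -
  \<comment> \<open>Coefficient vectors have at least one term, so the zero operator needs an
    explicit zero coefficient.\<close>
  have zero: "(\<lambda>x t. 0) \<in> net_operators \<sigma> \<Omega> L s"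
    using net_operators_single[where L=L and s=s and \<Omega>=\<Omega> and \<sigma>=\<sigma> and c=0, OF Ls] by simp
  have one: "(\<lambda>x t. c * \<sigma> (l (sensor_values L s x) + b) * g t) \<in> net_operators \<sigma> \<Omega> L s" if l: "l \<in> sensor_forms L" for l c b
    using g
  proof induction
    case zero then show ?case using \<open>(\<lambda>x t. 0) \<in> net_operators \<sigma> \<Omega> L s\<close> by simp
  next
    case (add l' f c' b')
    obtain w where w: "l = (\<lambda>v. \<Sum>l=1..L. w l * v l)" using l by (auto simp: sensor_forms_def)
    obtain v where v: "l' = (\<lambda>t. v \<bullet> t)" using add(1) by (auto simp: linear_forms_def)
    have "l (sensor_values L s x) = (\<Sum>l=1..L. w l * x (s l))" for x
      unfolding w by (intro sum.cong) (auto simp: sensor_values_def)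
    then have "(\<lambda>x t. c * c' * \<sigma> (l (sensor_values L s x) + b) * \<sigma> (v \<bullet> t + b')) \<in> net_operators \<sigma> \<Omega> L s"
      using net_operators_single[where L=L and s=s and \<Omega>=\<Omega> and \<sigma>=\<sigma> and c="c * c'" and w=w and b=b and v=v and z=b', OF Ls] by simp
    from net_operators_add[OF this add.IH] show ?case by (simp add: v algebra_simps)
  qed
  show ?thesis using f
  proof induction
    case zero then show ?case using \<open>(\<lambda>x t. 0) \<in> net_operators \<sigma> \<Omega> L s\<close> by simp
  next
    case (add l f c b)
    from net_operators_add[OF one[OF add(1)] add.IH] show ?case by (simp add: algebra_simps)
  qed
qed

lemma net_operators_sum:
  assumes "finite I" "I \<noteq> {}" "\<And>i. i \<in> I \<Longrightarrow> A i \<in> net_operators \<sigma> \<Omega> L s"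
  shows "(\<lambda>x t. \<Sum>i\<in>I. A i x t) \<in> net_operators \<sigma> \<Omega> L s"
  using assms by (induction rule: finite_ne_induct) (auto intro: net_operators_add)

lemma sig_net_continuous:
  assumes "sigmoid_fun \<sigma>" "\<And>l. l \<in> \<Lambda> \<Longrightarrow> continuous_on S l" "f \<in> sig_net \<sigma> \<Lambda>"
  shows "continuous_on S f"
  using assms(3)
proof induction
  case (add l f c b)
  have "continuous_on S (\<lambda>x. l x + b)" by (intro continuous_on_add continuous_on_const assms(2) add)
  then have "continuous_on S (\<lambda>x. \<sigma> (l x + b))"
    by (rule continuous_on_compose2[OF sigmoid_continuous[OF assms(1), of UNIV]]) auto
  then show ?case by (intro continuous_on_add continuous_on_mult continuous_on_const add)
qed simp

text \<open>The bounded readings form a product of intervals and singletons {0}, compact by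
  Tychonoff; two of its points differ in one of the first L coordinates, and this coordinate is a
  sensor form.\<close>

lemma sensor_forms_approx:
  assumes \<sigma>: "sigmoid_fun \<sigma>" and f: "continuous_on (PiE UNIV (\<lambda>l. if l \<in> {1..L} then {-B..B} else {0::real})) f" and e: "e > 0"
  shows "\<exists>g\<in>sig_net \<sigma> (sensor_forms L). \<forall>v\<in>PiE UNIV (\<lambda>l. if l \<in> {1..L} then {-B..B} else {0}). \<bar>f v - g v\<bar> < e"
proof (rule sigmoid_universal_approximation[OF \<sigma> _ _ _ _ _ _ f e])
  let ?S = "PiE UNIV (\<lambda>l. if l \<in> {1..L} then {-B..B} else {0::real})"
  have "compactin (product_topology (\<lambda>_. euclidean) UNIV) ?S"
    by (auto simp: compactin_PiE)
  then show "compact ?S" by (simp add: euclidean_product_topology)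
  show "continuous_on ?S l" if "l \<in> sensor_forms L" for l
    using that by (auto simp: sensor_forms_def intro!: continuous_intros continuous_on_subset[OF continuous_on_product_coordinates])
  show "sensor_forms L \<noteq> {}" by (auto simp: sensor_forms_def)
  show "(\<lambda>x. l x + l' x) \<in> sensor_forms L" if ll: "l \<in> sensor_forms L" "l' \<in> sensor_forms L" for l l'
  proof -
    obtain w w' where "l = (\<lambda>v. \<Sum>l=1..L. w l * v l)" "l' = (\<lambda>v. \<Sum>l=1..L. w' l * v l)"
      using ll by (auto simp: sensor_forms_def)
    then have "(\<lambda>x. l x + l' x) = (\<lambda>v. \<Sum>l=1..L. (w l + w' l) * v l)" by (simp add: sum.distrib distrib_right)
    then show ?thesis unfolding sensor_forms_def by (intro CollectI exI[of _ "\<lambda>l. w l + w' l"]) simp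
  qed
  show "(\<lambda>x. a * l x) \<in> sensor_forms L" if ll: "l \<in> sensor_forms L" for l a
  proof -
    obtain w where "l = (\<lambda>v. \<Sum>l=1..L. w l * v l)" using ll by (auto simp: sensor_forms_def)
    then have "(\<lambda>x. a * l x) = (\<lambda>v. \<Sum>l=1..L. (a * w l) * v l)" by (simp add: sum_distrib_left mult.assoc)
    then show ?thesis unfolding sensor_forms_def by (intro CollectI exI[of _ "\<lambda>l. a * w l"]) simp
  qed
  show "\<exists>l\<in>sensor_forms L. l x \<noteq> l y" if xy: "x \<in> ?S" "y \<in> ?S" "x \<noteq> y" for x y
  proof -
    obtain i where i: "x i \<noteq> y i" using xy(3) by auto
    have iL: "i \<in> {1..L}"
    proof (rule ccontr)
      assume "i \<notin> {1..L}"
      then have "x i = 0" "y i = 0" using PiE_mem[OF xy(1), of i] PiE_mem[OF xy(2), of i] by (auto split: if_splits)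
      with i show False by simp
    qed
    have sel: "(\<Sum>l=1..L. (if l = i then 1 else 0) * z l) = z i" for z :: "nat \<Rightarrow> real"
      using iL by (simp add: if_distrib[of "\<lambda>c. c * _"] cong: if_cong)
    have "(\<lambda>v. \<Sum>l=1..L. (if l = i then 1 else 0) * v l) \<in> sensor_forms L"
      unfolding sensor_forms_def by (rule CollectI, rule exI[of _ "\<lambda>l. if l = i then 1 else 0"]) (rule conjI[OF refl TrueI])
    then show ?thesis by (rule bexI[rotated]) (unfold sel, rule i)
  qed
qed

lemma l2_approx_sig_net:
  fixes \<Omega> :: "'a::euclidean_space set"
  assumes \<sigma>: "sigmoid_fun \<sigma>" and dom: "open \<Omega>" "bounded \<Omega>" and f: "f \<in> elems (l2 (lebesgue_on \<Omega>))" and e: "e > 0"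
  shows "\<exists>g\<in>sig_net \<sigma> linear_forms. g \<in> elems (l2 (lebesgue_on \<Omega>)) \<and> fs_norm (l2 (lebesgue_on \<Omega>)) (f - g) < e"
proof -
  let ?M = "lebesgue_on \<Omega>"
  interpret L: pre_hilbert "l2 ?M" by (rule pre_hilbert_l2)
  note fin = finite_measure_lebesgue_on[OF dom]
  obtain h where h: "continuous_on UNIV h" "h \<in> elems (l2 ?M)" "fs_norm (l2 ?M) (f - h) < e / 2"
    using l2_dense_continuous[OF dom f, of "e/2"] e by auto
  define m where "m = sqrt (measure ?M (space ?M))"
  have m: "m \<ge> 0" by (simp add: m_def)
  define e' where "e' = (e / 2) / (m + 1)"
  have e': "e' > 0" using e m by (simp add: e'_def)
  have lc: "continuous_on A l" if "l \<in> linear_forms" for l :: "'a \<Rightarrow> real" and A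
    using that by (auto simp: linear_forms_def intro!: continuous_intros)
  have "\<exists>g\<in>sig_net \<sigma> linear_forms. \<forall>x\<in>closure \<Omega>. \<bar>h x - g x\<bar> < e'"
  proof (rule sigmoid_universal_approximation[OF \<sigma> _ lc _ _ _ _ continuous_on_subset[OF h(1)] e'])
    show "compact (closure \<Omega>)" using dom by simp
    show "linear_forms \<noteq> {}" by (auto simp: linear_forms_def)
    show "(\<lambda>x. l x + l' x) \<in> linear_forms" if ll: "l \<in> linear_forms" "l' \<in> linear_forms" for l l' :: "'a \<Rightarrow> real"
    proof -
      obtain w w' where "l = (\<lambda>t. w \<bullet> t)" "l' = (\<lambda>t. w' \<bullet> t)" using ll by (auto simp: linear_forms_def)
      then have "(\<lambda>x. l x + l' x) = (\<lambda>t. (w + w') \<bullet> t)" by (simp add: inner_add_left)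
      then show ?thesis unfolding linear_forms_def by blast
    qed
    show "(\<lambda>x. a * l x) \<in> linear_forms" if l: "l \<in> linear_forms" for l :: "'a \<Rightarrow> real" and a
    proof -
      obtain w where "l = (\<lambda>t. w \<bullet> t)" using l by (auto simp: linear_forms_def)
      then have "(\<lambda>x. a * l x) = (\<lambda>t. (a *\<^sub>R w) \<bullet> t)" by simp
      then show ?thesis unfolding linear_forms_def by blast
    qed
    show "\<exists>l\<in>linear_forms. l x \<noteq> l y" if "x \<noteq> y" for x y :: 'a
    proof (intro bexI[of _ "\<lambda>t. (x - y) \<bullet> t"] notI)
      assume "(x - y) \<bullet> x = (x - y) \<bullet> y"
      then have "(x - y) \<bullet> (x - y) = 0" by (simp add: inner_diff_right)
      with that show False by simp
    qed (auto simp: linear_forms_def)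
  qed auto
  then obtain g where g: "g \<in> sig_net \<sigma> linear_forms" "\<forall>x\<in>closure \<Omega>. \<bar>h x - g x\<bar> < e'" by (rule bexE) (rule that)
  have gc: "continuous_on \<Omega> g" by (rule sig_net_continuous[OF \<sigma> lc g(1)])
  then have gm: "g \<in> borel_measurable ?M" using dom(1) by (intro continuous_imp_measurable_on_sets_lebesgue) auto
  have dm: "h - g \<in> borel_measurable ?M" using gm l2_measurable[OF h(2)] by (simp add: fun_diff_def)
  have db: "\<bar>(h - g) t\<bar> \<le> e'" if "t \<in> space ?M" for t
  proof -
    have "t \<in> \<Omega>" using that by simp
    then have "t \<in> closure \<Omega>" by (rule subsetD[OF closure_subset])
    then show ?thesis using less_imp_le[OF g(2)[rule_format]] by simp
  qed
  have dl: "h - g \<in> elems (l2 ?M)" by (rule bounded_mem_l2[OF fin dm db])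
  have "h - (h - g) \<in> elems (l2 ?M)" by (rule L.diff_mem[OF h(2) dl])
  moreover have "h - (h - g) = g" by auto
  ultimately have gl: "g \<in> elems (l2 ?M)" by (simp only:)
  have "fs_norm (l2 ?M) (h - g) \<le> e' * m" unfolding m_def by (rule bounded_l2_norm_le[OF fin dm db]) (use e' in auto)
  also have "\<dots> \<le> e' * (m + 1)" using e' by (intro mult_left_mono) auto
  also have "\<dots> = e / 2"
  proof -
    have "m + 1 \<noteq> 0" using m by linarith
    then show ?thesis by (simp only: e'_def times_divide_eq_left[of "e / 2"] nonzero_mult_div_cancel_right not_False_eq_True)
  qed
  finally have "fs_norm (l2 ?M) (f - g) < e" using L.norm_triangle_diff[OF f h(2) gl] h(3) by linarith
  then show ?thesis by (intro bexI[OF _ g(1)] conjI gl)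
qed

context sobolev_embedding
begin

text \<open>Finitely many \<open>z \<in> D\<close> are sensor-close to every \<open>u \<in> D\<close>, so a partition of unity \<open>p\<^sub>z\<close> in the sensor values
  gives \<open>F u \<approx> \<Sum>\<^sub>z p\<^sub>z(u) F z\<close>.  Replacing the \<open>p\<^sub>z\<close> and the functions \<open>F z\<close> by networks gives a neural operator.\<close>

lemma neural_operator_approx:
  fixes F :: "(real^'m \<Rightarrow> real) \<Rightarrow> (real^'n \<Rightarrow> real)" and \<Omega>\<^sub>Y :: "(real^'n) set"
  defines "G \<equiv> l2 (lebesgue_on \<Omega>\<^sub>Y)"
  assumes \<sigma>: "sigmoid_fun \<sigma>" and dom: "open \<Omega>\<^sub>Y" "bounded \<Omega>\<^sub>Y"
    and D: "closedin (weak_topology H) D" "\<And>u. u \<in> D \<Longrightarrow> fs_norm H u \<le> C" "D \<subseteq> elems H" "D \<noteq> {}"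
    and FG: "\<And>u. u \<in> D \<Longrightarrow> F u \<in> elems G"
    and F: "\<forall>x\<in>D. \<forall>e>0. \<exists>d>0. \<forall>z\<in>D. Linf_norm \<Omega> (z - x) < ereal d \<longrightarrow> fs_norm G (F z - F x) < e"
    and e: "e > 0"
  shows "\<exists>T\<in>coeff_vectors \<Omega>. \<forall>u\<in>D. fs_norm G (F u - neural_operator \<sigma> T u) \<le> e"
proof -
  interpret G: pre_hilbert G unfolding G_def by (rule pre_hilbert_l2)
  have e3: "e / 3 > 0" using e by simp
  obtain P d where P: "finite P" "P \<subseteq> \<Omega>" "P \<noteq> {}" "d > 0"
    "\<forall>u\<in>D. \<forall>v\<in>D. (\<forall>p\<in>P. \<bar>u p - v p\<bar> \<le> d) \<longrightarrow> fs_norm G (F u - F v) < e / 3"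
    using sensor_continuity[of D C G F, OF D(1-3) G.pre_hilbert_axioms FG F e3] by blast
  define L where "L = card P"
  have L: "1 \<le> L" using P(1,3) by (simp add: L_def card_gt_0_iff Suc_le_eq)
  obtain s where s: "bij_betw s {1..L} P" using ex_bij_betw_nat_finite_1[OF P(1)] unfolding L_def by blast
  have s\<Omega>: "s l \<in> \<Omega>" if "l \<in> {1..L}" for l using bij_betwE[OF s] that P(2) by blast
  have Ps: "\<exists>l\<in>{1..L}. p = s l" if "p \<in> P" for p using s that by (auto simp: bij_betw_def)
  obtain S where S: "S \<ge> 0" "\<forall>u\<in>elems H. \<forall>x\<in>\<Omega>. \<bar>u x\<bar> \<le> S * fs_norm H u" using sup_bound by blast
  define B where "B = S * C"
  have B: "\<bar>u x\<bar> \<le> B" if "u \<in> D" "x \<in> \<Omega>" for u x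
  proof -
    have "\<bar>u x\<bar> \<le> S * fs_norm H u" using S(2) D(3) that by blast
    also have "\<dots> \<le> B" unfolding B_def using D(2)[OF that(1)] S(1) by (intro mult_left_mono)
    finally show ?thesis .
  qed
  have "d / 2 > 0" using P(4) by simp
  from sup_classifier[OF this, of C] obtain code :: "(real^'m \<Rightarrow> real) \<Rightarrow> ((real^'m) \<times> (real^'m) \<Rightarrow> int)"
    where code: "finite (code ` {u \<in> elems H. fs_norm H u \<le> C})"
    "\<forall>u\<in>elems H. \<forall>v\<in>elems H. fs_norm H u \<le> C \<longrightarrow> fs_norm H v \<le> C \<longrightarrow> code u = code v \<longrightarrow>
       (\<forall>x\<in>\<Omega>. \<bar>u x - v x\<bar> \<le> d / 2)" by blast
  \<comment> \<open>One representative in \<open>D\<close> for each code; there are finitely many,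
    and each element of \<open>D\<close> is within d/2 of one of them on \<Omega>.\<close>
  define Z where "Z = inv_into D code ` (code ` D)"
  have Z: "finite Z" "Z \<subseteq> D" "Z \<noteq> {}"
  proof -
    have "code ` D \<subseteq> code ` {u \<in> elems H. fs_norm H u \<le> C}" using D by auto
    then show "finite Z" unfolding Z_def using code(1) finite_subset by blast
    show "Z \<subseteq> D" by (auto simp: Z_def inv_into_into)
    show "Z \<noteq> {}" using D(4) by (simp add: Z_def)
  qed
  have Znear: "\<exists>z\<in>Z. \<forall>x\<in>\<Omega>. \<bar>u x - z x\<bar> \<le> d / 2" if u: "u \<in> D" for u
  proof -
    let ?z = "inv_into D code (code u)"
    have z: "?z \<in> D" "code ?z = code u" using u by (auto simp: inv_into_into f_inv_into_f)
    have "?z \<in> Z" using u by (auto simp: Z_def)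
    moreover have "\<forall>x\<in>\<Omega>. \<bar>u x - ?z x\<bar> \<le> d / 2" using code(2)[rule_format, of u ?z] z u D by auto
    ultimately show ?thesis by blast
  qed
  let ?S = "PiE UNIV (\<lambda>l. if l \<in> {1..L} then {-B..B} else {0::real})"
  let ?ev = "sensor_values L s"
  have ev: "?ev u \<in> ?S" if "u \<in> D" for u
  proof -
    have "u (s l) \<in> {-B..B}" if "l \<in> {1..L}" for l
      using abs_le_D1[OF B[OF \<open>u \<in> D\<close> s\<Omega>[OF that]]] abs_le_D2[OF B[OF \<open>u \<in> D\<close> s\<Omega>[OF that]]] by simp
    then show ?thesis by (auto simp: sensor_values_def)
  qed
  \<comment> \<open>A product of tents of radius d: it is nonzero only if every reading is within d
    of that of z, the range in which \<open>F u\<close> and \<open>F z\<close> are close.\<close>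
  define \<phi> where "\<phi> z v = (\<Prod>l=1..L. max 0 (d - \<bar>v l - z (s l)\<bar>))" for z :: "real^'m \<Rightarrow> real" and v
  define \<Phi> where "\<Phi> v = (\<Sum>z\<in>Z. \<phi> z v)" for v
  \<comment> \<open>At the readings of any u in \<open>D\<close> the nearby representative makes
    every tent at least d/2, so the sum \<Phi> is at least \<eta> there. Taking the maximum with
    \<eta> in \<open>p\<close> is thus inactive at such readings, and it keeps \<open>p\<close>
    continuous on the whole product set.\<close>
  define \<eta> where "\<eta> = (d / 2) ^ L"
  have \<eta>: "\<eta> > 0" using P(4) by (simp add: \<eta>_def)
  define p where "p z v = \<phi> z v / max (\<Phi> v) \<eta>" for z v
  have \<phi>0: "0 \<le> \<phi> z v" for z v unfolding \<phi>_def by (intro prod_nonneg) auto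
  have p0: "0 \<le> p z v" for z v using \<phi>0 \<eta> by (auto simp: p_def intro!: divide_nonneg_nonneg)
  have vc: "continuous_on ?S (\<lambda>v. v l)" for l by (intro continuous_on_subset[OF continuous_on_product_coordinates]) auto
  have \<phi>c: "continuous_on ?S (\<phi> z)" for z unfolding \<phi>_def by (intro continuous_intros vc)
  have pc: "continuous_on ?S (p z)" for z
  proof -
    have "max (\<Phi> v) \<eta> \<noteq> 0" for v using \<eta> by (simp add: max_def)
    then show ?thesis unfolding p_def \<Phi>_def by (intro continuous_intros \<phi>c) auto
  qed
  have psum: "(\<Sum>z\<in>Z. p z (?ev u)) = 1" if u: "u \<in> D" for u
  proof -
    obtain z where z: "z \<in> Z" "\<forall>x\<in>\<Omega>. \<bar>u x - z x\<bar> \<le> d / 2" using Znear[OF u] by blast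
    have "(\<Prod>l\<in>{1..L}. d / 2) \<le> \<phi> z (?ev u)"
      unfolding \<phi>_def
    proof (rule prod_mono, intro conjI)
      fix l assume l: "l \<in> {1..L}"
      have "\<bar>u (s l) - z (s l)\<bar> \<le> d / 2" using z(2) s\<Omega>[OF l] by blast
      moreover have "?ev u l = u (s l)" using l by (simp add: sensor_values_def)
      ultimately have "d / 2 \<le> d - \<bar>?ev u l - z (s l)\<bar>" by simp
      then show "d / 2 \<le> max 0 (d - \<bar>?ev u l - z (s l)\<bar>)" by (rule max.coboundedI2)
    qed (use P(4) in auto)
    then have "\<eta> \<le> \<phi> z (?ev u)" by (simp add: \<eta>_def)
    also have "\<dots> \<le> \<Phi> (?ev u)" unfolding \<Phi>_def using z(1) Z(1) \<phi>0 by (intro member_le_sum) auto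
    finally have "max (\<Phi> (?ev u)) \<eta> = \<Phi> (?ev u)" "\<Phi> (?ev u) \<noteq> 0" using \<eta> by auto
    then show ?thesis by (simp add: p_def sum_divide_distrib[symmetric] \<Phi>_def[symmetric])
  qed
  have ploc: "fs_norm G (F u - F z) \<le> e / 3" if "u \<in> D" "z \<in> Z" "p z (?ev u) \<noteq> 0" for u z
  proof -
    have "\<bar>u q - z q\<bar> \<le> d" if q: "q \<in> P" for q
    proof -
      obtain l where l: "l \<in> {1..L}" "q = s l" using Ps[OF q] by blast
      have "\<phi> z (?ev u) \<noteq> 0" using \<open>p z (?ev u) \<noteq> 0\<close> by (auto simp: p_def)
      then have "max 0 (d - \<bar>?ev u l - z (s l)\<bar>) \<noteq> 0" unfolding \<phi>_def using l(1) by simp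
      then show ?thesis using l by (auto simp: sensor_values_def max_def split: if_splits)
    qed
    then show ?thesis using P(5) that Z(2) by (meson less_imp_le subsetD)
  qed
  have "\<forall>z\<in>Z. \<exists>g. g \<in> sig_net \<sigma> linear_forms \<and> g \<in> elems G \<and> fs_norm G (F z - g) < e / 3"
  proof
    fix z assume "z \<in> Z"
    then have "F z \<in> elems (l2 (lebesgue_on \<Omega>\<^sub>Y))" using FG Z(2) unfolding G_def by blast
    from l2_approx_sig_net[OF \<sigma> dom this e3] show "\<exists>g. g \<in> sig_net \<sigma> linear_forms \<and> g \<in> elems G \<and> fs_norm G (F z - g) < e / 3"
      unfolding G_def by blast
  qed
  then obtain g where g: "\<And>z. z \<in> Z \<Longrightarrow> g z \<in> sig_net \<sigma> linear_forms" "\<And>z. z \<in> Z \<Longrightarrow> g z \<in> elems G"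
    "\<And>z. z \<in> Z \<Longrightarrow> fs_norm G (F z - g z) < e / 3" by metis
  define N where "N = (\<Sum>z\<in>Z. fs_norm G (g z))"
  have N: "N \<ge> 0" unfolding N_def using g(2) G.norm_nonneg by (intro sum_nonneg) auto
  \<comment> \<open>Errors in the weights are multiplied by the norms of the output networks, whose
    sum is N; the output networks are therefore chosen before the weight networks.\<close>
  define e2 where "e2 = (e / 3) / (N + 1)"
  have e2: "e2 > 0" "e2 * N \<le> e / 3"
  proof -
    show e2: "e2 > 0" using e N by (simp add: e2_def)
    have "N + 1 \<noteq> 0" using N by linarith
    then have "e2 * (N + 1) = e / 3" by (simp only: e2_def times_divide_eq_left[of "e / 3"] nonzero_mult_div_cancel_right not_False_eq_True)
    moreover have "e2 * N \<le> e2 * (N + 1)" using e2 by (intro mult_left_mono) auto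
    ultimately show "e2 * N \<le> e / 3" by linarith
  qed
  have "\<forall>z. \<exists>h. h \<in> sig_net \<sigma> (sensor_forms L) \<and> (\<forall>v\<in>?S. \<bar>p z v - h v\<bar> < e2)"
  proof
    fix z
    show "\<exists>h. h \<in> sig_net \<sigma> (sensor_forms L) \<and> (\<forall>v\<in>?S. \<bar>p z v - h v\<bar> < e2)"
      using sensor_forms_approx[OF \<sigma> pc e2(1), of z] by (rule bexE) (intro exI conjI)
  qed
  then obtain h where h: "\<And>z. h z \<in> sig_net \<sigma> (sensor_forms L)" "\<And>z v. v \<in> ?S \<Longrightarrow> \<bar>p z v - h z v\<bar> < e2" by metis
  have "(\<lambda>x t. \<Sum>z\<in>Z. h z (?ev x) * g z t) \<in> net_operators \<sigma> \<Omega> L s"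
    by (intro net_operators_sum Z net_operators_product L s\<Omega> h g)
  then obtain T where T: "T \<in> coeff_vectors \<Omega>" "neural_operator \<sigma> T = (\<lambda>x t. \<Sum>z\<in>Z. h z (?ev x) * g z t)"
    unfolding net_operators_def by blast
  have "fs_norm G (F u - neural_operator \<sigma> T u) \<le> e" if u: "u \<in> D" for u
  proof -
    let ?p = "\<lambda>z. p z (?ev u)" and ?h = "\<lambda>z. h z (?ev u)"
    \<comment> \<open>The error splits into freezing the argument at representatives, replacing
      their images by networks, and replacing the weights by networks. In the first two the weights
      sum to 1.\<close>
    define A1 where "A1 = (\<lambda>t. \<Sum>z\<in>Z. ?p z * (F u - F z) t)"
    define A2 where "A2 = (\<lambda>t. \<Sum>z\<in>Z. ?p z * (F z - g z) t)"
    define A3 where "A3 = (\<lambda>t. \<Sum>z\<in>Z. (?p z - ?h z) * g z t)"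
    have m1: "F u - F z \<in> elems G" and m2: "F z - g z \<in> elems G" if "z \<in> Z" for z
      using that u Z(2) FG g(2) by (auto intro!: G.diff_mem)
    have A: "A1 \<in> elems G" "A2 \<in> elems G" "A3 \<in> elems G"
      unfolding A1_def A2_def A3_def by (rule G.sum_mem[OF Z(1,3)], rule m1 m2 g(2), assumption)+
    have "fs_norm G A1 \<le> (\<Sum>z\<in>Z. \<bar>?p z\<bar> * fs_norm G (F u - F z))"
      unfolding A1_def by (intro G.norm_sum_le Z m1)
    also have "\<dots> \<le> (\<Sum>z\<in>Z. ?p z * (e / 3))"
    proof (rule sum_mono)
      fix z assume z: "z \<in> Z"
      show "\<bar>?p z\<bar> * fs_norm G (F u - F z) \<le> ?p z * (e / 3)"
        using ploc[OF u z] p0[of z "?ev u"] by (cases "?p z = 0") (auto intro!: mult_left_mono)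
    qed
    also have "\<dots> = e / 3" by (simp only: sum_distrib_right[symmetric] psum[OF u] mult_1_left)
    finally have n1: "fs_norm G A1 \<le> e / 3" .
    have "fs_norm G A2 \<le> (\<Sum>z\<in>Z. \<bar>?p z\<bar> * fs_norm G (F z - g z))"
      unfolding A2_def by (intro G.norm_sum_le Z m2)
    also have "\<dots> \<le> (\<Sum>z\<in>Z. ?p z * (e / 3))"
    proof (rule sum_mono)
      fix z assume z: "z \<in> Z"
      show "\<bar>?p z\<bar> * fs_norm G (F z - g z) \<le> ?p z * (e / 3)"
        unfolding abs_of_nonneg[OF p0] by (rule mult_left_mono[OF less_imp_le[OF g(3)[OF z]] p0])
    qed
    also have "\<dots> = e / 3" by (simp only: sum_distrib_right[symmetric] psum[OF u] mult_1_left)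
    finally have n2: "fs_norm G A2 \<le> e / 3" .
    have "fs_norm G A3 \<le> (\<Sum>z\<in>Z. \<bar>?p z - ?h z\<bar> * fs_norm G (g z))"
      unfolding A3_def by (intro G.norm_sum_le Z g)
    also have "\<dots> \<le> (\<Sum>z\<in>Z. e2 * fs_norm G (g z))"
      using h(2)[OF ev[OF u]] g(2) G.norm_nonneg by (intro sum_mono mult_right_mono) (auto intro: less_imp_le)
    also have "\<dots> = e2 * N" by (simp add: N_def sum_distrib_left)
    finally have n3: "fs_norm G A3 \<le> e / 3" using e2(2) by linarith
    have "F u - neural_operator \<sigma> T u = (\<lambda>t. A1 t + (A2 t + A3 t))"
    proof
      fix t
      have "A1 t + (A2 t + A3 t) = (\<Sum>z\<in>Z. ?p z * F u t - ?h z * g z t)"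
        unfolding A1_def A2_def A3_def sum.distrib[symmetric] by (intro sum.cong) (auto simp: algebra_simps)
      also have "\<dots> = (\<Sum>z\<in>Z. ?p z) * F u t - (\<Sum>z\<in>Z. ?h z * g z t)"
        by (simp add: sum_subtractf sum_distrib_right)
      finally show "(F u - neural_operator \<sigma> T u) t = A1 t + (A2 t + A3 t)" using psum[OF u] T(2) by simp
    qed
    moreover have "fs_norm G (\<lambda>t. A1 t + (A2 t + A3 t)) \<le> fs_norm G A1 + (fs_norm G A2 + fs_norm G A3)"
      using G.norm_triangle[OF A(1) G.add_mem[OF A(2,3)]] G.norm_triangle[OF A(2,3)] by linarith
    ultimately show ?thesis using n1 n2 n3 by simp
  qed
  then show ?thesis using T(1) by blast
qed

end

subsection \<open>Convergence rate under the source condition\<close>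

lemma neural_operator_mem_l2:
  fixes \<Omega> :: "(real^'n) set"
  assumes \<sigma>: "sigmoid_fun \<sigma>" and dom: "open \<Omega>" "bounded \<Omega>"
  shows "neural_operator \<sigma> T x \<in> elems (l2 (lebesgue_on \<Omega>))"
proof -
  let ?f = "neural_operator \<sigma> T x"
  have sc: "continuous_on UNIV (\<lambda>t. \<sigma> (w \<bullet> t + z))" for w :: "real^'n" and z
    by (rule continuous_on_compose2[OF sigmoid_continuous[OF \<sigma>, of UNIV]]) (auto intro!: continuous_intros)
  have c: "continuous_on UNIV ?f"
    unfolding neural_operator_def by (intro continuous_on_sum continuous_on_mult continuous_on_const sc)
  have "compact (?f ` closure \<Omega>)"
    using dom(2) by (intro compact_continuous_image continuous_on_subset[OF c]) auto
  then obtain B where B: "\<forall>v\<in>?f ` closure \<Omega>. norm v \<le> B" using compact_imp_bounded bounded_iff by metis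
  show ?thesis
  proof (rule bounded_mem_l2[OF finite_measure_lebesgue_on[OF dom]])
    show "?f \<in> borel_measurable (lebesgue_on \<Omega>)"
      using dom(1) continuous_on_subset[OF c] by (intro continuous_imp_measurable_on_sets_lebesgue) auto
    fix t assume "t \<in> space (lebesgue_on \<Omega>)"
    then have "t \<in> \<Omega>" by simp
    then have "t \<in> closure \<Omega>" by (rule subsetD[OF closure_subset])
    with B show "\<bar>?f t\<bar> \<le> B" by simp
  qed
qed

lemma (in pre_hilbert) inner_fs_eq:
  assumes "u \<in> elems H" "v \<in> elems H" "w \<in> elems H" "fs_eq H u v"
  shows "inner_on H u w = inner_on H v w"
  using norm_eq_inner_zero[of "u - v" w] assms by (simp add: fs_eq_def diff_mem inner_diff_left)

lemma bounded_linear_op_mem: "bounded_linear_op H G A \<Longrightarrow> h \<in> elems H \<Longrightarrow> A h \<in> elems G"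
  by (simp add: bounded_linear_op_def)

lemma bounded_linear_op_scale:
  assumes "bounded_linear_op H G A" "h \<in> elems H"
  shows "fs_eq G (A (\<lambda>t. c * h t)) (\<lambda>t. c * A h t)"
proof -
  have "fs_eq G (A (\<lambda>t. c * h t + 0 * h t)) (\<lambda>t. c * A h t + 0 * A h t)"
    using assms unfolding bounded_linear_op_def by blast
  then show ?thesis by simp
qed

text \<open>For \<open>h\<close> of norm zero the scaling is by arbitrarily large factors.\<close>

lemma op_norm_diff_bound:
  assumes "pre_hilbert H" "pre_hilbert G"
    and A: "bounded_linear_op H G A" "bounded_linear_op H G A'"
    and c: "op_norm H G (\<lambda>h. A h - A' h) \<le> ereal c" and h: "h \<in> elems H"
  shows "fs_norm G (A h - A' h) \<le> c * fs_norm H h"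
proof -
  interpret H: pre_hilbert H by fact
  interpret G: pre_hilbert G by fact
  have Am: "A u \<in> elems G" "A' u \<in> elems G" if "u \<in> elems H" for u
    using that A by (auto intro: bounded_linear_op_mem)
  define K where "K = fs_norm G (A h - A' h)"
  have K0: "K \<ge> 0" unfolding K_def by (intro G.norm_nonneg G.diff_mem Am h)
  have scaled: "l * K \<le> c" if l: "l > 0" "l * fs_norm H h \<le> 1" for l
  proof -
    let ?h = "\<lambda>t. l * h t"
    have hm: "?h \<in> elems H" by (rule H.scale_mem[OF h])
    have "fs_norm H ?h \<le> 1" using l by (simp add: H.norm_scale[OF h])
    then have "ereal (fs_norm G (A ?h - A' ?h)) \<le> op_norm H G (\<lambda>h. A h - A' h)"
      unfolding op_norm_def using hm by (intro SUP_upper2[of ?h]) auto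
    then have 1: "fs_norm G (A ?h - A' ?h) \<le> c" using c order_trans ereal_less_eq(3) by blast
    let ?u = "\<lambda>t. l * A h t" and ?v = "\<lambda>t. l * A' h t"
    have uv: "?u \<in> elems G" "?v \<in> elems G" by (intro G.scale_mem Am h)+
    \<comment> \<open>Linearity is available only up to \<open>fs_eq\<close>, so scaling inserts two
      differences of norm zero into the triangle inequality.\<close>
    have 2: "fs_norm G (?u - A ?h) = 0" "fs_norm G (A' ?h - ?v) = 0"
      using bounded_linear_op_scale[OF A(1) h, of l] bounded_linear_op_scale[OF A(2) h, of l]
        G.norm_minus_commute[OF uv(1) Am(1)[OF hm]] by (simp_all add: fs_eq_def)
    have "?u - ?v = (\<lambda>t. l * (A h - A' h) t)" by (auto simp: right_diff_distrib)
    then have "l * K = fs_norm G (?u - ?v)"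
      using l G.norm_scale[OF G.diff_mem[OF Am(1)[OF h] Am(2)[OF h]], of l] by (simp add: K_def)
    also have "\<dots> \<le> fs_norm G (?u - A ?h) + fs_norm G (A ?h - ?v)"
      by (intro G.norm_triangle_diff uv Am hm)
    also have "\<dots> \<le> fs_norm G (?u - A ?h) + (fs_norm G (A ?h - A' ?h) + fs_norm G (A' ?h - ?v))"
      by (intro add_left_mono G.norm_triangle_diff uv Am hm)
    finally show ?thesis using 1 2 by linarith
  qed
  show ?thesis
  proof (cases "fs_norm H h = 0")
    case True
    have "K = 0"
    proof (rule ccontr)
      assume "K \<noteq> 0"
      then have "K > 0" using K0 by simp
      then show False using scaled[of "(\<bar>c\<bar> + 1) / K"] True by simp
    qed
    then show ?thesis using True by (simp add: K_def)
  next
    case False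
    then have "fs_norm H h > 0" using H.norm_nonneg[OF h] by simp
    then show ?thesis using scaled[of "1 / fs_norm H h"] by (simp add: K_def field_simps)
  qed
qed

text \<open>The rate is a statement about two pre-Hilbert spaces. The approximating operator enters
  it only through its values in \<open>G\<close> and its error on the ball.\<close>

locale source_problem = H: pre_hilbert H + G: pre_hilbert G
  for H :: "'a fspace" and G :: "'b fspace" +
  fixes D F F' F'_adj x\<^sub>0 x\<^sub>d y \<omega> r L
  assumes D_sub: "D \<subseteq> elems H"
    and F_maps: "\<And>x. x \<in> D \<Longrightarrow> F x \<in> elems G"
    and x0: "x\<^sub>0 \<in> D" and xd: "x\<^sub>d \<in> D" and y: "y \<in> elems G" and sol: "fs_eq G (F x\<^sub>d) y"
    and r: "r > 0" "r > 2 * fs_norm H (x\<^sub>0 - x\<^sub>d)" and ball: "fs_ball H x\<^sub>d r \<subseteq> D"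
    and F_diff: "\<And>x. x \<in> fs_ball H x\<^sub>d r \<Longrightarrow> has_frechet_derivative H G D F (F' x) x"
    and lip: "\<And>x. x \<in> fs_ball H x\<^sub>d r \<Longrightarrow>
      op_norm H G (\<lambda>h. F' x h - F' x\<^sub>d h) \<le> ereal (L * fs_norm H (x - x\<^sub>d))"
    and adj: "is_adjoint H G (F' x\<^sub>d) F'_adj"
    and \<omega>: "\<omega> \<in> elems G" and source: "fs_eq H (x\<^sub>0 - x\<^sub>d) (F'_adj \<omega>)" and small: "L * fs_norm G \<omega> < 1"
begin

lemma elems_D: "x \<in> D \<Longrightarrow> x \<in> elems H"
  using D_sub by blast

lemma xd_ball: "x\<^sub>d \<in> fs_ball H x\<^sub>d r"
  using r H.norm_zero[OF elems_D[OF xd]] xd elems_D by (simp add: fs_ball_def)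

lemma F'_bounded: "x \<in> fs_ball H x\<^sub>d r \<Longrightarrow> bounded_linear_op H G (F' x)"
  using F_diff by (simp add: has_frechet_derivative_def)

lemma F'_mem: "x \<in> fs_ball H x\<^sub>d r \<Longrightarrow> h \<in> elems H \<Longrightarrow> F' x h \<in> elems G"
  by (rule bounded_linear_op_mem[OF F'_bounded])

text \<open>Testing with \<omega> makes the function along the segment scalar, so that the mean
  value theorem can be used. The remainder of the Frechet derivative is carried over by
  Cauchy-Schwarz.\<close>

lemma has_derivative_segment:
  assumes e: "e \<in> elems H" and S: "\<And>t. t \<in> S \<Longrightarrow> (\<lambda>p. x\<^sub>d p + t * e p) \<in> fs_ball H x\<^sub>d r" and t: "t \<in> S"
  shows "((\<lambda>t. inner_on G (F (\<lambda>p. x\<^sub>d p + t * e p)) \<omega>) has_field_derivative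
      inner_on G (F' (\<lambda>p. x\<^sub>d p + t * e p) e) \<omega>) (at t within S)"
proof -
  let ?\<gamma> = "\<lambda>t p. x\<^sub>d p + t * e p"
  let ?A = "F' (?\<gamma> t)" and ?N = "fs_norm H e" and ?W = "fs_norm G \<omega>"
  have N: "?N \<ge> 0" and W: "?W \<ge> 0" using H.norm_nonneg[OF e] G.norm_nonneg[OF \<omega>] .
  have F\<gamma>: "F (?\<gamma> u) \<in> elems G" if "u \<in> S" for u using F_maps ball S[OF that] by blast
  show ?thesis
    unfolding has_field_derivative_def has_derivative_within_alt
  proof (intro conjI allI impI)
    show "bounded_linear ((*) (inner_on G (?A e) \<omega>))" by (rule bounded_linear_mult_right)
    fix c :: real assume c: "c > 0"
    define c' where "c' = c / (?N * ?W + 1)"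
    have NW: "?N * ?W + 1 > 0" using mult_nonneg_nonneg[OF N W] by linarith
    have c': "c' > 0" "c' * (?N * ?W) \<le> c"
    proof -
      show c': "c' > 0" using c NW by (simp add: c'_def)
      have "c' * (?N * ?W + 1) = c" using NW by (simp add: c'_def)
      then show "c' * (?N * ?W) \<le> c" using c' by (simp add: distrib_left)
    qed
    obtain d where d: "d > 0" "\<forall>z\<in>D. fs_norm H (z - ?\<gamma> t) < d \<longrightarrow>
        fs_norm G (F z - F (?\<gamma> t) - ?A (z - ?\<gamma> t)) \<le> c' * fs_norm H (z - ?\<gamma> t)"
      using F_diff[OF S[OF t]] c'(1) unfolding has_frechet_derivative_def by blast
    have "norm (inner_on G (F (?\<gamma> u)) \<omega> - inner_on G (F (?\<gamma> t)) \<omega> - inner_on G (?A e) \<omega> * (u - t)) \<le> c * norm (u - t)"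
      if u: "u \<in> S" "norm (u - t) < d / (?N + 1)" for u
    proof -
      let ?h = "\<lambda>p. (u - t) * e p"
      have hm: "?h \<in> elems H" by (rule H.scale_mem[OF e])
      have df: "?\<gamma> u - ?\<gamma> t = ?h" by (auto simp: algebra_simps)
      have nh: "fs_norm H ?h = \<bar>u - t\<bar> * ?N" by (rule H.norm_scale[OF e])
      have "\<bar>u - t\<bar> * ?N \<le> \<bar>u - t\<bar> * (?N + 1)" by (intro mult_left_mono) auto
      also have "\<dots> < d" using u(2) N by (simp add: pos_less_divide_eq)
      finally have "fs_norm G (F (?\<gamma> u) - F (?\<gamma> t) - ?A ?h) \<le> c' * (\<bar>u - t\<bar> * ?N)"
        using d(2)[rule_format, of "?\<gamma> u"] S[OF u(1)] ball unfolding df nh by blast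
      then have "\<bar>inner_on G (F (?\<gamma> u) - F (?\<gamma> t) - ?A ?h) \<omega>\<bar> \<le> c' * (\<bar>u - t\<bar> * ?N) * ?W"
        using G.Cauchy_Schwarz[of "F (?\<gamma> u) - F (?\<gamma> t) - ?A ?h" \<omega>] W
          G.diff_mem[OF G.diff_mem[OF F\<gamma>[OF u(1)] F\<gamma>[OF t]] F'_mem[OF S[OF t] hm]] \<omega>
        by (meson mult_right_mono order_trans)
      also have "\<dots> = c' * (?N * ?W) * \<bar>u - t\<bar>" by simp
      also have "\<dots> \<le> c * \<bar>u - t\<bar>" by (rule mult_right_mono[OF c'(2)]) simp
      finally have "\<bar>inner_on G (F (?\<gamma> u) - F (?\<gamma> t) - ?A ?h) \<omega>\<bar> \<le> c * \<bar>u - t\<bar>" .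
      moreover have "inner_on G (?A ?h) \<omega> = (u - t) * inner_on G (?A e) \<omega>"
        using G.inner_fs_eq[OF F'_mem[OF S[OF t] hm] G.scale_mem[OF F'_mem[OF S[OF t] e]] \<omega>
            bounded_linear_op_scale[OF F'_bounded[OF S[OF t]] e]]
        by (simp only: G.inner_scale_left[OF F'_mem[OF S[OF t] e] \<omega>])
      ultimately show ?thesis
        using F\<gamma>[OF u(1)] F\<gamma>[OF t] F'_mem[OF S[OF t] hm] \<omega>
        by (simp add: G.inner_diff_left G.diff_mem mult.commute)
    qed
    moreover have "d / (?N + 1) > 0" using d(1) N by simp
    ultimately show "\<exists>d>0. \<forall>u\<in>S. norm (u - t) < d \<longrightarrow>
        norm (inner_on G (F (?\<gamma> u)) \<omega> - inner_on G (F (?\<gamma> t)) \<omega> - inner_on G (?A e) \<omega> * (u - t)) \<le> c * norm (u - t)"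
      by blast
  qed
qed

text \<open>Along the segment the scalar function minus its linearisation at
  \<open>x\<^sub>d\<close> plus L N^2 W t^2/2 has a nonnegative derivative, since the Lipschitz
  condition bounds the change of the derivative by L t N. Comparing the values at 0 and 1 yields the
  constant L/2.\<close>

lemma taylor_lower_bound:
  assumes x: "x \<in> fs_ball H x\<^sub>d r"
  shows "inner_on G (F' x\<^sub>d (x - x\<^sub>d)) \<omega> \<le>
    inner_on G (F x - F x\<^sub>d) \<omega> + L / 2 * (fs_norm H (x - x\<^sub>d))\<^sup>2 * fs_norm G \<omega>"
proof -
  define e where "e = x - x\<^sub>d"
  have e: "e \<in> elems H" unfolding e_def using x elems_D[OF xd] by (auto simp: fs_ball_def intro!: H.diff_mem)
  let ?\<gamma> = "\<lambda>t p. x\<^sub>d p + t * e p"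
  let ?N = "fs_norm H e" and ?W = "fs_norm G \<omega>" and ?D = "\<lambda>t. inner_on G (F' (?\<gamma> t) e) \<omega>"
  have N: "?N \<ge> 0" and W: "?W \<ge> 0" using H.norm_nonneg[OF e] G.norm_nonneg[OF \<omega>] .
  have \<gamma>d: "?\<gamma> t - x\<^sub>d = (\<lambda>p. t * e p)" for t by auto
  have \<gamma>n: "fs_norm H (?\<gamma> t - x\<^sub>d) = \<bar>t\<bar> * ?N" for t unfolding \<gamma>d by (rule H.norm_scale[OF e])
  have \<gamma>: "?\<gamma> t \<in> fs_ball H x\<^sub>d r" if t: "t \<in> {0..1}" for t
  proof -
    have "\<bar>t\<bar> * ?N \<le> 1 * ?N" using t N by (intro mult_right_mono) auto
    also have "\<dots> < r" using x by (simp add: e_def fs_ball_def)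
    finally show ?thesis unfolding fs_ball_def using \<gamma>n H.add_mem[OF elems_D[OF xd] H.scale_mem[OF e]] by simp
  qed
  let ?f = "\<lambda>t. inner_on G (F (?\<gamma> t)) \<omega> - t * inner_on G (F' x\<^sub>d e) \<omega> + L * ?N\<^sup>2 * ?W * t\<^sup>2 / 2"
  let ?f' = "\<lambda>t. ?D t - inner_on G (F' x\<^sub>d e) \<omega> + L * ?N\<^sup>2 * ?W * t"
  have der: "(?f has_field_derivative ?f' t) (at t within {0..1})" if "t \<in> {0..1}" for t
    by (rule derivative_eq_intros has_derivative_segment[OF e \<gamma> that] refl | simp)+
  obtain t where t: "t \<in> {0<..<1}" "?f 1 - ?f 0 = ?f' t * (1 - 0)"
    using mvt_simple[of 0 1 ?f "\<lambda>t. (*) (?f' t)"] der[unfolded has_field_derivative_def] by auto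
  have t01: "t \<in> {0..1}" using t(1) by simp
  have "fs_norm G (F' (?\<gamma> t) e - F' x\<^sub>d e) \<le> L * fs_norm H (?\<gamma> t - x\<^sub>d) * ?N"
    by (rule op_norm_diff_bound[OF H.pre_hilbert_axioms G.pre_hilbert_axioms F'_bounded[OF \<gamma>[OF t01]] F'_bounded[OF xd_ball] lip[OF \<gamma>[OF t01]] e])
  then have "fs_norm G (F' (?\<gamma> t) e - F' x\<^sub>d e) * ?W \<le> L * (t * ?N) * ?N * ?W"
    using t01 by (intro mult_right_mono W) (simp add: \<gamma>n)
  moreover have "\<bar>inner_on G (F' (?\<gamma> t) e - F' x\<^sub>d e) \<omega>\<bar> \<le> fs_norm G (F' (?\<gamma> t) e - F' x\<^sub>d e) * ?W"
    by (intro G.Cauchy_Schwarz G.diff_mem F'_mem[OF \<gamma>[OF t01] e] F'_mem[OF xd_ball e] \<omega>)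
  moreover have "inner_on G (F' (?\<gamma> t) e - F' x\<^sub>d e) \<omega> = ?D t - inner_on G (F' x\<^sub>d e) \<omega>"
    by (intro G.inner_diff_left F'_mem[OF \<gamma>[OF t01] e] F'_mem[OF xd_ball e] \<omega>)
  moreover have "L * (t * ?N) * ?N * ?W = L * ?N\<^sup>2 * ?W * t" by (simp add: power2_eq_square)
  ultimately have "0 \<le> ?f' t" by linarith
  moreover have "?\<gamma> 1 = x" "?\<gamma> 0 = x\<^sub>d" by (auto simp: e_def)
  ultimately have "inner_on G (F x\<^sub>d) \<omega> \<le> inner_on G (F x) \<omega> - inner_on G (F' x\<^sub>d e) \<omega> + L * ?N\<^sup>2 * ?W / 2"
    using t(2) by simp
  moreover have "inner_on G (F x - F x\<^sub>d) \<omega> = inner_on G (F x) \<omega> - inner_on G (F x\<^sub>d) \<omega>"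
    using x xd ball F_maps \<omega> by (intro G.inner_diff_left) auto
  ultimately show ?thesis by (simp add: e_def)
qed

text \<open>The source condition and the adjoint move the cross term of the penalty from
  \<open>H\<close> to \<open>G\<close>, where it is an inner product of the linearised residual with
  \<omega>.\<close>

lemma inner_source_le:
  assumes x: "x \<in> fs_ball H x\<^sub>d r"
  shows "inner_on H (x - x\<^sub>d) (x\<^sub>0 - x\<^sub>d) \<le>
    fs_norm G (F x - F x\<^sub>d) * fs_norm G \<omega> + L / 2 * (fs_norm H (x - x\<^sub>d))\<^sup>2 * fs_norm G \<omega>"
proof -
  have xD: "x \<in> D" using x ball by blast
  have e: "x - x\<^sub>d \<in> elems H" and e0: "x\<^sub>0 - x\<^sub>d \<in> elems H" using elems_D xD xd x0 by (auto intro!: H.diff_mem)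
  have am: "F'_adj \<omega> \<in> elems H" "inner_on G (F' x\<^sub>d (x - x\<^sub>d)) \<omega> = inner_on H (x - x\<^sub>d) (F'_adj \<omega>)"
    using adj \<omega> e unfolding is_adjoint_def by blast+
  have "inner_on H (x - x\<^sub>d) (x\<^sub>0 - x\<^sub>d) = inner_on H (x\<^sub>0 - x\<^sub>d) (x - x\<^sub>d)" by (rule H.inner_sym[OF e e0])
  also have "\<dots> = inner_on H (F'_adj \<omega>) (x - x\<^sub>d)" by (rule H.inner_fs_eq[OF e0 am(1) e source])
  also have "\<dots> = inner_on G (F' x\<^sub>d (x - x\<^sub>d)) \<omega>" using H.inner_sym[OF am(1) e] am(2) by simp
  also have "\<dots> \<le> inner_on G (F x - F x\<^sub>d) \<omega> + L / 2 * (fs_norm H (x - x\<^sub>d))\<^sup>2 * fs_norm G \<omega>"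
    by (rule taylor_lower_bound[OF x])
  finally show ?thesis using G.Cauchy_Schwarz[OF G.diff_mem[OF F_maps[OF xD] F_maps[OF xd]] \<omega>] by linarith
qed

context
  fixes F\<^sub>n :: "('a \<Rightarrow> real) \<Rightarrow> ('b \<Rightarrow> real)" and \<epsilon> \<delta> \<alpha> \<eta> y\<^sub>\<delta> x
  assumes Fn: "\<And>x. F\<^sub>n x \<in> elems G"
    and err: "approx_error G (fs_ball H x\<^sub>d r) F F\<^sub>n \<le> ereal \<epsilon>"
    and noisy: "y\<^sub>\<delta> \<in> elems G" "fs_norm G (y - y\<^sub>\<delta>) \<le> \<delta>"
    and \<alpha>: "\<alpha> > 0"
    and min: "approx_minimizer (tikhonov H G F\<^sub>n y\<^sub>\<delta> x\<^sub>0 \<alpha>) D \<eta> x"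
begin

lemma operator_error: "z \<in> fs_ball H x\<^sub>d r \<Longrightarrow> fs_norm G (F z - F\<^sub>n z) \<le> \<epsilon>"
  using order_trans[OF SUP_upper err[unfolded approx_error_def]] by simp

lemma minimizer_mem: "x \<in> D"
  using min by (simp add: approx_minimizer_def)

lemma minimizer_value:
  "(fs_norm G (F\<^sub>n x - y\<^sub>\<delta>))\<^sup>2 + \<alpha> * (fs_norm H (x - x\<^sub>0))\<^sup>2 \<le> (\<epsilon> + \<delta>)\<^sup>2 + \<alpha> * (fs_norm H (x\<^sub>0 - x\<^sub>d))\<^sup>2 + \<eta>"
proof -
  let ?T = "tikhonov H G F\<^sub>n y\<^sub>\<delta> x\<^sub>0 \<alpha>"
  have "?T x \<le> (INF z\<in>D. ?T z) + \<eta>" using min by (simp add: approx_minimizer_def)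
  \<comment> \<open>The functional is nonnegative, so the real-valued infimum is a genuine lower
    bound.\<close>
  also have "(INF z\<in>D. ?T z) \<le> ?T x\<^sub>d"
    using \<alpha> xd by (intro cINF_lower bdd_belowI2[of _ 0]) (auto simp: tikhonov_def)
  finally have 1: "?T x \<le> ?T x\<^sub>d + \<eta>" by simp
  have "fs_norm G (F\<^sub>n x\<^sub>d - y\<^sub>\<delta>) \<le> fs_norm G (F\<^sub>n x\<^sub>d - F x\<^sub>d) + fs_norm G (F x\<^sub>d - y\<^sub>\<delta>)"
    by (intro G.norm_triangle_diff Fn F_maps[OF xd] noisy)
  moreover have "fs_norm G (F x\<^sub>d - y\<^sub>\<delta>) \<le> fs_norm G (F x\<^sub>d - y) + fs_norm G (y - y\<^sub>\<delta>)"
    by (intro G.norm_triangle_diff y F_maps[OF xd] noisy)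
  moreover have "fs_norm G (F\<^sub>n x\<^sub>d - F x\<^sub>d) \<le> \<epsilon>"
    using operator_error[OF xd_ball] G.norm_minus_commute[OF Fn F_maps[OF xd], of x\<^sub>d] by simp
  moreover have "fs_norm G (F x\<^sub>d - y) = 0" using sol by (simp add: fs_eq_def)
  ultimately have "fs_norm G (F\<^sub>n x\<^sub>d - y\<^sub>\<delta>) \<le> \<epsilon> + \<delta>" using noisy(2) by linarith
  then have "(fs_norm G (F\<^sub>n x\<^sub>d - y\<^sub>\<delta>))\<^sup>2 \<le> (\<epsilon> + \<delta>)\<^sup>2"
    by (intro power_mono G.norm_nonneg G.diff_mem Fn noisy)
  with 1 show ?thesis using H.norm_minus_commute[OF elems_D[OF xd] elems_D[OF x0]] by (simp add: tikhonov_def)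
qed

text \<open>Used before the minimizer is known to lie in the ball: it locates the minimizer relative
  to \<open>x\<^sub>0\<close>, with no recourse to the derivative.\<close>

lemma minimizer_near_initial:
  "\<alpha> * (fs_norm H (x - x\<^sub>0))\<^sup>2 \<le> (\<epsilon> + \<delta>)\<^sup>2 + \<alpha> * (fs_norm H (x\<^sub>0 - x\<^sub>d))\<^sup>2 + \<eta>"
  using minimizer_value zero_le_power2[of "fs_norm G (F\<^sub>n x - y\<^sub>\<delta>)"] by linarith

text \<open>Expanding the penalty around \<open>x\<^sub>d\<close> isolates the squared error and the
  cross term. The quadratic part of the bound for the cross term moves to the left, leaving the
  factor 1 - L ||\<omega>||.\<close>

lemma error_estimate:
  assumes x: "x \<in> fs_ball H x\<^sub>d r"
  shows "\<alpha> * (1 - L * fs_norm G \<omega>) * (fs_norm H (x - x\<^sub>d))\<^sup>2 \<le>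
    (\<epsilon> + \<delta>)\<^sup>2 + \<eta> + 2 * \<alpha> * fs_norm G \<omega> * (\<epsilon> + \<delta>) + \<alpha>\<^sup>2 * (fs_norm G \<omega>)\<^sup>2"
proof -
  let ?N = "fs_norm H (x - x\<^sub>d)" and ?W = "fs_norm G \<omega>" and ?p = "fs_norm G (F\<^sub>n x - y\<^sub>\<delta>)"
    and ?R = "fs_norm H (x\<^sub>0 - x\<^sub>d)" and ?I = "inner_on H (x - x\<^sub>d) (x\<^sub>0 - x\<^sub>d)"
  note xD = minimizer_mem
  have "fs_norm G (F x - F x\<^sub>d) \<le> fs_norm G (F x - F\<^sub>n x) + fs_norm G (F\<^sub>n x - F x\<^sub>d)"
    by (intro G.norm_triangle_diff Fn F_maps xD xd)
  moreover have "fs_norm G (F\<^sub>n x - F x\<^sub>d) \<le> ?p + fs_norm G (y\<^sub>\<delta> - F x\<^sub>d)"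
    by (intro G.norm_triangle_diff Fn F_maps xD xd noisy)
  moreover have "fs_norm G (y\<^sub>\<delta> - F x\<^sub>d) \<le> fs_norm G (y\<^sub>\<delta> - y) + fs_norm G (y - F x\<^sub>d)"
    by (intro G.norm_triangle_diff y F_maps xd noisy)
  moreover have "fs_norm G (y - F x\<^sub>d) = 0"
    using sol G.norm_minus_commute[OF y F_maps[OF xd]] by (simp add: fs_eq_def)
  ultimately have "fs_norm G (F x - F x\<^sub>d) \<le> \<epsilon> + \<delta> + ?p"
    using operator_error[OF x] noisy(2) G.norm_minus_commute[OF y noisy(1)] by linarith
  then have "fs_norm G (F x - F x\<^sub>d) * ?W \<le> (\<epsilon> + \<delta> + ?p) * ?W"
    by (intro mult_right_mono G.norm_nonneg \<omega>)
  then have "?I \<le> (\<epsilon> + \<delta> + ?p) * ?W + L / 2 * ?N\<^sup>2 * ?W" using inner_source_le[OF x] by linarith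
  then have I: "\<alpha> * ?I \<le> \<alpha> * ((\<epsilon> + \<delta> + ?p) * ?W + L / 2 * ?N\<^sup>2 * ?W)" using \<alpha> by simp
  have "x - x\<^sub>0 = (x - x\<^sub>d) - (x\<^sub>0 - x\<^sub>d)" by auto
  then have "(fs_norm H (x - x\<^sub>0))\<^sup>2 = ?N\<^sup>2 + ?R\<^sup>2 - 2 * ?I"
    using H.norm_diff_sq[of "x - x\<^sub>d" "x\<^sub>0 - x\<^sub>d"] elems_D xD xd x0 by (simp only: H.diff_mem)
  then have "?p\<^sup>2 + \<alpha> * (?N\<^sup>2 + ?R\<^sup>2 - 2 * ?I) \<le> (\<epsilon> + \<delta>)\<^sup>2 + \<alpha> * ?R\<^sup>2 + \<eta>"
    using minimizer_value by simp
  then have "?p\<^sup>2 + \<alpha> * ?N\<^sup>2 \<le> (\<epsilon> + \<delta>)\<^sup>2 + \<eta> + 2 * (\<alpha> * ?I)" by (simp add: distrib_left right_diff_distrib)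
  also have "\<dots> \<le> (\<epsilon> + \<delta>)\<^sup>2 + \<eta> + 2 * (\<alpha> * ((\<epsilon> + \<delta> + ?p) * ?W + L / 2 * ?N\<^sup>2 * ?W))" using I by simp
  finally have "?p\<^sup>2 + \<alpha> * ?N\<^sup>2 \<le> (\<epsilon> + \<delta>)\<^sup>2 + \<eta> + 2 * \<alpha> * ?W * (\<epsilon> + \<delta>) + 2 * (\<alpha> * ?W) * ?p + \<alpha> * L * ?W * ?N\<^sup>2"
    by (simp add: distrib_left distrib_right mult_ac)
  \<comment> \<open>Young's inequality makes the unknown residual cancel against its square on the
    left, at the price of a term of order \<alpha>^2.\<close>
  moreover have "2 * (\<alpha> * ?W) * ?p \<le> ?p\<^sup>2 + (\<alpha> * ?W)\<^sup>2"
    using sum_squares_bound[of ?p "\<alpha> * ?W"] by (simp add: mult_ac)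
  moreover have "\<alpha> * (1 - L * ?W) * ?N\<^sup>2 = \<alpha> * ?N\<^sup>2 - \<alpha> * L * ?W * ?N\<^sup>2"
    by (simp add: right_diff_distrib left_diff_distrib)
  ultimately show ?thesis by (simp add: power_mult_distrib)
qed

end

lemma rate:
  fixes F\<^sub>n :: "real \<Rightarrow> ('a \<Rightarrow> real) \<Rightarrow> ('b \<Rightarrow> real)" and \<alpha> \<eta> \<epsilon> :: "real \<Rightarrow> real"
  assumes Fn: "\<And>e x. F\<^sub>n e x \<in> elems G"
    and err: "\<And>e. e > 0 \<Longrightarrow> approx_error G (fs_ball H x\<^sub>d r) F (F\<^sub>n e) \<le> ereal e"
    and noisy: "\<And>\<delta>. \<delta> > 0 \<Longrightarrow> y\<^sub>\<delta> \<delta> \<in> elems G" "\<And>\<delta>. \<delta> > 0 \<Longrightarrow> fs_norm G (y - y\<^sub>\<delta> \<delta>) \<le> \<delta>"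
    and orders: "same_order \<alpha> (\<lambda>\<delta>. \<delta>)" "same_order \<eta> (\<lambda>\<delta>. (\<alpha> \<delta>)\<^sup>2)" "same_order \<epsilon> (\<lambda>\<delta>. \<delta>)"
    and min: "\<And>\<delta>. \<delta> > 0 \<Longrightarrow> approx_minimizer (tikhonov H G (F\<^sub>n (\<epsilon> \<delta>)) (y\<^sub>\<delta> \<delta>) x\<^sub>0 (\<alpha> \<delta>)) D (\<eta> \<delta>) (x\<^sub>n \<delta>)"
  shows "(\<lambda>\<delta>. fs_norm H (x\<^sub>n \<delta> - x\<^sub>d)) \<in> O[at_right 0](\<lambda>\<delta>. sqrt \<delta>)"
proof -
  obtain a1 a2 where a: "0 < a1" "a1 \<le> a2" "\<And>\<delta>. \<delta> > 0 \<Longrightarrow> a1 * \<delta> \<le> \<alpha> \<delta> \<and> \<alpha> \<delta> \<le> a2 * \<delta>"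
    using orders(1) unfolding same_order_def by auto
  obtain h1 h2 where h: "0 < h1" "h1 \<le> h2" "\<And>\<delta>. \<delta> > 0 \<Longrightarrow> h1 * (\<alpha> \<delta>)\<^sup>2 \<le> \<eta> \<delta> \<and> \<eta> \<delta> \<le> h2 * (\<alpha> \<delta>)\<^sup>2"
    using orders(2) unfolding same_order_def by auto
  obtain e1 e2 where e: "0 < e1" "e1 \<le> e2" "\<And>\<delta>. \<delta> > 0 \<Longrightarrow> e1 * \<delta> \<le> \<epsilon> \<delta> \<and> \<epsilon> \<delta> \<le> e2 * \<delta>"
    using orders(3) unfolding same_order_def by auto
  let ?W = "fs_norm G \<omega>" and ?R = "fs_norm H (x\<^sub>0 - x\<^sub>d)"
  have W: "?W \<ge> 0" by (rule G.norm_nonneg[OF \<omega>])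
  have R: "?R \<ge> 0" using elems_D x0 xd by (intro H.norm_nonneg H.diff_mem)
  have LW: "1 - L * ?W > 0" using small by simp
  have \<alpha>0: "\<alpha> \<delta> > 0" and \<epsilon>0: "\<epsilon> \<delta> > 0" if "\<delta> > 0" for \<delta>
    using a(1) e(1) a(3)[OF that] e(3)[OF that] that mult_pos_pos by (meson less_le_trans)+
  define M where "M = (e2 + 1)\<^sup>2 + h2 * a2\<^sup>2"
  define M' where "M' = M + 2 * a2 * ?W * (e2 + 1) + a2\<^sup>2 * ?W\<^sup>2"
  have M: "M \<ge> 0" using h by (simp add: M_def)
  have M': "M' \<ge> 0" using M a e W by (simp add: M'_def)
  have noise: "\<epsilon> \<delta> + \<delta> \<le> (e2 + 1) * \<delta>" if "\<delta> > 0" for \<delta> using e(3)[OF that] by (simp add: distrib_right)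
  have quad: "(\<epsilon> \<delta> + \<delta>)\<^sup>2 + \<eta> \<delta> \<le> M * \<delta>\<^sup>2" if \<delta>: "\<delta> > 0" for \<delta>
  proof -
    have "(\<epsilon> \<delta> + \<delta>)\<^sup>2 \<le> ((e2 + 1) * \<delta>)\<^sup>2" using noise[OF \<delta>] \<epsilon>0[OF \<delta>] \<delta> by (intro power_mono) auto
    moreover have "(\<alpha> \<delta>)\<^sup>2 \<le> (a2 * \<delta>)\<^sup>2" using a(3)[OF \<delta>] \<alpha>0[OF \<delta>] by (intro power_mono) auto
    then have "h2 * (\<alpha> \<delta>)\<^sup>2 \<le> h2 * (a2 * \<delta>)\<^sup>2" using h by (intro mult_left_mono) auto
    moreover have "M * \<delta>\<^sup>2 = ((e2 + 1) * \<delta>)\<^sup>2 + h2 * (a2 * \<delta>)\<^sup>2"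
      by (simp only: M_def power_mult_distrib distrib_right[of "(e2 + 1)\<^sup>2"] mult.assoc)
    ultimately show ?thesis using h(3)[OF \<delta>] by linarith
  qed
  \<comment> \<open>For \<delta> below d the excess M \<delta>^2 is smaller than \<alpha> times the
    gap between (r - R)^2 and R^2. The gap is positive because r > 2 R; M + 1 avoids a zero
    denominator.\<close>
  define d where "d = ((r - ?R)\<^sup>2 - ?R\<^sup>2) * a1 / (M + 1)"
  have "?R\<^sup>2 < (r - ?R)\<^sup>2" using r R by (intro power_strict_mono) auto
  then have d: "d > 0" using a(1) M by (simp add: d_def)
  \<comment> \<open>The error estimate has a right-hand side of at most M' \<delta>^2 and a
    left-hand factor \<alpha> \<ge> a1 \<delta>; dividing by a1 \<delta> (1 - L W) leaves K \<delta>
    for the squared error.\<close>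
  define K where "K = M' / (a1 * (1 - L * ?W))"
  have K: "K \<ge> 0" using M' a(1) LW by (simp add: K_def)
  have bound: "fs_norm H (x\<^sub>n \<delta> - x\<^sub>d) \<le> sqrt K * sqrt \<delta>" if \<delta>: "\<delta> > 0" "\<delta> < d" for \<delta>
  proof -
    note facts = Fn err[OF \<epsilon>0[OF \<delta>(1)]] noisy[OF \<delta>(1)] \<alpha>0[OF \<delta>(1)] min[OF \<delta>(1)]
    let ?x = "x\<^sub>n \<delta>"
    have xH: "?x \<in> elems H" by (rule elems_D[OF minimizer_mem[OF facts]])
    have "\<alpha> \<delta> * ((fs_norm H (?x - x\<^sub>0))\<^sup>2 - ?R\<^sup>2) \<le> M * \<delta>\<^sup>2"
      using minimizer_near_initial[OF facts] quad[OF \<delta>(1)] by (simp add: right_diff_distrib)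
    also have "\<dots> \<le> (M + 1) * \<delta> * \<delta>" using \<delta>(1) by (simp add: power2_eq_square)
    also have "\<dots> < (M + 1) * d * \<delta>" using \<delta> M by (intro mult_strict_right_mono mult_strict_left_mono) auto
    also have "\<dots> = ((r - ?R)\<^sup>2 - ?R\<^sup>2) * (a1 * \<delta>)" using M by (simp add: d_def)
    also have "\<dots> \<le> ((r - ?R)\<^sup>2 - ?R\<^sup>2) * \<alpha> \<delta>" using a(3)[OF \<delta>(1)] \<open>?R\<^sup>2 < (r - ?R)\<^sup>2\<close> by (intro mult_left_mono) auto
    finally have "(fs_norm H (?x - x\<^sub>0))\<^sup>2 < (r - ?R)\<^sup>2" using \<alpha>0[OF \<delta>(1)] by (simp add: mult.commute)
    then have "fs_norm H (?x - x\<^sub>0) < r - ?R" by (rule power2_less_imp_less) (use r R in linarith)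
    then have "fs_norm H (?x - x\<^sub>d) < r"
      using H.norm_triangle_diff[OF xH elems_D[OF x0] elems_D[OF xd]] by linarith
    then have xb: "?x \<in> fs_ball H x\<^sub>d r" using xH by (simp add: fs_ball_def)
    let ?N = "fs_norm H (?x - x\<^sub>d)"
    have "a1 * \<delta> * (1 - L * ?W) * ?N\<^sup>2 \<le> \<alpha> \<delta> * (1 - L * ?W) * ?N\<^sup>2"
      using a(3)[OF \<delta>(1)] LW by (intro mult_right_mono) auto
    also have "\<dots> \<le> (\<epsilon> \<delta> + \<delta>)\<^sup>2 + \<eta> \<delta> + 2 * \<alpha> \<delta> * ?W * (\<epsilon> \<delta> + \<delta>) + (\<alpha> \<delta>)\<^sup>2 * ?W\<^sup>2"
      by (rule error_estimate[OF facts xb])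
    also have "\<dots> \<le> M * \<delta>\<^sup>2 + 2 * (a2 * \<delta>) * ?W * ((e2 + 1) * \<delta>) + (a2 * \<delta>)\<^sup>2 * ?W\<^sup>2"
      using quad[OF \<delta>(1)] a(3)[OF \<delta>(1)] \<alpha>0[OF \<delta>(1)] \<epsilon>0[OF \<delta>(1)] \<delta>(1) noise[OF \<delta>(1)] W a(1,2)
      by (intro add_mono mult_mono power_mono) auto
    also have "\<dots> = M' * \<delta> * \<delta>" by (simp add: M'_def power2_eq_square algebra_simps)
    finally have "a1 * (1 - L * ?W) * ?N\<^sup>2 * \<delta> \<le> M' * \<delta> * \<delta>" by (simp add: mult_ac)
    then have "a1 * (1 - L * ?W) * ?N\<^sup>2 \<le> M' * \<delta>" using \<delta>(1) by (simp only: mult_le_cancel_right_pos)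
    then have "?N\<^sup>2 \<le> K * \<delta>" using a(1) LW by (simp add: K_def pos_le_divide_eq mult.commute)
    then have "?N \<le> sqrt (K * \<delta>)" by (rule real_le_rsqrt)
    then show ?thesis by (simp add: real_sqrt_mult)
  qed
  show ?thesis
  proof (rule bigoI)
    have "\<forall>\<^sub>F \<delta> in at_right 0. \<delta> \<in> {0<..<d}" by (rule eventually_at_right_real[OF d])
    then show "\<forall>\<^sub>F \<delta> in at_right 0. norm (fs_norm H (x\<^sub>n \<delta> - x\<^sub>d)) \<le> sqrt K * norm (sqrt \<delta>)"
    proof eventually_elim
      fix \<delta> assume \<delta>: "\<delta> \<in> {0<..<d}"
      then have "fs_norm H (x\<^sub>n \<delta> - x\<^sub>d) \<ge> 0"
        using elems_D[OF xd] min[of \<delta>] elems_D by (intro H.norm_nonneg H.diff_mem) (auto simp: approx_minimizer_def)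
      with bound[of \<delta>] \<delta> show "norm (fs_norm H (x\<^sub>n \<delta> - x\<^sub>d)) \<le> sqrt K * norm (sqrt \<delta>)" by simp
    qed
  qed
qed

end

text \<open>The rate is stated for every family of coefficient vectors meeting the error bound, not
  just for a constructed one; the first conjunct ensures that such families exist.\<close>

theorem theorem6p4:
  fixes \<Omega>\<^sub>X :: "(real^'m) set" and \<Omega>\<^sub>Y :: "(real^'n) set"
    and s r L\<^sub>1 :: real
    and \<sigma> :: "real \<Rightarrow> real"
    and D :: "(real^'m \<Rightarrow> real) set"
    and F :: "(real^'m \<Rightarrow> real) \<Rightarrow> (real^'n \<Rightarrow> real)"
    and F' :: "(real^'m \<Rightarrow> real) \<Rightarrow> (real^'m \<Rightarrow> real) \<Rightarrow> (real^'n \<Rightarrow> real)"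
    and F'_adj :: "(real^'n \<Rightarrow> real) \<Rightarrow> (real^'m \<Rightarrow> real)"
    and x\<^sub>0 x\<^sub>d :: "real^'m \<Rightarrow> real"
    and y \<omega> :: "real^'n \<Rightarrow> real"
  defines "H \<equiv> Hs s \<Omega>\<^sub>X" and "G \<equiv> L2 \<Omega>\<^sub>Y"
  assumes dom_X: "admissible_domain \<Omega>\<^sub>X"
    and dom_Y: "admissible_domain \<Omega>\<^sub>Y"
    and sigmoid: "sigmoid_fun \<sigma>"
    and s: "s > real CARD('m) / 2"
    and D_sub: "D \<subseteq> elems H"
    and F_maps: "\<forall>x\<in>D. F x \<in> elems G"
    and x0: "x\<^sub>0 \<in> D"
    and y: "y \<in> elems G"
    and xd: "min_norm_solution H G D F y x\<^sub>0 x\<^sub>d"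
    and r: "r > 0" "r > 2 * fs_norm H (x\<^sub>0 - x\<^sub>d)"
    and ball: "fs_ball H x\<^sub>d r \<subseteq> D"
    and D_bounded: "fs_bounded H D"
    and D_closed: "closedin (weak_topology H) D"
    and F_cont:
      "\<forall>x\<in>D. \<forall>e>0. \<exists>d>0. \<forall>z\<in>D.
         Linf_norm \<Omega>\<^sub>X (z - x) < ereal d \<longrightarrow> fs_norm G (F z - F x) < e"
    and F_wsc: "weakly_seq_closed H G D F"
    and F_diff: "\<forall>x\<in>fs_ball H x\<^sub>d r. has_frechet_derivative H G D F (F' x) x"
    and L1: "L\<^sub>1 > 0"
    and F'_lip:
      "\<forall>x\<in>fs_ball H x\<^sub>d r.
         op_norm H G (\<lambda>h. F' x h - F' x\<^sub>d h) \<le> ereal (L\<^sub>1 * fs_norm H (x - x\<^sub>d))"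
    and adj: "is_adjoint H G (F' x\<^sub>d) F'_adj"
    and source: "\<omega> \<in> elems G" "fs_eq H (x\<^sub>0 - x\<^sub>d) (F'_adj \<omega>)" "L\<^sub>1 * fs_norm G \<omega> < 1"
  shows
    "(\<forall>\<epsilon>>0. \<exists>(n::nat) (T :: (real^'m, real^'n) no_coeffs).
        T \<in> coeff_vectors \<Omega>\<^sub>X \<and> coeff_size T = n \<and>
        approx_error G (fs_ball H x\<^sub>d r) F (neural_operator \<sigma> T) \<le> ereal \<epsilon>) \<and>
     (\<forall>(T :: real \<Rightarrow> (real^'m, real^'n) no_coeffs) (\<alpha> :: real \<Rightarrow> real) (\<eta> :: real \<Rightarrow> real)
        (\<epsilon> :: real \<Rightarrow> real) (y\<^sub>\<delta> :: real \<Rightarrow> real^'n \<Rightarrow> real) (x\<^sub>n :: real \<Rightarrow> real^'m \<Rightarrow> real).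
        (\<forall>e>0. T e \<in> coeff_vectors \<Omega>\<^sub>X \<and>
           approx_error G (fs_ball H x\<^sub>d r) F (neural_operator \<sigma> (T e)) \<le> ereal e) \<and>
        (\<forall>\<delta>>0. y\<^sub>\<delta> \<delta> \<in> elems G \<and> fs_norm G (y - y\<^sub>\<delta> \<delta>) \<le> \<delta>) \<and>
        same_order \<alpha> (\<lambda>\<delta>. \<delta>) \<and> same_order \<eta> (\<lambda>\<delta>. (\<alpha> \<delta>)\<^sup>2) \<and> same_order \<epsilon> (\<lambda>\<delta>. \<delta>) \<and>
        (\<forall>\<delta>>0. approx_minimizer
           (tikhonov H G (neural_operator \<sigma> (T (\<epsilon> \<delta>))) (y\<^sub>\<delta> \<delta>) x\<^sub>0 (\<alpha> \<delta>)) D (\<eta> \<delta>) (x\<^sub>n \<delta>))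
        \<longrightarrow> (\<lambda>\<delta>. fs_norm H (x\<^sub>n \<delta> - x\<^sub>d)) \<in> O[at_right 0](\<lambda>\<delta>. sqrt \<delta>))"
proof -
  have G: "G = l2 (lebesgue_on \<Omega>\<^sub>Y)" by (simp add: G_def L2_eq_l2)
  have oY: "open \<Omega>\<^sub>Y" "bounded \<Omega>\<^sub>Y" using dom_Y by (auto simp: admissible_domain_def)
  interpret X: sobolev_embedding \<Omega>\<^sub>X s
    using dom_X s by unfold_locales (auto simp: admissible_domain_def)
  interpret G: pre_hilbert G unfolding G by (rule pre_hilbert_l2)
  interpret H: pre_hilbert H unfolding H_def by (rule X.Hs.pre_hilbert_axioms)
  interpret source_problem H G D F F' F'_adj x\<^sub>0 x\<^sub>d y \<omega> r L\<^sub>1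
    using D_sub F_maps x0 y xd r ball F_diff F'_lip adj source
    by unfold_locales (auto simp: min_norm_solution_def)
  obtain C where C: "\<And>x. x \<in> D \<Longrightarrow> fs_norm H x \<le> C" using D_bounded unfolding fs_bounded_def by blast
  show ?thesis
  proof (intro conjI allI impI)
    fix \<epsilon> :: real assume \<epsilon>: "\<epsilon> > 0"
    have "\<exists>T\<in>coeff_vectors \<Omega>\<^sub>X. \<forall>u\<in>D. fs_norm (l2 (lebesgue_on \<Omega>\<^sub>Y)) (F u - neural_operator \<sigma> T u) \<le> \<epsilon>"
      by (rule X.neural_operator_approx[OF sigmoid oY D_closed[unfolded H_def] C[unfolded H_def]
            D_sub[unfolded H_def] _ _ F_cont[unfolded G] \<epsilon>])
        (use x0 F_maps G in auto)
    then obtain T :: "(real^'m, real^'n) no_coeffs" where T: "T \<in> coeff_vectors \<Omega>\<^sub>X"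
      "\<forall>u\<in>D. fs_norm G (F u - neural_operator \<sigma> T u) \<le> \<epsilon>"
      unfolding G by blast
    \<comment> \<open>The approximation holds uniformly on \<open>D\<close>, and the ball is
      contained in \<open>D\<close>.\<close>
    have "approx_error G (fs_ball H x\<^sub>d r) F (neural_operator \<sigma> T) \<le> ereal \<epsilon>"
      unfolding approx_error_def using T(2) ball by (intro SUP_least) auto
    then show "\<exists>(n::nat) (T :: (real^'m, real^'n) no_coeffs). T \<in> coeff_vectors \<Omega>\<^sub>X \<and> coeff_size T = n \<and>
        approx_error G (fs_ball H x\<^sub>d r) F (neural_operator \<sigma> T) \<le> ereal \<epsilon>"
      using T(1) by blast
  next
    fix T :: "real \<Rightarrow> (real^'m, real^'n) no_coeffs" and \<alpha> \<eta> \<epsilon> :: "real \<Rightarrow> real"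
      and y\<^sub>\<delta> :: "real \<Rightarrow> real^'n \<Rightarrow> real" and x\<^sub>n :: "real \<Rightarrow> real^'m \<Rightarrow> real"
    assume *: "(\<forall>e>0. T e \<in> coeff_vectors \<Omega>\<^sub>X \<and>
           approx_error G (fs_ball H x\<^sub>d r) F (neural_operator \<sigma> (T e)) \<le> ereal e) \<and>
        (\<forall>\<delta>>0. y\<^sub>\<delta> \<delta> \<in> elems G \<and> fs_norm G (y - y\<^sub>\<delta> \<delta>) \<le> \<delta>) \<and>
        same_order \<alpha> (\<lambda>\<delta>. \<delta>) \<and> same_order \<eta> (\<lambda>\<delta>. (\<alpha> \<delta>)\<^sup>2) \<and> same_order \<epsilon> (\<lambda>\<delta>. \<delta>) \<and>
        (\<forall>\<delta>>0. approx_minimizer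
           (tikhonov H G (neural_operator \<sigma> (T (\<epsilon> \<delta>))) (y\<^sub>\<delta> \<delta>) x\<^sub>0 (\<alpha> \<delta>)) D (\<eta> \<delta>) (x\<^sub>n \<delta>))"
    have "neural_operator \<sigma> (T e) x \<in> elems G" for e x
      unfolding G by (rule neural_operator_mem_l2[OF sigmoid oY])
    then show "(\<lambda>\<delta>. fs_norm H (x\<^sub>n \<delta> - x\<^sub>d)) \<in> O[at_right 0](\<lambda>\<delta>. sqrt \<delta>)"
      by (rule rate[where F\<^sub>n="\<lambda>e. neural_operator \<sigma> (T e)" and \<alpha>=\<alpha> and \<eta>=\<eta> and \<epsilon>=\<epsilon> and y\<^sub>\<delta>=y\<^sub>\<delta>])
        (use * in blast)+
  qed
qed

end
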